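(* Let $\widehat{\mathcal S}$ be a Neumann subgroup of $\widehat{\mathcal M}=PGL(2,\mathbb Z)$ that is not entirely contained in $\mathcal M=PSL(2,\mathbb Z)$, and let $\mathcal S=\widehat{\mathcal S}\cap\mathcal M$. Let $\overline\Gamma_0$ and $\widetilde\Gamma_0$ be the graphs associated with $\widehat{\mathcal S}$ as described in the context. Then: 1. $\widehat{\mathcal S}$ has $(\widehat r_2,\widehat r_3,\widehat r_\infty)$-structure for some $\widehat r_2,\widehat r_3,\widehat r_\infty\in\mathbb N_0\cup\{\infty\}$, subject to the following conditions: (a) $\widehat r_2+\widehat r_3+\widehat r_\infty=\infty$; (b) $\widehat r_\infty\ge 1$; (c) if $\tilde\beta$ denotes the Betti number of $\widetilde\Gamma_0$, then $\widehat r_\infty=\tilde\beta$; (d) all independent generators of finite order (i.e. the generators of the finite cyclic free factors) are elliptic elements of the modular group $\mathcal M$. 2. If $\mathcal S$ has $(r_2,r_3,r_\infty)$-structure, then (a) $(r_2,r_3,r_\infty)=(2\widehat r_2,\,2\widehat r_3,\,2\widehat r_\infty-1)$ (with $2\cdot\infty=2\cdot\infty-1=\infty$); (b) if $\beta$ denotes the Betti number of $\overline\Gamma_0$, then $r_\infty=\beta$.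
   Context: Groups. $\mathcal M=PSL(2,\mathbb Z)$ is the index $2$ subgroup of determinant $1$ elements of $\widehat{\mathcal M}=PGL(2,\mathbb Z)$. Put $A=\omega=\pm\begin{pmatrix}0&-1\\1&0\end{pmatrix}$, $B=\varphi=\pm\begin{pmatrix}0&-1\\1&1\end{pmatrix}$, $V=\nu=\pm\begin{pmatrix}-1&0\\0&1\end{pmatrix}$, $C=AB=\tau=\pm\begin{pmatrix}1&1\\0&1\end{pmatrix}$. They generate $\widehat{\mathcal M}$ with defining relations $A^2=B^3=V^2=(AV)^2=(ABV)^2=1$. Let $\widehat{\mathcal T}=\{\tau^n\nu^\epsilon:n\in\mathbb Z,\ \epsilon\in\{0,1\}\}$. A Neumann subgroup of $\widehat{\mathcal M}$ is a subgroup $\widehat{\mathcal S}$ with $\widehat{\mathcal S}\,\widehat{\mathcal T}=\widehat{\mathcal M}$ and $\widehat{\mathcal S}\cap\widehat{\mathcal T}=1$. A group has $(k,l,m)$-structure, $k,l,m\in\mathbb N_0\cup\{\infty\}$, if it is a free product of $k$ subgroups of order $2$, $l$ subgroups of order $3$ and $m$ infinite cyclic subgroups. Generators. $\widehat{\mathcal M}$ acts by right multiplication on the set of right cosets $\widehat{\mathcal S}g$; let $\widehat p=\widehat{\mathcal S}$ be the trivial coset. As $\widehat{\mathcal S}$ is Neumann, the cosets $\widehat pC^nV^\epsilon$ ($n\in\mathbb Z$, $\epsilon\in\{0,1\}$) are pairwise distinct and exhaust all right cosets. Define $\iota:\mathbb Z\to\mathbb Z$ and $\delta:\mathbb Z\to\{-1,1\}$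 by $\widehat pC^nA=\widehat pC^{\iota(n)}V^{(1-\delta_n)/2}$, and $\Sigma_n=C^nAV^{(1-\delta_n)/2}C^{-\iota(n)}\in\widehat{\mathcal S}$. Graphs. $\Gamma=\Gamma(\widehat{\mathcal S})$ is the graph whose vertices are the right cosets of $\widehat{\mathcal S}$ in $\widehat{\mathcal M}$, with one undirected $A$-edge joining $v$ and $vA$ (a loop if $vA=v$) and one directed $B$-edge from $v$ to $vB$, for each vertex $v$ (there are no $V$-edges). The $A$-edge at $\widehat pC^nV^\epsilon$ is labeled by $\{\Sigma_n,\Sigma_{\iota(n)}\}$. $\overline\Gamma$ is the graph obtained from $\Gamma$ by contracting all $B$-edges, i.e. each $B$-orbit becomes a single vertex and the edges are the images of the $A$-edges with the induced labels. The map $v\mapsto vAV$ carries $B$-orbits to $B$-orbits and $A$-edges to $A$-edges, hence induces an automorphism $AV$ of $\overline\Gamma$; $\widetilde\Gamma$ is the graph obtained from $\overline\Gamma$ by identifying each vertex with its image under $AV$ and identifying edges having the same label (i.e. each edge with its image under $AV$). $\overline\Gamma_0$ is obtained from $\overline\Gamma$ by removing all loops (these are exactly the images of the $A$-edges labeled by involutions) and all vertices of valence $1$, with their incident edges (these vertices are the images of the vertices of $\Gamma$ fixed by $B$; their edges are labeled by elements of order $3$). $\widetilde\Gamma_0$ is the image of $\overline\Gamma_0$ in $\widetilde\Gamma$, i.e. it is obtained from $\widetilde\Gamma$ by removing all edges labeled by some $\Sigma_n$ with $\Sigma_n^2=1$ or $\Sigma_n^3=1$; it may still contain loops. The Betti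 number of a graph is its cycle rank (first Betti number), possibly $\infty$; loops count as cycles. *)

theory Defs
  imports
    "HOL-Analysis.Determinants"
    "HOL-Algebra.Coset"
    "HOL-Algebra.Generated_Groups"
    "HOL-Algebra.Elementary_Groups"
    "HOL-Library.Extended_Nat"
begin

text \<open>An integer matrix is invertible over the integers iff its determinant is a unit.\<close>

definition GL2Z :: "(int ^ 2 ^ 2) monoid" where
  "GL2Z = \<lparr>carrier = {M. det M = 1 \<or> det M = - 1}, mult = (\<lambda>M N. M ** N), one = mat 1\<rparr>"

definition center2 :: "(int ^ 2 ^ 2) set" where
  "center2 = {mat 1, - mat 1}"

definition PGL2Z :: "(int ^ 2 ^ 2) set monoid" where
  "PGL2Z = GL2Z Mod center2"

definition pm :: "int ^ 2 ^ 2 \<Rightarrow> (int ^ 2 ^ 2) set" where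
  "pm M = center2 #>\<^bsub>GL2Z\<^esub> M"

definition PSL2Z :: "(int ^ 2 ^ 2) set set" where
  "PSL2Z = pm ` {M. det M = 1}"

definition mA :: "(int ^ 2 ^ 2) set" where
  "mA = pm (vector [vector [0, - 1], vector [1, 0]])"

definition mB :: "(int ^ 2 ^ 2) set" where
  "mB = pm (vector [vector [0, - 1], vector [1, 1]])"

definition mV :: "(int ^ 2 ^ 2) set" where
  "mV = pm (vector [vector [- 1, 0], vector [0, 1]])"

definition mC :: "(int ^ 2 ^ 2) set" where
  "mC = pm (vector [vector [1, 1], vector [0, 1]])"

text \<open>The trace is defined up to sign; the identity has trace \<open>\<plusminus>2\<close> and is not elliptic.\<close>

definition elliptic :: "(int ^ 2 ^ 2) set \<Rightarrow> bool" where
  "elliptic X \<longleftrightarrow> X \<in> PSL2Z \<and> (\<exists>M\<in>X. \<bar>trace M\<bar> < 2)"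

definition That :: "(int ^ 2 ^ 2) set set" where
  "That = {mC [^]\<^bsub>PGL2Z\<^esub> n \<otimes>\<^bsub>PGL2Z\<^esub> mV [^]\<^bsub>PGL2Z\<^esub> e | (n::int) (e::nat). e \<in> {0, 1}}"

definition neumann_subgroup :: "(int ^ 2 ^ 2) set set \<Rightarrow> bool" where
  "neumann_subgroup S \<longleftrightarrow>
     subgroup S PGL2Z \<and> S <#>\<^bsub>PGL2Z\<^esub> That = carrier PGL2Z \<and> S \<inter> That = {\<one>\<^bsub>PGL2Z\<^esub>}"

definition ecard :: "'a set \<Rightarrow> enat" where
  "ecard X = (if finite X then enat (card X) else \<infinity>)"

text \<open>A reduced word is a list of letters, each tagged with the factor it comes from.\<close>

definition reduced_word :: "('a, 'b) monoid_scheme \<Rightarrow> 'a set set \<Rightarrow> ('a set \<times> 'a) list \<Rightarrow> bool" where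
  "reduced_word G F w \<longleftrightarrow>
     (\<forall>(H, x)\<in>set w. H \<in> F \<and> x \<in> H \<and> x \<noteq> \<one>\<^bsub>G\<^esub>) \<and> distinct_adj (map fst w)"

text \<open>Internal free product of a set of subgroups. Indexing the factors by themselves loses nothing
  for nontrivial factors: two equal nontrivial factors with different indices would violate the
  normal form condition.\<close>

definition is_free_product :: "('a, 'b) monoid_scheme \<Rightarrow> 'a set set \<Rightarrow> bool" where
  "is_free_product G F \<longleftrightarrow>
     (\<forall>H\<in>F. subgroup H G) \<and> generate G (\<Union>F) = carrier G \<and>
     (\<forall>w. reduced_word G F w \<and> w \<noteq> [] \<longrightarrow>
        foldr (\<lambda>x y. x \<otimes>\<^bsub>G\<^esub> y) (map snd w) \<one>\<^bsub>G\<^esub> \<noteq> \<one>\<^bsub>G\<^esub>)"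

definition cyclic_decomposition ::
  "('a, 'b) monoid_scheme \<Rightarrow> 'a set set \<Rightarrow> 'a set set \<Rightarrow> 'a set set \<Rightarrow> bool" where
  "cyclic_decomposition G F\<^sub>2 F\<^sub>3 F\<^sub>i \<longleftrightarrow>
     is_free_product G (F\<^sub>2 \<union> F\<^sub>3 \<union> F\<^sub>i) \<and>
     (\<forall>H\<in>F\<^sub>2. card H = 2) \<and> (\<forall>H\<in>F\<^sub>3. card H = 3) \<and>
     (\<forall>H\<in>F\<^sub>i. infinite H \<and> (\<exists>x\<in>H. H = generate G {x}))"

definition has_structure :: "('a, 'b) monoid_scheme \<Rightarrow> enat \<Rightarrow> enat \<Rightarrow> enat \<Rightarrow> bool" where
  "has_structure G k l m \<longleftrightarrow>
     (\<exists>F\<^sub>2 F\<^sub>3 F\<^sub>i. cyclic_decomposition G F\<^sub>2 F\<^sub>3 F\<^sub>i \<and> ecard F\<^sub>2 = k \<and> ecard F\<^sub>3 = l \<and> ecard F\<^sub>i = m)"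

text \<open>Undirected multigraphs. A loop is an edge whose set of ends is a singleton.\<close>

record ('v, 'e) mgraph =
  verts :: "'v set"
  edges :: "'e set"
  ends :: "'e \<Rightarrow> 'v set"

definition is_loop :: "('v, 'e, 'z) mgraph_scheme \<Rightarrow> 'e \<Rightarrow> bool" where
  "is_loop G e \<longleftrightarrow> card (ends G e) = 1"

text \<open>Valence of a vertex in the subgraph with edge set \<open>D\<close>; loops count twice.\<close>

definition valence_in :: "('v, 'e, 'z) mgraph_scheme \<Rightarrow> 'e set \<Rightarrow> 'v \<Rightarrow> enat" where
  "valence_in G D v =
     ecard {e \<in> D. v \<in> ends G e} + ecard {e \<in> D. v \<in> ends G e \<and> is_loop G e}"

definition valence :: "('v, 'e, 'z) mgraph_scheme \<Rightarrow> 'v \<Rightarrow> enat" where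
  "valence G = valence_in G (edges G)"

text \<open>The cycle space over the field with two elements: its members are the finite edge sets with
  all valences even (that is, the 1-cycles modulo 2), its addition is symmetric difference.\<close>

definition cycle_space :: "('v, 'e, 'z) mgraph_scheme \<Rightarrow> 'e set set" where
  "cycle_space G =
     {D. finite D \<and> D \<subseteq> edges G \<and> (\<forall>v\<in>verts G. even (the_enat (valence_in G D v)))}"

definition sum_mod2 :: "'e set set \<Rightarrow> 'e set" where
  "sum_mod2 \<D> = {e. odd (card {D \<in> \<D>. e \<in> D})}"

definition independent_mod2 :: "'e set set \<Rightarrow> bool" where
  "independent_mod2 \<B> \<longleftrightarrow> (\<forall>\<D>. finite \<D> \<and> \<D> \<subseteq> \<B> \<and> \<D> \<noteq> {} \<longrightarrow> sum_mod2 \<D> \<noteq> {})"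

text \<open>The cycle rank, i.e. the dimension of the cycle space in \<open>\<nat> \<union> {\<infinity>}\<close>.\<close>

definition betti :: "('v, 'e, 'z) mgraph_scheme \<Rightarrow> enat" where
  "betti G = Sup {ecard \<B> | \<B>. finite \<B> \<and> \<B> \<subseteq> cycle_space G \<and> independent_mod2 \<B>}"

text \<open>A group element \<open>g\<close> acts on right cosets by \<open>v \<mapsto> v #> g\<close>; the trivial coset is
  \<open>S\<close> itself.\<close>

type_synonym pgl_coset = "(int ^ 2 ^ 2) set set"

definition coset_at :: "(int ^ 2 ^ 2) set set \<Rightarrow> int \<Rightarrow> nat \<Rightarrow> pgl_coset" where
  "coset_at S n e = S #>\<^bsub>PGL2Z\<^esub> (mC [^]\<^bsub>PGL2Z\<^esub> n \<otimes>\<^bsub>PGL2Z\<^esub> mV [^]\<^bsub>PGL2Z\<^esub> e)"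

definition sign_exp :: "int \<Rightarrow> nat" where
  "sign_exp d = nat ((1 - d) div 2)"

definition iota :: "(int ^ 2 ^ 2) set set \<Rightarrow> int \<Rightarrow> int" where
  "iota S n = (THE m. \<exists>d\<in>{- 1, 1}. coset_at S n 0 #>\<^bsub>PGL2Z\<^esub> mA = coset_at S m (sign_exp d))"

definition delta :: "(int ^ 2 ^ 2) set set \<Rightarrow> int \<Rightarrow> int" where
  "delta S n = (THE d. d \<in> {- 1, 1} \<and>
     coset_at S n 0 #>\<^bsub>PGL2Z\<^esub> mA = coset_at S (iota S n) (sign_exp d))"

definition Sigma_gen :: "(int ^ 2 ^ 2) set set \<Rightarrow> int \<Rightarrow> (int ^ 2 ^ 2) set" where
  "Sigma_gen S n =
     mC [^]\<^bsub>PGL2Z\<^esub> n \<otimes>\<^bsub>PGL2Z\<^esub> mA \<otimes>\<^bsub>PGL2Z\<^esub> mV [^]\<^bsub>PGL2Z\<^esub> sign_exp (delta S n)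
       \<otimes>\<^bsub>PGL2Z\<^esub> mC [^]\<^bsub>PGL2Z\<^esub> (- iota S n)"

text \<open>An \<open>A\<close>-edge of the coset graph \<open>\<Gamma>\<close> is identified with the set of its end points
  \<open>{v, vA}\<close>, so there is exactly one for each orbit of \<open>A\<close>.\<close>

definition A_edges :: "(int ^ 2 ^ 2) set set \<Rightarrow> pgl_coset set set" where
  "A_edges S = (\<lambda>v. {v, v #>\<^bsub>PGL2Z\<^esub> mA}) ` (rcosets\<^bsub>PGL2Z\<^esub> S)"

text \<open>The edge at \<open>coset_at S n e\<close> carries the label \<open>{\<Sigma>\<^sub>n, \<Sigma>\<^bsub>\<iota>(n)\<^esub>}\<close>; for a Neumann
  subgroup this does not depend on which of the (at most two) end points is used.\<close>

definition label :: "(int ^ 2 ^ 2) set set \<Rightarrow> pgl_coset set \<Rightarrow> (int ^ 2 ^ 2) set set" where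
  "label S a = (THE L. \<exists>n. \<exists>e\<in>{0, 1}.
     coset_at S n e \<in> a \<and> L = {Sigma_gen S n, Sigma_gen S (iota S n)})"

definition B_orbit :: "pgl_coset \<Rightarrow> pgl_coset set" where
  "B_orbit v = range (\<lambda>k::int. v #>\<^bsub>PGL2Z\<^esub> (mB [^]\<^bsub>PGL2Z\<^esub> k))"

definition Gamma_bar :: "(int ^ 2 ^ 2) set set \<Rightarrow> (pgl_coset set, pgl_coset set) mgraph" where
  "Gamma_bar S =
     \<lparr>verts = B_orbit ` (rcosets\<^bsub>PGL2Z\<^esub> S), edges = A_edges S, ends = (\<lambda>a. B_orbit ` a)\<rparr>"

text \<open>Valences are those in the full graph, before any loops have been removed.\<close>

definition Gamma_bar0 :: "(int ^ 2 ^ 2) set set \<Rightarrow> (pgl_coset set, pgl_coset set) mgraph" where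
  "Gamma_bar0 S = (let G = Gamma_bar S; W = {x \<in> verts G. valence G x \<noteq> 1} in
     G\<lparr>verts := W, edges := {a \<in> edges G. \<not> is_loop G a \<and> ends G a \<subseteq> W}\<rparr>)"

definition AV_image :: "pgl_coset set \<Rightarrow> pgl_coset set" where
  "AV_image x = (\<lambda>v. v #>\<^bsub>PGL2Z\<^esub> (mA \<otimes>\<^bsub>PGL2Z\<^esub> mV)) ` x"

text \<open>The automorphism \<open>v \<mapsto> vAV\<close> is an involution, so its orbits have at most two elements.\<close>

definition vert_class :: "pgl_coset set \<Rightarrow> pgl_coset set set" where
  "vert_class x = {x, AV_image x}"

definition edge_class :: "(int ^ 2 ^ 2) set set \<Rightarrow> pgl_coset set \<Rightarrow> pgl_coset set set" where
  "edge_class S a = {b \<in> A_edges S. label S b = label S a}"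

definition Gamma_tilde ::
  "(int ^ 2 ^ 2) set set \<Rightarrow> (pgl_coset set set, pgl_coset set set) mgraph" where
  "Gamma_tilde S =
     \<lparr>verts = vert_class ` verts (Gamma_bar S), edges = edge_class S ` edges (Gamma_bar S),
      ends = (\<lambda>E. \<Union>a\<in>E. vert_class ` ends (Gamma_bar S) a)\<rparr>"

definition Gamma_tilde0 ::
  "(int ^ 2 ^ 2) set set \<Rightarrow> (pgl_coset set set, pgl_coset set set) mgraph" where
  "Gamma_tilde0 S = (Gamma_tilde S)
     \<lparr>verts := vert_class ` verts (Gamma_bar0 S), edges := edge_class S ` edges (Gamma_bar0 S)\<rparr>"

end

theory Submission
  imports Defs "HOL-Number_Theory.Cong" "HOL-Algebra.Multiplicative_Group"
begin

text \<open>The ranks of the finite and infinite cyclic factors of a free product are ranks of pairings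
  between group elements (involutions, elements of order 3, everything) and homomorphisms to
  \<open>\<int>/2\<close> or \<open>\<int>/3\<close>, so they do not depend on the decomposition. Homomorphisms on the index two
  subgroup \<open>S \<inter> PSL2Z\<close> correspond to cocycles on \<open>S\<close> with values twisted by the parity of the
  determinant, and prescribing them on the factors yields the ranks \<open>2r\<^sub>2\<close>, \<open>2r\<^sub>3\<close> and \<open>2r\<^sub>\<infinity> - 1\<close>;
  the summand \<open>-1\<close> comes from a generator outside \<open>PSL2Z\<close> that serves as coset representative.

  A decomposition of \<open>S\<close> exists by a ping-pong argument. Write \<open>U = AV\<close>, which commutes with \<open>A\<close>
  and inverts \<open>B\<close>. By Zorn's lemma there is a transversal \<open>D\<close> of \<open>S\<close> that is connected in the
  Cayley graph and compatible with \<open>B\<close> and \<open>U\<close>; the elements of \<open>S\<close> moving \<open>D\<close> to its neighbours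
  generate the factors, and the normal form in \<open>PSL2Z = \<langle>A\<rangle> * \<langle>B\<rangle>\<close> shows that they are free.
  An involution of determinant \<open>-1\<close> is conjugate into \<open>That\<close>, hence not in \<open>S\<close>, so the factors
  of finite order consist of elliptic elements.

  An edge of a quotient graph gives the integral cocycle counting its signed traversals by words in
  the generators. These cocycles pair elements of \<open>S\<close>, seen as closed paths, with edges, and
  identify the cycle space with the dual of the homomorphisms to \<open>\<int>/2\<close> that kill involutions.\<close>

text \<open>PGL2(Z) is the amalgam of the Klein four-group {1, A, U, AU} and the dihedral group
  generated by B and U, of order 6, over {1, U}. Since \<open>S\<close> contains no reflection, it
  meets each conjugate of {1, U} trivially and the conjugates of the two larger groups in subgroups
  of order at most 2 and at most 3, respectively. This is why only factors of order 2, of order 3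
  and of infinite order occur. The claim on the even part of \<open>S\<close> concerns all of its
  decompositions. None of them is constructed; algebra and graphs meet only in the numbers
  \<open>dual_rank\<close>. Both graphs are orbit graphs of one kind, so a single duality argument
  covers them: the contracted graph belongs to PSL2(Z), the group generated by B, and {1}; its
  quotient to PGL2(Z), the dihedral group, and {1, U}. The complement \<open>That\<close> enters in
  three ways: it excludes reflections; it makes every nontrivial power of C move every coset, so
  that an A-edge becomes a loop of the contracted graph only if A fixes its end; and it keeps the
  cosets of the powers of C apart, which forces infinitely many factors.\<close>

section \<open>Ranks of pairings\<close>

text \<open>If \<open>\<Phi>\<close> consists of functions that are homomorphisms modulo a prime \<open>q\<close>, this is the rank in
  \<open>\<nat> \<union> {\<infinity>}\<close> of the pairing \<open>(x, f) \<mapsto> f x\<close> between \<open>X\<close> and \<open>\<Phi>\<close>; working with integer valued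
  functions and congruences avoids quotients and a type of residues.\<close>

definition dual_rank :: "int \<Rightarrow> 'a set \<Rightarrow> ('a \<Rightarrow> int) set \<Rightarrow> enat" where
  "dual_rank q X \<Phi> = Sup {enat n | n. \<exists>x f. (\<forall>i<n. x i \<in> X \<and> f i \<in> \<Phi>) \<and>
     (\<forall>i<n. \<forall>j<n. [f i (x j) = of_bool (i = j)] (mod q))}"

lemma dual_rank_ge:
  assumes "finite J"
    and "\<And>i. i \<in> J \<Longrightarrow> x i \<in> X" "\<And>i. i \<in> J \<Longrightarrow> e i \<in> \<Phi>"
    and "\<And>i j. i \<in> J \<Longrightarrow> j \<in> J \<Longrightarrow> [e i (x j) = of_bool (i = j)] (mod q)"
  shows "enat (card J) \<le> dual_rank q X \<Phi>"
proof -
  obtain h where h: "bij_betw h {0..<card J} J"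
    using ex_bij_betw_nat_finite[OF assms(1)] by blast
  have hJ: "h i \<in> J" if "i < card J" for i
    using h that by (auto simp: bij_betw_def)
  have hi: "h i = h j \<longleftrightarrow> i = j" if "i < card J" "j < card J" for i j
    using h that by (auto simp: bij_betw_def inj_on_def)
  have *: "(\<forall>i<card J. (x \<circ> h) i \<in> X \<and> (e \<circ> h) i \<in> \<Phi>) \<and>
     (\<forall>i<card J. \<forall>j<card J. [(e \<circ> h) i ((x \<circ> h) j) = of_bool (i = j)] (mod q))"
  proof (intro conjI allI impI)
    fix i j assume "i < card J" "j < card J"
    then show "[(e \<circ> h) i ((x \<circ> h) j) = of_bool (i = j)] (mod q)"
      using assms(4)[OF hJ hJ, of i j] hi by simp
  qed (use assms(2,3) hJ in auto)
  show ?thesis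
    unfolding dual_rank_def by (intro Sup_upper CollectI exI[of _ "card J"] conjI refl, intro exI) (rule *)
qed

text \<open>A rank bound by counting instead of linear algebra: coefficient vectors in (Z/q)^n
  inject into (Z/q)^I, hence q^n is at most q^|I|.\<close>

lemma dual_rank_le:
  fixes e :: "'i \<Rightarrow> 'a \<Rightarrow> int"
  assumes "finite I" "q > 1"
    and exp: "\<And>f g. f \<in> \<Phi> \<Longrightarrow> g \<in> X \<Longrightarrow> [f g = (\<Sum>i\<in>I. f (x i) * e i g)] (mod q)"
  shows "dual_rank q X \<Phi> \<le> enat (card I)"
  unfolding dual_rank_def
proof (rule Sup_least, clarsimp)
  fix n :: nat and y :: "nat \<Rightarrow> 'a" and f :: "nat \<Rightarrow> 'a \<Rightarrow> int"
  assume yf: "\<forall>i<n. y i \<in> X \<and> f i \<in> \<Phi>"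
    and d: "\<forall>i<n. \<forall>j<n. [f i (y j) = of_bool (i = j)] (mod q)"
  \<comment> \<open>\<open>b a\<close> lists the coordinates, with respect to the
    \<open>e k\<close>, of the combination of the \<open>y j\<close> with coefficients
    \<open>a\<close>. By \<open>exp\<close>, pairing this combination with \<open>f i\<close>
    returns \<open>a i\<close>, which makes \<open>b\<close> injective.\<close>
  define b where "b a = restrict (\<lambda>k. (\<Sum>j<n. a j * e k (y j)) mod q) I" for a :: "nat \<Rightarrow> int"
  have recover: "[(\<Sum>k\<in>I. f i (x k) * b a k) = a i] (mod q)" if i: "i < n" for i a
  proof -
    have "[(\<Sum>k\<in>I. f i (x k) * b a k) = (\<Sum>k\<in>I. f i (x k) * (\<Sum>j<n. a j * e k (y j)))] (mod q)"
      by (intro cong_sum cong_mult) (auto simp: b_def)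
    also have "(\<Sum>k\<in>I. f i (x k) * (\<Sum>j<n. a j * e k (y j)))
       = (\<Sum>j<n. a j * (\<Sum>k\<in>I. f i (x k) * e k (y j)))"
      by (simp add: sum_distrib_left sum.swap[of _ I] mult_ac)
    also have "[\<dots> = (\<Sum>j<n. a j * of_bool (i = j))] (mod q)"
    proof (intro cong_sum cong_mult cong_refl)
      fix j assume j: "j \<in> {..<n}"
      have "[(\<Sum>k\<in>I. f i (x k) * e k (y j)) = f i (y j)] (mod q)"
        using exp yf i j by (auto intro: cong_sym)
      also have "[f i (y j) = of_bool (i = j)] (mod q)" using d i j by auto
      finally show "[(\<Sum>k\<in>I. f i (x k) * e k (y j)) = of_bool (i = j)] (mod q)" .
    qed
    also have "(\<Sum>j<n. a j * of_bool (i = j)) = a i" using i by simp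
    finally show ?thesis .
  qed
  have inj: "inj_on b ({..<n} \<rightarrow>\<^sub>E {0..<q})"
  proof (rule inj_onI)
    fix a a' assume a: "a \<in> {..<n} \<rightarrow>\<^sub>E {0..<q}" "a' \<in> {..<n} \<rightarrow>\<^sub>E {0..<q}" "b a = b a'"
    show "a = a'"
    proof (rule PiE_ext[OF a(1,2)])
      fix i assume i: "i \<in> {..<n}"
      have "[a i = a' i] (mod q)"
        using cong_trans[OF cong_sym[OF recover[of i a]] recover[of i a', folded a(3)]] i by simp
      moreover have "a i \<in> {0..<q}" "a' i \<in> {0..<q}"
        using PiE_mem[OF a(1) i] PiE_mem[OF a(2) i] by simp_all
      ultimately show "a i = a' i" by (simp add: cong_def)
    qed
  qed
  have "b ` ({..<n} \<rightarrow>\<^sub>E {0..<q}) \<subseteq> I \<rightarrow>\<^sub>E {0..<q}"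
    by (intro image_subsetI PiE_I) (use assms(2) in \<open>simp_all add: b_def\<close>)
  then have "card ({..<n} \<rightarrow>\<^sub>E {0..<q}) \<le> card (I \<rightarrow>\<^sub>E {0..<q})"
    by (rule card_inj_on_le[OF inj]) (use assms(1) in \<open>auto intro: finite_PiE\<close>)
  then have "nat q ^ n \<le> nat q ^ card I"
    using assms(1) by (simp add: card_PiE)
  then show "n \<le> card I"
    by (rule power_le_imp_le_exp[rotated]) (use assms(2) in simp)
qed

text \<open>The expansion is demanded for finite \<open>I\<close> only: for infinite
  \<open>I\<close> the finite parts of the dual system already push the supremum to
  infinity.\<close>

lemma dual_rank_eqI:
  fixes e :: "'i \<Rightarrow> 'a \<Rightarrow> int"
  assumes "q > 1"
    and "\<And>i. i \<in> I \<Longrightarrow> x i \<in> X" "\<And>i. i \<in> I \<Longrightarrow> e i \<in> \<Phi>"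
    and "\<And>i j. i \<in> I \<Longrightarrow> j \<in> I \<Longrightarrow> [e i (x j) = of_bool (i = j)] (mod q)"
    and "\<And>f g. finite I \<Longrightarrow> f \<in> \<Phi> \<Longrightarrow> g \<in> X \<Longrightarrow> [f g = (\<Sum>i\<in>I. f (x i) * e i g)] (mod q)"
  shows "dual_rank q X \<Phi> = ecard I"
proof (cases "finite I")
  case True
  have "dual_rank q X \<Phi> \<le> enat (card I)"
    using dual_rank_le[OF True assms(1)] assms(5)[OF True] by blast
  moreover have "enat (card I) \<le> dual_rank q X \<Phi>"
    using dual_rank_ge[OF True] assms(2-4) by blast
  ultimately show ?thesis using True by (simp add: ecard_def)
next
  case False
  have "enat n \<le> dual_rank q X \<Phi>" for n
  proof -
    obtain J where "J \<subseteq> I" "finite J" "card J = n"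
      using infinite_arbitrarily_large[OF False] by blast
    then show ?thesis using dual_rank_ge[of J x X e \<Phi> q] assms(2-4) by blast
  qed
  then have "dual_rank q X \<Phi> = \<infinity>"
    by (metis enat_ord_simps(1) linorder_not_less neq_iff not_infinity_eq lessI less_irrefl enat_ord_simps(2) order.strict_trans2)
  then show ?thesis using False by (simp add: ecard_def)
qed

text \<open>A dual basis over the field with two elements, built one vector at a time. A functional
  is stored as an integer weight on the edges, summed over an edge set and read modulo 2.\<close>

lemma independent_mod2_dual:
  fixes B :: "'e set set"
  assumes "finite B" "independent_mod2 B" "\<And>D. D \<in> B \<Longrightarrow> finite D"
  shows "\<exists>w :: 'e set \<Rightarrow> 'e \<Rightarrow> int. \<forall>C\<in>B. \<forall>D\<in>B. [sum (w C) D = of_bool (C = D)] (mod 2)"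
  using assms
proof (induction B)
  case empty
  then show ?case by simp
next
  case (insert Z B)
  have "independent_mod2 B"
    using insert.prems(1) unfolding independent_mod2_def by blast
  then have "\<exists>w :: 'e set \<Rightarrow> 'e \<Rightarrow> int. \<forall>C\<in>B. \<forall>D\<in>B. [sum (w C) D = of_bool (C = D)] (mod 2)"
    using insert by simp
  then obtain w :: "'e set \<Rightarrow> 'e \<Rightarrow> int"
    where w: "\<And>C D. C \<in> B \<Longrightarrow> D \<in> B \<Longrightarrow> [sum (w C) D = of_bool (C = D)] (mod 2)"
    by blast
  define s where "s C = sum (w C) Z" for C
  \<comment> \<open>The sum of this family is \<open>Z\<close> plus all \<open>s C\<close> times
    \<open>C\<close>, that is, \<open>Z\<close> made orthogonal to the old functionals. Independence
    keeps it nonzero, so some edge \<open>e\<close> survives in it.\<close>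
  define \<D> where "\<D> = insert Z {C \<in> B. odd (s C)}"
  have "sum_mod2 \<D> \<noteq> {}"
  proof -
    have "finite \<D> \<and> \<D> \<subseteq> insert Z B \<and> \<D> \<noteq> {}"
      using insert.hyps(1) by (auto simp: \<D>_def)
    then show ?thesis
      using insert.prems(1) unfolding independent_mod2_def by blast
  qed
  then obtain e where e: "odd (card {D \<in> \<D>. e \<in> D})"
    unfolding sum_mod2_def by blast
  have fB: "finite B" and fZ: "finite Z" and fD: "\<And>D. D \<in> B \<Longrightarrow> finite D"
    using insert by auto
  \<comment> \<open>The coordinate at \<open>e\<close>, corrected so as to vanish on
    \<open>B\<close>. Its value on \<open>Z\<close> is the coordinate at \<open>e\<close> of the
    reduced vector, hence odd.\<close>
  define wZ where "wZ x = of_bool (x = e) - (\<Sum>C\<in>{C\<in>B. e \<in> C}. w C x)" for x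
  have sumwZ: "sum wZ D = of_bool (e \<in> D) - (\<Sum>C\<in>{C\<in>B. e \<in> C}. sum (w C) D)" if "finite D" for D
    using that by (simp add: wZ_def sum_subtractf sum.swap[of _ D])
  have wZB: "[sum wZ D = 0] (mod 2)" if D: "D \<in> B" for D
  proof -
    have "[sum wZ D = of_bool (e \<in> D) - (\<Sum>C\<in>{C\<in>B. e \<in> C}. of_bool (C = D))] (mod 2)"
      unfolding sumwZ[OF fD[OF D]] by (intro cong_diff cong_sum cong_refl w) (use D in auto)
    also have "(\<Sum>C\<in>{C\<in>B. e \<in> C}. of_bool (C = D)) = (of_bool (e \<in> D) :: int)"
      using fB D by (simp add: of_bool_def)
    finally show ?thesis by simp
  qed
  have wZZ: "[sum wZ Z = 1] (mod 2)"
  proof -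
    have "{D \<in> \<D>. e \<in> D} = (if e \<in> Z then {Z} else {}) \<union> {C \<in> B. e \<in> C \<and> odd (s C)}"
      by (auto simp: \<D>_def)
    moreover have "(if e \<in> Z then {Z} else {}) \<inter> {C \<in> B. e \<in> C \<and> odd (s C)} = {}"
      using insert.hyps(2) by auto
    ultimately have "card {D \<in> \<D>. e \<in> D} = of_bool (e \<in> Z) + card {C \<in> B. e \<in> C \<and> odd (s C)}"
      using fB by (simp add: card_Un_disjoint)
    moreover have "[(\<Sum>C\<in>{C\<in>B. e \<in> C}. s C) = (\<Sum>C\<in>{C\<in>B. e \<in> C}. of_bool (odd (s C)))] (mod 2)"
      by (intro cong_sum) (auto simp: cong_def odd_iff_mod_2_eq_one)
    moreover have "(\<Sum>C\<in>{C\<in>B. e \<in> C}. of_bool (odd (s C))) = int (card {C \<in> B. e \<in> C \<and> odd (s C)})"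
      using fB by (simp add: of_bool_def sum.If_cases Int_def conj_commute conj_left_commute)
    ultimately have card_eq: "int (card {D \<in> \<D>. e \<in> D}) =
        of_bool (e \<in> Z) + (\<Sum>C\<in>{C\<in>B. e \<in> C}. of_bool (odd (s C)))"
      and cong: "[(\<Sum>C\<in>{C\<in>B. e \<in> C}. s C) = (\<Sum>C\<in>{C\<in>B. e \<in> C}. of_bool (odd (s C)))] (mod 2)"
      by simp_all
    have "[of_bool (e \<in> Z) + (\<Sum>C\<in>{C\<in>B. e \<in> C}. s C) = int (card {D \<in> \<D>. e \<in> D})] (mod 2)"
      unfolding card_eq by (intro cong_add cong_refl cong)
    then have "odd (of_bool (e \<in> Z) + (\<Sum>C\<in>{C\<in>B. e \<in> C}. s C))"
      using e cong_dvd_iff by fastforce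
    then have "odd (sum wZ Z)"
      unfolding sumwZ[OF fZ] s_def by simp
    then show ?thesis by (simp add: cong_def odd_iff_mod_2_eq_one)
  qed
  \<comment> \<open>The old functionals are corrected in turn by multiples of \<open>wZ\<close>; as
    \<open>wZ\<close> vanishes on \<open>B\<close>, only their values on \<open>Z\<close>
    change.\<close>
  define w' where "w' C = (if C = Z then wZ else (\<lambda>x. w C x - s C * wZ x))" for C
  have "[sum (w' C) D = of_bool (C = D)] (mod 2)" if "C \<in> insert Z B" "D \<in> insert Z B" for C D
  proof (cases "C = Z")
    case True
    then show ?thesis using wZB wZZ that insert.hyps(2) by (auto simp: w'_def)
  next
    case False
    then have C: "C \<in> B" using that by simp
    have *: "sum (w' C) D = sum (w C) D - s C * sum wZ D"
      using False by (simp add: w'_def sum_subtractf sum_distrib_left)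
    show ?thesis
    proof (cases "D = Z")
      case True
      have "[s C - s C * sum wZ Z = s C - s C * 1] (mod 2)"
        by (intro cong_diff cong_mult cong_refl wZZ)
      then show ?thesis using * True False by (simp add: s_def)
    next
      case D: False
      then have D: "D \<in> B" using that by simp
      have "[sum (w C) D - s C * sum wZ D = of_bool (C = D) - s C * 0] (mod 2)"
        by (intro cong_diff cong_mult cong_refl wZB w D C)
      then show ?thesis using * by simp
    qed
  qed
  then show ?case by blast
qed

section \<open>Free products and cocycles\<close>

definition fword :: "'a set set \<Rightarrow> ('a set \<times> 'a) list \<Rightarrow> bool" where
  "fword F w \<longleftrightarrow> (\<forall>(H, x)\<in>set w. H \<in> F \<and> x \<in> H)"

definition weval :: "('a, 'b) monoid_scheme \<Rightarrow> ('a set \<times> 'a) list \<Rightarrow> 'a" where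
  "weval G w = foldr (\<lambda>x y. x \<otimes>\<^bsub>G\<^esub> y) (map snd w) \<one>\<^bsub>G\<^esub>"

lemma fword_simps [simp]:
  "fword F []" "fword F ((H, x) # w) \<longleftrightarrow> H \<in> F \<and> x \<in> H \<and> fword F w"
  "fword F (u @ w) \<longleftrightarrow> fword F u \<and> fword F w"
  by (auto simp: fword_def)

lemma weval_simps [simp]:
  "weval G [] = \<one>\<^bsub>G\<^esub>" "weval G ((H, x) # w) = x \<otimes>\<^bsub>G\<^esub> weval G w"
  by (simp_all add: weval_def)

lemma reduced_word_Nil [simp]: "reduced_word G F []"
  by (simp add: reduced_word_def)

lemma reduced_word_Cons:
  "reduced_word G F ((H, x) # w) \<longleftrightarrow>
     H \<in> F \<and> x \<in> H \<and> x \<noteq> \<one>\<^bsub>G\<^esub> \<and> reduced_word G F w \<and> (w = [] \<or> fst (hd w) \<noteq> H)"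
  by (cases w) (auto simp: reduced_word_def)

lemma reduced_word_fword: "reduced_word G F w \<Longrightarrow> fword F w"
  by (auto simp: reduced_word_def fword_def)

text \<open>Left multiplication by a letter on reduced words, as in van der Waerden's proof of the
  normal form theorem: the tail is already reduced, so one merger or cancellation suffices.\<close>

fun rcons :: "('a, 'b) monoid_scheme \<Rightarrow> 'a set \<Rightarrow> 'a \<Rightarrow> ('a set \<times> 'a) list \<Rightarrow> ('a set \<times> 'a) list" where
  "rcons G H x [] = (if x = \<one>\<^bsub>G\<^esub> then [] else [(H, x)])"
| "rcons G H x ((H', y) # w) =
     (if x = \<one>\<^bsub>G\<^esub> then (H', y) # w else
      if H' = H then if x \<otimes>\<^bsub>G\<^esub> y = \<one>\<^bsub>G\<^esub> then w else (H, x \<otimes>\<^bsub>G\<^esub> y) # w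
      else (H, x) # (H', y) # w)"

locale factors = group G for G (structure) +
  fixes F :: "'a set set"
  assumes factor_subgroup: "H \<in> F \<Longrightarrow> subgroup H G"
begin

lemma factor_carrier: "H \<in> F \<Longrightarrow> x \<in> H \<Longrightarrow> x \<in> carrier G"
  using factor_subgroup subgroup.mem_carrier by metis

lemma weval_closed [simp]: "fword F w \<Longrightarrow> weval G w \<in> carrier G"
  by (induction w) (auto simp: factor_carrier)

lemma weval_append: "fword F u \<Longrightarrow> fword F w \<Longrightarrow> weval G (u @ w) = weval G u \<otimes> weval G w"
  by (induction u) (auto simp: factor_carrier m_assoc)

lemma reduced_rcons:
  assumes "reduced_word G F w" "H \<in> F" "x \<in> H"
  shows "reduced_word G F (rcons G H x w)"
proof (cases "(G, H, x, w)" rule: rcons.cases)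
  case (2 G' H'' x' H' y w')
  then show ?thesis
    using assms subgroup.m_closed[OF factor_subgroup[OF assms(2)]]
    by (auto simp: reduced_word_Cons)
qed (use assms in \<open>auto simp: reduced_word_Cons\<close>)

lemma weval_rcons:
  assumes "fword F w" "H \<in> F" "x \<in> H"
  shows "weval G (rcons G H x w) = x \<otimes> weval G w"
proof (cases w)
  case Nil
  then show ?thesis using assms by (auto simp: factor_carrier)
next
  case (Cons a w')
  obtain H' y where a: "a = (H', y)" by force
  have "x \<in> carrier G" "y \<in> carrier G" "weval G w' \<in> carrier G"
    using assms by (auto simp: Cons a factor_carrier)
  then show ?thesis
    using m_assoc[of x y "weval G w'"] by (auto simp: Cons a)
qed

lemma generate_words:
  assumes "g \<in> generate G (\<Union>F)"
  shows "\<exists>w. fword F w \<and> weval G w = g"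
  using assms
proof (induction g rule: generate.induct)
  case one
  show ?case by (intro exI[of _ "[]"]) simp
next
  case (incl h)
  then obtain H where "H \<in> F" "h \<in> H" by blast
  then show ?case by (intro exI[of _ "[(H, h)]"]) (auto simp: factor_carrier)
next
  case (inv h)
  then obtain H where "H \<in> F" "h \<in> H" by blast
  then show ?case
    using subgroup.m_inv_closed[OF factor_subgroup]
    by (intro exI[of _ "[(H, inv h)]"]) (auto simp: factor_carrier)
next
  case (eng h1 h2)
  then obtain w1 w2 where "fword F w1" "weval G w1 = h1" "fword F w2" "weval G w2 = h2" by blast
  then show ?case by (intro exI[of _ "w1 @ w2"]) (auto simp: weval_append)
qed

end

locale free_product = group G for G (structure) +
  fixes F :: "'a set set"
  assumes fp: "is_free_product G F"

sublocale free_product \<subseteq> factors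
  using fp by (intro factors.intro factors_axioms.intro is_group) (auto simp: is_free_product_def)

lemma (in free_product) reduced_nontrivial:
  "reduced_word G F w \<Longrightarrow> weval G w = \<one> \<Longrightarrow> w = []"
  using fp by (auto simp: is_free_product_def weval_def)

lemma (in free_product) words_exist: "g \<in> carrier G \<Longrightarrow> \<exists>w. fword F w \<and> weval G w = g"
  using fp generate_words by (auto simp: is_free_product_def)

text \<open>Left cancellation passes to shorter words: multiplying by \<open>inv x\<close> gives
  \<open>w = rcons G H (inv x) w'\<close>. As \<open>w\<close> does not start in \<open>H\<close>,
  the new letter must have been absorbed completely, so \<open>w'\<close> starts with
  \<open>(H, x)\<close>.\<close>

lemma (in free_product) reduced_unique:
  assumes "reduced_word G F w" "reduced_word G F w'" "weval G w = weval G w'"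
  shows "w = w'"
  using assms
proof (induction w arbitrary: w')
  case Nil
  then show ?case using reduced_nontrivial[of w'] by simp
next
  case (Cons a w)
  obtain H x where a: "a = (H, x)" by force
  have H: "H \<in> F" "x \<in> H" "x \<noteq> \<one>" "reduced_word G F w" "w = [] \<or> fst (hd w) \<noteq> H"
    using Cons.prems(1) by (auto simp: a reduced_word_Cons)
  have ix: "inv x \<in> H" "inv x \<noteq> \<one>" and xc: "x \<in> carrier G"
    using H subgroup.m_inv_closed[OF factor_subgroup] factor_carrier by auto
  note fw = reduced_word_fword[OF Cons.prems(2)] reduced_word_fword[OF H(4)]
  have "weval G w = inv x \<otimes> weval G w'"
    using Cons.prems(3) fw xc by (simp add: a flip: m_assoc) (metis inv_solve_left weval_closed)
  then have "weval G w = weval G (rcons G H (inv x) w')"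
    using weval_rcons[OF fw(1) H(1) ix(1)] by simp
  then have w: "w = rcons G H (inv x) w'"
    using Cons.IH[OF H(4) reduced_rcons[OF Cons.prems(2) H(1) ix(1)]] by blast
  show ?case
  proof (cases w')
    case Nil
    then show ?thesis using w ix(2) H(5) by auto
  next
    case (Cons b v)
    obtain H' y where b: "b = (H', y)" by force
    have "y \<in> carrier G"
      using Cons.prems(2) Cons by (auto simp: b reduced_word_Cons factor_carrier)
    have "H' = H" using w ix(2) H(5) by (auto simp: Cons b simp del: inv_eq_1_iff split: if_splits)
    moreover have "inv x \<otimes> y = \<one>"
      using w ix(2) H(5) \<open>H' = H\<close> by (auto simp: Cons b simp del: inv_eq_1_iff split: if_splits)
    ultimately have "w = v" using w ix(2) by (simp add: Cons b)
    moreover have "y = x"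
      using \<open>inv x \<otimes> y = \<one>\<close> xc \<open>y \<in> carrier G\<close> by (metis inv_closed inv_equality inv_inv)
    ultimately show ?thesis using \<open>H' = H\<close> by (simp add: Cons a b)
  qed
qed

text \<open>\<open>E k g\<close> is the cost of reading \<open>g\<close> from state
  \<open>k\<close>, and \<open>st k g\<close> is the state reached. If the state never changes, this
  is a homomorphism modulo \<open>q\<close>; \<open>q = 0\<close> gives integral cocycles, as
  congruence modulo 0 is equality.\<close>

definition cocycle ::
    "('a, 'b) monoid_scheme \<Rightarrow> 'k set \<Rightarrow> ('k \<Rightarrow> 'a \<Rightarrow> 'k) \<Rightarrow> int \<Rightarrow> ('k \<Rightarrow> 'a \<Rightarrow> int) \<Rightarrow> bool" where
  "cocycle G K st q E \<longleftrightarrow>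
     (\<forall>k\<in>K. \<forall>g\<in>carrier G. \<forall>h\<in>carrier G. [E k (g \<otimes>\<^bsub>G\<^esub> h) = E k g + E (st k g) h] (mod q))"

lemma cocycleD:
  "cocycle G K st q E \<Longrightarrow> k \<in> K \<Longrightarrow> g \<in> carrier G \<Longrightarrow> h \<in> carrier G \<Longrightarrow>
     [E k (g \<otimes>\<^bsub>G\<^esub> h) = E k g + E (st k g) h] (mod q)"
  by (auto simp: cocycle_def)

locale state_action = group G for G (structure) +
  fixes K :: "'k set" and st :: "'k \<Rightarrow> 'a \<Rightarrow> 'k"
  assumes st_closed [simp]: "k \<in> K \<Longrightarrow> g \<in> carrier G \<Longrightarrow> st k g \<in> K"
    and st_one [simp]: "k \<in> K \<Longrightarrow> st k \<one> = k"
    and st_mult: "k \<in> K \<Longrightarrow> g \<in> carrier G \<Longrightarrow> h \<in> carrier G \<Longrightarrow> st k (g \<otimes> h) = st (st k g) h"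
begin

lemma cocycle_one:
  assumes "cocycle G K st q E" "k \<in> K"
  shows "[E k \<one> = 0] (mod q)"
  using cocycleD[OF assms one_closed one_closed] assms(2)
  by (simp add: cong_iff_dvd_diff)

lemma cocycle_zero:
  assumes E: "cocycle G K st q E" and X: "X \<subseteq> carrier G"
    and gens: "\<And>k x. k \<in> K \<Longrightarrow> x \<in> X \<Longrightarrow> [E k x = 0] (mod q)"
    and "g \<in> generate G X"
  shows "k \<in> K \<Longrightarrow> [E k g = 0] (mod q)"
  using assms(4)
proof (induction g arbitrary: k rule: generate.induct)
  case one
  then show ?case using cocycle_one[OF E] by simp
next
  case (incl h)
  then show ?case using gens by simp
next
  case (inv h)
  then have h: "h \<in> carrier G" using X by auto
  have "[E k (inv h) + E (st k (inv h)) h = E k (inv h \<otimes> h)] (mod q)"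
    using cocycleD[OF E inv(2) inv_closed[OF h] h] by (rule cong_sym)
  also have "[E k (inv h \<otimes> h) = 0] (mod q)" using cocycle_one[OF E inv(2)] h by simp
  finally have "[E k (inv h) + E (st k (inv h)) h - E (st k (inv h)) h = 0 - 0] (mod q)"
    by (intro cong_diff) (use gens inv h in auto)
  then show ?case by simp
next
  case (eng h1 h2)
  then have h: "h1 \<in> carrier G" "h2 \<in> carrier G"
    using generate_in_carrier[OF X] by auto
  have "[E k (h1 \<otimes> h2) = E k h1 + E (st k h1) h2] (mod q)"
    using cocycleD[OF E eng(5) h] .
  also have "[E k h1 + E (st k h1) h2 = 0 + 0] (mod q)"
    by (intro cong_add eng.IH) (use eng h in auto)
  finally show ?case by simp
qed

lemma cocycle_lin:
  assumes "cocycle G K st q E" "cocycle G K st q E'"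
  shows "cocycle G K st q (\<lambda>k g. E k g - c * E' k g)"
  unfolding cocycle_def
proof (intro ballI)
  fix k g h assume k: "k \<in> K" "g \<in> carrier G" "h \<in> carrier G"
  have "[E k (g \<otimes> h) - c * E' k (g \<otimes> h) =
      (E k g + E (st k g) h) - c * (E' k g + E' (st k g) h)] (mod q)"
    by (intro cong_diff cong_mult cong_refl cocycleD[OF assms(1) k] cocycleD[OF assms(2) k])
  then show "[E k (g \<otimes> h) - c * E' k (g \<otimes> h) =
       E k g - c * E' k g + (E (st k g) h - c * E' (st k g) h)] (mod q)"
    by (simp add: algebra_simps)
qed

lemma cocycle_lincomb:
  assumes "\<And>i. i \<in> I \<Longrightarrow> cocycle G K st q (E i)"
  shows "cocycle G K st q (\<lambda>k g. \<Sum>i\<in>I. c i * E i k g)"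
  unfolding cocycle_def
proof (intro ballI)
  fix k g h assume k: "k \<in> K" "g \<in> carrier G" "h \<in> carrier G"
  have "[(\<Sum>i\<in>I. c i * E i k (g \<otimes> h)) = (\<Sum>i\<in>I. c i * (E i k g + E i (st k g) h))] (mod q)"
    by (intro cong_sum cong_mult cong_refl cocycleD[OF assms k])
  then show "[(\<Sum>i\<in>I. c i * E i k (g \<otimes> h)) =
      (\<Sum>i\<in>I. c i * E i k g) + (\<Sum>i\<in>I. c i * E i (st k g) h)] (mod q)"
    by (simp add: distrib_left sum.distrib)
qed

lemma cocycle_agree:
  assumes "cocycle G K st q E" "cocycle G K st q E'" "X \<subseteq> carrier G"
    and "\<And>k x. k \<in> K \<Longrightarrow> x \<in> X \<Longrightarrow> [E k x = E' k x] (mod q)"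
    and "g \<in> generate G X" "k \<in> K"
  shows "[E k g = E' k g] (mod q)"
proof -
  have "[E k g - 1 * E' k g = 0] (mod q)"
  proof (rule cocycle_zero[OF cocycle_lin[OF assms(1,2)] assms(3) _ assms(5,6)])
    fix k x assume "k \<in> K" "x \<in> X"
    then show "[E k x - 1 * E' k x = 0] (mod q)"
      using assms(4) by (simp add: cong_diff_iff_cong_0)
  qed
  then show ?thesis by (simp add: cong_diff_iff_cong_0)
qed

end

text \<open>Extending compatible values on the free factors to a cocycle: the value on a product is
  computed from any word, and rewriting a word to reduced form does not change the result.\<close>

context
  fixes st :: "'k \<Rightarrow> 'a \<Rightarrow> 'k" and c :: "'k \<Rightarrow> 'a set \<Rightarrow> 'a \<Rightarrow> int"
begin

fun word_sum :: "'k \<Rightarrow> ('a set \<times> 'a) list \<Rightarrow> int" where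
  "word_sum k [] = 0"
| "word_sum k ((H, x) # w) = c k H x + word_sum (st k x) w"

end

theorem (in free_product) cocycle_extension:
  assumes "state_action G K st"
    and c: "\<And>k H x y. k \<in> K \<Longrightarrow> H \<in> F \<Longrightarrow> x \<in> H \<Longrightarrow> y \<in> H \<Longrightarrow>
        [c k H (x \<otimes> y) = c k H x + c (st k x) H y] (mod q)"
  shows "\<exists>E. cocycle G K st q E \<and> (\<forall>k\<in>K. \<forall>H\<in>F. \<forall>x\<in>H. [E k x = c k H x] (mod q))"
proof -
  interpret state_action G K st by fact
  let ?ws = "word_sum st c"
  have append: "?ws k (u @ w) = ?ws k u + ?ws (st k (weval G u)) w"
    if "fword F u" "k \<in> K" for k u w
    using that by (induction u arbitrary: k) (auto simp: factor_carrier st_mult)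
  have c1: "[c k H \<one> = 0] (mod q)" if "k \<in> K" "H \<in> F" for k H
    using c[OF that, of \<one> \<one>] subgroup.one_closed[OF factor_subgroup[OF that(2)]] that(1)
    by (simp add: cong_iff_dvd_diff)
  \<comment> \<open>Merging two adjacent letters needs exactly the compatibility \<open>c\<close>
    within one factor; a trivial letter costs 0 by \<open>c1\<close>.\<close>
  have rc: "[?ws k (rcons G H x w) = c k H x + ?ws (st k x) w] (mod q)"
    if "fword F w" "H \<in> F" "x \<in> H" "k \<in> K" for k H x w
  proof (cases w)
    case Nil
    then show ?thesis using that cong_sym[OF c1[OF that(4,2)]] by auto
  next
    case (Cons a w')
    obtain H' y where a: "a = (H', y)" by force
    show ?thesis
    proof (cases "x = \<one> \<or> H' \<noteq> H")
      case True
      then show ?thesis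
        using that c1[OF that(4,2)] cong_add[OF cong_sym[OF c1[OF that(4,2)]] cong_refl]
        by (auto simp: Cons a)
    next
      case False
      have y: "y \<in> H" "x \<in> carrier G" "y \<in> carrier G"
        using that False by (auto simp: Cons a factor_carrier)
      have "[?ws k (rcons G H x w) = c k H (x \<otimes> y) + ?ws (st k (x \<otimes> y)) w'] (mod q)"
        using False that c1[OF that(4,2)]
          cong_add[OF cong_sym[OF c1[OF that(4,2)]] cong_refl, of "?ws k w'"] by (auto simp: Cons a)
      also have "[c k H (x \<otimes> y) + ?ws (st k (x \<otimes> y)) w' =
          (c k H x + c (st k x) H y) + ?ws (st k (x \<otimes> y)) w'] (mod q)"
        by (intro cong_add cong_refl c that y(1))
      finally show ?thesis using that y False by (simp add: Cons a st_mult add.assoc)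
    qed
  qed
  define nf where "nf w = foldr (\<lambda>(H, x). rcons G H x) w []" for w
  have nf: "reduced_word G F (nf w) \<and> weval G (nf w) = weval G w \<and>
      (\<forall>k\<in>K. [?ws k (nf w) = ?ws k w] (mod q))" if "fword F w" for w
    using that
  proof (induction w)
    case Nil
    then show ?case by (simp add: nf_def)
  next
    case (Cons a w)
    obtain H x where a: "a = (H, x)" by force
    have H: "H \<in> F" "x \<in> H" "fword F w" using Cons.prems by (auto simp: a)
    note IH = Cons.IH[OF H(3)]
    have eq: "nf (a # w) = rcons G H x (nf w)" by (simp add: nf_def a)
    have "[?ws k (nf (a # w)) = ?ws k (a # w)] (mod q)" if k: "k \<in> K" for k
    proof -
      have "[?ws k (nf (a # w)) = c k H x + ?ws (st k x) (nf w)] (mod q)"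
        unfolding eq using rc[OF reduced_word_fword H(1,2) k] IH by blast
      also have "[c k H x + ?ws (st k x) (nf w) = c k H x + ?ws (st k x) w] (mod q)"
        by (intro cong_add cong_refl) (use IH k H factor_carrier in auto)
      finally show ?thesis by (simp add: a)
    qed
    then show ?case
      using reduced_rcons[of "nf w" H x] weval_rcons[of "nf w" H x] reduced_word_fword[of G F "nf w"] IH H
      by (simp add: eq[unfolded a] a)
  qed
  have zero: "[?ws k w = 0] (mod q)" if "fword F w" "weval G w = \<one>" "k \<in> K" for k w
  proof -
    have "nf w = []" using nf[OF that(1)] reduced_nontrivial[of "nf w"] that(2) by simp
    moreover have "[?ws k w = ?ws k (nf w)] (mod q)"
      by (rule cong_sym) (use nf[OF that(1)] that(3) in simp)
    ultimately show ?thesis by simp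
  qed
  \<comment> \<open>A common word for the inverse is appended to both words. The extended words
    evaluate to the identity, so both cost 0, and their tails cost the same.\<close>
  have wd: "[?ws k w = ?ws k w'] (mod q)"
    if "fword F w" "fword F w'" "weval G w = weval G w'" "k \<in> K" for k w w'
  proof -
    have "inv (weval G w) \<in> carrier G" using that by simp
    then obtain v where v: "fword F v" "weval G v = inv (weval G w)"
      using words_exist by blast
    have "[?ws k (w @ v) = ?ws k (w' @ v)] (mod q)"
      by (rule cong_trans[OF zero cong_sym[OF zero]]) (use that v in \<open>simp_all add: weval_append\<close>)
    then show ?thesis using append that by (simp add: cong_add_rcancel)
  qed
  define W where "W g = (SOME w. fword F w \<and> weval G w = g)" for g
  have W: "fword F (W g)" "weval G (W g) = g" if "g \<in> carrier G" for g
    using someI_ex[OF words_exist[OF that]] by (auto simp: W_def)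
  define E where "E k g = ?ws k (W g)" for k g
  have "cocycle G K st q E"
    unfolding cocycle_def
  proof (intro ballI)
    fix k g h assume *: "k \<in> K" "g \<in> carrier G" "h \<in> carrier G"
    have "[?ws k (W (g \<otimes> h)) = ?ws k (W g @ W h)] (mod q)"
      using * W by (intro wd) (auto simp: weval_append)
    then show "[E k (g \<otimes> h) = E k g + E (st k g) h] (mod q)"
      using * W by (simp add: append E_def)
  qed
  moreover have "[E k x = c k H x] (mod q)" if "k \<in> K" "H \<in> F" "x \<in> H" for k H x
    using wd[of "W x" "[(H, x)]" k] W[of x] that factor_carrier by (auto simp: E_def)
  ultimately show ?thesis by blast
qed

section \<open>Decompositions into cyclic factors\<close>

definition hom_mod :: "int \<Rightarrow> ('a, 'b) monoid_scheme \<Rightarrow> ('a \<Rightarrow> int) set" where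
  "hom_mod q G = {f. \<forall>x\<in>carrier G. \<forall>y\<in>carrier G. [f (x \<otimes>\<^bsub>G\<^esub> y) = f x + f y] (mod q)}"

text \<open>In a free product of cyclic groups of order 2, order 3 and infinite order, these
  homomorphisms see the infinite factors alone: involutions are killed by definition and elements of
  order 3 die modulo 2.\<close>

definition hom_mod2_tf :: "('a, 'b) monoid_scheme \<Rightarrow> ('a \<Rightarrow> int) set" where
  "hom_mod2_tf G =
     {f \<in> hom_mod 2 G. \<forall>x\<in>carrier G. x \<otimes>\<^bsub>G\<^esub> x = \<one>\<^bsub>G\<^esub> \<longrightarrow> [f x = 0] (mod 2)}"

lemma hom_modD:
  "f \<in> hom_mod q G \<Longrightarrow> x \<in> carrier G \<Longrightarrow> y \<in> carrier G \<Longrightarrow> [f (x \<otimes>\<^bsub>G\<^esub> y) = f x + f y] (mod q)"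
  by (simp add: hom_mod_def)

lemma (in group) hom_mod_one: "f \<in> hom_mod q G \<Longrightarrow> [f \<one> = 0] (mod q)"
  using hom_modD[of f q G \<one> \<one>] by (simp add: cong_iff_dvd_diff)

text \<open>With \<open>x\<close>, \<open>y\<close>, \<open>z\<close> as coset representatives this
  is the multiplicativity of Schreier rewriting.\<close>

lemma (in group) telescope:
  assumes [simp]: "x \<in> carrier G" "g \<in> carrier G" "y \<in> carrier G" "h \<in> carrier G" "z \<in> carrier G"
  shows "(x \<otimes> g \<otimes> inv y) \<otimes> (y \<otimes> h \<otimes> inv z) = x \<otimes> (g \<otimes> h) \<otimes> inv z"
proof -
  have "inv y \<otimes> (y \<otimes> (h \<otimes> inv z)) = h \<otimes> inv z" by (simp flip: m_assoc)
  then show ?thesis by (simp add: m_assoc)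
qed

definition torsion2 :: "('a, 'b) monoid_scheme \<Rightarrow> 'a set" where
  "torsion2 G = {x \<in> carrier G. x \<otimes>\<^bsub>G\<^esub> x = \<one>\<^bsub>G\<^esub>}"

definition torsion3 :: "('a, 'b) monoid_scheme \<Rightarrow> 'a set" where
  "torsion3 G = {x \<in> carrier G. x \<otimes>\<^bsub>G\<^esub> x \<otimes>\<^bsub>G\<^esub> x = \<one>\<^bsub>G\<^esub>}"

lemma (in group) prime_order_subgroup_generated:
  assumes H: "subgroup H G" and "prime (card H)" "x \<in> H" "x \<noteq> \<one>"
  shows "generate G {x} = H \<and> ord x = card H"
proof -
  have fH: "finite H" using assms(2) by (metis card.infinite not_prime_0)
  have x: "x \<in> carrier G" using H assms(3) subgroup.mem_carrier by metis
  have sub: "generate G {x} \<subseteq> H" using generate_subgroup_incl[OF _ H] assms(3) by blast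
  interpret GH: group "G\<lparr>carrier := H\<rparr>" using subgroup.subgroup_is_group[OF H is_group] .
  have "subgroup (generate G {x}) (G\<lparr>carrier := H\<rparr>)"
    using subgroup_incl[OF generate_is_subgroup H sub] x by blast
  then have "card (generate G {x}) dvd card H"
    using GH.lagrange[of "generate G {x}"] fH by (simp add: order_def) (metis dvd_triv_right)
  moreover have "card (generate G {x}) \<noteq> 1"
  proof
    assume "card (generate G {x}) = 1"
    moreover have "x \<in> generate G {x}" "\<one> \<in> generate G {x}"
      by (auto intro: generate.incl generate.one)
    ultimately show False using assms(4) by (auto simp: card_1_singleton_iff)
  qed
  ultimately have "card (generate G {x}) = card H"
    using assms(2) prime_nat_iff by blast
  then show ?thesis using card_subset_eq[OF fH sub] generate_pow_card[OF x] by simp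
qed

locale cyclic_free_product = group G for G (structure) +
  fixes F\<^sub>2 F\<^sub>3 F\<^sub>i :: "'a set set"
  assumes decomp: "cyclic_decomposition G F\<^sub>2 F\<^sub>3 F\<^sub>i"

sublocale cyclic_free_product \<subseteq> free_product G "F\<^sub>2 \<union> F\<^sub>3 \<union> F\<^sub>i"
  using decomp by (intro free_product.intro free_product_axioms.intro is_group)
    (auto simp: cyclic_decomposition_def)

context cyclic_free_product
begin

abbreviation "F \<equiv> F\<^sub>2 \<union> F\<^sub>3 \<union> F\<^sub>i"

definition gen :: "'a set \<Rightarrow> 'a" where
  "gen H = (SOME x. x \<in> H \<and> generate G {x} = H)"

text \<open>The value 0 on infinite factors makes \<open>fac_ord H dvd n\<close> mean
  \<open>n = 0\<close> there, so one divisibility condition serves all three kinds of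
  factors.\<close>

definition fac_ord :: "'a set \<Rightarrow> int" where
  "fac_ord H = (if H \<in> F\<^sub>2 then 2 else if H \<in> F\<^sub>3 then 3 else 0)"

lemma cards: "H \<in> F\<^sub>2 \<Longrightarrow> card H = 2" "H \<in> F\<^sub>3 \<Longrightarrow> card H = 3" "H \<in> F\<^sub>i \<Longrightarrow> infinite H"
  using decomp by (auto simp: cyclic_decomposition_def)

lemma factors_disjoint: "F\<^sub>2 \<inter> F\<^sub>3 = {}" "F\<^sub>2 \<inter> F\<^sub>i = {}" "F\<^sub>3 \<inter> F\<^sub>i = {}"
  using cards by fastforce+

lemma gen_ex:
  assumes "H \<in> F"
  shows "\<exists>x. x \<in> H \<and> generate G {x} = H"
proof (cases "H \<in> F\<^sub>i")
  case True
  then show ?thesis using decomp by (auto simp: cyclic_decomposition_def)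
next
  case False
  then have p: "prime (card H)" using assms cards by auto
  then have "\<not> card H \<le> 1" using prime_gt_1_nat[OF p] by simp
  then have "\<not> H \<subseteq> {\<one>}" using card_mono[of "{\<one>}" H] by auto
  then obtain x where "x \<in> H" "x \<noteq> \<one>" by blast
  then show ?thesis
    using prime_order_subgroup_generated[OF factor_subgroup[OF assms] p] by blast
qed

lemma gen: "H \<in> F \<Longrightarrow> gen H \<in> H" "H \<in> F \<Longrightarrow> generate G {gen H} = H"
  using someI_ex[OF gen_ex] by (auto simp: gen_def)

lemma gen_carrier [simp]: "H \<in> F \<Longrightarrow> gen H \<in> carrier G"
  using gen(1) factor_carrier by metis

lemma gen_pow_eq_one:
  assumes "H \<in> F"
  shows "gen H [^] (n::int) = \<one> \<longleftrightarrow> fac_ord H dvd n"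
proof -
  have "ord (gen H) = card H"
    using generate_pow_card[OF gen_carrier[OF assms]] gen(2)[OF assms] by simp
  moreover have "int (card H) = fac_ord H"
    using cards assms factors_disjoint by (auto simp: fac_ord_def)
  ultimately show ?thesis using int_pow_eq_id[OF gen_carrier[OF assms]] by simp
qed

lemma gens_generate: "generate G (gen ` F) = carrier G"
proof
  show "generate G (gen ` F) \<subseteq> carrier G" by (rule generate_incl) auto
  have sub: "subgroup (generate G (gen ` F)) G" by (rule generate_is_subgroup) auto
  have "\<Union>F \<subseteq> generate G (gen ` F)"
  proof clarify
    fix x H assume "x \<in> H" "H \<in> F"
    moreover from this have "generate G {gen H} \<subseteq> generate G (gen ` F)"
      by (intro mono_generate) auto
    ultimately show "x \<in> generate G (gen ` F)" using gen(2) by auto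
  qed
  then have "generate G (\<Union>F) \<subseteq> generate G (gen ` F)" by (rule generate_subgroup_incl[OF _ sub])
  then show "carrier G \<subseteq> generate G (gen ` F)" using fp by (simp add: is_free_product_def)
qed

definition dlog :: "'a set \<Rightarrow> 'a \<Rightarrow> int" where
  "dlog H y = (SOME n. y = gen H [^] n)"

lemma dlog: assumes "H \<in> F" "y \<in> H" shows "gen H [^] dlog H y = y"
proof -
  have "\<exists>n::int. y = gen H [^] n"
    using assms gen(2)[OF assms(1)] generate_pow[OF gen_carrier[OF assms(1)]] by auto
  then show ?thesis unfolding dlog_def by (metis (mono_tags, lifting) someI_ex)
qed

lemma dlog_mult:
  assumes "H \<in> F" "x \<in> H" "y \<in> H"
  shows "fac_ord H dvd dlog H (x \<otimes> y) - dlog H x - dlog H y"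
proof -
  have xy: "x \<otimes> y \<in> H" using subgroup.m_closed[OF factor_subgroup] assms by blast
  have "gen H [^] dlog H (x \<otimes> y) = gen H [^] (dlog H x + dlog H y)"
    using dlog[OF assms(1,2)] dlog[OF assms(1,3)] dlog[OF assms(1) xy] assms(1)
    by (simp add: int_pow_mult)
  then have "gen H [^] (dlog H (x \<otimes> y) - (dlog H x + dlog H y)) = \<one>"
    using assms(1) by (simp add: int_pow_diff)
  then show ?thesis using gen_pow_eq_one[OF assms(1)] by (simp add: algebra_simps)
qed

lemma dlog_gen: assumes "H \<in> F" shows "fac_ord H dvd dlog H (gen H) - 1"
proof -
  have "gen H [^] (dlog H (gen H) - 1) = \<one>"
    using dlog[OF assms gen(1)[OF assms]] assms by (simp add: int_pow_diff)
  then show ?thesis using gen_pow_eq_one[OF assms] by simp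
qed

end

text \<open>The states are the two parities. A constant parity gives ordinary homomorphisms; the
  parity of the determinant gives the cocycles on \<open>S\<close> that describe homomorphisms on
  its even part. Both uses share the results below.\<close>

locale parity_free_product = cyclic_free_product +
  fixes \<pi> :: "'a \<Rightarrow> bool"
  assumes \<pi>_mult: "x \<in> carrier G \<Longrightarrow> y \<in> carrier G \<Longrightarrow> \<pi> (x \<otimes> y) = (\<pi> x \<noteq> \<pi> y)"
    and \<pi>_torsion: "H \<in> F\<^sub>2 \<union> F\<^sub>3 \<Longrightarrow> x \<in> H \<Longrightarrow> \<not> \<pi> x"
begin

abbreviation st :: "bool \<Rightarrow> 'a \<Rightarrow> bool" where "st k g \<equiv> (k \<noteq> \<pi> g)"

abbreviation "coc \<equiv> cocycle G UNIV st"

abbreviation "ker\<pi> \<equiv> {g \<in> carrier G. \<not> \<pi> g}"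

lemma \<pi>_one [simp]: "\<not> \<pi> \<one>"
  using \<pi>_mult[of \<one> \<one>] by simp

lemma \<pi>_inv [simp]: "x \<in> carrier G \<Longrightarrow> \<pi> (inv x) = \<pi> x"
  using \<pi>_mult[of x "inv x"] by simp

sublocale state_action G UNIV st
  by unfold_locales (auto simp: \<pi>_mult)

lemma \<pi>_pow: "x \<in> carrier G \<Longrightarrow> \<pi> (x [^] (n::int)) = (\<pi> x \<and> odd n)"
proof -
  assume x: "x \<in> carrier G"
  have nat: "\<pi> (x [^] (m::nat)) = (\<pi> x \<and> odd m)" for m
    by (induction m) (use x in \<open>auto simp: \<pi>_mult\<close>)
  show ?thesis
    using nat x by (cases n rule: int_cases2) (auto simp: int_pow_int int_pow_neg)
qed

text \<open>Freeness at work: the values at the generators may be prescribed independently in both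
  states. A factor of finite order n only demands that n times the value vanish modulo
  \<open>q\<close>.\<close>

lemma cocycle_ext:
  fixes v :: "bool \<Rightarrow> 'a set \<Rightarrow> int"
  assumes "\<And>H k. H \<in> F\<^sub>2 \<union> F\<^sub>3 \<Longrightarrow> q dvd fac_ord H * v k H"
  shows "\<exists>E. coc q E \<and> (\<forall>k. \<forall>H\<in>F. [E k (gen H) = v k H] (mod q))"
proof -
  \<comment> \<open>The cost of the \<open>n\<close>-th power of the generator. An odd generator
    flips the state at each step, so half of the steps, rounded up, start in state \<open>k\<close>
    and the others in the opposite state. Since \<open>div\<close> rounds down, the formula also
    holds for negative \<open>n\<close>.\<close>
  define \<gamma> where "\<gamma> k H n = (if \<pi> (gen H) then v k H * ((n + 1) div 2) + v (\<not> k) H * (n div 2)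
    else n * v k H)" for k H and n :: int
  have crossed: "[\<gamma> k H (dlog H (x \<otimes> y)) = \<gamma> k H (dlog H x) + \<gamma> (st k x) H (dlog H y)] (mod q)"
    if H: "H \<in> F" "x \<in> H" "y \<in> H" for k H x y
  proof -
    define a b c where "a = dlog H x" "b = dlog H y" "c = dlog H (x \<otimes> y)"
    have px: "\<pi> x = (\<pi> (gen H) \<and> odd a)"
      using \<pi>_pow[OF gen_carrier[OF H(1)], of a] dlog[OF H(1,2)] by (simp add: a_b_c_def)
    have dv: "fac_ord H dvd c - a - b" using dlog_mult[OF H] by (simp add: a_b_c_def)
    show ?thesis
    proof (cases "\<pi> (gen H)")
      case False
      have "q dvd (c - a - b) * v k H"
      proof (cases "H \<in> F\<^sub>i")
        case True
        then have "fac_ord H = 0" using factors_disjoint by (auto simp: fac_ord_def)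
        then show ?thesis using dv by simp
      next
        case False
        then have "q dvd fac_ord H * v k H" using H(1) assms by auto
        then show ?thesis using dv by (meson dvd_trans mult_dvd_mono dvd_refl)
      qed
      then show ?thesis using False px
        by (simp add: \<gamma>_def cong_iff_dvd_diff algebra_simps flip: a_b_c_def)
    next
      case True
      then have "H \<in> F\<^sub>i" using \<pi>_torsion gen(1)[OF H(1)] H(1) by auto
      then have "fac_ord H = 0" using factors_disjoint by (auto simp: fac_ord_def)
      then have c: "c = a + b" using dv by simp
      have "\<gamma> k H c = \<gamma> k H a + \<gamma> (st k x) H b"
      proof (cases "odd a")
        case True
        then obtain m where m: "a = 2 * m + 1" by (elim oddE)
        have ab: "(a + b + 1) div 2 = m + 1 + b div 2" "(a + b) div 2 = m + (b + 1) div 2"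
          using m by presburger+
        have am: "(a + 1) div 2 = m + 1" "a div 2 = m"
          using m by presburger+
        show ?thesis
          unfolding \<gamma>_def c ab am using \<open>\<pi> (gen H)\<close> px True by (simp add: distrib_left)
      next
        case False
        then have "even a" by simp
        then obtain m where m: "a = 2 * m" by (elim evenE)
        have ab: "(a + b + 1) div 2 = m + (b + 1) div 2" "(a + b) div 2 = m + b div 2"
          using m by presburger+
        have am: "(a + 1) div 2 = m" "a div 2 = m"
          using m by simp_all
        show ?thesis
          unfolding \<gamma>_def c ab am using \<open>\<pi> (gen H)\<close> px False by (simp add: distrib_left)
      qed
      then show ?thesis by (simp add: a_b_c_def)
    qed
  qed
  obtain E where E: "coc q E" "\<And>k H x. H \<in> F \<Longrightarrow> x \<in> H \<Longrightarrow> [E k x = \<gamma> k H (dlog H x)] (mod q)"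
    using cocycle_extension[of UNIV st "\<lambda>k H x. \<gamma> k H (dlog H x)" q] crossed state_action_axioms
    by auto
  have "[E k (gen H) = v k H] (mod q)" if H: "H \<in> F" for k H
  proof (cases "H \<in> F\<^sub>i")
    case True
    then have "fac_ord H = 0" using factors_disjoint by (auto simp: fac_ord_def)
    then have "dlog H (gen H) = 1" using dlog_gen[OF H] by simp
    then show ?thesis using E(2)[OF H gen(1)[OF H], of k] by (simp add: \<gamma>_def split: if_splits)
  next
    case False
    then have H': "H \<in> F\<^sub>2 \<union> F\<^sub>3" using H by blast
    have "q dvd (dlog H (gen H) - 1) * v k H"
      using dlog_gen[OF H] assms[OF H', of k] by (meson dvd_trans mult_dvd_mono dvd_refl)
    then have "[dlog H (gen H) * v k H = v k H] (mod q)"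
      by (simp add: cong_iff_dvd_diff algebra_simps)
    then show ?thesis
      using E(2)[OF H gen(1)[OF H], of k] \<pi>_torsion[OF H' gen(1)[OF H]]
      by (simp add: \<gamma>_def) (rule cong_trans)
  qed
  then show ?thesis using E(1) by blast
qed

lemma cocycle_unique:
  assumes "coc q E" "coc q E'" "\<And>k H. H \<in> F \<Longrightarrow> [E k (gen H) = E' k (gen H)] (mod q)"
    and "g \<in> carrier G"
  shows "[E k g = E' k g] (mod q)"
proof (rule cocycle_agree[OF assms(1,2), of "gen ` F"])
  show "g \<in> generate G (gen ` F)" using assms(4) gens_generate by simp
qed (use assms(3) in auto)

lemma cocycle_twice:
  assumes "coc q E" "g \<in> ker\<pi>"
  shows "[E k (g \<otimes> g) = 2 * E k g] (mod q)" "[E k (g \<otimes> g \<otimes> g) = 3 * E k g] (mod q)"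
proof -
  show *: "[E k (g \<otimes> g) = 2 * E k g] (mod q)"
    using cocycleD[OF assms(1), of k g g] assms(2) by simp
  have "[E k (g \<otimes> g \<otimes> g) = E k (g \<otimes> g) + E k g] (mod q)"
    using cocycleD[OF assms(1), of k "g \<otimes> g" g] assms(2) by (simp add: \<pi>_mult)
  also have "[E k (g \<otimes> g) + E k g = 2 * E k g + E k g] (mod q)"
    by (intro cong_add * cong_refl)
  finally show "[E k (g \<otimes> g \<otimes> g) = 3 * E k g] (mod q)" by simp
qed

lemma integral_cocycle_torsion:
  assumes "coc 0 E" "g \<in> ker\<pi>" "g \<otimes> g = \<one> \<or> g \<otimes> g \<otimes> g = \<one>"
  shows "E k g = 0"
proof -
  have "E k \<one> = 0" using cocycle_one[OF assms(1), of k] by simp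
  then show ?thesis using cocycle_twice[OF assms(1,2), of k] assms(3) by auto
qed

text \<open>A cocycle modulo \<open>q\<close> that vanishes on the finite factors lifts to an integral one, so it
  vanishes on all torsion elements.\<close>

lemma cocycle_torsion:
  assumes E: "coc q E" and z: "\<And>k H. H \<in> F\<^sub>2 \<union> F\<^sub>3 \<Longrightarrow> [E k (gen H) = 0] (mod q)"
    and g: "g \<in> ker\<pi>" "g \<otimes> g = \<one> \<or> g \<otimes> g \<otimes> g = \<one>"
  shows "[E k g = 0] (mod q)"
proof -
  \<comment> \<open>Only the values on infinite factors are kept. They carry no divisibility
    condition, so an integral extension exists.\<close>
  define v where "v k H = (if H \<in> F\<^sub>i then E k (gen H) else 0)" for k H
  have v: "\<And>H k. H \<in> F\<^sub>2 \<union> F\<^sub>3 \<Longrightarrow> 0 dvd fac_ord H * v k H"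
    using factors_disjoint by (auto simp: v_def)
  obtain E' where E': "coc 0 E'" "\<And>k H. H \<in> F \<Longrightarrow> E' k (gen H) = v k H"
    using cocycle_ext[of 0 v, OF v] by auto
  have "coc q E'" using E'(1) by (simp add: cocycle_def)
  then have "[E k g = E' k g] (mod q)"
  proof (rule cocycle_unique[OF E])
    fix k H assume H: "H \<in> F"
    show "[E k (gen H) = E' k (gen H)] (mod q)"
      using E'(2)[OF H] z[of H k] H by (auto simp: v_def)
  qed (use g in simp)
  then show ?thesis using integral_cocycle_torsion[OF E'(1) g] by simp
qed

lemma cocycle_hom_mod:
  assumes "coc q E"
  shows "E k \<in> hom_mod q (G\<lparr>carrier := ker\<pi>\<rparr>)"
proof -
  have "[E k (x \<otimes> y) = E k x + E k y] (mod q)" if "x \<in> ker\<pi>" "y \<in> ker\<pi>" for x y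
    using cocycleD[OF assms, of k x y] that by simp
  then show ?thesis by (simp add: hom_mod_def)
qed

lemma cocycle_F3_mod2:
  assumes "coc 2 E" "H \<in> F\<^sub>3"
  shows "[E k (gen H) = 0] (mod 2)"
proof -
  have H: "H \<in> F" using assms by blast
  have "gen H [^] (3::int) = \<one>"
    using gen_pow_eq_one[OF H, of 3] assms(2) factors_disjoint by (auto simp: fac_ord_def)
  then have "gen H \<otimes> gen H \<otimes> gen H = \<one>" using H by (simp add: numeral_3_eq_3 int_pow_def2)
  then have "[3 * E k (gen H) = 0] (mod 2)"
    using cocycle_twice(2)[OF assms(1), of "gen H" k] H \<pi>_torsion[of H "gen H"] gen(1)[OF H] assms(2)
      cocycle_one[OF assms(1), of k] by simp (meson cong_sym cong_trans)
  then show ?thesis by (simp add: cong_0_iff)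
qed

lemma cocycle_F2_mod3:
  assumes "coc 3 E" "H \<in> F\<^sub>2"
  shows "[E k (gen H) = 0] (mod 3)"
proof -
  have H: "H \<in> F" using assms by blast
  have "gen H [^] (2::int) = \<one>"
    using gen_pow_eq_one[OF H, of 2] assms(2) by (auto simp: fac_ord_def)
  then have "gen H \<otimes> gen H = \<one>" using H by (simp add: numeral_2_eq_2 int_pow_def2)
  then have "[2 * E k (gen H) = 0] (mod 3)"
    using cocycle_twice(1)[OF assms(1), of "gen H" k] H \<pi>_torsion[of H "gen H"] gen(1)[OF H] assms(2)
      cocycle_one[OF assms(1), of k] by simp (meson cong_sym cong_trans)
  then show ?thesis by (simp add: cong_0_iff) presburger
qed

text \<open>Each factor carries one free parameter per state, two in all: the origin of the factor 2
  in the ranks of the even part.\<close>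

lemma delta_cocycles:
  assumes "P \<subseteq> F" "\<And>H. H \<in> P \<Longrightarrow> H \<in> F\<^sub>2 \<union> F\<^sub>3 \<Longrightarrow> q dvd fac_ord H"
  shows "\<exists>e. \<forall>i\<in>P \<times> UNIV. coc q (e i) \<and>
    (\<forall>k. \<forall>H\<in>F. [e i k (gen H) = of_bool (i = (H, k))] (mod q))"
proof (rule bchoice, rule ballI)
  fix i :: "'a set \<times> bool" assume i: "i \<in> P \<times> UNIV"
  show "\<exists>E. coc q E \<and> (\<forall>k. \<forall>H\<in>F. [E k (gen H) = of_bool (i = (H, k))] (mod q))"
    by (rule cocycle_ext) (use assms i in \<open>auto simp: of_bool_def\<close>)
qed

end

section \<open>Ranks of a group read off from a decomposition\<close>

context cyclic_free_product
begin

lemma plain_parity: "parity_free_product G F\<^sub>2 F\<^sub>3 F\<^sub>i (\<lambda>_. False)"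
  by unfold_locales auto

text \<open>The state map is \<open>st\<close> for the constant parity, left in this form so that
  the facts on parities apply literally.\<close>

abbreviation "pcoc \<equiv> cocycle G UNIV (\<lambda>k g. k \<noteq> False)"

lemma plain_state: "state_action G UNIV (\<lambda>k g. k \<noteq> False)"
  by unfold_locales auto

lemmas plain_cocycle_ext = parity_free_product.cocycle_ext[OF plain_parity]
  and plain_cocycle_unique = parity_free_product.cocycle_unique[OF plain_parity]
  and plain_cocycle_torsion = parity_free_product.cocycle_torsion[OF plain_parity]
  and plain_cocycle_F3_mod2 = parity_free_product.cocycle_F3_mod2[OF plain_parity]
  and plain_cocycle_F2_mod3 = parity_free_product.cocycle_F2_mod3[OF plain_parity]
  and plain_integral_cocycle_torsion = parity_free_product.integral_cocycle_torsion[OF plain_parity]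
  and plain_cocycle_lin = state_action.cocycle_lin[OF plain_state]
  and plain_cocycle_lincomb = state_action.cocycle_lincomb[OF plain_state]

lemma hom_mod_cocycle: "f \<in> hom_mod q G \<Longrightarrow> pcoc q (\<lambda>_. f)"
  by (auto simp: cocycle_def hom_mod_def)

text \<open>The generators of the factors in \<open>P\<close> are dual to the cocycles
  \<open>e H\<close>. Why the difference of \<open>f\<close> and its expansion vanishes on
  \<open>X\<close> depends on the use, and is left to \<open>vanish\<close>.\<close>

lemma rank_plain:
  assumes P: "P \<subseteq> F" and q: "q > 1"
    and e: "\<And>H. H \<in> P \<Longrightarrow> pcoc q (e H)"
      "\<And>H H' k. H \<in> P \<Longrightarrow> H' \<in> F \<Longrightarrow> [e H k (gen H') = of_bool (H = H')] (mod q)"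
    and X: "\<And>H. H \<in> P \<Longrightarrow> gen H \<in> X" "X \<subseteq> carrier G"
    and \<Phi>: "\<And>H. H \<in> P \<Longrightarrow> e H False \<in> \<Phi>" "\<Phi> \<subseteq> hom_mod q G"
    and vanish: "\<And>f E g. f \<in> \<Phi> \<Longrightarrow> pcoc q E \<Longrightarrow> (\<And>k H. H \<in> P \<Longrightarrow> [E k (gen H) = 0] (mod q)) \<Longrightarrow>
      (\<And>k H. H \<in> F - P \<Longrightarrow> [E k (gen H) = f (gen H)] (mod q)) \<Longrightarrow> g \<in> X \<Longrightarrow> [E False g = 0] (mod q)"
  shows "dual_rank q X \<Phi> = ecard P"
proof (rule dual_rank_eqI[OF q, where x = gen and e = "\<lambda>H. e H False"])
  fix f g assume fin: "finite P" and f: "f \<in> \<Phi>" and g: "g \<in> X"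
  define E where "E k g = f g - 1 * (\<Sum>H\<in>P. f (gen H) * e H k g)" for k g
  have E: "pcoc q E"
    unfolding E_def
    by (rule plain_cocycle_lin[OF hom_mod_cocycle plain_cocycle_lincomb[OF e(1)]]) (use f \<Phi>(2) in auto)
  have val: "[E k (gen H) = f (gen H) - (if H \<in> P then f (gen H) else 0)] (mod q)" if H: "H \<in> F" for k H
  proof -
    have "[E k (gen H) = f (gen H) - (\<Sum>H'\<in>P. f (gen H') * of_bool (H' = H))] (mod q)"
      unfolding E_def mult_1 by (intro cong_diff cong_sum cong_mult cong_refl e(2) H)
    then show ?thesis using fin by (simp add: of_bool_def if_distrib cong: if_cong)
  qed
  have "[E False g = 0] (mod q)"
  proof (rule vanish[OF f E _ _ g])
    fix k H assume H: "H \<in> P"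
    then have "H \<in> F" using P by blast
    from val[OF this, of k] show "[E k (gen H) = 0] (mod q)" using H by simp
  next
    fix k H assume H: "H \<in> F - P"
    then have H': "H \<in> F" "H \<notin> P" by blast+
    show "[E k (gen H) = f (gen H)] (mod q)"
      using val[OF H'(1), of k] unfolding if_not_P[OF H'(2)] diff_zero .
  qed
  then show "[f g = (\<Sum>H\<in>P. f (gen H) * e H False g)] (mod q)"
    unfolding E_def mult_1 cong_diff_iff_cong_0 .
next
  fix H H' assume "H \<in> P" "H' \<in> P"
  then show "[e H False (gen H') = of_bool (H = H')] (mod q)" using e(2) P by blast
qed (use X(1) \<Phi>(1) in blast)+

lemma gen_order: 
  "H \<in> F\<^sub>2 \<Longrightarrow> gen H \<otimes> gen H = \<one>" "H \<in> F\<^sub>3 \<Longrightarrow> gen H \<otimes> gen H \<otimes> gen H = \<one>"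
  using gen_pow_eq_one[of H 2] gen_pow_eq_one[of H 3] factors_disjoint
  by (auto simp: fac_ord_def int_pow_def2 numeral_2_eq_2 numeral_3_eq_3)

text \<open>No left-hand side mentions the factors, whence their invariance. In the first two
  equations the infinite factors are silenced by pairing with torsion only: a cocycle vanishing on
  the finite factors vanishes on elements of order 2 or 3.\<close>

theorem decomposition_ranks:
  "dual_rank 2 (torsion2 G) (hom_mod 2 G) = ecard F\<^sub>2"
  "dual_rank 3 (torsion3 G) (hom_mod 3 G) = ecard F\<^sub>3"
  "dual_rank 2 (carrier G) (hom_mod2_tf G) = ecard F\<^sub>i"
proof -
  have hom: "E False \<in> hom_mod q G" if E: "pcoc q E" for q E
  proof -
    have "[E False (x \<otimes> y) = E False x + E False y] (mod q)" if "x \<in> carrier G" "y \<in> carrier G" for x y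
      using cocycleD[OF E UNIV_I that, of False] unfolding not_False_eq_True simp_thms by assumption
    then show ?thesis by (simp add: hom_mod_def)
  qed
  have slice: "\<exists>e. \<forall>H\<in>P. pcoc q (e H) \<and> (\<forall>k. \<forall>H'\<in>F. [e H k (gen H') = of_bool (H = H')] (mod q))"
    if P: "P \<subseteq> F" "\<And>H. H \<in> P \<Longrightarrow> H \<in> F\<^sub>2 \<union> F\<^sub>3 \<Longrightarrow> q dvd fac_ord H" for P q
  proof (rule bchoice, rule ballI)
    fix H assume "H \<in> P"
    then have "q dvd fac_ord H' * of_bool (H = H')" if "H' \<in> F\<^sub>2 \<union> F\<^sub>3" for H'
      using P(2) that by (cases "H = H'") auto
    then show "\<exists>E. pcoc q E \<and> (\<forall>k. \<forall>H'\<in>F. [E k (gen H') = of_bool (H = H')] (mod q))"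
      by (rule plain_cocycle_ext)
  qed
  have "\<exists>e. \<forall>H\<in>F\<^sub>2. pcoc 2 (e H) \<and>
      (\<forall>k. \<forall>H'\<in>F. [e H k (gen H') = of_bool (H = H')] (mod 2))"
    by (rule slice) (use factors_disjoint in \<open>auto simp: fac_ord_def\<close>)
  then obtain e2 where e2': "\<forall>H\<in>F\<^sub>2. pcoc 2 (e2 H) \<and>
      (\<forall>k. \<forall>H'\<in>F. [e2 H k (gen H') = of_bool (H = H')] (mod 2))" ..
  have e2: "\<And>H. H \<in> F\<^sub>2 \<Longrightarrow> pcoc 2 (e2 H)"
    "\<And>H H' k. H \<in> F\<^sub>2 \<Longrightarrow> H' \<in> F \<Longrightarrow> [e2 H k (gen H') = of_bool (H = H')] (mod 2)"
    using e2' by blast+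
  have "\<exists>e. \<forall>H\<in>F\<^sub>3. pcoc 3 (e H) \<and>
      (\<forall>k. \<forall>H'\<in>F. [e H k (gen H') = of_bool (H = H')] (mod 3))"
    by (rule slice) (use factors_disjoint in \<open>auto simp: fac_ord_def\<close>)
  then obtain e3 where e3': "\<forall>H\<in>F\<^sub>3. pcoc 3 (e3 H) \<and>
      (\<forall>k. \<forall>H'\<in>F. [e3 H k (gen H') = of_bool (H = H')] (mod 3))" ..
  have e3: "\<And>H. H \<in> F\<^sub>3 \<Longrightarrow> pcoc 3 (e3 H)"
    "\<And>H H' k. H \<in> F\<^sub>3 \<Longrightarrow> H' \<in> F \<Longrightarrow> [e3 H k (gen H') = of_bool (H = H')] (mod 3)"
    using e3' by blast+
  \<comment> \<open>Modulus 0 instead of 2: integral cocycles kill torsion, so their reductions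
    belong to \<open>hom_mod2_tf\<close>.\<close>
  have "\<exists>e. \<forall>H\<in>F\<^sub>i. pcoc 0 (e H) \<and>
      (\<forall>k. \<forall>H'\<in>F. [e H k (gen H') = of_bool (H = H')] (mod 0))"
    by (rule slice) (use factors_disjoint in \<open>auto simp: fac_ord_def\<close>)
  then obtain ei where ei': "\<forall>H\<in>F\<^sub>i. pcoc 0 (ei H) \<and>
      (\<forall>k. \<forall>H'\<in>F. [ei H k (gen H') = of_bool (H = H')] (mod 0))" ..
  have ei: "\<And>H. H \<in> F\<^sub>i \<Longrightarrow> pcoc 0 (ei H)"
    "\<And>H H' k. H \<in> F\<^sub>i \<Longrightarrow> H' \<in> F \<Longrightarrow> [ei H k (gen H') = of_bool (H = H')] (mod 0)"
    using ei' by blast+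
  show "dual_rank 2 (torsion2 G) (hom_mod 2 G) = ecard F\<^sub>2"
  proof (rule rank_plain[OF _ _ e2])
    fix E g assume E: "pcoc 2 E" "\<And>k H. H \<in> F\<^sub>2 \<Longrightarrow> [E k (gen H) = 0] (mod 2)" and g: "g \<in> torsion2 G"
    show "[E False g = 0] (mod 2)"
      by (rule plain_cocycle_torsion[OF E(1)]) (use E(2) plain_cocycle_F3_mod2[OF E(1)] g in \<open>auto simp: torsion2_def\<close>)
  qed (use hom[OF e2(1)] gen_order in \<open>auto simp: torsion2_def\<close>)
  show "dual_rank 3 (torsion3 G) (hom_mod 3 G) = ecard F\<^sub>3"
  proof (rule rank_plain[OF _ _ e3])
    fix E g assume E: "pcoc 3 E" "\<And>k H. H \<in> F\<^sub>3 \<Longrightarrow> [E k (gen H) = 0] (mod 3)" and g: "g \<in> torsion3 G"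
    show "[E False g = 0] (mod 3)"
      by (rule plain_cocycle_torsion[OF E(1)]) (use E(2) plain_cocycle_F2_mod3[OF E(1)] g in \<open>auto simp: torsion3_def\<close>)
  qed (use hom[OF e3(1)] gen_order in \<open>auto simp: torsion3_def\<close>)
  have ei_2: "pcoc 2 (ei H)" if "H \<in> F\<^sub>i" for H
    using ei(1)[OF that] by (simp add: cocycle_def)
  show "dual_rank 2 (carrier G) (hom_mod2_tf G) = ecard F\<^sub>i"
  proof (rule rank_plain[OF _ _ ei_2])
    fix f E g assume f: "f \<in> hom_mod2_tf G" and E: "pcoc 2 E"
      and E0: "\<And>k H. H \<in> F\<^sub>i \<Longrightarrow> [E k (gen H) = 0] (mod 2)"
      and E1: "\<And>k H. H \<in> F - F\<^sub>i \<Longrightarrow> [E k (gen H) = f (gen H)] (mod 2)" and g: "g \<in> carrier G"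
    have "pcoc 2 (\<lambda>_ _. 0)" by (simp add: cocycle_def)
    then show "[E False g = 0] (mod 2)"
    proof (rule plain_cocycle_unique[OF E])
      fix k H assume H: "H \<in> F"
      show "[E k (gen H) = 0] (mod 2)"
      proof (cases "H \<in> F\<^sub>2")
        case True
        then have "[E k (gen H) = f (gen H)] (mod 2)" using E1 factors_disjoint by auto
        also have "[f (gen H) = 0] (mod 2)"
          using f True gen_order H by (auto simp: hom_mod2_tf_def)
        finally show ?thesis .
      qed (use H E0 plain_cocycle_F3_mod2[OF E] in auto)
    qed (use g in auto)
  next
    fix H assume H: "H \<in> F\<^sub>i"
    show "ei H False \<in> hom_mod2_tf G"
      using hom[OF ei_2[OF H]] plain_integral_cocycle_torsion[OF ei(1)[OF H]]
      by (auto simp: hom_mod2_tf_def)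
  qed (use ei in \<open>auto simp: hom_mod2_tf_def\<close>)
qed

end

section \<open>Kernels of odd characters\<close>

locale odd_free_product = parity_free_product +
  fixes H\<^sub>0 assumes H0: "H\<^sub>0 \<in> F\<^sub>i" "\<pi> (gen H\<^sub>0)"
begin

text \<open>A transversal of the even elements, indexed by the parity of its members.\<close>

definition tt :: "bool \<Rightarrow> 'a" where "tt k = (if k then gen H\<^sub>0 else \<one>)"

lemma tt [simp]: "tt k \<in> carrier G" "\<pi> (tt k) = k" "tt False = \<one>"
  using H0 by (auto simp: tt_def)

text \<open>Shapiro's lemma made explicit: a homomorphism \<open>f\<close> on the even elements
  becomes a cocycle on the whole group, which in state \<open>False\<close> restricts to
  \<open>f\<close> again.\<close>

definition push :: "('a \<Rightarrow> int) \<Rightarrow> bool \<Rightarrow> 'a \<Rightarrow> int" where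
  "push f k g = f (tt k \<otimes> g \<otimes> inv (tt (st k g)))"

text \<open>The Schreier generators of the even elements for the transversal \<open>tt\<close>. The
  one at \<open>(H\<^sub>0, False)\<close> is trivial.\<close>

definition basis :: "'a set \<times> bool \<Rightarrow> 'a" where
  "basis = (\<lambda>(H, k). tt k \<otimes> gen H \<otimes> inv (tt (st k (gen H))))"

abbreviation "K \<equiv> G\<lparr>carrier := ker\<pi>\<rparr>"

lemma shift_ker: "g \<in> carrier G \<Longrightarrow> tt k \<otimes> g \<otimes> inv (tt (st k g)) \<in> ker\<pi>"
  by (auto simp: \<pi>_mult)

lemma hom_mod_K:
  "f \<in> hom_mod q K \<Longrightarrow> x \<in> ker\<pi> \<Longrightarrow> y \<in> ker\<pi> \<Longrightarrow> [f (x \<otimes> y) = f x + f y] (mod q)"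
  by (simp add: hom_mod_def)

lemma push_cocycle:
  assumes f: "f \<in> hom_mod q K"
  shows "coc q (push f)"
  unfolding cocycle_def
proof (intro ballI)
  fix k g h assume g: "g \<in> carrier G" and h: "h \<in> carrier G"
  let ?a = "tt k \<otimes> g \<otimes> inv (tt (st k g))" and ?b = "tt (st k g) \<otimes> h \<otimes> inv (tt (st (st k g) h))"
  have "?a \<otimes> ?b = tt k \<otimes> (g \<otimes> h) \<otimes> inv (tt (st k (g \<otimes> h)))"
  proof -
    have st: "st k (g \<otimes> h) = st (st k g) h" using g h by (auto simp: \<pi>_mult)
    show ?thesis unfolding st by (rule telescope) (use g h in simp_all)
  qed
  moreover have "[f (?a \<otimes> ?b) = f ?a + f ?b] (mod q)"
    by (rule hom_mod_K[OF f shift_ker[OF g] shift_ker[OF h]])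
  ultimately show "[push f k (g \<otimes> h) = push f k g + push f (st k g) h] (mod q)"
    unfolding push_def by (simp only:)
qed

lemma push_False: "g \<in> ker\<pi> \<Longrightarrow> push f False g = f g"
  by (simp add: push_def)

lemma push_gen: "push f k (gen H) = f (basis (H, k))"
  by (simp add: push_def basis_def)

text \<open>Normalising \<open>E\<close> to 0 at the generator of \<open>H\<^sub>0\<close> makes the
  transversal free of cost, so a Schreier generator costs as much as the letter in its
  middle.\<close>

lemma cocycle_basis:
  assumes E: "coc q E" and 0: "[E False (gen H\<^sub>0) = 0] (mod q)" and H: "H \<in> F"
  shows "[E False (basis (H, k)) = E k (gen H)] (mod q)"
proof -
  have t0: "[E False (tt j) = 0] (mod q)" for j
    using 0 cocycle_one[OF E, of False] by (auto simp: tt_def)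
  have ti: "[E j (inv (tt j)) = 0] (mod q)" for j
  proof -
    have "[E False (tt j) + E j (inv (tt j)) = E False \<one>] (mod q)"
      using cong_sym[OF cocycleD[OF E, of False "tt j" "inv (tt j)"]] by simp
    then have "[E False (tt j) + E j (inv (tt j)) - E False (tt j) = E False \<one> - 0] (mod q)"
      by (intro cong_diff t0)
    also have "[E False \<one> - 0 = 0] (mod q)" using cocycle_one[OF E, of False] by simp
    finally show ?thesis by simp
  qed
  let ?j = "st k (gen H)"
  have "[E False (basis (H, k)) = E False (tt k \<otimes> gen H) + E ?j (inv (tt ?j))] (mod q)"
    using cocycleD[OF E, of False "tt k \<otimes> gen H" "inv (tt ?j)"] H by (simp add: basis_def \<pi>_mult)
  also have "[E False (tt k \<otimes> gen H) + E ?j (inv (tt ?j)) = (E False (tt k) + E k (gen H)) + 0] (mod q)"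
    using cocycleD[OF E, of False "tt k" "gen H"] H by (intro cong_add ti) simp_all
  also have "[(E False (tt k) + E k (gen H)) + 0 = (0 + E k (gen H)) + 0] (mod q)"
    by (intro cong_add t0 cong_refl)
  finally show ?thesis by simp
qed

text \<open>The counterpart of \<open>rank_plain\<close> for the even elements. The index of the
  trivial Schreier generator is taken out; it accounts for the summand -1 in the final
  formula.\<close>

lemma rank_crossed:
  fixes P X \<Phi>
  defines "I \<equiv> P \<times> UNIV - {(H\<^sub>0, False)}"
  assumes P: "P \<subseteq> F" and q: "q > 1"
    and e: "\<And>i. i \<in> P \<times> UNIV \<Longrightarrow> coc q (e i)"
      "\<And>i H k. i \<in> P \<times> UNIV \<Longrightarrow> H \<in> F \<Longrightarrow> [e i k (gen H) = of_bool (i = (H, k))] (mod q)"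
    and X: "\<And>i. i \<in> P \<times> UNIV \<Longrightarrow> basis i \<in> X" "X \<subseteq> ker\<pi>"
    and \<Phi>: "\<And>i. i \<in> P \<times> UNIV \<Longrightarrow> e i False \<in> \<Phi>" "\<Phi> \<subseteq> hom_mod q K"
    and vanish: "\<And>f E g. f \<in> \<Phi> \<Longrightarrow> coc q E \<Longrightarrow> (\<And>k H. H \<in> P \<Longrightarrow> [E k (gen H) = 0] (mod q)) \<Longrightarrow>
      (\<And>k H. H \<in> F - P \<Longrightarrow> [E k (gen H) = f (basis (H, k))] (mod q)) \<Longrightarrow> g \<in> X \<Longrightarrow> [E False g = 0] (mod q)"
  shows "dual_rank q X \<Phi> = ecard I"
proof (rule dual_rank_eqI[OF q, where x = basis and e = "\<lambda>i. e i False"])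
  fix i j assume i: "i \<in> I" and j: "j \<in> I"
  obtain H k where Hk: "j = (H, k)" by force
  have iP: "i \<in> P \<times> UNIV" "i \<noteq> (H\<^sub>0, False)" and H: "H \<in> F" and "H\<^sub>0 \<in> F"
    using i j P H0 by (auto simp: I_def Hk)
  then have "[e i False (gen H\<^sub>0) = 0] (mod q)"
    using e(2)[OF iP(1), of H\<^sub>0 False] unfolding of_bool_def if_not_P[OF iP(2)] by blast
  then have "[e i False (basis j) = e i k (gen H)] (mod q)"
    unfolding Hk by (rule cocycle_basis[OF e(1)[OF iP(1)] _ H])
  also have "[e i k (gen H) = of_bool (i = j)] (mod q)"
    unfolding Hk by (rule e(2)[OF iP(1) H])
  finally show "[e i False (basis j) = of_bool (i = j)] (mod q)" .
next
  fix f g assume fin: "finite I" and f: "f \<in> \<Phi>" and g: "g \<in> X"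
  define E where "E k g = push f k g - 1 * (\<Sum>i\<in>I. f (basis i) * e i k g)" for k g
  have E: "coc q E"
    unfolding E_def
    by (rule cocycle_lin[OF push_cocycle cocycle_lincomb[OF e(1)]]) (use f \<Phi>(2) in \<open>auto simp: I_def\<close>)
  have val: "[E k (gen H) = f (basis (H, k)) - (if (H, k) \<in> I then f (basis (H, k)) else 0)] (mod q)"
    if H: "H \<in> F" for k H
  proof -
    have "[E k (gen H) = f (basis (H, k)) - (\<Sum>i\<in>I. f (basis i) * of_bool (i = (H, k)))] (mod q)"
      unfolding E_def mult_1 push_gen by (intro cong_diff cong_sum cong_mult cong_refl e(2) H) (auto simp: I_def)
    then show ?thesis using fin by (simp add: of_bool_def if_distrib cong: if_cong)
  qed
  have "[E False g = 0] (mod q)"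
  proof (rule vanish[OF f E _ _ g])
    fix k H assume HP: "H \<in> P"
    show "[E k (gen H) = 0] (mod q)"
    proof (cases "(H, k) = (H\<^sub>0, False)")
      case False
      then show ?thesis using val[of H k] P HP by (auto simp: I_def)
    next
      \<comment> \<open>The missing index leaves no gap: \<open>f\<close> vanishes on the trivial
        Schreier generator, so the expansion is correct there as well.\<close>
      case True
      then have "basis (H, k) = \<one>" using H0 by (simp add: basis_def) (simp add: tt_def)
      moreover have "[f \<one> = 0] (mod q)"
      proof -
        have "[push f False \<one> = 0] (mod q)"
          by (rule cocycle_one) (use f \<Phi>(2) push_cocycle in auto)
        then show ?thesis by (simp add: push_def)
      qed
      moreover have H': "H \<in> F" "(H, k) \<notin> I" using P HP True by (auto simp: I_def)
      ultimately show ?thesis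
        using val[OF H'(1), of k] unfolding if_not_P[OF H'(2)] diff_zero by (metis cong_trans)
    qed
  next
    fix k H assume "H \<in> F - P"
    then have H': "H \<in> F" "(H, k) \<notin> I" by (auto simp: I_def)
    show "[E k (gen H) = f (basis (H, k))] (mod q)"
      using val[OF H'(1), of k] unfolding if_not_P[OF H'(2)] diff_zero .
  qed
  then have "[push f False g = (\<Sum>i\<in>I. f (basis i) * e i False g)] (mod q)"
    unfolding E_def mult_1 cong_diff_iff_cong_0 .
  then show "[f g = (\<Sum>i\<in>I. f (basis i) * e i False g)] (mod q)"
    using push_False X(2) g by auto
next
  fix i assume "i \<in> I"
  then show "basis i \<in> X" "e i False \<in> \<Phi>" using X(1) \<Phi>(1) by (simp_all add: I_def)
qed

lemma basis_torsion:
  assumes "H \<in> F\<^sub>2 \<union> F\<^sub>3"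
  shows "basis (H, k) \<otimes> basis (H, k) = tt k \<otimes> (gen H \<otimes> gen H) \<otimes> inv (tt k)"
    and "basis (H, k) \<otimes> basis (H, k) \<otimes> basis (H, k) = tt k \<otimes> (gen H \<otimes> gen H \<otimes> gen H) \<otimes> inv (tt k)"
proof -
  have H: "H \<in> F" using assms by blast
  then have "\<not> \<pi> (gen H)" using \<pi>_torsion[OF assms gen(1)] by blast
  then have b: "basis (H, k) = tt k \<otimes> gen H \<otimes> inv (tt k)" by (simp add: basis_def)
  have *: "(tt k \<otimes> x \<otimes> inv (tt k)) \<otimes> (tt k \<otimes> y \<otimes> inv (tt k)) = tt k \<otimes> (x \<otimes> y) \<otimes> inv (tt k)"
    if "x \<in> carrier G" "y \<in> carrier G" for x y
    using telescope[of "tt k" x "tt k" y "tt k"] that by simp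
  show "basis (H, k) \<otimes> basis (H, k) = tt k \<otimes> (gen H \<otimes> gen H) \<otimes> inv (tt k)"
    "basis (H, k) \<otimes> basis (H, k) \<otimes> basis (H, k) = tt k \<otimes> (gen H \<otimes> gen H \<otimes> gen H) \<otimes> inv (tt k)"
    using H by (simp_all add: b *)
qed

lemma ecard_times_bool: "ecard (P \<times> (UNIV :: bool set)) = 2 * ecard P"
proof (cases "finite P")
  case True
  then show ?thesis by (simp add: ecard_def card_cartesian_product numeral_eq_enat)
next
  case False
  then have "infinite (P \<times> (UNIV :: bool set))" by (auto dest: finite_cartesian_productD1)
  then show ?thesis using False by (simp add: ecard_def numeral_eq_enat)
qed

theorem kernel_ranks:
  "dual_rank 2 (torsion2 K) (hom_mod 2 K) = 2 * ecard F\<^sub>2"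
  "dual_rank 3 (torsion3 K) (hom_mod 3 K) = 2 * ecard F\<^sub>3"
  "dual_rank 2 (carrier K) (hom_mod2_tf K) = 2 * ecard F\<^sub>i - 1"
proof -
  have bk: "basis (H, k) \<in> ker\<pi>" if "H \<in> F" for H k
    using shift_ker[of "gen H" k] that by (simp add: basis_def)
  have "\<exists>e. \<forall>i\<in>F\<^sub>2 \<times> UNIV. coc 2 (e i) \<and>
      (\<forall>k. \<forall>H\<in>F. [e i k (gen H) = of_bool (i = (H, k))] (mod 2))"
    by (rule delta_cocycles) (use factors_disjoint in \<open>auto simp: fac_ord_def\<close>)
  then obtain e2 where e2': "\<forall>i\<in>F\<^sub>2 \<times> UNIV. coc 2 (e2 i) \<and>
      (\<forall>k. \<forall>H\<in>F. [e2 i k (gen H) = of_bool (i = (H, k))] (mod 2))" ..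
  have e2: "\<And>i. i \<in> F\<^sub>2 \<times> UNIV \<Longrightarrow> coc 2 (e2 i)"
    "\<And>i H k. i \<in> F\<^sub>2 \<times> UNIV \<Longrightarrow> H \<in> F \<Longrightarrow> [e2 i k (gen H) = of_bool (i = (H, k))] (mod 2)"
    using e2' by blast+
  have "\<exists>e. \<forall>i\<in>F\<^sub>3 \<times> UNIV. coc 3 (e i) \<and>
      (\<forall>k. \<forall>H\<in>F. [e i k (gen H) = of_bool (i = (H, k))] (mod 3))"
    by (rule delta_cocycles) (use factors_disjoint in \<open>auto simp: fac_ord_def\<close>)
  then obtain e3 where e3': "\<forall>i\<in>F\<^sub>3 \<times> UNIV. coc 3 (e3 i) \<and>
      (\<forall>k. \<forall>H\<in>F. [e3 i k (gen H) = of_bool (i = (H, k))] (mod 3))" ..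
  have e3: "\<And>i. i \<in> F\<^sub>3 \<times> UNIV \<Longrightarrow> coc 3 (e3 i)"
    "\<And>i H k. i \<in> F\<^sub>3 \<times> UNIV \<Longrightarrow> H \<in> F \<Longrightarrow> [e3 i k (gen H) = of_bool (i = (H, k))] (mod 3)"
    using e3' by blast+
  have "\<exists>e. \<forall>i\<in>F\<^sub>i \<times> UNIV. coc 0 (e i) \<and>
      (\<forall>k. \<forall>H\<in>F. [e i k (gen H) = of_bool (i = (H, k))] (mod 0))"
    by (rule delta_cocycles) (use factors_disjoint in \<open>auto simp: fac_ord_def\<close>)
  then obtain ei where ei': "\<forall>i\<in>F\<^sub>i \<times> UNIV. coc 0 (ei i) \<and>
      (\<forall>k. \<forall>H\<in>F. [ei i k (gen H) = of_bool (i = (H, k))] (mod 0))" ..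
  have ei: "\<And>i. i \<in> F\<^sub>i \<times> UNIV \<Longrightarrow> coc 0 (ei i)"
    "\<And>i H k. i \<in> F\<^sub>i \<times> UNIV \<Longrightarrow> H \<in> F \<Longrightarrow> [ei i k (gen H) = of_bool (i = (H, k))] (mod 0)"
    using ei' by blast+
  \<comment> \<open>The removed index belongs to an infinite factor, so only the third rank loses
    1.\<close>
  have n0: "(H\<^sub>0, False) \<notin> F\<^sub>2 \<times> UNIV" "(H\<^sub>0, False) \<notin> F\<^sub>3 \<times> UNIV"
    using H0 factors_disjoint by auto
  have "dual_rank 2 (torsion2 K) (hom_mod 2 K) = ecard (F\<^sub>2 \<times> UNIV - {(H\<^sub>0, False)})"
  proof (rule rank_crossed[OF _ _ e2])
    fix E g assume E: "coc 2 E" "\<And>k H. H \<in> F\<^sub>2 \<Longrightarrow> [E k (gen H) = 0] (mod 2)" and g: "g \<in> torsion2 K"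
    show "[E False g = 0] (mod 2)"
      by (rule cocycle_torsion[OF E(1)]) (use E(2) cocycle_F3_mod2[OF E(1)] g in \<open>auto simp: torsion2_def\<close>)
  next
    fix i :: "'a set \<times> bool" assume "i \<in> F\<^sub>2 \<times> UNIV"
    then show "basis i \<in> torsion2 K"
      using bk basis_torsion(1) gen_order(1) by (auto simp: torsion2_def)
  qed (use cocycle_hom_mod[OF e2(1)] in \<open>auto simp: torsion2_def\<close>)
  then show "dual_rank 2 (torsion2 K) (hom_mod 2 K) = 2 * ecard F\<^sub>2"
    using n0 by (simp add: ecard_times_bool)
  have "dual_rank 3 (torsion3 K) (hom_mod 3 K) = ecard (F\<^sub>3 \<times> UNIV - {(H\<^sub>0, False)})"
  proof (rule rank_crossed[OF _ _ e3])
    fix E g assume E: "coc 3 E" "\<And>k H. H \<in> F\<^sub>3 \<Longrightarrow> [E k (gen H) = 0] (mod 3)" and g: "g \<in> torsion3 K"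
    show "[E False g = 0] (mod 3)"
      by (rule cocycle_torsion[OF E(1)]) (use E(2) cocycle_F2_mod3[OF E(1)] g in \<open>auto simp: torsion3_def\<close>)
  next
    fix i :: "'a set \<times> bool" assume "i \<in> F\<^sub>3 \<times> UNIV"
    then show "basis i \<in> torsion3 K"
      using bk basis_torsion(2) gen_order(2) by (auto simp: torsion3_def)
  qed (use cocycle_hom_mod[OF e3(1)] in \<open>auto simp: torsion3_def\<close>)
  then show "dual_rank 3 (torsion3 K) (hom_mod 3 K) = 2 * ecard F\<^sub>3"
    using n0 by (simp add: ecard_times_bool)
  have ei_2: "coc 2 (ei i)" if "i \<in> F\<^sub>i \<times> UNIV" for i
    using ei(1)[OF that] by (simp add: cocycle_def)
  have "dual_rank 2 (carrier K) (hom_mod2_tf K) = ecard (F\<^sub>i \<times> UNIV - {(H\<^sub>0, False)})"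
  proof (rule rank_crossed[OF _ _ ei_2])
    fix f E g assume f: "f \<in> hom_mod2_tf K" and E: "coc 2 E"
      and E0: "\<And>k H. H \<in> F\<^sub>i \<Longrightarrow> [E k (gen H) = 0] (mod 2)"
      and E1: "\<And>k H. H \<in> F - F\<^sub>i \<Longrightarrow> [E k (gen H) = f (basis (H, k))] (mod 2)" and g: "g \<in> carrier K"
    have "coc 2 (\<lambda>_ _. 0)" by (simp add: cocycle_def)
    then show "[E False g = 0] (mod 2)"
    proof (rule cocycle_unique[OF E])
      fix k H assume H: "H \<in> F"
      show "[E k (gen H) = 0] (mod 2)"
      proof (cases "H \<in> F\<^sub>2")
        case True
        then have "[E k (gen H) = f (basis (H, k))] (mod 2)" using E1 factors_disjoint by auto
        also have "[f (basis (H, k)) = 0] (mod 2)"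
          using f True gen_order H basis_torsion(1)[of H k] bk[OF H, of k] by (auto simp: hom_mod2_tf_def)
        finally show ?thesis .
      qed (use H E0 cocycle_F3_mod2[OF E] in auto)
    qed (use g in auto)
  next
    fix i :: "'a set \<times> bool" assume i: "i \<in> F\<^sub>i \<times> UNIV"
    show "ei i False \<in> hom_mod2_tf K"
      using cocycle_hom_mod[OF ei_2[OF i]] integral_cocycle_torsion[OF ei(1)[OF i]]
      by (auto simp: hom_mod2_tf_def)
  qed (use ei bk in \<open>auto simp: hom_mod2_tf_def\<close>)
  also have "ecard (F\<^sub>i \<times> UNIV - {(H\<^sub>0, False)}) = 2 * ecard F\<^sub>i - 1"
  proof (cases "finite F\<^sub>i")
    case True
    then show ?thesis using H0
      by (simp add: ecard_def card_cartesian_product numeral_eq_enat one_enat_def)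
  next
    case False
    then have "infinite (F\<^sub>i \<times> (UNIV :: bool set))" by (auto dest: finite_cartesian_productD1)
    then show ?thesis using False by (simp add: ecard_def numeral_eq_enat one_enat_def)
  qed
  finally show "dual_rank 2 (carrier K) (hom_mod2_tf K) = 2 * ecard F\<^sub>i - 1" .
qed

end

section \<open>The modular group as a free product\<close>

definition mk :: "int \<Rightarrow> int \<Rightarrow> int \<Rightarrow> int \<Rightarrow> int ^ 2 ^ 2" where
  "mk a b c d = vector [vector [a, b], vector [c, d]]"

lemma mk_nth [simp]:
  "mk a b c d $ 1 $ 1 = a" "mk a b c d $ 1 $ 2 = b" "mk a b c d $ 2 $ 1 = c" "mk a b c d $ 2 $ 2 = d"
  by (simp_all add: mk_def)

lemma mk_cases: obtains a b c d where "M = mk a b c d"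
proof
  show "M = mk (M $ 1 $ 1) (M $ 1 $ 2) (M $ 2 $ 1) (M $ 2 $ 2)"
    by (simp add: vec_eq_iff forall_2)
qed

lemma mk_eq_iff [simp]: "mk a b c d = mk a' b' c' d' \<longleftrightarrow> a = a' \<and> b = b' \<and> c = c' \<and> d = d'"
  by (auto simp: vec_eq_iff forall_2)

lemma mk_mult [simp]:
  "mk a b c d ** mk a' b' c' d' = mk (a * a' + b * c') (a * b' + b * d') (c * a' + d * c') (c * b' + d * d')"
  by (simp add: vec_eq_iff forall_2 matrix_matrix_mult_def sum_2)

lemma det_mk [simp]: "det (mk a b c d) = a * d - b * c"
  by (simp add: det_2)

lemma trace_mk [simp]: "trace (mk a b c d) = a + d"
  by (simp add: trace_def sum_2)

lemma uminus_mk [simp]: "- mk a b c d = mk (- a) (- b) (- c) (- d)"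
  by (simp add: vec_eq_iff forall_2)

lemma mat_1_mk: "mat 1 = mk 1 0 0 1"
  by (simp add: vec_eq_iff forall_2 mat_def)

lemma minus_mult_2 [simp]: "(- M) ** N = - (M ** N)" "M ** (- N) = - (M ** N)" for M N :: "int ^ 2 ^ 2"
  by (cases M rule: mk_cases; cases N rule: mk_cases; simp)+

lemma det_minus_2 [simp]: "det (- M) = det M" for M :: "int ^ 2 ^ 2"
  by (cases M rule: mk_cases) simp

lemma GL2Z_simps [simp]:
  "carrier GL2Z = {M. det M = 1 \<or> det M = - 1}" "x \<otimes>\<^bsub>GL2Z\<^esub> y = x ** y" "\<one>\<^bsub>GL2Z\<^esub> = mat 1"
  by (simp_all add: GL2Z_def)

lemma group_GL2Z: "group GL2Z"
proof (rule groupI)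
  fix x assume "x \<in> carrier GL2Z"
  moreover obtain a b c d where x: "x = mk a b c d" by (rule mk_cases)
  ultimately have "(\<exists>y\<in>carrier GL2Z. y \<otimes>\<^bsub>GL2Z\<^esub> x = \<one>\<^bsub>GL2Z\<^esub>)"
  proof -
    assume "x \<in> carrier GL2Z"
    then consider "a * d - b * c = 1" | "a * d - b * c = - 1" by (auto simp: x)
    then show ?thesis
    proof cases
      case 1
      then show ?thesis
        by (intro bexI[of _ "mk d (- b) (- c) a"]) (auto simp: x mat_1_mk algebra_simps)
    next
      case 2
      then show ?thesis
        by (intro bexI[of _ "mk (- d) b c (- a)"]) (auto simp: x mat_1_mk algebra_simps)
    qed
  qed
  then show "\<exists>y\<in>carrier GL2Z. y \<otimes>\<^bsub>GL2Z\<^esub> x = \<one>\<^bsub>GL2Z\<^esub>" .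
qed (auto simp: det_mul matrix_mul_assoc)

lemma normal_center2: "center2 \<lhd> GL2Z"
proof -
  interpret group GL2Z by (rule group_GL2Z)
  have "subgroup center2 GL2Z"
  proof (rule subgroupI)
    fix a assume "a \<in> center2"
    moreover have "inv\<^bsub>GL2Z\<^esub> (mat 1) = mat 1" using inv_one by simp
    moreover have "inv\<^bsub>GL2Z\<^esub> (- mat 1) = - mat 1"
      by (rule inv_equality) auto
    ultimately show "inv\<^bsub>GL2Z\<^esub> a \<in> center2" by (auto simp: center2_def)
  qed (auto simp: center2_def)
  then show ?thesis
  proof (rule normal_invI)
    fix x h assume x: "x \<in> carrier GL2Z" and h: "h \<in> center2"
    have "x \<otimes>\<^bsub>GL2Z\<^esub> inv\<^bsub>GL2Z\<^esub> x = mat 1" using r_inv[OF x] by simp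
    then show "x \<otimes>\<^bsub>GL2Z\<^esub> h \<otimes>\<^bsub>GL2Z\<^esub> inv\<^bsub>GL2Z\<^esub> x \<in> center2"
      using h by (auto simp: center2_def)
  qed
qed

interpretation PG: group PGL2Z
  unfolding PGL2Z_def using normal.factorgroup_is_group[OF normal_center2] .

definition unimod :: "int ^ 2 ^ 2 \<Rightarrow> bool" where
  "unimod M \<longleftrightarrow> det M = 1 \<or> det M = - 1"

lemma pm_eq: "pm M = {M, - M}"
  by (auto simp: pm_def r_coset_def center2_def)

lemma pm_eq_iff: "pm M = pm N \<longleftrightarrow> M = N \<or> M = - N"
  by (auto simp: pm_eq doubleton_eq_iff)

lemma carrier_PGL2Z: "carrier PGL2Z = pm ` {M. unimod M}"
  by (auto simp: PGL2Z_def FactGroup_def RCOSETS_def pm_def unimod_def)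

lemma pm_mult: "unimod M \<Longrightarrow> unimod N \<Longrightarrow> pm M \<otimes>\<^bsub>PGL2Z\<^esub> pm N = pm (M ** N)"
  using normal.rcos_sum[OF normal_center2, of M N]
  by (simp add: PGL2Z_def FactGroup_def pm_def unimod_def)

lemma pm_one: "\<one>\<^bsub>PGL2Z\<^esub> = pm (mk 1 0 0 1)"
  by (simp add: PGL2Z_def FactGroup_def pm_eq center2_def flip: mat_1_mk)

lemma unimod_mk: "unimod (mk a b c d) \<longleftrightarrow> a * d - b * c = 1 \<or> a * d - b * c = - 1"
  by (simp add: unimod_def)

lemma unimod_mult: "unimod M \<Longrightarrow> unimod N \<Longrightarrow> unimod (M ** N)"
  by (auto simp: unimod_def det_mul)

lemma pm_closed [simp]: "unimod M \<Longrightarrow> pm M \<in> carrier PGL2Z"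
  by (simp add: carrier_PGL2Z)

lemma gens_mk:
  "mA = pm (mk 0 (- 1) 1 0)" "mB = pm (mk 0 (- 1) 1 1)" "mV = pm (mk (- 1) 0 0 1)" "mC = pm (mk 1 1 0 1)"
  by (simp_all add: mA_def mB_def mV_def mC_def mk_def)

lemma pm_mk_mult:
  "unimod (mk a b c d) \<Longrightarrow> unimod (mk a' b' c' d') \<Longrightarrow> pm (mk a b c d) \<otimes>\<^bsub>PGL2Z\<^esub> pm (mk a' b' c' d') =
     pm (mk (a * a' + b * c') (a * b' + b * d') (c * a' + d * c') (c * b' + d * d'))"
  by (simp add: pm_mult)

definition mU :: "(int ^ 2 ^ 2) set" where "mU = mA \<otimes>\<^bsub>PGL2Z\<^esub> mV"

lemma mU_mk: "mU = pm (mk 0 1 1 0)"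
  by (simp add: mU_def gens_mk pm_mk_mult unimod_mk pm_eq_iff)

lemma gens_closed [simp]:
  "mA \<in> carrier PGL2Z" "mB \<in> carrier PGL2Z" "mV \<in> carrier PGL2Z" "mC \<in> carrier PGL2Z" "mU \<in> carrier PGL2Z"
  by (simp_all add: gens_mk mU_mk unimod_mk)

lemma relations:
  "mA \<otimes>\<^bsub>PGL2Z\<^esub> mA = \<one>\<^bsub>PGL2Z\<^esub>" "mB \<otimes>\<^bsub>PGL2Z\<^esub> mB \<otimes>\<^bsub>PGL2Z\<^esub> mB = \<one>\<^bsub>PGL2Z\<^esub>"
  "mU \<otimes>\<^bsub>PGL2Z\<^esub> mU = \<one>\<^bsub>PGL2Z\<^esub>" "mU \<otimes>\<^bsub>PGL2Z\<^esub> mA = mA \<otimes>\<^bsub>PGL2Z\<^esub> mU"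
  "mU \<otimes>\<^bsub>PGL2Z\<^esub> mB = mB \<otimes>\<^bsub>PGL2Z\<^esub> mB \<otimes>\<^bsub>PGL2Z\<^esub> mU" "mC = mA \<otimes>\<^bsub>PGL2Z\<^esub> mB" "mV = mA \<otimes>\<^bsub>PGL2Z\<^esub> mU"
  by (simp_all add: gens_mk mU_mk pm_one pm_mk_mult unimod_mk pm_eq_iff)

lemma PSL2Z_eq: "PSL2Z = pm ` {M. det M = 1}"
  by (simp add: PSL2Z_def)

lemma pm_PSL2Z: "pm M \<in> PSL2Z \<longleftrightarrow> det M = 1"
  by (auto simp: PSL2Z_eq pm_eq_iff)

lemma PSL2Z_mult:
  assumes "x \<in> carrier PGL2Z" "y \<in> carrier PGL2Z"
  shows "x \<otimes>\<^bsub>PGL2Z\<^esub> y \<in> PSL2Z \<longleftrightarrow> (x \<in> PSL2Z \<longleftrightarrow> y \<in> PSL2Z)"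
  using assms by (auto simp: carrier_PGL2Z pm_mult pm_PSL2Z det_mul unimod_def)

lemma gens_PSL2Z: "mA \<in> PSL2Z" "mB \<in> PSL2Z" "mU \<notin> PSL2Z" "mC \<in> PSL2Z" "\<one>\<^bsub>PGL2Z\<^esub> \<in> PSL2Z"
  by (simp_all add: gens_mk mU_mk pm_one pm_PSL2Z)

lemma PSL2Z_carrier: "PSL2Z \<subseteq> carrier PGL2Z"
  by (auto simp: carrier_PGL2Z PSL2Z_eq unimod_def)

lemma subgroup_PSL2Z: "subgroup PSL2Z PGL2Z"
proof (rule PG.subgroupI)
  fix a assume a: "a \<in> PSL2Z"
  then have "a \<in> carrier PGL2Z" using PSL2Z_carrier by blast
  then show "inv\<^bsub>PGL2Z\<^esub> a \<in> PSL2Z"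
    using PSL2Z_mult[of a "inv\<^bsub>PGL2Z\<^esub> a"] a gens_PSL2Z(5) by simp
qed (use PSL2Z_carrier PSL2Z_mult gens_PSL2Z in \<open>auto simp: subset_iff\<close>)

lemma mC_pow: "mC [^]\<^bsub>PGL2Z\<^esub> (n::int) = pm (mk 1 n 0 1)"
proof -
  have nat: "mC [^]\<^bsub>PGL2Z\<^esub> (m::nat) = pm (mk 1 (int m) 0 1)" for m
  proof (induction m)
    case 0
    then show ?case by (simp add: pm_one)
  next
    case (Suc m)
    then show ?case by (simp add: gens_mk pm_mk_mult unimod_mk)
  qed
  show ?thesis
  proof (cases n rule: int_cases2)
    case (nonneg m)
    then show ?thesis using nat by (simp add: int_pow_int)
  next
    case (nonpos m)
    have "inv\<^bsub>PGL2Z\<^esub> (pm (mk 1 (int m) 0 1)) = pm (mk 1 (- int m) 0 1)"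
      by (rule PG.inv_equality) (simp_all add: pm_mk_mult unimod_mk pm_one)
    then show ?thesis using nat[of m] nonpos by (simp add: PG.int_pow_neg int_pow_int)
  qed
qed

text \<open>Euclid's algorithm on the lower row, carried out by right multiplication with powers of
  C = AB and with A.\<close>

lemma PSL2Z_generated: "generate PGL2Z {mA, mB} = PSL2Z"
proof
  show "generate PGL2Z {mA, mB} \<subseteq> PSL2Z"
    using PG.generate_subgroup_incl[OF _ subgroup_PSL2Z] gens_PSL2Z by simp
  have sub: "subgroup (generate PGL2Z {mA, mB}) PGL2Z"
    by (rule PG.generate_is_subgroup) simp
  let ?S = "generate PGL2Z {mA, mB}"
  have A: "mA \<in> ?S" and B: "mB \<in> ?S" by (auto intro: generate.incl)
  have C: "mC [^]\<^bsub>PGL2Z\<^esub> (n::int) \<in> ?S" for n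
    using PG.subgroup_int_pow_closed[OF sub, of mC n] subgroup.m_closed[OF sub A B] relations(6) by simp
  have "pm (mk a b c d) \<in> ?S" if "a * d - b * c = 1" for a b c d
    using that
  proof (induction "nat \<bar>c\<bar>" arbitrary: a b c d rule: less_induct)
    case less
    show ?case
    proof (cases "c = 0")
      case True
      then have "a = 1 \<and> d = 1 \<or> a = - 1 \<and> d = - 1" using less.prems by (simp add: zmult_eq_1_iff)
      then have "pm (mk a b c d) = mC [^]\<^bsub>PGL2Z\<^esub> (a * b)"
        using True by (auto simp: mC_pow pm_eq_iff)
      then show ?thesis using C by simp
    next
      case False
      \<comment> \<open>Right multiplication by C^n and then by A turns the lower row (c, d) into (d
        mod c, -c).\<close>
      define n where "n = - (d div c)"
      have cn: "c * n + d = d mod c" by (simp add: n_def minus_mult_div_eq_mod)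
      have "nat \<bar>c * n + d\<bar> < nat \<bar>c\<bar>" using False by (simp add: cn abs_mod_less)
      moreover have "(a * n + b) * (- c) - (- a) * (c * n + d) = 1"
        using less.prems by (simp add: algebra_simps)
      ultimately have IH: "pm (mk (a * n + b) (- a) (c * n + d) (- c)) \<in> ?S"
        using less.hyps by blast
      have "pm (mk a b c d) =
          pm (mk (a * n + b) (- a) (c * n + d) (- c)) \<otimes>\<^bsub>PGL2Z\<^esub> mA \<otimes>\<^bsub>PGL2Z\<^esub> mC [^]\<^bsub>PGL2Z\<^esub> (- n)"
        using less.prems by (simp add: gens_mk(1) mC_pow pm_mk_mult unimod_mk pm_eq_iff algebra_simps)
      then show ?thesis
        using IH A C[of "- n"] by (simp add: subgroup.m_closed[OF sub])
    qed
  qed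
  then show "PSL2Z \<subseteq> ?S"
    unfolding PSL2Z_eq by (clarsimp, metis det_mk mk_cases)
qed

definition HA :: "(int ^ 2 ^ 2) set set" where "HA = {\<one>\<^bsub>PGL2Z\<^esub>, mA}"

definition HB :: "(int ^ 2 ^ 2) set set" where "HB = {\<one>\<^bsub>PGL2Z\<^esub>, mB, mB \<otimes>\<^bsub>PGL2Z\<^esub> mB}"

lemma HA_HB_ne: "HA \<noteq> HB" "mA \<noteq> \<one>\<^bsub>PGL2Z\<^esub>" "mB \<noteq> \<one>\<^bsub>PGL2Z\<^esub>" "mB \<otimes>\<^bsub>PGL2Z\<^esub> mB \<noteq> \<one>\<^bsub>PGL2Z\<^esub>"
  "mB \<otimes>\<^bsub>PGL2Z\<^esub> mB \<noteq> mB"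
proof -
  have "mB \<notin> HA" "mB \<in> HB" by (simp_all add: HA_def HB_def gens_mk pm_one pm_eq_iff)
  then show "HA \<noteq> HB" by blast
qed (simp_all add: gens_mk pm_one pm_eq_iff pm_mk_mult unimod_mk)

lemma inv_gens:
  "inv\<^bsub>PGL2Z\<^esub> mA = mA" "inv\<^bsub>PGL2Z\<^esub> mB = mB \<otimes>\<^bsub>PGL2Z\<^esub> mB" "inv\<^bsub>PGL2Z\<^esub> (mB \<otimes>\<^bsub>PGL2Z\<^esub> mB) = mB"
  "inv\<^bsub>PGL2Z\<^esub> mU = mU"
  by (rule PG.inv_equality; simp add: relations PG.m_assoc[symmetric])+

lemma subgroup_HA: "subgroup HA PGL2Z"
  by (rule PG.subgroupI) (auto simp: HA_def relations inv_gens)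

lemma B_pow4: "mB \<otimes>\<^bsub>PGL2Z\<^esub> (mB \<otimes>\<^bsub>PGL2Z\<^esub> mB) = \<one>\<^bsub>PGL2Z\<^esub>"
  "mB \<otimes>\<^bsub>PGL2Z\<^esub> mB \<otimes>\<^bsub>PGL2Z\<^esub> (mB \<otimes>\<^bsub>PGL2Z\<^esub> mB) = mB"
  using relations(2) by (simp_all add: PG.m_assoc[symmetric])

lemma subgroup_HB: "subgroup HB PGL2Z"
  by (rule PG.subgroupI) (auto simp: HB_def relations inv_gens B_pow4)

text \<open>Up to sign, \<open>AB\<close> and \<open>AB\<^sup>2\<close> are the nonnegative matrices generating the
  unimodular semigroup, so a reduced word starting with \<open>A\<close> is a nonnegative matrix, possibly
  times a last letter \<open>A\<close>.\<close>

lemma reduced_word_shape: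
  assumes "reduced_word PGL2Z {HA, HB} w"
  shows "\<exists>a b c d. a \<ge> 0 \<and> b \<ge> 0 \<and> c \<ge> 0 \<and> d \<ge> 0 \<and> a * d - b * c = 1 \<and>
    (\<exists>X. (X = mk a b c d \<or> X = mk b (- a) d (- c)) \<and>
      (if w = [] \<or> fst (hd w) = HA
       then weval PGL2Z w = pm X \<and> (w \<noteq> [] \<longrightarrow> X \<noteq> mk 1 0 0 1)
       else weval PGL2Z w = mB \<otimes>\<^bsub>PGL2Z\<^esub> pm X \<or> weval PGL2Z w = mB \<otimes>\<^bsub>PGL2Z\<^esub> mB \<otimes>\<^bsub>PGL2Z\<^esub> pm X))"
  using assms
proof (induction w)
  case Nil
  show ?case
    by (rule exI[of _ 1], rule exI[of _ 0], rule exI[of _ 0], rule exI[of _ 1])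
      (auto simp: pm_one intro!: exI[of _ "mk 1 0 0 1"])
next
  case (Cons l w)
  obtain H x where l: "l = (H, x)" by force
  have H: "H \<in> {HA, HB}" "x \<in> H" "x \<noteq> \<one>\<^bsub>PGL2Z\<^esub>" "reduced_word PGL2Z {HA, HB} w" "w = [] \<or> fst (hd w) \<noteq> H"
    using Cons.prems by (auto simp: l reduced_word_Cons)
  obtain a b c d X where nn: "a \<ge> 0" "b \<ge> 0" "c \<ge> 0" "d \<ge> 0" "a * d - b * c = 1"
    and X: "X = mk a b c d \<or> X = mk b (- a) d (- c)"
    and w: "if w = [] \<or> fst (hd w) = HA
       then weval PGL2Z w = pm X \<and> (w \<noteq> [] \<longrightarrow> X \<noteq> mk 1 0 0 1)
       else weval PGL2Z w = mB \<otimes>\<^bsub>PGL2Z\<^esub> pm X \<or> weval PGL2Z w = mB \<otimes>\<^bsub>PGL2Z\<^esub> mB \<otimes>\<^bsub>PGL2Z\<^esub> pm X"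
    using Cons.IH[OF H(4)] by blast
  have uX: "unimod X" using X nn(5) by (auto simp: unimod_mk algebra_simps)
  show ?case
  proof (cases "H = HB")
    case True
    then have x: "x = mB \<or> x = mB \<otimes>\<^bsub>PGL2Z\<^esub> mB" using H by (auto simp: HB_def)
    have wA: "w = [] \<or> fst (hd w) = HA"
    proof (cases w)
      case (Cons l' w')
      then have "fst l' \<in> {HA, HB}" using H(4) by (cases l') (auto simp: reduced_word_Cons)
      then show ?thesis using H(5) True Cons by auto
    qed simp
    show ?thesis
      by (rule exI[of _ a], rule exI[of _ b], rule exI[of _ c], rule exI[of _ d])
        (use nn X w wA x True HA_HB_ne in \<open>auto simp: l\<close>)
  next
    case False
    then have HA: "H = HA" and x: "x = mA" using H by (auto simp: HA_def)
    have "\<exists>a b c d. a \<ge> 0 \<and> b \<ge> 0 \<and> c \<ge> 0 \<and> d \<ge> 0 \<and> a * d - b * c = 1 \<and>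
      (\<exists>Y. (Y = mk a b c d \<or> Y = mk b (- a) d (- c)) \<and> mA \<otimes>\<^bsub>PGL2Z\<^esub> weval PGL2Z w = pm Y \<and> Y \<noteq> mk 1 0 0 1)"
    proof (cases "w = []")
      case True
      show ?thesis
        by (rule exI[of _ 1], rule exI[of _ 0], rule exI[of _ 0], rule exI[of _ 1])
          (auto simp: True gens_mk unimod_mk pm_eq_iff intro!: exI[of _ "mk 0 (- 1) 1 0"])
    next
      case wne: False
      then have "fst (hd w) \<noteq> HA" using H(5) HA by auto
      then consider "weval PGL2Z w = mB \<otimes>\<^bsub>PGL2Z\<^esub> pm X" | "weval PGL2Z w = mB \<otimes>\<^bsub>PGL2Z\<^esub> mB \<otimes>\<^bsub>PGL2Z\<^esub> pm X"
        using w wne by auto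
      then show ?thesis
      proof cases
        case 1
        then have e: "mA \<otimes>\<^bsub>PGL2Z\<^esub> weval PGL2Z w = pm (mk 1 1 0 1) \<otimes>\<^bsub>PGL2Z\<^esub> pm X"
          using uX by (simp add: gens_mk pm_mk_mult unimod_mk pm_eq_iff flip: PG.m_assoc)
        show ?thesis
        proof (rule exI[of _ "a + c"], rule exI[of _ "b + d"], rule exI[of _ c], rule exI[of _ d], intro conjI)
          show "\<exists>Y. (Y = mk (a + c) (b + d) c d \<or> Y = mk (b + d) (- (a + c)) d (- c)) \<and>
              mA \<otimes>\<^bsub>PGL2Z\<^esub> weval PGL2Z w = pm Y \<and> Y \<noteq> mk 1 0 0 1"
            using X nn unfolding e by (auto simp: pm_mk_mult unimod_mk)
        qed (use nn in \<open>auto simp: algebra_simps\<close>)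
      next
        case 2
        then have e: "mA \<otimes>\<^bsub>PGL2Z\<^esub> weval PGL2Z w = pm (mk 1 0 1 1) \<otimes>\<^bsub>PGL2Z\<^esub> pm X"
          using uX by (simp add: gens_mk pm_mk_mult unimod_mk pm_eq_iff flip: PG.m_assoc)
        show ?thesis
        proof (rule exI[of _ a], rule exI[of _ b], rule exI[of _ "a + c"], rule exI[of _ "b + d"], intro conjI)
          show "\<exists>Y. (Y = mk a b (a + c) (b + d) \<or> Y = mk b (- a) (b + d) (- (a + c))) \<and>
              mA \<otimes>\<^bsub>PGL2Z\<^esub> weval PGL2Z w = pm Y \<and> Y \<noteq> mk 1 0 0 1"
            using X nn unfolding e by (auto simp: pm_mk_mult unimod_mk)
        qed (use nn in \<open>auto simp: algebra_simps\<close>)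
      qed
    qed
    then show ?thesis by (simp add: l HA x)
  qed
qed

text \<open>From ad = 1 + bc with bc nonnegative, both a and d are positive. With this, no
  \<open>X\<close> of the shape in \<open>reduced_word_shape\<close> is plus or minus the inverse of
  B or of B^2, and the only one that is plus or minus the identity is excluded there for words
  starting with A.\<close>

lemma reduced_word_nontrivial:
  assumes "reduced_word PGL2Z {HA, HB} w" "w \<noteq> []"
  shows "weval PGL2Z w \<noteq> \<one>\<^bsub>PGL2Z\<^esub>"
proof
  assume one: "weval PGL2Z w = \<one>\<^bsub>PGL2Z\<^esub>"
  obtain a b c d X where nn: "a \<ge> 0" "b \<ge> 0" "c \<ge> 0" "d \<ge> 0" "a * d - b * c = 1"
    and X: "X = mk a b c d \<or> X = mk b (- a) d (- c)"
    and w: "if w = [] \<or> fst (hd w) = HA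
       then weval PGL2Z w = pm X \<and> (w \<noteq> [] \<longrightarrow> X \<noteq> mk 1 0 0 1)
       else weval PGL2Z w = mB \<otimes>\<^bsub>PGL2Z\<^esub> pm X \<or> weval PGL2Z w = mB \<otimes>\<^bsub>PGL2Z\<^esub> mB \<otimes>\<^bsub>PGL2Z\<^esub> pm X"
    using reduced_word_shape[OF assms(1)] by blast
  have uX: "unimod X" using X nn(5) by (auto simp: unimod_mk algebra_simps)
  have u: "a = 0 \<longrightarrow> b * c = - 1" "b = 0 \<longrightarrow> a * d = 1" "c = 0 \<longrightarrow> a * d = 1" "d = 0 \<longrightarrow> b * c = - 1"
    using nn(5) by auto
  have nbc: "b * c \<noteq> - 1" using nn by (metis mult_nonneg_nonneg neg_0_le_iff_le not_one_le_zero)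
  have ad: "a \<noteq> 0" "d \<noteq> 0" using u nbc by auto
  show False
  proof (cases "fst (hd w) = HA")
    case True
    then have "pm X = pm (mk 1 0 0 1)" "X \<noteq> mk 1 0 0 1" using w assms(2) one by (auto simp: pm_one)
    then show False using X nn ad by (auto simp: pm_eq_iff)
  next
    case False
    then consider "mB \<otimes>\<^bsub>PGL2Z\<^esub> pm X = pm (mk 1 0 0 1)" | "mB \<otimes>\<^bsub>PGL2Z\<^esub> mB \<otimes>\<^bsub>PGL2Z\<^esub> pm X = pm (mk 1 0 0 1)"
      using w assms(2) one by (auto simp: pm_one)
    then show False
      using X nn ad uX by cases (auto simp: gens_mk pm_mk_mult unimod_mk pm_eq_iff)
  qed
qed

abbreviation "PSLG \<equiv> PGL2Z\<lparr>carrier := PSL2Z\<rparr>"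

lemma free_product_PSL2Z: "is_free_product PSLG {HA, HB}"
  unfolding is_free_product_def
proof (intro conjI ballI allI impI)
  fix H assume "H \<in> {HA, HB}"
  then have "subgroup H PGL2Z" "H \<subseteq> PSL2Z"
    using subgroup_HA subgroup_HB gens_PSL2Z PSL2Z_mult by (auto simp: HA_def HB_def)
  then show "subgroup H PSLG" using PG.subgroup_incl[OF _ subgroup_PSL2Z] by blast
next
  have sub: "HA \<union> HB \<subseteq> PSL2Z" using gens_PSL2Z PSL2Z_mult by (auto simp: HA_def HB_def)
  have "generate PSLG (\<Union> {HA, HB}) = generate PGL2Z (HA \<union> HB)"
    using PG.generate_consistent[OF sub subgroup_PSL2Z] by simp
  also have "\<dots> = PSL2Z"
  proof
    show "generate PGL2Z (HA \<union> HB) \<subseteq> PSL2Z" by (rule PG.generate_subgroup_incl[OF sub subgroup_PSL2Z])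
    have "generate PGL2Z {mA, mB} \<subseteq> generate PGL2Z (HA \<union> HB)"
      by (rule PG.mono_generate) (auto simp: HA_def HB_def)
    then show "PSL2Z \<subseteq> generate PGL2Z (HA \<union> HB)" by (simp add: PSL2Z_generated)
  qed
  finally show "generate PSLG (\<Union> {HA, HB}) = carrier PSLG" by simp
next
  fix w assume w: "reduced_word PSLG {HA, HB} w \<and> w \<noteq> []"
  then have "reduced_word PGL2Z {HA, HB} w" by (simp add: reduced_word_def)
  from reduced_word_nontrivial[OF this] w
  show "foldr (\<otimes>\<^bsub>PSLG\<^esub>) (map snd w) \<one>\<^bsub>PSLG\<^esub> \<noteq> \<one>\<^bsub>PSLG\<^esub>" by (simp add: weval_def)
qed

section \<open>The group \<open>That\<close> and the elements of finite order\<close>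

lemma That_mk: "That = {pm (mk e n 0 1) | e n. e = 1 \<or> e = - 1}"
proof -
  have 1: "mC [^]\<^bsub>PGL2Z\<^esub> n \<otimes>\<^bsub>PGL2Z\<^esub> mV [^]\<^bsub>PGL2Z\<^esub> (0::nat) = pm (mk 1 n 0 1)" for n :: int
    by (simp add: mC_pow unimod_mk)
  have 2: "mC [^]\<^bsub>PGL2Z\<^esub> n \<otimes>\<^bsub>PGL2Z\<^esub> mV [^]\<^bsub>PGL2Z\<^esub> (Suc 0) = pm (mk (- 1) n 0 1)" for n :: int
    by (simp add: mC_pow unimod_mk gens_mk(1,3) pm_mk_mult)
  show ?thesis
  proof (intro equalityI subsetI)
    fix x assume "x \<in> That"
    then obtain n :: int and e :: nat where "x = mC [^]\<^bsub>PGL2Z\<^esub> n \<otimes>\<^bsub>PGL2Z\<^esub> mV [^]\<^bsub>PGL2Z\<^esub> e" "e = 0 \<or> e = Suc 0"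
      by (auto simp: That_def)
    then have "x = pm (mk 1 n 0 1) \<or> x = pm (mk (- 1) n 0 1)" using 1[of n] 2[of n] by metis
    then show "x \<in> {pm (mk e n 0 1) | e n. e = 1 \<or> e = - 1}" by blast
  next
    fix x assume "x \<in> {pm (mk e n 0 1) | e n. e = 1 \<or> e = - 1}"
    then obtain n where "x = pm (mk 1 n 0 1) \<or> x = pm (mk (- 1) n 0 1)" by blast
    then have "x = mC [^]\<^bsub>PGL2Z\<^esub> n \<otimes>\<^bsub>PGL2Z\<^esub> mV [^]\<^bsub>PGL2Z\<^esub> (0::nat) \<or>
        x = mC [^]\<^bsub>PGL2Z\<^esub> n \<otimes>\<^bsub>PGL2Z\<^esub> mV [^]\<^bsub>PGL2Z\<^esub> (Suc 0)" by (simp only: 1 2)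
    moreover have "0 \<in> {0, 1 :: nat}" "Suc 0 \<in> {0, 1 :: nat}" by simp_all
    ultimately show "x \<in> That" unfolding That_def by blast
  qed
qed

text \<open>The product is lower triangular with off-diagonal entry \<open>k\<close> up to sign,
  whereas \<open>That\<close> is upper triangular. This separates the labels
  \<open>Sigma_gen S n\<close> later on.\<close>

lemma A_C_pow_A_That:
  assumes "mA \<otimes>\<^bsub>PGL2Z\<^esub> mC [^]\<^bsub>PGL2Z\<^esub> (k::int) \<otimes>\<^bsub>PGL2Z\<^esub> mA \<in> That"
  shows "k = 0"
  using assms by (auto simp: That_mk mC_pow gens_mk(1) pm_mk_mult unimod_mk pm_eq_iff)

text \<open>An involution of determinant -1 has trace 0, hence eigenvalues 1 and -1. A primitive
  integral eigenvector for 1 extends to a basis of Z^2, and in this basis the matrix is upper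
  triangular with diagonal 1, -1.\<close>

lemma reflection_conjugate:
  assumes x: "x \<in> carrier PGL2Z" "x \<notin> PSL2Z" "x \<otimes>\<^bsub>PGL2Z\<^esub> x = \<one>\<^bsub>PGL2Z\<^esub>"
  shows "\<exists>g\<in>carrier PGL2Z. \<exists>t\<in>That. x \<otimes>\<^bsub>PGL2Z\<^esub> g = g \<otimes>\<^bsub>PGL2Z\<^esub> t"
proof -
  obtain M where M: "unimod M" "x = pm M" using x by (auto simp: carrier_PGL2Z)
  obtain a b c d where abcd: "M = mk a b c d" by (rule mk_cases)
  have det: "a * d - b * c = - 1" using M x(2) by (auto simp: abcd pm_PSL2Z unimod_mk)
  have "pm (mk (a * a + b * c) (a * b + b * d) (c * a + d * c) (c * b + d * d)) = pm (mk 1 0 0 1)"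
    using x(3) M by (simp add: abcd pm_mk_mult pm_one)
  then have sq: "b * (a + d) = 0" "c * (a + d) = 0"
    by (auto simp: pm_eq_iff algebra_simps)
  have d: "d = - a"
  proof (rule ccontr)
    assume *: "d \<noteq> - a"
    then have "b = 0" "c = 0" using sq by auto
    then have "a * d = - 1" using det by simp
    then have "a = 1 \<and> d = - 1 \<or> a = - 1 \<and> d = 1"
      by (metis add.inverse_inverse minus_mult_left mult_minus1 zmult_eq_1_iff)
    then show False using * by auto
  qed
  have q: "a * a + b * c = 1" using det d by (simp add: algebra_simps)
  \<comment> \<open>The vector (b, 1 - a) is fixed because a^2 + bc = 1, but it is zero if b = 0 and
    a = 1; in that case (2, c) is fixed.\<close>
  obtain x0 y0 where xy0: "a * x0 + b * y0 = x0" "c * x0 - a * y0 = y0" "x0 \<noteq> 0 \<or> y0 \<noteq> 0"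
  proof (cases "b = 0 \<and> a = 1")
    case True
    show ?thesis by (rule that[of 2 c]) (use True in auto)
  next
    case False
    show ?thesis by (rule that[of b "1 - a"]) (use False q in \<open>auto simp: algebra_simps\<close>)
  qed
  define g where "g = gcd x0 y0"
  have g0: "g \<noteq> 0" using xy0(3) by (simp add: g_def)
  obtain x1 y1 where x1: "x0 = g * x1" "y0 = g * y1"
    by (metis dvdE g_def gcd_dvd1 gcd_dvd2)
  have cop: "coprime x1 y1"
  proof -
    have "g * gcd x1 y1 = \<bar>g\<bar> * 1" using x1 by (metis abs_gcd_int g_def gcd_mult_distrib_int mult.right_neutral)
    then show ?thesis using g0 xy0(3) by (auto simp: g_def coprime_iff_gcd_eq_1)
  qed
  have e: "a * x1 + b * y1 = x1" "c * x1 - a * y1 = y1"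
  proof -
    have "g * (a * x1 + b * y1) = g * x1" "g * (c * x1 - a * y1) = g * y1"
      using xy0 x1 by (simp_all add: algebra_simps)
    then show "a * x1 + b * y1 = x1" "c * x1 - a * y1 = y1" using g0 by simp_all
  qed
  obtain s r where sr: "x1 * s - y1 * r = 1"
  proof -
    obtain u v where "u * x1 + v * y1 = 1" using cop bezout_int[of x1 y1] by auto
    then show ?thesis using that[of u "- v"] by (simp add: algebra_simps)
  qed
  \<comment> \<open>The image of the second basis vector (r, s) is k (x1, y1) - (r, s), which
    determines k as its component along the eigenvector.\<close>
  define k where "k = s * (a * r + b * s) - r * (c * r - a * s)"
  define w1 w2 where "w1 = a * r + b * s" and "w2 = c * r - a * s"
  have k: "k = s * w1 - r * w2" by (simp add: k_def w1_def w2_def)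
  have "y1 * w1 - x1 * w2 = s * (a * x1 + b * y1) - r * (c * x1 - a * y1)"
    by (simp add: w1_def w2_def algebra_simps)
  then have w: "y1 * w1 - x1 * w2 = 1" using e sr by (simp add: algebra_simps)
  have "x1 * k - r = w1 * (x1 * s - y1 * r) + r * (y1 * w1 - x1 * w2 - 1)"
    "y1 * k - s = w2 * (x1 * s - y1 * r) + s * (y1 * w1 - x1 * w2 - 1)"
    by (simp_all add: k algebra_simps)
  then have col1: "a * r + b * s = x1 * k - r" and col2: "c * r - a * s = y1 * k - s"
    using w sr by (simp_all add: w1_def w2_def)
  have "x \<otimes>\<^bsub>PGL2Z\<^esub> pm (mk x1 r y1 s) = pm (mk x1 r y1 s) \<otimes>\<^bsub>PGL2Z\<^esub> pm (mk (- 1) (- k) 0 1)"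
    using M sr e col1 col2 d by (simp add: abcd pm_mk_mult unimod_mk pm_eq_iff algebra_simps)
  moreover have "pm (mk (- 1) (- k) 0 1) \<in> That" by (auto simp: That_mk)
  moreover have "unimod (mk x1 r y1 s)" using sr by (simp add: unimod_mk algebra_simps)
  ultimately show ?thesis by (metis pm_closed)
qed

lemma elliptic_order2:
  assumes "x \<in> PSL2Z" "x \<noteq> \<one>\<^bsub>PGL2Z\<^esub>" "x \<otimes>\<^bsub>PGL2Z\<^esub> x = \<one>\<^bsub>PGL2Z\<^esub>"
  shows "elliptic x"
proof -
  obtain M where M: "det M = 1" "x = pm M" using assms(1) by (auto simp: PSL2Z_eq)
  obtain a b c d where abcd: "M = mk a b c d" by (rule mk_cases)
  have det: "a * d - b * c = 1" using M by (simp add: abcd)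
  have "pm (mk (a * a + b * c) (a * b + b * d) (c * a + d * c) (c * b + d * d)) = pm (mk 1 0 0 1)"
    using assms(3) M by (simp add: abcd pm_mk_mult pm_one unimod_mk)
  then have sq: "b * (a + d) = 0" "c * (a + d) = 0" "(a - d) * (a + d) = 0"
    by (auto simp: pm_eq_iff algebra_simps)
  have "a + d = 0"
  proof (rule ccontr)
    assume "a + d \<noteq> 0"
    then have "b = 0" "c = 0" "d = a" using sq by auto
    moreover from this have "a = 1 \<or> a = - 1" using det by (auto simp: zmult_eq_1_iff)
    ultimately have "x = \<one>\<^bsub>PGL2Z\<^esub>" by (auto simp: M abcd pm_one pm_eq_iff)
    then show False using assms by simp
  qed
  then show ?thesis unfolding elliptic_def
    by (intro conjI assms bexI[of _ M]) (simp_all add: M abcd pm_eq)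
qed

text \<open>A cube equal to 1 forces determinant 1. Then Cayley-Hamilton gives M^3 = (t^2 - 1) M - t
  with t the trace, and since M^3 is scalar while M is not, t^2 = 1.\<close>

lemma order3_elliptic:
  assumes "x \<in> carrier PGL2Z" "x \<noteq> \<one>\<^bsub>PGL2Z\<^esub>" "x \<otimes>\<^bsub>PGL2Z\<^esub> x \<otimes>\<^bsub>PGL2Z\<^esub> x = \<one>\<^bsub>PGL2Z\<^esub>"
  shows "elliptic x"
proof -
  have x: "x \<in> PSL2Z" using assms PSL2Z_mult gens_PSL2Z(5) by (metis PG.m_closed)
  obtain M where M: "det M = 1" "x = pm M" using x by (auto simp: PSL2Z_eq)
  obtain a b c d where abcd: "M = mk a b c d" by (rule mk_cases)
  have det: "a * d - b * c = 1" using M by (simp add: abcd)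
  define t where "t = a + d"
  have uM: "unimod M" using M by (simp add: unimod_def)
  have "pm (M ** M ** M) = pm (mk 1 0 0 1)"
    using assms(3) M uM by (simp add: pm_mult unimod_mult pm_one)
  moreover have "M ** M ** M = mk ((t * t - 1) * a - t) ((t * t - 1) * b) ((t * t - 1) * c) ((t * t - 1) * d - t)"
  proof -
    have "(a * a + b * c) * a + (a * b + b * d) * c = (t * t - 1) * a - t - (2 * a + d) * (a * d - b * c - 1)"
      "(a * a + b * c) * b + (a * b + b * d) * d = (t * t - 1) * b - b * (a * d - b * c - 1)"
      "(c * a + d * c) * a + (c * b + d * d) * c = (t * t - 1) * c - c * (a * d - b * c - 1)"
      "(c * a + d * c) * b + (c * b + d * d) * d = (t * t - 1) * d - t - (2 * d + a) * (a * d - b * c - 1)"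
      unfolding t_def by (simp_all add: algebra_simps)
    then show ?thesis unfolding abcd mk_mult mk_eq_iff using det by simp
  qed
  ultimately have sq: "(t * t - 1) * b = 0" "(t * t - 1) * c = 0" "(t * t - 1) * (a - d) = 0"
    by (auto simp: pm_eq_iff algebra_simps)
  have "t * t = 1"
  proof (rule ccontr)
    assume "t * t \<noteq> 1"
    then have "b = 0" "c = 0" "d = a" using sq by auto
    moreover from this have "a = 1 \<or> a = - 1" using det by (auto simp: zmult_eq_1_iff)
    ultimately have "x = \<one>\<^bsub>PGL2Z\<^esub>" by (auto simp: M abcd pm_one pm_eq_iff)
    then show False using assms by simp
  qed
  then have "\<bar>t\<bar> < 2" by (auto simp: zmult_eq_1_iff)
  then show ?thesis unfolding elliptic_def
    by (intro conjI x bexI[of _ M]) (simp_all add: M abcd pm_eq t_def)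
qed

section \<open>Saturated transversals of Neumann subgroups\<close>

abbreviation pmul (infixl "\<star>" 70) where "x \<star> y \<equiv> x \<otimes>\<^bsub>PGL2Z\<^esub> y"
abbreviation pone ("\<e>") where "\<e> \<equiv> \<one>\<^bsub>PGL2Z\<^esub>"
abbreviation pinv where "pinv x \<equiv> inv\<^bsub>PGL2Z\<^esub> x"
abbreviation "Mh \<equiv> carrier PGL2Z"
abbreviation "B2 \<equiv> mB \<star> mB"

lemma letter_relations:
  "mA \<star> mA = \<e>" "mU \<star> mU = \<e>" "mB \<star> B2 = \<e>" "B2 \<star> mB = \<e>" "B2 \<star> B2 = mB"
  "mU \<star> mA = mA \<star> mU" "mU \<star> mB = B2 \<star> mU" "mU \<star> B2 = mB \<star> mU"
proof -
  show 1: "mU \<star> mB = B2 \<star> mU" by (rule relations)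
  have "mU \<star> B2 = (mU \<star> mB) \<star> mB" by (simp add: PG.m_assoc)
  also have "\<dots> = B2 \<star> (mU \<star> mB)" by (simp only: 1 PG.m_assoc gens_closed PG.m_closed)
  also have "\<dots> = (B2 \<star> B2) \<star> mU" by (simp only: 1) (simp add: PG.m_assoc)
  finally show "mU \<star> B2 = mB \<star> mU" by (simp only: B_pow4)
qed (use relations B_pow4 in auto)

lemma letter_cancel:
  assumes "g \<in> Mh"
  shows "g \<star> mA \<star> mA = g" "g \<star> mU \<star> mU = g" "g \<star> mB \<star> B2 = g" "g \<star> B2 \<star> mB = g" "g \<star> mB \<star> mB = g \<star> B2"
    "g \<star> B2 \<star> B2 = g \<star> mB" "g \<star> mU \<star> mA = g \<star> mA \<star> mU" "g \<star> mU \<star> mB = g \<star> B2 \<star> mU"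
    "g \<star> mU \<star> B2 = g \<star> mB \<star> mU"
  using assms by (simp_all only: PG.m_assoc gens_closed PG.m_closed letter_relations PG.r_one)

interpretation LF: factors PGL2Z "{HA, HB}"
  by (intro factors.intro factors_axioms.intro PG.is_group) (use subgroup_HA subgroup_HB in auto)

interpretation PSLG: group PSLG
  using PG.subgroup_imp_group[OF subgroup_PSL2Z] .

interpretation FP: free_product PSLG "{HA, HB}"
  by unfold_locales (rule free_product_PSL2Z)

lemma weval_PSLG [simp]: "weval PSLG w = weval PGL2Z w"
  by (simp add: weval_def)

lemma reduced_word_PSLG [simp]: "reduced_word PSLG = reduced_word PGL2Z"
  by (simp add: reduced_word_def fun_eq_iff)

abbreviation "rword \<equiv> reduced_word PGL2Z {HA, HB}"
abbreviation "lword \<equiv> fword {HA, HB}"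
abbreviation "ev \<equiv> weval PGL2Z"

lemma rword_unique: "rword u \<Longrightarrow> rword w \<Longrightarrow> ev u = ev w \<Longrightarrow> u = w"
  using FP.reduced_unique[of u w] by simp

lemma ev_PSL2Z: "lword w \<Longrightarrow> ev w \<in> PSL2Z"
  using FP.weval_closed[of w] by simp

lemma PSL2Z_words: "g \<in> PSL2Z \<Longrightarrow> \<exists>w. lword w \<and> ev w = g"
  using FP.words_exist[of g] by simp

lemma Mh_split:
  assumes "g \<in> Mh"
  obtains m where "m \<in> PSL2Z" "g = m" | m where "m \<in> PSL2Z" "g = m \<star> mU"
proof (cases "g \<in> PSL2Z")
  case False
  then have "g \<star> mU \<in> PSL2Z" using PSL2Z_mult assms gens_PSL2Z by simp
  then show ?thesis using that(2)[of "g \<star> mU"] assms by (simp add: letter_cancel)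
qed (use that(1) in blast)

lemma Mh_induct:
  assumes "g \<in> Mh" "P \<e>"
    and step: "\<And>h x. h \<in> Mh \<Longrightarrow> x \<in> {mA, mB, mU} \<Longrightarrow> P h \<Longrightarrow> P (h \<star> x)"
  shows "P g"
proof -
  have w: "P (h \<star> ev w)" if "lword w" "h \<in> Mh" "P h" for w h
    using that
  proof (induction w arbitrary: h)
    case Nil
    then show ?case by simp
  next
    case (Cons a w)
    obtain H x where a: "a = (H, x)" by force
    have x: "x \<in> {\<e>, mA, mB, B2}" "lword w" using Cons.prems by (auto simp: a HA_def HB_def)
    then have xM: "x \<in> Mh" by auto
    have "P (h \<star> x)"
      using x(1) Cons.prems(2,3) step[of h mA] step[of h mB] step[of "h \<star> mB" mB]
      by (auto simp: letter_cancel(5))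
    then have "P (h \<star> x \<star> ev w)" using Cons.IH[OF x(2)] Cons.prems(2) xM by simp
    then show ?case using Cons.prems xM x(2) by (simp add: a PG.m_assoc)
  qed
  have "P m" if "m \<in> PSL2Z" for m
    using PSL2Z_words[OF that] w[of _ \<e>] assms(2) by auto
  then show ?thesis
  proof (rule_tac Mh_split[OF assms(1)])
    fix m assume P: "\<And>m. m \<in> PSL2Z \<Longrightarrow> P m" and m: "m \<in> PSL2Z" "g = m \<star> mU"
    then have "m \<in> Mh" using PSL2Z_carrier by blast
    then show "P g" using step[of m mU] P m by simp
  qed simp
qed

section \<open>Paths in the Cayley graph that stay in a given set\<close>

fun dpath :: "(int ^ 2 ^ 2) set set \<Rightarrow> (int ^ 2 ^ 2) set \<Rightarrow>
    ((int ^ 2 ^ 2) set set \<times> (int ^ 2 ^ 2) set) list \<Rightarrow> bool" where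
  "dpath D g [] \<longleftrightarrow> g \<in> D"
| "dpath D g ((H, x) # w) \<longleftrightarrow> g \<in> D \<and> dpath D (g \<star> x) w"

lemma dpath_start: "dpath D g w \<Longrightarrow> g \<in> D"
  by (cases "(D, g, w)" rule: dpath.cases) auto

lemma dpath_append:
  assumes "lword u" "g \<in> Mh"
  shows "dpath D g (u @ w) \<longleftrightarrow> dpath D g u \<and> dpath D (g \<star> ev u) w"
  using assms
proof (induction u arbitrary: g)
  case Nil
  then show ?case using dpath_start by auto
next
  case (Cons a u)
  obtain H x where a: "a = (H, x)" by force
  then have "x \<in> Mh" "lword u" using Cons.prems LF.factor_carrier by auto
  then show ?case using Cons by (simp add: a PG.m_assoc)
qed

text \<open>Merging two letters of one factor only skips the vertex between them, so reducing a word
  visits no new vertex.\<close>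

lemma dpath_rcons:
  assumes "lword w" "H \<in> {HA, HB}" "x \<in> H" "g \<in> Mh" "g \<in> D" "dpath D (g \<star> x) w"
  shows "dpath D g (rcons PGL2Z H x w)"
proof (cases w)
  case Nil
  then show ?thesis using assms by auto
next
  case (Cons a w')
  obtain H' y where a: "a = (H', y)" by force
  have xy: "x \<in> Mh" "y \<in> Mh" using assms LF.factor_carrier by (auto simp: Cons a)
  show ?thesis
    using assms xy PG.m_assoc[of g x y] by (auto simp: Cons a)
qed

text \<open>Conjugation by \<open>U\<close>, letter by letter. It carries a \<open>U\<close> from
  the front of a word to its end, so the \<open>U\<close>-steps of a path can be collected at its
  end.\<close>

definition twist :: "((int ^ 2 ^ 2) set set \<times> (int ^ 2 ^ 2) set) list \<Rightarrow>
    ((int ^ 2 ^ 2) set set \<times> (int ^ 2 ^ 2) set) list" where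
  "twist w = map (\<lambda>(H, x). (H, mU \<star> x \<star> mU)) w"

lemma U_conj:
  "mU \<star> mA \<star> mU = mA" "mU \<star> mB \<star> mU = B2" "mU \<star> B2 \<star> mU = mB" "mU \<star> \<e> \<star> mU = \<e>"
  by (simp_all add: letter_relations letter_cancel)

lemma U_conj_factor: "H \<in> {HA, HB} \<Longrightarrow> x \<in> H \<Longrightarrow> mU \<star> x \<star> mU \<in> H"
  using U_conj by (auto simp: HA_def HB_def)

lemma U_conj_eq_one:
  assumes x: "x \<in> Mh" and 1: "mU \<star> x \<star> mU = \<e>"
  shows "x = \<e>"
proof -
  have "mU \<star> x = mU \<star> x \<star> mU \<star> mU" using x by (simp add: letter_cancel)
  then have U: "mU \<star> x = mU" using 1 by simp
  have "x = mU \<star> (mU \<star> x)" using x by (simp add: letter_relations flip: PG.m_assoc)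
  then show "x = \<e>" unfolding U by (simp add: letter_relations)
qed

lemma rword_twist: "rword w \<Longrightarrow> rword (twist w)"
proof (induction w)
  case (Cons a w)
  obtain H x where a: "a = (H, x)" by force
  have "x \<in> Mh" using Cons.prems LF.factor_carrier[of H x] by (auto simp: a reduced_word_Cons)
  moreover have "fst (hd (twist w)) = fst (hd w)" if "w \<noteq> []"
    using that by (cases w) (auto simp: twist_def split: prod.splits)
  ultimately show ?case
    using Cons U_conj_factor U_conj_eq_one
    by (auto simp: a reduced_word_Cons twist_def)
qed (simp add: twist_def)

lemma twist_step:
  assumes "g \<in> Mh" "x \<in> Mh" shows "g \<star> mU \<star> (mU \<star> x \<star> mU) = g \<star> x \<star> mU"
proof -
  have "g \<star> mU \<star> (mU \<star> x \<star> mU) = (g \<star> mU \<star> mU) \<star> x \<star> mU"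
    using assms by (simp only: PG.m_assoc gens_closed PG.m_closed)
  then show ?thesis using assms by (simp add: letter_cancel)
qed

lemma ev_twist: "lword w \<Longrightarrow> g \<in> Mh \<Longrightarrow> g \<star> mU \<star> ev (twist w) = g \<star> ev w \<star> mU"
proof (induction w arbitrary: g)
  case (Cons a w)
  obtain H x where a: "a = (H, x)" by force
  have x: "x \<in> Mh" "H \<in> {HA, HB}" "x \<in> H" "lword w"
    using Cons.prems LF.factor_carrier[of H x] by (auto simp: a)
  have lt: "lword (twist w)"
    using x(4) U_conj_factor by (auto simp: twist_def fword_def)
  have "g \<star> mU \<star> ev (twist (a # w)) = (g \<star> mU \<star> (mU \<star> x \<star> mU)) \<star> ev (twist w)"
    using Cons.prems x lt by (simp add: a twist_def PG.m_assoc)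
  also have "\<dots> = g \<star> x \<star> ev w \<star> mU"
    using Cons.prems x Cons.IH[of "g \<star> x"] by (simp add: twist_step)
  finally show ?case using Cons.prems x by (simp add: a PG.m_assoc)
qed (simp add: twist_def)

lemma dpath_twist:
  assumes "\<And>d. d \<in> D \<Longrightarrow> d \<star> mU \<in> D"
  shows "lword w \<Longrightarrow> g \<in> Mh \<Longrightarrow> dpath D g w \<Longrightarrow> dpath D (g \<star> mU) (twist w)"
proof (induction w arbitrary: g)
  case Nil
  then show ?case using assms by (simp add: twist_def)
next
  case (Cons a w)
  obtain H x where a: "a = (H, x)" by force
  have x: "x \<in> Mh" using Cons.prems LF.factor_carrier[of H x] by (auto simp: a)
  then show ?case
    using Cons.prems Cons.IH[of "g \<star> x"] assms twist_step[of g x] by (simp add: a twist_def)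
qed

definition stepR :: "(int ^ 2 ^ 2) set set \<Rightarrow> ((int ^ 2 ^ 2) set \<times> (int ^ 2 ^ 2) set) set" where
  "stepR D = {(g, h). g \<in> D \<and> h \<in> D \<and> (\<exists>x\<in>{mA, mB, B2, mU}. h = g \<star> x)}"

lemma stepR_sym:
  assumes "D \<subseteq> Mh" "(g, h) \<in> stepR D"
  shows "(h, g) \<in> stepR D"
proof -
  obtain x where x: "x \<in> {mA, mB, B2, mU}" "h = g \<star> x" and g: "g \<in> D" "h \<in> D"
    using assms(2) by (auto simp: stepR_def)
  have "g \<in> Mh" using g assms(1) by blast
  then have "g = h \<star> mA \<or> g = h \<star> mB \<or> g = h \<star> B2 \<or> g = h \<star> mU"
    using x letter_cancel(1-4)[of g] by (elim insertE) simp_all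
  then show ?thesis using g unfolding stepR_def by blast
qed

lemma stepR_rtrancl_sym: "D \<subseteq> Mh \<Longrightarrow> (g, h) \<in> (stepR D)\<^sup>* \<Longrightarrow> (h, g) \<in> (stepR D)\<^sup>*"
  by (rule symD[OF sym_rtrancl]) (blast intro: symI stepR_sym)+

text \<open>In the Cayley graph \<open>U\<close> only reflects, so a path is a word in \<open>A\<close> and \<open>B\<close> up to a
  final \<open>U\<close>; reducing the word does not leave \<open>D\<close>.\<close>

lemma connected_path:
  assumes "(g, h) \<in> (stepR D)\<^sup>*" "g \<in> D" "D \<subseteq> Mh" "\<And>d. d \<in> D \<Longrightarrow> d \<star> mU \<in> D"
  shows "\<exists>w. rword w \<and> dpath D g w \<and> (h = g \<star> ev w \<or> h = g \<star> ev w \<star> mU)"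
  using assms(1,2)
proof (induction rule: converse_rtrancl_induct)
  case base
  then show ?case using assms(3) by (intro exI[of _ "[]"]) auto
next
  case (step g g')
  then obtain x where x: "x \<in> {mA, mB, B2, mU}" "g' = g \<star> x" and D: "g \<in> D" "g' \<in> D"
    by (auto simp: stepR_def)
  then have gM: "g \<in> Mh" "x \<in> Mh" using assms(3) by auto
  obtain w where w: "rword w" "dpath D g' w" "h = g' \<star> ev w \<or> h = g' \<star> ev w \<star> mU"
    using step.IH D by blast
  have lw: "lword w" and eM: "ev w \<in> Mh" using reduced_word_fword[OF w(1)] by auto
  show ?case
  proof (cases "x = mU")
    case True
    have g': "g' \<star> mU = g" using x gM True by (simp add: letter_cancel)
    have "g' \<in> Mh" using x gM by simp
    then have "dpath D g (twist w)" "g \<star> ev (twist w) = g' \<star> ev w \<star> mU"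
      using dpath_twist[OF assms(4) lw, of g'] w(2) ev_twist[OF lw, of g'] g' by auto
    moreover have "g' \<star> ev w \<star> mU \<star> mU = g' \<star> ev w" using \<open>g' \<in> Mh\<close> eM by (simp add: letter_cancel)
    ultimately show ?thesis using w(3) rword_twist[OF w(1)] by (intro exI[of _ "twist w"]) auto
  next
    case False
    then obtain H where H: "H \<in> {HA, HB}" "x \<in> H" using x by (auto simp: HA_def HB_def)
    have "g \<star> ev (rcons PGL2Z H x w) = g' \<star> ev w"
      using LF.weval_rcons[OF lw H] gM eM x by (simp add: PG.m_assoc)
    then have "h = g \<star> ev (rcons PGL2Z H x w) \<or> h = g \<star> ev (rcons PGL2Z H x w) \<star> mU"
      using w(3) by (simp only:)
    moreover have "dpath D g (rcons PGL2Z H x w)"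
      using dpath_rcons[OF lw H gM(1) D(1)] w(2) x by simp
    ultimately show ?thesis
      using LF.reduced_rcons[OF w(1) H] by blast
  qed
qed

lemma left_norm:
  "mA \<star> mA = \<e>" "mU \<star> mU = \<e>" "mB \<star> mB \<star> mB = \<e>" "mU \<star> mA = mA \<star> mU" "mU \<star> mB = mB \<star> mB \<star> mU"
  "g \<in> Mh \<Longrightarrow> g \<star> mA \<star> mA = g" "g \<in> Mh \<Longrightarrow> g \<star> mU \<star> mU = g" "g \<in> Mh \<Longrightarrow> g \<star> mB \<star> mB \<star> mB = g"
  "g \<in> Mh \<Longrightarrow> g \<star> mU \<star> mA = g \<star> mA \<star> mU" "g \<in> Mh \<Longrightarrow> g \<star> mU \<star> mB = g \<star> mB \<star> mB \<star> mU"
  using letter_cancel[of g] relations by (simp_all add: PG.m_assoc)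

lemma subgroup_That: "subgroup That PGL2Z"
proof (rule PG.subgroupI)
  show "That \<subseteq> carrier PGL2Z" by (auto simp: That_mk unimod_mk)
  show "That \<noteq> {}" by (auto simp: That_mk)
next
  fix a assume "a \<in> That"
  then obtain e n where a: "a = pm (mk e n 0 1)" "e = 1 \<or> e = - 1" by (auto simp: That_mk)
  have "pinv a = pm (mk e (- e * n) 0 1)"
    by (rule PG.inv_equality) (use a in \<open>auto simp: pm_mk_mult unimod_mk pm_one pm_eq_iff\<close>)
  then show "pinv a \<in> That" using a(2) by (auto simp: That_mk)
next
  fix a b assume "a \<in> That" "b \<in> That"
  then obtain e n e' n' where a: "a = pm (mk e n 0 1)" "e = 1 \<or> e = - 1" "b = pm (mk e' n' 0 1)" "e' = 1 \<or> e' = - 1"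
    by (auto simp: That_mk)
  then have "a \<star> b = pm (mk (e * e') (e * n' + n) 0 1)"
    by (auto simp: pm_mk_mult unimod_mk)
  moreover have "e * e' = 1 \<or> e * e' = - 1" using a by auto
  ultimately show "a \<star> b \<in> That" unfolding That_mk by blast
qed

section \<open>Absence of reflections and existence of a saturated transversal\<close>

locale neumann =
  fixes S :: "(int ^ 2 ^ 2) set set"
  assumes neumann: "neumann_subgroup S"
begin

lemma sub: "subgroup S PGL2Z"
  using neumann by (simp add: neumann_subgroup_def)

lemma S_Mh: "s \<in> S \<Longrightarrow> s \<in> Mh"
  using subgroup.mem_carrier[OF sub] .

lemmas S_mult = subgroup.m_closed[OF sub] and S_inv = subgroup.m_inv_closed[OF sub]
  and S_one [simp] = subgroup.one_closed[OF sub]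

lemma S_That: "x \<in> S \<Longrightarrow> x \<in> That \<Longrightarrow> x = \<e>"
  using neumann by (auto simp: neumann_subgroup_def)

lemma S_That_factor: assumes "g \<in> Mh" obtains s t where "s \<in> S" "t \<in> That" "g = s \<star> t"
proof -
  have "g \<in> (\<Union>s\<in>S. \<Union>t\<in>That. {s \<star> t})"
    using neumann assms by (simp add: neumann_subgroup_def set_mult_def)
  then show ?thesis using that by blast
qed

lemma That_Mh: "t \<in> That \<Longrightarrow> t \<in> Mh"
  using subgroup.mem_carrier[OF subgroup_That] .

text \<open>By \<open>reflection_conjugate\<close> a conjugate of \<open>x\<close> lies in
  \<open>That\<close>. Writing the conjugator as a product of s in \<open>S\<close> and an element
  of \<open>That\<close> shows that the conjugate of \<open>x\<close> by s lies in both
  \<open>S\<close> and \<open>That\<close>.\<close>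

lemma no_reflection:
  assumes x: "x \<in> S" "x \<star> x = \<e>"
  shows "x \<in> PSL2Z"
proof (rule ccontr)
  assume nx: "x \<notin> PSL2Z"
  have xM: "x \<in> Mh" using S_Mh[OF x(1)] .
  obtain g t where g: "g \<in> Mh" "t \<in> That" "x \<star> g = g \<star> t"
    using reflection_conjugate[OF xM nx x(2)] by blast
  obtain s t' where s: "s \<in> S" "t' \<in> That" "g = s \<star> t'" using S_That_factor[OF g(1)] .
  have M: "s \<in> Mh" "t' \<in> Mh" "t \<in> Mh" using S_Mh That_Mh s g by auto
  have "pinv s \<star> x \<star> s = pinv s \<star> (x \<star> (s \<star> t')) \<star> pinv t'"
    using M xM by (simp add: PG.m_assoc)
  also have "\<dots> = pinv s \<star> (s \<star> t' \<star> t) \<star> pinv t'"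
    using g(3) unfolding s(3) by simp
  also have "\<dots> = (pinv s \<star> s) \<star> (t' \<star> t \<star> pinv t')"
    using M by (simp only: PG.m_assoc PG.m_closed PG.inv_closed)
  also have "\<dots> = t' \<star> t \<star> pinv t'" using M by simp
  finally have eq: "pinv s \<star> x \<star> s = t' \<star> t \<star> pinv t'" .
  have "pinv s \<star> x \<star> s \<in> S" using s x S_mult S_inv by simp
  moreover have "t' \<star> t \<star> pinv t' \<in> That"
    using s(2) g(2) subgroup.m_closed[OF subgroup_That] subgroup.m_inv_closed[OF subgroup_That] by simp
  ultimately have "pinv s \<star> x \<star> s = \<e>" using S_That eq by simp
  then have "s \<star> (pinv s \<star> x \<star> s) \<star> pinv s = \<e>" using M by simp
  moreover have "s \<star> (pinv s \<star> x \<star> s) \<star> pinv s = (s \<star> pinv s) \<star> x \<star> (s \<star> pinv s)"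
    using M xM by (simp only: PG.m_assoc PG.m_closed PG.inv_closed)
  ultimately have "x = \<e>" using M xM by simp
  then show False using nx gens_PSL2Z by simp
qed

text \<open>The dihedral group of order 6 generated by B and U.\<close>

definition D3 :: "(int ^ 2 ^ 2) set set" where
  "D3 = {\<e>, mB, B2, mU, mB \<star> mU, B2 \<star> mU}"

lemma D3_closed:
  assumes "d \<in> D3"
  shows "d \<in> Mh" "d \<star> mB \<in> D3" "d \<star> B2 \<in> D3" "d \<star> mU \<in> D3"
  using assms unfolding D3_def by (elim insertE emptyE; simp add: left_norm flip: PG.m_assoc)+

lemma subgroup_D3: "subgroup D3 PGL2Z"
proof (rule PG.subgroupI)
  show "D3 \<subseteq> carrier PGL2Z" "D3 \<noteq> {}" using D3_closed by (auto simp: D3_def)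
next
  fix a assume a: "a \<in> D3"
  have "\<e> \<star> \<e> = \<e>" "B2 \<star> mB = \<e>" "mB \<star> B2 = \<e>" "mU \<star> mU = \<e>"
    "(mB \<star> mU) \<star> (mB \<star> mU) = \<e>" "(B2 \<star> mU) \<star> (B2 \<star> mU) = \<e>"
    by (simp_all add: left_norm flip: PG.m_assoc)
  then have "\<exists>b\<in>D3. b \<star> a = \<e>" using a unfolding D3_def by blast
  then show "pinv a \<in> D3" using PG.inv_equality D3_closed(1) a by metis
next
  fix a b assume "a \<in> D3" "b \<in> D3"
  then show "a \<star> b \<in> D3"
    unfolding D3_def by (elim insertE emptyE) (simp_all add: left_norm flip: PG.m_assoc)
qed

lemma D3_reflection:
  assumes "d \<in> D3" "d \<notin> {\<e>, mB, B2}"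
  shows "d \<star> d = \<e> \<and> d \<notin> PSL2Z"
proof -
  have "mU \<star> mU = \<e>" "(mB \<star> mU) \<star> (mB \<star> mU) = \<e>" "(B2 \<star> mU) \<star> (B2 \<star> mU) = \<e>"
    by (simp_all add: left_norm flip: PG.m_assoc)
  moreover have "B2 \<in> PSL2Z" "mB \<star> mU \<notin> PSL2Z"
    using PSL2Z_mult[of mB mB] PSL2Z_mult[of mB mU] gens_PSL2Z by simp_all
  moreover from this have "B2 \<star> mU \<notin> PSL2Z"
    using PSL2Z_mult[of B2 mU] gens_PSL2Z by simp
  moreover have "d \<in> {mU, mB \<star> mU, B2 \<star> mU}" using assms unfolding D3_def by blast
  ultimately show ?thesis using gens_PSL2Z(3) by (elim insertE) simp_all
qed

lemma conj_mult:
  assumes "x \<in> Mh" "y \<in> Mh" "z \<in> Mh"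
  shows "(x \<star> y \<star> pinv x) \<star> (x \<star> z \<star> pinv x) = x \<star> (y \<star> z) \<star> pinv x"
  using PG.telescope[of x y x z x] assms by simp

lemma conj_cancel: "x \<in> Mh \<Longrightarrow> y \<in> Mh \<Longrightarrow> (x \<star> y \<star> pinv x) \<star> x = x \<star> y"
  by (simp add: PG.m_assoc)

lemma conj_PSL2Z: "x \<in> Mh \<Longrightarrow> y \<in> Mh \<Longrightarrow> x \<star> y \<star> pinv x \<in> PSL2Z \<longleftrightarrow> y \<in> PSL2Z"
proof -
  assume x: "x \<in> Mh" "y \<in> Mh"
  have "x \<star> y \<star> pinv x \<in> PSL2Z \<longleftrightarrow> (x \<star> y \<star> pinv x) \<star> x \<in> PSL2Z \<longleftrightarrow> x \<in> PSL2Z"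
    using PSL2Z_mult[of "x \<star> y \<star> pinv x" x] x by auto
  then show ?thesis using PSL2Z_mult[of x y] x by (simp add: conj_cancel) blast
qed

lemma no_conj_reflection:
  assumes "x \<in> Mh" "y \<in> Mh" "y \<star> y = \<e>" "y \<notin> PSL2Z"
  shows "x \<star> y \<star> pinv x \<notin> S"
  using no_reflection[of "x \<star> y \<star> pinv x"] conj_mult[of x y y] conj_PSL2Z[of x y] assms by auto

text \<open>The elements of \<open>D3\<close> outside the powers of B are reflections, so only
  rotations are conjugate into \<open>S\<close>; and either nontrivial rotation generates the
  other.\<close>

lemma conj_D3:
  assumes x: "x \<in> Mh" "d \<in> D3" "x \<star> d \<star> pinv x \<in> S"
  shows "d \<in> {\<e>, mB, B2}" "d \<noteq> \<e> \<Longrightarrow> x \<star> mB \<star> pinv x \<in> S"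
proof -
  show d: "d \<in> {\<e>, mB, B2}"
    using no_conj_reflection[OF x(1), of d] D3_reflection[OF x(2)] D3_closed(1)[OF x(2)] x(3) by blast
  assume "d \<noteq> \<e>"
  then consider "d = mB" | "d = B2" using d by blast
  then show "x \<star> mB \<star> pinv x \<in> S"
  proof cases
    case 2
    have "(x \<star> B2 \<star> pinv x) \<star> (x \<star> B2 \<star> pinv x) = x \<star> mB \<star> pinv x"
      using conj_mult[of x B2 B2] x(1) by (simp add: letter_relations)
    then show ?thesis using S_mult[OF x(3) x(3)] 2 by simp
  qed (use x in simp)
qed

lemma conj_B_pow:
  assumes "x \<in> Mh" "x \<star> mB \<star> pinv x \<in> S"
  shows "x \<star> B2 \<star> pinv x \<in> S"
  using S_mult[OF assms(2,2)] conj_mult[of x mB mB] assms(1) by simp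

text \<open>Guarantees that a B-step leaves \<open>D\<close> only at a coset fixed by B, so that
  exits of this kind yield factors of order 3.\<close>

definition saturated :: "(int ^ 2 ^ 2) set set \<Rightarrow> bool" where
  "saturated D \<longleftrightarrow> (\<forall>d\<in>D. d \<star> mB \<in> D \<and> d \<star> B2 \<in> D \<or> d \<star> mB \<star> pinv d \<in> S)"

definition partial_transversal :: "(int ^ 2 ^ 2) set set \<Rightarrow> bool" where
  "partial_transversal D \<longleftrightarrow> D \<subseteq> Mh \<and> \<e> \<in> D \<and> (\<forall>d\<in>D. d \<star> mU \<in> D) \<and>
     (\<forall>d\<in>D. \<forall>s\<in>S. s \<star> d \<in> D \<longrightarrow> s = \<e>) \<and> saturated D \<and> (\<forall>d\<in>D. (\<e>, d) \<in> (stepR D)\<^sup>*)"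

lemma partial_transversalD:
  assumes "partial_transversal D"
  shows "D \<subseteq> Mh" "\<e> \<in> D" "d \<in> D \<Longrightarrow> d \<star> mU \<in> D" "d \<in> D \<Longrightarrow> s \<in> S \<Longrightarrow> s \<star> d \<in> D \<Longrightarrow> s = \<e>"
    "d \<in> D \<Longrightarrow> d \<star> mB \<in> D \<and> d \<star> B2 \<in> D \<or> d \<star> mB \<star> pinv d \<in> S" "d \<in> D \<Longrightarrow> (\<e>, d) \<in> (stepR D)\<^sup>*"
proof -
  note * = assms[unfolded partial_transversal_def saturated_def]
  show "D \<subseteq> Mh" "\<e> \<in> D" using * by simp_all
  show "d \<in> D \<Longrightarrow> d \<star> mU \<in> D" using * by simp
  show "d \<in> D \<Longrightarrow> s \<in> S \<Longrightarrow> s \<star> d \<in> D \<Longrightarrow> s = \<e>" using * by simp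
  show "d \<in> D \<Longrightarrow> d \<star> mB \<in> D \<and> d \<star> B2 \<in> D \<or> d \<star> mB \<star> pinv d \<in> S" using * by simp
  show "d \<in> D \<Longrightarrow> (\<e>, d) \<in> (stepR D)\<^sup>*" using * by simp
qed

text \<open>The smallest saturated piece through \<open>x\<close> that is closed under
  \<open>U\<close>. If B fixes the coset of \<open>x\<close>, the rest of \<open>x D3\<close> lies
  in the cosets of \<open>x\<close> and \<open>xU\<close>, which are represented already.\<close>

definition block :: "(int ^ 2 ^ 2) set \<Rightarrow> (int ^ 2 ^ 2) set set" where
  "block x = (if x \<star> mB \<star> pinv x \<in> S then {x, x \<star> mU} else (\<lambda>d. x \<star> d) ` D3)"

lemma block_D3: "block x \<subseteq> (\<lambda>d. x \<star> d) ` D3" if "x \<in> Mh"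
  using that by (auto simp: block_def D3_def)

lemma block_props:
  assumes x: "x \<in> Mh"
  shows "block x \<subseteq> Mh" "x \<in> block x" "\<And>d. d \<in> block x \<Longrightarrow> d \<star> mU \<in> block x"
    "\<And>d. d \<in> block x \<Longrightarrow> (d \<star> mB \<in> block x \<and> d \<star> B2 \<in> block x) \<or> d \<star> mB \<star> pinv d \<in> S"
    "\<And>d s. d \<in> block x \<Longrightarrow> s \<in> S \<Longrightarrow> s \<star> d \<in> block x \<Longrightarrow> s = \<e>"
    "\<And>d. d \<in> block x \<Longrightarrow> (x, d) \<in> (stepR (block x))\<^sup>*"
proof -
  show 1: "block x \<subseteq> Mh" using block_D3[OF x] D3_closed(1) x by auto
  show 2: "x \<in> block x" using x by (auto simp: block_def D3_def intro: rev_image_eqI)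
  show 3: "d \<star> mU \<in> block x" if d: "d \<in> block x" for d
  proof (cases "x \<star> mB \<star> pinv x \<in> S")
    case True
    then show ?thesis using d x by (auto simp: block_def letter_cancel)
  next
    case False
    then obtain b where b: "b \<in> D3" "d = x \<star> b" using d by (auto simp: block_def)
    then have "d \<star> mU = x \<star> (b \<star> mU)" using x D3_closed(1) by (simp add: PG.m_assoc)
    then show ?thesis using False D3_closed(4)[OF b(1)] by (auto simp: block_def)
  qed
  show "(d \<star> mB \<in> block x \<and> d \<star> B2 \<in> block x) \<or> d \<star> mB \<star> pinv d \<in> S" if d: "d \<in> block x" for d
  proof (cases "x \<star> mB \<star> pinv x \<in> S")
    case True
    have "(x \<star> mU) \<star> mB \<star> pinv (x \<star> mU) = x \<star> B2 \<star> pinv x"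
    proof -
      have "(x \<star> mU) \<star> mB \<star> pinv (x \<star> mU) = (x \<star> mU \<star> mB) \<star> mU \<star> pinv x"
        using x by (simp add: PG.inv_mult_group inv_gens PG.m_assoc)
      also have "\<dots> = x \<star> B2 \<star> pinv x" using x by (simp add: letter_cancel)
      finally show ?thesis .
    qed
    then show ?thesis using d True conj_B_pow[OF x True] by (auto simp: block_def)
  next
    case False
    then obtain b where b: "b \<in> D3" "d = x \<star> b" using d by (auto simp: block_def)
    then have "d \<star> mB = x \<star> (b \<star> mB)" "d \<star> B2 = x \<star> (b \<star> B2)"
      using x D3_closed(1) by (simp_all add: PG.m_assoc)
    then show ?thesis using False D3_closed(2,3)[OF b(1)] by (auto simp: block_def)
  qed
  show "s = \<e>" if d: "d \<in> block x" "s \<in> S" "s \<star> d \<in> block x" for d s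
  proof -
    obtain b c where b: "b \<in> D3" "d = x \<star> b" and c: "c \<in> D3" "s \<star> d = x \<star> c"
      using d block_D3[OF x] by blast
    have M: "b \<in> Mh" "c \<in> Mh" "s \<in> Mh" using b c D3_closed(1) S_Mh d by auto
    have cb: "c \<star> pinv b \<in> D3"
      using b c subgroup.m_closed[OF subgroup_D3] subgroup.m_inv_closed[OF subgroup_D3] by blast
    have "x \<star> c = s \<star> (x \<star> b)" using b c by simp
    then have "s = x \<star> c \<star> pinv (x \<star> b)"
      using M x PG.inv_solve_right[of s "x \<star> c" "x \<star> b"] by simp
    then have s: "s = x \<star> (c \<star> pinv b) \<star> pinv x"
      using M x by (simp add: PG.m_assoc PG.inv_mult_group)
    \<comment> \<open>A nontrivial quotient of two block elements would be a rotation by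
      \<open>conj_D3\<close>, and B would fix the coset of \<open>x\<close>. But then the block has
      only the elements \<open>x\<close> and \<open>xU\<close>, whose quotient is the reflection
      U.\<close>
    have e: "c \<star> pinv b = \<e>"
    proof (rule ccontr)
      assume ne: "c \<star> pinv b \<noteq> \<e>"
      have "x \<star> (c \<star> pinv b) \<star> pinv x \<in> S" using s d by simp
      note * = conj_D3[OF x cb this]
      have BS: "x \<star> mB \<star> pinv x \<in> S" using *(2) ne by simp
      then have bl: "block x = {x, x \<star> mU}" by (simp add: block_def)
      have U: "x \<star> y = x \<star> mU \<Longrightarrow> y \<in> Mh \<Longrightarrow> y = mU" "x \<star> y = x \<Longrightarrow> y \<in> Mh \<Longrightarrow> y = \<e>" for y
      proof -
        have c: "pinv x \<star> (x \<star> z) = z" if "z \<in> Mh" for z using x that by (simp flip: PG.m_assoc)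
        show "y = mU" if "x \<star> y = x \<star> mU" "y \<in> Mh"
          using c[OF that(2)] c[OF gens_closed(5)] unfolding that(1) by (rule trans[OF sym])
        show "y = \<e>" if "x \<star> y = x" "y \<in> Mh"
        proof -
          have "pinv x \<star> x = y" using c[OF that(2)] unfolding that(1) .
          then show ?thesis using x by simp
        qed
      qed
      have "x \<star> b = x \<or> x \<star> b = x \<star> mU" "x \<star> c = x \<or> x \<star> c = x \<star> mU"
        using d(1,3) b c bl by auto
      then have bc: "b = \<e> \<or> b = mU" "c = \<e> \<or> c = mU"
        using U M(1,2) by blast+
      have "\<e> \<star> pinv \<e> = \<e>" "\<e> \<star> pinv mU = mU" "mU \<star> pinv \<e> = mU" "mU \<star> pinv mU = \<e>"
        by (simp_all add: inv_gens letter_relations)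
      then have "c \<star> pinv b \<in> {\<e>, mU}" using bc by (elim disjE) simp_all
      then have "c \<star> pinv b = mU" using ne by blast
      then show False using *(1) gens_PSL2Z PSL2Z_mult[of mB mB] by auto
    qed
    then show ?thesis using s x by simp
  qed
  show "(x, d) \<in> (stepR (block x))\<^sup>*" if d: "d \<in> block x" for d
  proof -
    have stp: "(x, y \<star> z) \<in> (stepR (block x))\<^sup>*"
      if "(x, y) \<in> (stepR (block x))\<^sup>*" "y \<in> block x" "y \<star> z \<in> block x" "z \<in> {mA, mB, B2, mU}" for y z
      using that by (intro rtrancl_into_rtrancl[OF that(1)]) (auto simp: stepR_def)
    show ?thesis
    proof (cases "x \<star> mB \<star> pinv x \<in> S")
      case True
      then have bl: "block x = {x, x \<star> mU}" by (simp add: block_def)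
      then show ?thesis using d stp[of x mU] 2 by auto
    next
      case False
      then have bl: "block x = (\<lambda>d. x \<star> d) ` D3" by (simp add: block_def)
      have in1: "x \<star> b \<in> block x" if "b \<in> {\<e>, mB, B2}" for b using that bl by (auto simp: D3_def)
      have r1: "(x, x \<star> b) \<in> (stepR (block x))\<^sup>*" if "b \<in> {\<e>, mB, B2}" for b
        using that stp[of x b] in1[OF that] 2 x by auto
      have r2: "(x, x \<star> b \<star> mU) \<in> (stepR (block x))\<^sup>*" if "b \<in> {\<e>, mB, B2}" for b
        using stp[OF r1[OF that] in1[OF that], of mU] 3[OF in1[OF that]] by simp
      obtain b0 where b0: "b0 \<in> D3" "d = x \<star> b0" using d bl by blast
      have "b0 \<in> {\<e>, mB, B2} \<or> b0 \<in> {\<e> \<star> mU, mB \<star> mU, B2 \<star> mU}"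
        using b0(1) unfolding D3_def by (elim insertE emptyE) simp_all
      then obtain b where b: "b \<in> {\<e>, mB, B2}" "d = x \<star> b \<or> d = x \<star> (b \<star> mU)"
        unfolding b0(2) by blast
      have "b \<in> Mh" using b(1) by auto
      then have "d = x \<star> b \<or> d = x \<star> b \<star> mU" using b(2) x by (simp add: PG.m_assoc)
      then show ?thesis using r1[OF b(1)] r2[OF b(1)] by (elim disjE) simp_all
    qed
  qed
qed

lemma stepR_mono: "D \<subseteq> D' \<Longrightarrow> (stepR D)\<^sup>* \<subseteq> (stepR D')\<^sup>*"
  by (intro rtrancl_mono) (auto simp: stepR_def)

lemma partial_transversal_block: "partial_transversal (block \<e>)"
  unfolding partial_transversal_def saturated_def
proof (intro conjI ballI impI)
  note bp = block_props[OF PG.one_closed]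
  show "block \<e> \<subseteq> Mh" "\<e> \<in> block \<e>" by (rule bp)+
  show "d \<star> mU \<in> block \<e>" "d \<star> mB \<in> block \<e> \<and> d \<star> B2 \<in> block \<e> \<or> d \<star> mB \<star> pinv d \<in> S"
    "(\<e>, d) \<in> (stepR (block \<e>))\<^sup>*" if "d \<in> block \<e>" for d
    using that by (fact bp)+
  show "s = \<e>" if "d \<in> block \<e>" "s \<in> S" "s \<star> d \<in> block \<e>" for d s
    using that by (rule bp)
qed

lemma partial_transversal_chain:
  assumes "\<C> \<noteq> {}" "\<forall>D\<in>\<C>. partial_transversal D" "subset.chain UNIV \<C>"
  shows "partial_transversal (\<Union>\<C>)"
proof -
  note pt = partial_transversalD[OF assms(2)[rule_format]]
  have dir: "\<exists>D\<in>\<C>. d \<in> D \<and> d' \<in> D" if "d \<in> \<Union>\<C>" "d' \<in> \<Union>\<C>" for d d'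
  proof -
    from that obtain D D' where "D \<in> \<C>" "d \<in> D" "D' \<in> \<C>" "d' \<in> D'" by blast
    moreover have "D \<subseteq> D' \<or> D' \<subseteq> D" using assms(3) \<open>D \<in> \<C>\<close> \<open>D' \<in> \<C>\<close> by (auto simp: subset.chain_def)
    ultimately show ?thesis by blast
  qed
  show ?thesis
    unfolding partial_transversal_def saturated_def
  proof (intro conjI ballI impI)
    show "\<Union>\<C> \<subseteq> Mh" "\<e> \<in> \<Union>\<C>" using pt assms(1) by blast+
  next
    fix d assume "d \<in> \<Union>\<C>"
    then obtain D where D: "D \<in> \<C>" "d \<in> D" by blast
    show "d \<star> mU \<in> \<Union>\<C>" using pt(3)[OF D] D by blast
    show "d \<star> mB \<in> \<Union>\<C> \<and> d \<star> B2 \<in> \<Union>\<C> \<or> d \<star> mB \<star> pinv d \<in> S" using pt(5)[OF D] D by blast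
    show "(\<e>, d) \<in> (stepR (\<Union>\<C>))\<^sup>*" using pt(6)[OF D] stepR_mono[of D "\<Union>\<C>"] D by blast
  next
    fix d s assume d: "d \<in> \<Union>\<C>" "s \<in> S" "s \<star> d \<in> \<Union>\<C>"
    then obtain D where "D \<in> \<C>" "d \<in> D" "s \<star> d \<in> D" using dir by blast
    then show "s = \<e>" using pt(4) d(2) by blast
  qed
qed

lemma maximal_transversal:
  "\<exists>D. partial_transversal D \<and> (\<forall>D'. partial_transversal D' \<longrightarrow> D \<subseteq> D' \<longrightarrow> D' = D)"
proof -
  have "\<exists>M\<in>Collect partial_transversal. \<forall>X\<in>Collect partial_transversal. M \<subseteq> X \<longrightarrow> X = M"
  proof (rule subset_Zorn_nonempty)
    show "Collect partial_transversal \<noteq> {}" using partial_transversal_block by blast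
    fix \<C> assume "\<C> \<noteq> {}" "subset.chain (Collect partial_transversal) \<C>"
    then show "\<Union>\<C> \<in> Collect partial_transversal"
      using partial_transversal_chain[of \<C>] by (auto simp: subset.chain_def)
  qed
  then show ?thesis by blast
qed

text \<open>Call an element covered if its coset meets \<open>D\<close>. Steps along B and U stay
  among covered elements, so if a maximal \<open>D\<close> missed a coset, some A-neighbour of
  \<open>D\<close> would be uncovered, and its block could be added to \<open>D\<close>.\<close>

lemma transversal_exists:
  "\<exists>D. partial_transversal D \<and> (\<forall>g\<in>Mh. \<exists>s\<in>S. \<exists>d\<in>D. g = s \<star> d)"
proof -
  obtain D where D: "partial_transversal D" and max: "\<And>D'. partial_transversal D' \<Longrightarrow> D \<subseteq> D' \<Longrightarrow> D' = D"
    using maximal_transversal by blast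
  note pt = partial_transversalD[OF D]
  define P where "P g \<longleftrightarrow> (\<exists>s\<in>S. \<exists>d\<in>D. g = s \<star> d)" for g
  have P1: "P d" if "d \<in> D" for d
    unfolding P_def using that pt(1) by (intro bexI[of _ \<e>] bexI[of _ d]) auto
  have PS: "P (s \<star> g)" if "P g" "s \<in> S" "g \<in> Mh" for s g
  proof -
    from that(1) obtain s' d where s': "s' \<in> S" "d \<in> D" "g = s' \<star> d" using P_def by blast
    then have "s \<star> g = (s \<star> s') \<star> d" using that(2) S_Mh pt(1) PG.m_assoc by auto
    then show ?thesis unfolding P_def using S_mult[OF that(2) s'(1)] s'(2) by blast
  qed
  have right: "P (g \<star> x)" if g: "P g" and x: "x \<in> Mh" "\<And>d. d \<in> D \<Longrightarrow> P (d \<star> x)" for g x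
  proof -
    obtain s d where s: "s \<in> S" "d \<in> D" "g = s \<star> d" using g P_def by blast
    then have M: "s \<in> Mh" "d \<in> Mh" using S_Mh pt(1) by auto
    then have "g \<star> x = s \<star> (d \<star> x)" using s x by (simp add: PG.m_assoc)
    then show ?thesis using PS[OF x(2)[OF s(2)] s(1)] M x(1) by simp
  qed
  have PU: "P (d \<star> mU)" if "d \<in> D" for d using P1 pt(3)[OF that] by blast
  have PB: "P (d \<star> x)" if d: "d \<in> D" and x: "x \<in> {mB, B2}" for d x
  proof -
    consider "d \<star> x \<in> D" | "d \<star> mB \<star> pinv d \<in> S" using pt(5)[OF d] x by blast
    then show ?thesis
    proof cases
      case 2
      have dM: "d \<in> Mh" using d pt(1) by blast
      have "d \<star> x \<star> pinv d \<in> S" using conj_B_pow[OF dM 2] 2 x by blast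
      then have "P ((d \<star> x \<star> pinv d) \<star> d)" using PS[OF P1[OF d]] dM by blast
      then show ?thesis using dM x conj_cancel[of d x] by auto
    qed (use P1 in blast)
  qed
  have PA: "\<forall>d\<in>D. P (d \<star> mA)"
  proof (rule ccontr)
    assume "\<not> ?thesis"
    then obtain d0 where d0: "d0 \<in> D" "\<not> P (d0 \<star> mA)" by blast
    define x where "x = d0 \<star> mA"
    have xM: "x \<in> Mh" using d0 pt(1) by (auto simp: x_def)
    note bp = block_props[OF xM]
    \<comment> \<open>The covered elements are closed under right multiplication by
      \<open>D3\<close>, so one covered element of the block would make \<open>x\<close>
      covered.\<close>
    have disj: "\<not> P y" if y: "y \<in> block x" for y
    proof
      assume Py: "P y"
      obtain b where b: "b \<in> D3" "y = x \<star> b" using y block_D3[OF xM] by blast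
      have yM: "y \<in> Mh" using y bp(1) by blast
      have stepD: "P (g \<star> c)" if "P g" "c \<in> {mB, B2, mU}" for g c
        using right[OF that(1), of c] PB PU that(2) by auto
      have "x = y \<star> pinv b" using b xM D3_closed(1) by (simp add: PG.m_assoc)
      moreover have "pinv b \<in> D3" using subgroup.m_inv_closed[OF subgroup_D3 b(1)] .
      moreover have "P (y \<star> c)" if "c \<in> D3" for c
      proof -
        have 1: "P (y \<star> mB)" "P (y \<star> B2)" "P (y \<star> mU)" using stepD[OF Py] by auto
        then have "P (y \<star> mB \<star> mU)" "P (y \<star> B2 \<star> mU)" using stepD by auto
        then show ?thesis using that 1 Py yM by (auto simp: D3_def PG.m_assoc)
      qed
      ultimately show False using d0(2) x_def by simp
    qed
    let ?D = "D \<union> block x"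
    have "partial_transversal ?D"
      unfolding partial_transversal_def saturated_def
    proof (intro conjI ballI impI)
      show "?D \<subseteq> Mh" "\<e> \<in> ?D" using pt bp by auto
    next
      fix d assume d: "d \<in> ?D"
      show "d \<star> mU \<in> ?D" using d pt(3) bp(3) by blast
      show "d \<star> mB \<in> ?D \<and> d \<star> B2 \<in> ?D \<or> d \<star> mB \<star> pinv d \<in> S" using d pt(5) bp(4) by blast
      have "(\<e>, d0) \<in> (stepR ?D)\<^sup>*" using pt(6)[OF d0(1)] stepR_mono[of D ?D] by blast
      moreover have "(d0, x) \<in> stepR ?D" using d0(1) bp(2) by (auto simp: stepR_def x_def)
      ultimately have ex: "(\<e>, x) \<in> (stepR ?D)\<^sup>*" by (rule rtrancl_into_rtrancl)
      show "(\<e>, d) \<in> (stepR ?D)\<^sup>*"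
      proof (cases "d \<in> D")
        case True
        then show ?thesis using pt(6) stepR_mono[of D ?D] by blast
      next
        case False
        then have "(x, d) \<in> (stepR ?D)\<^sup>*" using d bp(6) stepR_mono[of "block x" ?D] by blast
        then show ?thesis using ex by simp
      qed
    next
      fix d s assume d: "d \<in> ?D" "s \<in> S" "s \<star> d \<in> ?D"
      then have M: "d \<in> Mh" "s \<in> Mh" using pt(1) bp(1) S_Mh by auto
      consider "d \<in> D" "s \<star> d \<in> D" | "d \<in> block x" "s \<star> d \<in> block x"
        | "d \<in> D" "s \<star> d \<in> block x" | "d \<in> block x" "s \<star> d \<in> D" using d by blast
      then show "s = \<e>"
      proof cases
        case 3
        then show ?thesis using disj[OF 3(2)] PS[OF P1[OF 3(1)] d(2) M(1)] by blast
      next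
        case 4
        have "pinv s \<star> (s \<star> d) = d" using M by (simp flip: PG.m_assoc)
        then show ?thesis using disj[OF 4(1)] PS[OF P1[OF 4(2)] S_inv[OF d(2)]] M by simp
      qed (use pt(4) bp(5) d(2) in blast)+
    qed
    then have "?D = D" using max by blast
    then have "x \<in> D" using bp(2) by blast
    then show False using P1 d0(2) x_def by blast
  qed
  have "P g" if "g \<in> Mh" for g
    using that
  proof (rule Mh_induct)
    show "P \<e>" using P1 pt(2) .
    fix h x assume "x \<in> {mA, mB, mU}" "P h"
    then show "P (h \<star> x)" using right[of h x] PU PB PA by auto
  qed
  then show ?thesis using D P_def by blast
qed

end

section \<open>Free generation by exits from a transversal\<close>

lemma rword_append:
  "rword (u @ w) \<longleftrightarrow> rword u \<and> rword w \<and> (u = [] \<or> w = [] \<or> fst (last u) \<noteq> fst (hd w))"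
proof -
  have *: "distinct_adj (map fst u @ map fst w) \<longleftrightarrow> distinct_adj (map fst u) \<and> distinct_adj (map fst w) \<and>
      (u = [] \<or> w = [] \<or> fst (last u) \<noteq> fst (hd w))"
    by (auto simp: distinct_adj_append_iff last_map hd_map)
  show ?thesis by (simp only: reduced_word_def set_append ball_Un map_append * conj_ac)
qed

lemma letters_Mh: "H \<in> {HA, HB} \<Longrightarrow> x \<in> H \<Longrightarrow> x \<in> Mh"
  using LF.factor_carrier by blast

lemma factor_inv: "H \<in> {HA, HB} \<Longrightarrow> x \<in> H \<Longrightarrow> pinv x \<in> H"
  using subgroup.m_inv_closed[OF LF.factor_subgroup] by blast

lemma subgroup_conj:
  assumes "subgroup H PGL2Z" "y \<in> Mh"
  shows "subgroup ((\<lambda>x. y \<star> x \<star> pinv y) ` H) PGL2Z"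
proof (rule PG.subgroupI)
  have HM: "x \<in> Mh" if "x \<in> H" for x using subgroup.mem_carrier[OF assms(1) that] .
  show "(\<lambda>x. y \<star> x \<star> pinv y) ` H \<subseteq> Mh" using HM assms(2) by auto
  show "(\<lambda>x. y \<star> x \<star> pinv y) ` H \<noteq> {}" using subgroup.one_closed[OF assms(1)] by blast
  fix a assume "a \<in> (\<lambda>x. y \<star> x \<star> pinv y) ` H"
  then obtain x where x: "x \<in> H" "a = y \<star> x \<star> pinv y" by blast
  have "pinv a = y \<star> pinv x \<star> pinv y"
    using x HM assms(2) by (simp add: PG.inv_mult_group PG.m_assoc)
  then show "pinv a \<in> (\<lambda>x. y \<star> x \<star> pinv y) ` H" using subgroup.m_inv_closed[OF assms(1) x(1)] by blast
  fix b assume "b \<in> (\<lambda>x. y \<star> x \<star> pinv y) ` H"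
  then obtain z where z: "z \<in> H" "b = y \<star> z \<star> pinv y" by blast
  have "a \<star> b = y \<star> (x \<star> z) \<star> pinv y"
    unfolding x z by (rule PG.telescope) (use HM x z assms(2) in auto)
  then show "a \<star> b \<in> (\<lambda>x. y \<star> x \<star> pinv y) ` H" using subgroup.m_closed[OF assms(1) x(1) z(1)] by blast
qed

lemma generate_inv: "s \<in> Mh \<Longrightarrow> generate PGL2Z {pinv s} = generate PGL2Z {s}"
proof -
  have "generate PGL2Z {pinv s} \<subseteq> generate PGL2Z {s}" if "s \<in> Mh" for s
    by (rule PG.generate_subgroup_incl) (use that in \<open>auto intro: generate.inv PG.generate_is_subgroup\<close>)
  from this[of s] this[of "pinv s"] show "s \<in> Mh \<Longrightarrow> ?thesis" by auto
qed

lemma conj_eq_one: "x \<in> Mh \<Longrightarrow> y \<in> Mh \<Longrightarrow> y \<star> x \<star> pinv y = \<e> \<Longrightarrow> x = \<e>"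
proof -
  assume M: "x \<in> Mh" "y \<in> Mh" "y \<star> x \<star> pinv y = \<e>"
  have "x = pinv y \<star> (y \<star> x \<star> pinv y) \<star> y" using M(1,2) by (simp add: PG.m_assoc flip: PG.m_assoc[of "pinv y" y])
  then show "x = \<e>" using M by simp
qed

locale neumann_transversal = neumann +
  fixes D :: "(int ^ 2 ^ 2) set set"
  assumes pt: "partial_transversal D"
    and cover: "g \<in> Mh \<Longrightarrow> \<exists>s\<in>S. \<exists>d\<in>D. g = s \<star> d"
begin

lemmas D_props = partial_transversalD[OF pt]

lemma D_Mh: "d \<in> D \<Longrightarrow> d \<in> Mh"
  using D_props(1) by blast

text \<open>In the unique factorization g = s d, s names the translate of \<open>D\<close>
  containing \<open>g\<close>; the other factor, \<open>rh g\<close>, is the position of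
  \<open>g\<close> in that translate.\<close>

definition sg :: "(int ^ 2 ^ 2) set \<Rightarrow> (int ^ 2 ^ 2) set" where
  "sg g = (SOME s. s \<in> S \<and> (\<exists>d\<in>D. g = s \<star> d))"

definition rh :: "(int ^ 2 ^ 2) set \<Rightarrow> (int ^ 2 ^ 2) set" where
  "rh g = (SOME d. d \<in> D \<and> g = sg g \<star> d)"

lemma sg_rh: assumes "g \<in> Mh" shows "sg g \<in> S" "rh g \<in> D" "sg g \<star> rh g = g"
proof -
  have 1: "sg g \<in> S \<and> (\<exists>d\<in>D. g = sg g \<star> d)"
    unfolding sg_def by (rule someI_ex) (use cover[OF assms] in blast)
  then show "sg g \<in> S" by blast
  have "rh g \<in> D \<and> g = sg g \<star> rh g"
    unfolding rh_def by (rule someI_ex) (use 1 in blast)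
  then show "rh g \<in> D" "sg g \<star> rh g = g" by simp_all
qed

lemma transversal_unique:
  assumes "s \<in> S" "d \<in> D" "s' \<in> S" "d' \<in> D" "s \<star> d = s' \<star> d'"
  shows "s = s'" "d = d'"
proof -
  have M: "s \<in> Mh" "d \<in> Mh" "s' \<in> Mh" "d' \<in> Mh" using assms S_Mh D_Mh by auto
  have "(pinv s' \<star> s) \<star> d = pinv s' \<star> (s' \<star> d')" using M assms(5) by (simp add: PG.m_assoc)
  also have "\<dots> = d'" using M by (simp flip: PG.m_assoc)
  finally have *: "(pinv s' \<star> s) \<star> d = d'" .
  have "pinv s' \<star> s \<in> S" using assms S_mult S_inv by blast
  then have e: "pinv s' \<star> s = \<e>" using D_props(4)[OF assms(2)] * assms(4) by simp
  then show "d = d'" using * M by simp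
  have "s' \<star> (pinv s' \<star> s) = s" using M by (simp flip: PG.m_assoc)
  then show "s = s'" using e M by simp
qed

lemma sg_eq: assumes "s \<in> S" "d \<in> D" shows "sg (s \<star> d) = s" "rh (s \<star> d) = d"
proof -
  have "s \<star> d \<in> Mh" using assms S_Mh D_Mh by simp
  from sg_rh[OF this] show "sg (s \<star> d) = s" "rh (s \<star> d) = d"
    using transversal_unique[OF _ _ assms] by blast+
qed

text \<open>An exit is an edge of the Cayley graph leaving \<open>D\<close>. It ends in the
  translate of \<open>D\<close> by \<open>lab e\<close>, at the position
  \<open>tgt e\<close>.\<close>

fun exits :: "(int ^ 2 ^ 2) set \<times> (int ^ 2 ^ 2) set set \<times> (int ^ 2 ^ 2) set \<Rightarrow> bool" where
  "exits (y, H, x) \<longleftrightarrow> y \<in> D \<and> H \<in> {HA, HB} \<and> x \<in> H \<and> y \<star> x \<notin> D"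

fun lab where "lab (y, H, x) = sg (y \<star> x)"
fun tgt where "tgt (y, H, x) = rh (y \<star> x)"
fun rev_exit where "rev_exit (y, H, x) = (rh (y \<star> x), H, pinv x)"

definition grp where "grp e = generate PGL2Z {lab e}"

text \<open>Excludes turning back. The mirror image of the target under \<open>U\<close> counts as
  the same place, because mirror exits have equal labels; for B, any further B-letter at the target
  counts as turning back.\<close>

fun adm where
  "adm (y, H, x) (y', H', x') \<longleftrightarrow> \<not> (H' = H \<and> (y' = rh (y \<star> x) \<or> y' = rh (y \<star> x) \<star> mU))"

definition sprod where "sprod es = foldr (\<lambda>e s. lab e \<star> s) es \<e>"

lemma sprod_simps [simp]: "sprod [] = \<e>" "sprod (e # es) = lab e \<star> sprod es"
  by (simp_all add: sprod_def)

lemma exits_Mh: "exits (y, H, x) \<Longrightarrow> y \<in> Mh" "exits (y, H, x) \<Longrightarrow> x \<in> Mh" "exits (y, H, x) \<Longrightarrow> x \<noteq> \<e>"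
  using D_Mh letters_Mh by auto

lemma lab_S: assumes "exits e" shows "lab e \<in> S" "tgt e \<in> D" "lab e \<in> Mh" "lab e \<noteq> \<e>"
proof -
  obtain y H x where e: "e = (y, H, x)" by (cases e)
  have M: "y \<star> x \<in> Mh" using exits_Mh[of y H x] assms e by simp
  show "lab e \<in> S" "tgt e \<in> D" using sg_rh[OF M] e by simp_all
  then show "lab e \<in> Mh" using S_Mh by blast
  show "lab e \<noteq> \<e>"
  proof
    assume "lab e = \<e>"
    then have "y \<star> x = rh (y \<star> x)" using sg_rh[OF M] e D_Mh by simp
    then show False using assms e sg_rh(2)[OF M] by simp
  qed
qed

lemma sprod_S: "\<forall>e\<in>set es. exits e \<Longrightarrow> sprod es \<in> S"
  by (induction es) (auto simp: lab_S S_mult)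

lemma sprod_append: "\<forall>e\<in>set es \<union> set fs. exits e \<Longrightarrow> sprod (es @ fs) = sprod es \<star> sprod fs"
proof (induction es)
  case Nil
  then show ?case using sprod_S S_Mh by simp
next
  case (Cons e es)
  then have "sprod es \<in> Mh" "sprod fs \<in> Mh" "lab e \<in> Mh" using sprod_S S_Mh lab_S by auto
  then show ?case using Cons by (simp add: PG.m_assoc)
qed

lemma exit_B: assumes "exits (y, HB, x)" shows "y \<star> mB \<star> pinv y \<in> S"
proof -
  have "x \<in> {mB, B2}" using assms exits_Mh(3)[OF assms] by (auto simp: HB_def)
  then show ?thesis using D_props(5)[of y] assms by auto
qed

lemma exit_B_conj: assumes "exits (y, HB, x)" "x' \<in> HB" shows "y \<star> x' \<star> pinv y \<in> S"
  using exit_B[OF assms(1)] conj_B_pow[of y] exits_Mh(1)[OF assms(1)] assms(2) by (auto simp: HB_def)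

text \<open>By saturation a B-exit starts at a coset fixed by B, so with one B-letter all of them
  leave \<open>D\<close>; \<open>HA\<close> has only one nontrivial letter.\<close>

lemma blocked: assumes "exits (y, H, x)" "x' \<in> H" "x' \<noteq> \<e>" shows "exits (y, H, x')"
proof (cases "H = HA")
  case True
  then have "x = x'" using assms exits_Mh(3)[OF assms(1)] by (auto simp: HA_def)
  then show ?thesis using assms by simp
next
  case False
  then have H: "H = HB" using assms by simp
  have M: "x' \<in> Mh" "y \<in> Mh" using letters_Mh[of HB x'] assms H exits_Mh by auto
  have "y \<star> x' \<notin> D"
  proof
    assume "y \<star> x' \<in> D"
    then have "(y \<star> x' \<star> pinv y) \<star> y \<in> D" using M by (simp add: conj_cancel)
    then have "y \<star> x' \<star> pinv y = \<e>"
      using D_props(4)[of y] exit_B_conj[of y x x'] assms H by simp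
    then show False using conj_eq_one M assms(3) by blast
  qed
  then show ?thesis using assms H by simp
qed

lemma rev_exit:
  assumes "exits (y, H, x)"
  shows "exits (rev_exit (y, H, x))" "lab (rev_exit (y, H, x)) = pinv (lab (y, H, x))"
    "tgt (rev_exit (y, H, x)) = y"
proof -
  note M = exits_Mh[OF assms]
  define s z where "s = sg (y \<star> x)" and "z = rh (y \<star> x)"
  have sz: "s \<in> S" "z \<in> D" "s \<star> z = y \<star> x" using sg_rh[of "y \<star> x"] M by (simp_all add: s_def z_def)
  have M': "s \<in> Mh" "z \<in> Mh" using sz S_Mh D_Mh by auto
  have "z = pinv s \<star> (s \<star> z)" using M' by (simp flip: PG.m_assoc)
  then have "z \<star> pinv x = pinv s \<star> (y \<star> x) \<star> pinv x" unfolding sz(3) by simp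
  also have "\<dots> = pinv s \<star> y" using M M' by (simp add: PG.m_assoc)
  finally have zx: "z \<star> pinv x = pinv s \<star> y" .
  have y: "y \<in> D" "H \<in> {HA, HB}" "x \<in> H" using assms by simp_all
  have sg: "sg (z \<star> pinv x) = pinv s" "rh (z \<star> pinv x) = y"
    unfolding zx using sg_eq[OF S_inv[OF sz(1)] y(1)] by simp_all
  then show "lab (rev_exit (y, H, x)) = pinv (lab (y, H, x))" "tgt (rev_exit (y, H, x)) = y"
    by (simp_all add: s_def z_def)
  have "z \<star> pinv x \<notin> D"
  proof
    assume "z \<star> pinv x \<in> D"
    then have "pinv s = \<e>" using D_props(4)[OF y(1) S_inv[OF sz(1)]] zx by simp
    then have "s = \<e>" using M' by simp
    then show False using lab_S(4)[OF assms] by (simp add: s_def)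
  qed
  then show "exits (rev_exit (y, H, x))"
    using sz(2) y factor_inv[OF y(2,3)] by (simp add: z_def)
qed

text \<open>Labels act from the left and \<open>U\<close> from the right, so an exit and its mirror
  image lead into the same translate.\<close>

lemma twist_exit:
  assumes "exits (y, H, x)"
  shows "exits (y \<star> mU, H, mU \<star> x \<star> mU)" "lab (y \<star> mU, H, mU \<star> x \<star> mU) = lab (y, H, x)"
    "tgt (y \<star> mU, H, mU \<star> x \<star> mU) = tgt (y, H, x) \<star> mU"
proof -
  note M = exits_Mh[OF assms]
  have eq: "y \<star> mU \<star> (mU \<star> x \<star> mU) = y \<star> x \<star> mU" using twist_step M by simp
  have sz: "sg (y \<star> x) \<in> S" "rh (y \<star> x) \<in> D" "sg (y \<star> x) \<star> rh (y \<star> x) = y \<star> x"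
    using sg_rh[of "y \<star> x"] M by simp_all
  have "y \<star> x \<star> mU = (sg (y \<star> x) \<star> rh (y \<star> x)) \<star> mU" using sz(3) by simp
  also have "\<dots> = sg (y \<star> x) \<star> (rh (y \<star> x) \<star> mU)"
    using sz(1,2) S_Mh D_Mh by (simp add: PG.m_assoc)
  finally have yU: "y \<star> x \<star> mU = sg (y \<star> x) \<star> (rh (y \<star> x) \<star> mU)" .
  show "lab (y \<star> mU, H, mU \<star> x \<star> mU) = lab (y, H, x)" "tgt (y \<star> mU, H, mU \<star> x \<star> mU) = tgt (y, H, x) \<star> mU"
    using sg_eq[OF sz(1) D_props(3)[OF sz(2)]] by (simp_all add: eq yU)
  have "y \<star> x \<star> mU \<notin> D"
  proof
    assume "y \<star> x \<star> mU \<in> D"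
    then have "y \<star> x \<star> mU \<star> mU \<in> D" by (rule D_props(3))
    then show False using M assms by (simp add: letter_cancel)
  qed
  then show "exits (y \<star> mU, H, mU \<star> x \<star> mU)"
    using assms D_props(3) U_conj_factor by (simp add: eq)
qed

text \<open>A sequence of exits without backtracking is traced by a reduced word in \<open>A\<close>, \<open>B\<close> running
  through successive translates of \<open>D\<close>.\<close>

lemma exit_path:
  assumes "es \<noteq> []" "\<forall>e\<in>set es. exits e" "successively adm es" "y \<in> D"
  shows "\<exists>u. rword u \<and> u \<noteq> [] \<and> (\<exists>d\<in>D. y \<star> ev u = sprod es \<star> d) \<and> \<not> dpath D y u \<and>
    (y \<star> snd (hd u) \<in> D \<or>
      fst (hd u) = fst (snd (hd es)) \<and> (y = fst (hd es) \<or> y = fst (hd es) \<star> mU))"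
  using assms
proof (induction es arbitrary: y)
  case Nil
  then show ?case by simp
next
  case (Cons e es)
  obtain ye H xe where e: "e = (ye, H, xe)" by (cases e)
  have ex: "exits (ye, H, xe)" using Cons.prems(2) e by simp
  have yM: "y \<in> Mh" and yeD: "ye \<in> D" "ye \<in> Mh" using Cons.prems(4) ex D_Mh by auto
  have "(y, \<e>) \<in> (stepR D)\<^sup>*" using stepR_rtrancl_sym[OF D_props(1)] D_props(6) Cons.prems(4) by blast
  then have "(y, ye) \<in> (stepR D)\<^sup>*" using D_props(6)[OF yeD(1)] by simp
  then obtain u0 where u0: "rword u0" "dpath D y u0" "ye = y \<star> ev u0 \<or> ye = y \<star> ev u0 \<star> mU"
    using connected_path[OF _ Cons.prems(4) D_props(1,3)] by blast
  have lu0: "lword u0" using reduced_word_fword[OF u0(1)] .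
  have eu0: "ev u0 \<in> Mh" using lu0 by simp
  define ys where "ys = y \<star> ev u0"
  have ysM: "ys \<in> Mh" using yM eu0 by (simp add: ys_def)
  \<comment> \<open>The path inside \<open>D\<close> reaches the source of \<open>e\<close> only up
    to \<open>U\<close>. In the mirrored case the mirror exit, which has the same label, replaces
    \<open>e\<close>.\<close>
  obtain xs where xs: "exits (ys, H, xs)" "lab (ys, H, xs) = lab e"
      "tgt (ys, H, xs) = tgt e \<or> tgt (ys, H, xs) = tgt e \<star> mU" "ys = ye \<or> ys = ye \<star> mU"
  proof (cases "ye = ys")
    case True
    then show ?thesis using that[of xe] ex e by simp
  next
    case False
    then have "ye = ys \<star> mU" using u0(3) by (simp add: ys_def)
    then have "ys = ye \<star> mU" using ysM by (simp add: letter_cancel)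
    then show ?thesis using that[of "mU \<star> xe \<star> mU"] twist_exit[OF ex] e by simp
  qed
  have xsM: "xs \<in> Mh" "xs \<noteq> \<e>" using exits_Mh[OF xs(1)] by simp_all
  have H: "H \<in> {HA, HB}" "xs \<in> H" "ys \<star> xs \<notin> D" using xs(1) by simp_all
  define zs where "zs = tgt (ys, H, xs)"
  have zsD: "zs \<in> D" using lab_S(2)[OF xs(1)] by (simp add: zs_def)
  have step: "ys \<star> xs = lab e \<star> zs"
    using sg_rh[of "ys \<star> xs"] ysM xsM xs(2) by (simp add: zs_def)
  \<comment> \<open>Had the path arrived by a letter of \<open>H\<close>, going back along it would
    stay in \<open>D\<close>, against \<open>blocked\<close>.\<close>
  have last0: "fst (last u0) \<noteq> H" if ne: "u0 \<noteq> []"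
  proof
    assume "fst (last u0) = H"
    then have l: "u0 = butlast u0 @ [(H, snd (last u0))]"
      using append_butlast_last_id[OF ne] by (metis prod.collapse)
    define u0' x' where "u0' = butlast u0" and "x' = snd (last u0)"
    then have l: "u0 = u0' @ [(H, x')]" using l by simp
    have x': "x' \<in> H" "x' \<noteq> \<e>" "lword u0'"
      using u0(1) lu0 by (auto simp: l rword_append reduced_word_Cons)
    then have M: "x' \<in> Mh" "ev u0' \<in> Mh" using letters_Mh[OF H(1)] by auto
    have "y \<star> ev u0' \<in> D" using u0(2) yM x'(3) by (simp add: l dpath_append)
    moreover have "ys = y \<star> ev u0' \<star> x'"
      using M yM x' lu0 LF.weval_append[of u0' "[(H, x')]"] by (simp add: ys_def l PG.m_assoc)
    then have "ys \<star> pinv x' = y \<star> ev u0'" using M yM by (simp add: PG.m_assoc)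
    moreover have "exits (ys, H, pinv x')"
      using blocked[OF xs(1) factor_inv[OF H(1) x'(1)]] x'(2) M by simp
    ultimately show False by simp
  qed
  have "\<exists>u'. rword u' \<and> (u' = [] \<or> fst (hd u') \<noteq> H) \<and> (\<exists>d\<in>D. zs \<star> ev u' = sprod es \<star> d)"
  proof (cases "es = []")
    case True
    then show ?thesis using zsD D_Mh by (intro exI[of _ "[]"]) auto
  next
    case False
    have "\<forall>e\<in>set es. exits e" "successively adm es"
      using Cons.prems(2,3) by (auto simp: successively_Cons)
    then obtain u' d where u': "rword u'" "u' \<noteq> []" "d \<in> D" "zs \<star> ev u' = sprod es \<star> d"
      "zs \<star> snd (hd u') \<in> D \<or>
        fst (hd u') = fst (snd (hd es)) \<and> (zs = fst (hd es) \<or> zs = fst (hd es) \<star> mU)"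
      using Cons.IH[OF False _ _ zsD] by blast
    \<comment> \<open>A continuation in \<open>H\<close> would leave \<open>D\<close> at once. By
      the last clause of the induction hypothesis it then starts at the source of the next exit, up
      to \<open>U\<close>, and uses the same factor, which admissibility forbids.\<close>
    have "fst (hd u') \<noteq> H"
    proof
      assume hH: "fst (hd u') = H"
      have adm: "adm e (hd es)" using Cons.prems(3) False by (auto simp: successively_Cons)
      define x1 where "x1 = snd (hd u')"
      have hd: "hd u' = (H, x1)" using hH by (simp add: x1_def prod_eq_iff)
      have "hd u' \<in> set u'" using u'(2) by simp
      then have x1: "x1 \<in> H" "x1 \<noteq> \<e>" using u'(1) unfolding reduced_word_def hd by auto
      have "exits (zs, H, pinv xs)" using rev_exit(1)[OF xs(1)] by (simp add: zs_def)
      from blocked[OF this x1] have "zs \<star> x1 \<notin> D" by simp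
      then have *: "H = fst (snd (hd es))" "zs = fst (hd es) \<or> zs = fst (hd es) \<star> mU"
        using u'(5) hd by auto
      define y' x' where "y' = fst (hd es)" and "x' = snd (snd (hd es))"
      have hde: "hd es = (y', H, x')" using *(1) by (simp add: y'_def x'_def prod_eq_iff)
      have y'M: "y' \<in> Mh" using Cons.prems(2) False hd_in_set[OF False] hde exits_Mh(1)[of y' H x'] by auto
      have tM: "tgt e \<in> Mh" using lab_S(2)[of e] ex e D_Mh by simp
      have "y' = tgt e \<or> y' = tgt e \<star> mU"
        using *(2) xs(3) letter_cancel(2)[OF y'M] letter_cancel(2)[OF tM]
        unfolding hde fst_conv zs_def by metis
      then show False using adm by (simp add: hde e)
    qed
    then show ?thesis using u' by blast
  qed
  then obtain u' d where u': "rword u'" "u' = [] \<or> fst (hd u') \<noteq> H" "d \<in> D" "zs \<star> ev u' = sprod es \<star> d"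
    by blast
  have lu': "lword u'" using reduced_word_fword[OF u'(1)] .
  have eu': "ev u' \<in> Mh" using lu' by simp
  define u where "u = u0 @ (H, xs) # u'"
  have "rword ((H, xs) # u')" using H xsM u'(1,2) by (auto simp: reduced_word_Cons)
  then have "rword u" using u0(1) last0 by (auto simp: u_def rword_append)
  moreover have "u \<noteq> []" by (simp add: u_def)
  moreover have "y \<star> ev u = sprod (e # es) \<star> d"
  proof -
    have lM: "lab e \<in> Mh" "sprod es \<in> Mh" using lab_S(3)[OF ex] e sprod_S[of es] Cons.prems(2) S_Mh by auto
    have "ev u = ev u0 \<star> (xs \<star> ev u')"
      using LF.weval_append[of u0 "(H, xs) # u'"] lu0 lu' H by (simp add: u_def)
    then have "y \<star> ev u = (ys \<star> xs) \<star> ev u'"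
      using yM eu0 eu' xsM by (simp add: ys_def PG.m_assoc)
    also have "\<dots> = lab e \<star> (zs \<star> ev u')" using lM D_Mh[OF zsD] eu' by (simp add: step PG.m_assoc)
    also have "\<dots> = sprod (e # es) \<star> d" using u'(3) lM D_Mh by (simp add: u'(4) PG.m_assoc)
    finally show ?thesis .
  qed
  moreover have "\<not> dpath D y u"
    using H(3) dpath_start[of D "ys \<star> xs" u'] lu0 yM by (auto simp: u_def dpath_append ys_def)
  moreover have "y \<star> snd (hd u) \<in> D \<or>
      fst (hd u) = fst (snd (hd (e # es))) \<and> (y = fst (hd (e # es)) \<or> y = fst (hd (e # es)) \<star> mU)"
  proof (cases u0)
    case Nil
    then show ?thesis using xs(4) yM by (auto simp: u_def e ys_def)
  next
    case (Cons a v)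
    obtain H1 x1 where "a = (H1, x1)" by force
    then show ?thesis using u0(2) dpath_start[of D "y \<star> x1" v] by (simp add: u_def Cons)
  qed
  ultimately show ?case using u'(3) by blast
qed

text \<open>If the product were 1, the word of \<open>exit_path\<close> would end in
  \<open>D\<close> after having left it. By connectedness the same endpoint is reached by a reduced
  word inside \<open>D\<close>, and uniqueness of normal forms makes the two words equal.\<close>

lemma sprod_nontrivial:
  assumes "es \<noteq> []" "\<forall>e\<in>set es. exits e" "successively adm es"
  shows "sprod es \<noteq> \<e>"
proof
  assume one: "sprod es = \<e>"
  obtain u d where u: "rword u" "d \<in> D" "\<e> \<star> ev u = sprod es \<star> d" "\<not> dpath D \<e> u"
    using exit_path[OF assms D_props(2)] by blast
  have lu: "lword u" using reduced_word_fword[OF u(1)] .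
  have d: "d = ev u" using u(3) one D_Mh[OF u(2)] lu by simp
  obtain w where w: "rword w" "dpath D \<e> w" "d = \<e> \<star> ev w \<or> d = \<e> \<star> ev w \<star> mU"
    using connected_path[OF D_props(6)[OF u(2)] D_props(2,1,3)] by blast
  have lw: "lword w" using reduced_word_fword[OF w(1)] .
  \<comment> \<open>The determinant tells whether the path inside \<open>D\<close> ends with a
    \<open>U\<close>; here it cannot.\<close>
  have "ev w \<star> mU \<notin> PSL2Z" using PSL2Z_mult[of "ev w" mU] ev_PSL2Z[OF lw] lw gens_PSL2Z by simp
  then have "d \<noteq> \<e> \<star> ev w \<star> mU" using d ev_PSL2Z[OF lu] lw by auto
  then have "d = \<e> \<star> ev w" using w(3) by blast
  then have "ev u = ev w" using d lw by simp
  then have "u = w" using rword_unique[OF u(1) w(1)] by simp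
  then show False using w(2) u(4) by simp
qed

end

lemma factor_subgroup_PGL2Z: "H \<in> {HA, HB} \<Longrightarrow> subgroup H PGL2Z"
  using subgroup_HA subgroup_HB by auto

context neumann_transversal
begin

lemma grp_S: "exits e \<Longrightarrow> subgroup (grp e) PGL2Z" "exits e \<Longrightarrow> grp e \<subseteq> S" "exits e \<Longrightarrow> lab e \<in> grp e"
  unfolding grp_def using lab_S[of e] PG.generate_is_subgroup PG.generate_subgroup_incl[OF _ sub]
  by (auto intro: generate.incl)

text \<open>The exits whose target is their own source (up to \<open>U\<close>) are those with a nontrivial
  stabilizer; the reflected target is impossible since \<open>S\<close> contains no reflection.\<close>

lemma HA_exit: assumes "exits (y, HA, x)" shows "x = mA"
  using assms exits_Mh(3)[OF assms] by (auto simp: HA_def)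

lemma tgt_cases:
  assumes "exits (y, H, x)" "tgt (y, H, x) = y \<or> tgt (y, H, x) = y \<star> mU \<or> H = HB"
  shows "tgt (y, H, x) = y" "\<And>x'. x' \<in> H \<Longrightarrow> y \<star> x' \<star> pinv y \<in> S"
proof -
  note M = exits_Mh[OF assms(1)]
  have yD: "y \<in> D" "H \<in> {HA, HB}" "x \<in> H" using assms(1) by simp_all
  have *: "tgt (y, H, x) = y" if "y \<star> x \<star> pinv y \<in> S"
  proof -
    have "(y \<star> x \<star> pinv y) \<star> y = y \<star> x" using M by (simp add: conj_cancel)
    then show ?thesis using sg_eq[OF that yD(1)] by simp
  qed
  show c: "y \<star> x' \<star> pinv y \<in> S" if x': "x' \<in> H" for x'
  proof (cases "H = HB")
    case True
    then show ?thesis using exit_B_conj[of y x x'] assms(1) x' by simp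
  next
    case False
    then have H: "H = HA" using yD by simp
    then have x: "x = mA" using HA_exit assms(1) by simp
    have s: "lab (y, H, x) \<in> S" "lab (y, H, x) \<star> tgt (y, H, x) = y \<star> x" "lab (y, H, x) \<in> Mh"
      using sg_rh[of "y \<star> x"] M S_Mh by simp_all
    have "tgt (y, H, x) \<noteq> y \<star> mU"
    proof
      assume t: "tgt (y, H, x) = y \<star> mU"
      have "y \<star> (mA \<star> mU) \<star> pinv y = (y \<star> mA) \<star> mU \<star> pinv y" using M by (simp add: PG.m_assoc)
      also have "\<dots> = (lab (y, H, x) \<star> (y \<star> mU)) \<star> mU \<star> pinv y" using s t x by simp
      also have "\<dots> = lab (y, H, x) \<star> (y \<star> mU \<star> mU) \<star> pinv y" using s M by (simp only: PG.m_assoc PG.m_closed gens_closed PG.inv_closed)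
      also have "\<dots> = lab (y, H, x)" unfolding letter_cancel(2)[OF M(1)] using s(3) M by (simp add: PG.m_assoc)
      finally have "y \<star> (mA \<star> mU) \<star> pinv y \<in> S" using s by simp
      moreover have "(mA \<star> mU) \<star> (mA \<star> mU) = \<e>" by (simp add: left_norm flip: PG.m_assoc)
      moreover have "mA \<star> mU \<notin> PSL2Z" using PSL2Z_mult[of mA mU] gens_PSL2Z by simp
      ultimately show False using no_conj_reflection[of y "mA \<star> mU"] M by simp
    qed
    then have "tgt (y, H, x) = y" using assms(2) H HA_HB_ne by auto
    then have "lab (y, H, x) = y \<star> mA \<star> pinv y" using s M x by (simp add: PG.inv_solve_right)
    then have "y \<star> mA \<star> pinv y \<in> S" using s by simp
    moreover have "y \<star> \<e> \<star> pinv y \<in> S" using M by simp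
    ultimately show ?thesis using x' H by (auto simp: HA_def)
  qed
  show "tgt (y, H, x) = y" using * c yD(3) by simp
qed

lemma conj_exit:
  assumes "exits (y, H, x)" "tgt (y, H, x) = y \<or> tgt (y, H, x) = y \<star> mU \<or> H = HB" "x' \<in> H" "x' \<noteq> \<e>"
  shows "exits (y, H, x')" "lab (y, H, x') = y \<star> x' \<star> pinv y"
proof -
  show ex: "exits (y, H, x')" using blocked[OF assms(1,3,4)] .
  have M: "y \<in> Mh" "x' \<in> Mh" using exits_Mh[OF ex] by simp_all
  have "(y \<star> x' \<star> pinv y) \<star> y = y \<star> x'" using M by (simp add: conj_cancel)
  then show "lab (y, H, x') = y \<star> x' \<star> pinv y"
    using sg_eq[OF tgt_cases(2)[OF assms(1-3)], of y] assms(1) by simp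
qed

lemma torsion_grp:
  assumes "exits (y, H, x)" "tgt (y, H, x) = y \<or> tgt (y, H, x) = y \<star> mU \<or> H = HB"
  shows "grp (y, H, x) = (\<lambda>x. y \<star> x \<star> pinv y) ` H"
proof -
  note M = exits_Mh[OF assms(1)]
  have H: "H \<in> {HA, HB}" "x \<in> H" using assms(1) by simp_all
  have l: "lab (y, H, x) = y \<star> x \<star> pinv y" using conj_exit(2)[OF assms H(2)] M by simp
  note sc = subgroup_conj[OF factor_subgroup_PGL2Z[OF H(1)] M(1)]
  have "grp (y, H, x) \<subseteq> (\<lambda>x. y \<star> x \<star> pinv y) ` H"
    unfolding grp_def by (rule PG.generate_subgroup_incl[OF _ sc]) (use l H in auto)
  moreover have "(\<lambda>x. y \<star> x \<star> pinv y) ` H \<subseteq> grp (y, H, x)"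
  proof clarify
    fix x' assume x': "x' \<in> H"
    note g = grp_S(1,3)[OF assms(1)]
    have "x' = \<e> \<or> x' = x \<or> x' = x \<star> x"
      using H x' M(3) by (auto simp: HA_def HB_def letter_relations)
    moreover have "y \<star> \<e> \<star> pinv y \<in> grp (y, H, x)" using M subgroup.one_closed[OF g(1)] by simp
    moreover have "y \<star> (x \<star> x) \<star> pinv y \<in> grp (y, H, x)"
      using subgroup.m_closed[OF g(1) g(2) g(2)] conj_mult[of y x x] M unfolding l by simp
    ultimately show "y \<star> x' \<star> pinv y \<in> grp (y, H, x)" using g(2) l by auto
  qed
  ultimately show ?thesis by blast
qed

lemma torsion_grp_card:
  assumes "exits (y, H, x)" "tgt (y, H, x) = y \<or> tgt (y, H, x) = y \<star> mU \<or> H = HB"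
  shows "card (grp (y, H, x)) = (if H = HA then 2 else 3)"
proof -
  note M = exits_Mh[OF assms(1)]
  have H: "H \<in> {HA, HB}" using assms(1) by simp
  have "inj_on (\<lambda>x. y \<star> x \<star> pinv y) H"
  proof (rule inj_onI)
    fix a b assume ab: "a \<in> H" "b \<in> H" "y \<star> a \<star> pinv y = y \<star> b \<star> pinv y"
    then have Mab: "a \<in> Mh" "b \<in> Mh" using letters_Mh[OF H] by auto
    have r: "pinv y \<star> (y \<star> z \<star> pinv y) \<star> y = z" if "z \<in> Mh" for z
    proof -
      have "pinv y \<star> (y \<star> z \<star> pinv y) \<star> y = (pinv y \<star> y) \<star> z \<star> (pinv y \<star> y)"
        using M that by (simp only: PG.m_assoc PG.m_closed PG.inv_closed)
      then show ?thesis using M that by simp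
    qed
    show "a = b" using r[OF Mab(1)] r[OF Mab(2)] unfolding ab(3) by simp
  qed
  then have "card (grp (y, H, x)) = card H" using torsion_grp[OF assms] by (simp add: card_image)
  also have "\<dots> = (if H = HA then 2 else 3)"
  proof (cases "H = HA")
    case True
    then show ?thesis using HA_HB_ne by (simp add: HA_def)
  next
    case False
    then have "H = HB" using H by simp
    moreover have "\<e> \<noteq> mB" "\<e> \<noteq> B2" "mB \<noteq> B2" using HA_HB_ne by metis+
    then have "card HB = 3" by (simp add: HB_def)
    ultimately show ?thesis using False by simp
  qed
  finally show ?thesis .
qed

text \<open>Turning back stays within one factor. Contrapositively, exits of distinct factors follow
  each other admissibly, so a reduced word in the factors turns into an admissible sequence of
  exits.\<close>

lemma not_adm_grp:
  assumes "exits e" "exits e'" "\<not> adm e e'"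
  shows "grp e' = grp e"
proof -
  obtain y H x where e: "e = (y, H, x)" by (cases e)
  obtain y' H' x' where e': "e' = (y', H', x')" by (cases e')
  define z where "z = tgt e"
  have ex: "exits (y, H, x)" and ex': "exits (y', H', x')" using assms e e' by simp_all
  have H': "H' = H" and y': "y' = z \<or> y' = z \<star> mU" using assms(3) by (auto simp: e e' z_def)
  have zM: "z \<in> Mh" using lab_S(2)[OF assms(1)] D_Mh by (simp add: z_def)
  obtain x'' where x'': "exits (z, H, x'')" "lab (z, H, x'') = lab e'"
  proof (cases "y' = z")
    case True
    then show ?thesis using that[of x'] ex' e' H' by simp
  next
    case False
    then have "y' = z \<star> mU" using y' by simp
    then have "z = y' \<star> mU" using zM by (simp add: letter_cancel)
    then show ?thesis using that[of "mU \<star> x' \<star> mU"] twist_exit[OF ex'] e' H' by simp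
  qed
  show ?thesis
  proof (cases "H = HB")
    case True
    have "z = y" using tgt_cases(1)[OF ex] True by (simp add: z_def e)
    then have "grp (y, H, x) = grp (y, H, x'')" using torsion_grp[OF ex] torsion_grp[of y H x''] x''(1) True by simp
    then show ?thesis using x''(2) \<open>z = y\<close> by (simp add: grp_def e)
  next
    case False
    then have H: "H = HA" using ex by simp
    have "x = mA" "x'' = mA" using HA_exit ex x''(1) H by simp_all
    moreover have "pinv mA = mA" by (simp add: inv_gens)
    ultimately have "lab e' = pinv (lab e)"
      using rev_exit(2)[OF ex] x''(2) by (simp add: z_def e)
    then show ?thesis unfolding grp_def using generate_inv[OF lab_S(3)[OF assms(1)]] by simp
  qed
qed

lemma sprod_replicate: "exits e \<Longrightarrow> sprod (replicate n e) = lab e [^]\<^bsub>PGL2Z\<^esub> n"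
proof (induction n)
  case (Suc n)
  have "lab e \<star> lab e [^]\<^bsub>PGL2Z\<^esub> n = lab e [^]\<^bsub>PGL2Z\<^esub> (Suc n)"
    using PG.nat_pow_Suc2[of "lab e" n] lab_S(3)[OF Suc.prems] by simp
  then show ?case using Suc by simp
qed simp

text \<open>Such an exit may be repeated admissibly, so by \<open>sprod_nontrivial\<close> no
  positive power of its label is trivial.\<close>

lemma free_exit:
  assumes "exits (y, H, x)" "\<not> (tgt (y, H, x) = y \<or> tgt (y, H, x) = y \<star> mU \<or> H = HB)"
  shows "adm (y, H, x) (y, H, x)" "adm (rev_exit (y, H, x)) (rev_exit (y, H, x))"
    "infinite (grp (y, H, x))"
proof -
  note M = exits_Mh[OF assms(1)]
  define z where "z = tgt (y, H, x)"
  have zM: "z \<in> Mh" using lab_S(2)[OF assms(1)] D_Mh by (simp add: z_def)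
  show a: "adm (y, H, x) (y, H, x)"
    using assms(2) letter_cancel(2)[OF zM] by (auto simp: z_def)
  show "adm (rev_exit (y, H, x)) (rev_exit (y, H, x))"
    using assms(2) rev_exit(3)[OF assms(1)] by auto
  have "lab (y, H, x) [^]\<^bsub>PGL2Z\<^esub> n \<noteq> \<e>" if "n \<noteq> 0" for n :: nat
  proof -
    have "successively adm (replicate n (y, H, x))"
    proof (induction n)
      case (Suc n)
      then show ?case using a by (cases n) auto
    qed simp
    then show ?thesis
      using sprod_nontrivial[of "replicate n (y, H, x)"] sprod_replicate[OF assms(1)] assms(1) that by simp
  qed
  then have "PG.ord (lab (y, H, x)) = 0"
    using PG.ord_eq_0[OF lab_S(3)[OF assms(1)]] by simp
  then have "card (grp (y, H, x)) = 0"
    unfolding grp_def using PG.generate_pow_card[OF lab_S(3)[OF assms(1)]] by simp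
  then show "infinite (grp (y, H, x))"
    using grp_S(3)[OF assms(1)] by (auto simp: card_eq_0_iff)
qed

lemma grp_elems:
  assumes "exits e" "h \<in> grp e" "h \<noteq> \<e>"
  shows "\<exists>es. es \<noteq> [] \<and> (\<forall>f\<in>set es. exits f \<and> grp f = grp e) \<and> successively adm es \<and> sprod es = h"
proof -
  obtain y H x where e: "e = (y, H, x)" by (cases e)
  have ex: "exits (y, H, x)" using assms e by simp
  note M = exits_Mh[OF ex]
  show ?thesis
  proof (cases "tgt (y, H, x) = y \<or> tgt (y, H, x) = y \<star> mU \<or> H = HB")
    case True
    obtain x' where x': "x' \<in> H" "h = y \<star> x' \<star> pinv y"
      using assms(2) torsion_grp[OF ex True] e by auto
    have ne: "x' \<noteq> \<e>" using x' assms(3) M by auto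
    note ce = conj_exit[OF ex True x'(1) ne]
    have "\<not> adm (y, H, x) (y, H, x')" using tgt_cases(1)[OF ex True] by simp
    then have "grp (y, H, x') = grp e" using not_adm_grp[OF ex ce(1)] e by simp
    moreover have "sprod [(y, H, x')] = h" using ce x'(2) lab_S(3)[OF ce(1)] by (simp del: lab.simps)
    ultimately show ?thesis using ce(1) by (intro exI[of _ "[(y, H, x')]"]) (simp del: lab.simps exits.simps)
  next
    case False
    note fe = free_exit[OF ex False]
    obtain k :: int where k: "h = lab e [^]\<^bsub>PGL2Z\<^esub> k"
      using assms(2) PG.generate_pow[OF lab_S(3)[OF assms(1)]] by (auto simp: grp_def)
    have rep: "successively adm (replicate n f)" if "adm f f" for n f
    proof (induction n)
      case (Suc n)
      then show ?case using that by (cases n) auto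
    qed simp
    show ?thesis
    proof (cases k rule: int_cases2)
      case (nonneg n)
      then have h: "h = sprod (replicate n e)" using k sprod_replicate[OF assms(1)] by (simp add: int_pow_int)
      have "n \<noteq> 0" using h assms(3) by auto
      then show ?thesis using h rep[OF fe(1)] assms(1) e by (intro exI[of _ "replicate n e"]) auto
    next
      case (nonpos n)
      let ?r = "rev_exit (y, H, x)"
      note r = rev_exit[OF ex]
      have "h = pinv (lab e) [^]\<^bsub>PGL2Z\<^esub> n"
        using k nonpos lab_S(3)[OF assms(1)] by (simp add: PG.int_pow_neg int_pow_int PG.nat_pow_inv)
      then have h: "h = sprod (replicate n ?r)" using sprod_replicate[OF r(1)] r(2) e by (simp del: rev_exit.simps lab.simps)
      have "n \<noteq> 0" using h assms(3) by auto
      moreover have "grp ?r = grp e" unfolding grp_def using r(2) generate_inv[OF lab_S(3)[OF assms(1)]] e by simp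
      ultimately show ?thesis using h rep[OF fe(2)] r(1)
        by (intro exI[of _ "replicate n ?r"]) (auto simp del: rev_exit.simps)
    qed
  qed
qed

text \<open>Passing to the generated subgroups identifies an exit with its reverse and with its
  mirror image.\<close>

definition FF where "FF = grp ` Collect exits"

lemma FF_word:
  assumes "reduced_word PGL2Z FF w" "w \<noteq> []"
  shows "\<exists>es. es \<noteq> [] \<and> (\<forall>f\<in>set es. exits f) \<and> successively adm es \<and> sprod es = weval PGL2Z w \<and>
    grp (hd es) = fst (hd w)"
  using assms
proof (induction w)
  case Nil
  then show ?case by simp
next
  case (Cons a w)
  obtain H h where a: "a = (H, h)" by force
  have H: "H \<in> FF" "h \<in> H" "h \<noteq> \<e>" "reduced_word PGL2Z FF w" "w = [] \<or> fst (hd w) \<noteq> H"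
    using Cons.prems by (auto simp: a reduced_word_Cons)
  obtain e where e: "exits e" "H = grp e" using H(1) by (auto simp: FF_def)
  obtain es where es: "es \<noteq> []" "\<forall>f\<in>set es. exits f \<and> grp f = H" "successively adm es" "sprod es = h"
    using grp_elems[OF e(1)] H(2,3) e(2) by blast
  show ?case
  proof (cases "w = []")
    case True
    have "h \<in> Mh" using H(2) e grp_S(2)[OF e(1)] S_Mh by blast
    then show ?thesis using es True a by (intro exI[of _ es]) auto
  next
    case False
    obtain fs where fs: "fs \<noteq> []" "\<forall>f\<in>set fs. exits f" "successively adm fs" "sprod fs = weval PGL2Z w"
      "grp (hd fs) = fst (hd w)"
      using Cons.IH[OF H(4) False] by blast
    have "adm (last es) (hd fs)"
    proof (rule ccontr)
      assume "\<not> ?thesis"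
      then have "grp (hd fs) = grp (last es)" by (rule not_adm_grp[rotated 2]) (use es fs in auto)
      then show False using fs(5) H(5) False es(1,2) by auto
    qed
    then have "successively adm (es @ fs)" using es fs by (auto simp: successively_append_iff)
    moreover have "sprod (es @ fs) = weval PGL2Z (a # w)"
      using sprod_append[of es fs] es fs by (auto simp: a)
    ultimately show ?thesis using es fs a by (intro exI[of _ "es @ fs"]) auto
  qed
qed

text \<open>Schreier's argument: along a word for \<open>g\<close>, each letter multiplies
  \<open>sg\<close> by the label of an exit if a translate of \<open>D\<close> is left, and by 1
  otherwise.\<close>

lemma FF_generate: "generate PGL2Z (\<Union>FF) = S"
proof
  have "\<Union>FF \<subseteq> S" using grp_S(2) by (auto simp: FF_def)
  then show "generate PGL2Z (\<Union>FF) \<subseteq> S" by (rule PG.generate_subgroup_incl[OF _ sub])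
  let ?G = "generate PGL2Z (\<Union>FF)"
  have G: "subgroup ?G PGL2Z"
    by (rule PG.generate_is_subgroup) (use \<open>\<Union>FF \<subseteq> S\<close> S_Mh in blast)
  have step: "sg (d \<star> x) \<in> ?G" if d: "d \<in> D" and x: "x \<in> {mA, mB, mU}" for d x
  proof (cases "d \<star> x \<in> D")
    case True
    then have "sg (\<e> \<star> (d \<star> x)) = \<e>" using sg_eq[of \<e>] by simp
    then show ?thesis using True D_Mh subgroup.one_closed[OF G] by simp
  next
    case False
    then have "x \<noteq> mU" using D_props(3)[OF d] by auto
    then obtain H where "H \<in> {HA, HB}" "x \<in> H" using x by (auto simp: HA_def HB_def)
    then have "exits (d, H, x)" using d False by simp
    then have "sg (d \<star> x) \<in> \<Union>FF" using grp_S(3)[of "(d, H, x)"] unfolding FF_def by force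
    then show ?thesis by (rule generate.incl)
  qed
  have "sg g \<in> ?G" if "g \<in> Mh" for g
    using that
  proof (rule Mh_induct)
    have "sg (\<e> \<star> \<e>) = \<e>" using sg_eq[OF S_one D_props(2)] by simp
    then show "sg \<e> \<in> ?G" using subgroup.one_closed[OF G] by simp
    fix h x assume h: "h \<in> Mh" "x \<in> {mA, mB, mU}" "sg h \<in> ?G"
    note sh = sg_rh[OF h(1)]
    have xM: "x \<in> Mh" using h(2) by auto
    have rM: "rh h \<in> Mh" "sg h \<in> Mh" using sh D_Mh S_Mh by auto
    note sr = sg_rh[of "rh h \<star> x"]
    have "h \<star> x = sg h \<star> (rh h \<star> x)" using sh(3) rM xM by (simp flip: PG.m_assoc)
    also have "\<dots> = sg h \<star> (sg (rh h \<star> x) \<star> rh (rh h \<star> x))" using sr rM xM by simp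
    also have "\<dots> = (sg h \<star> sg (rh h \<star> x)) \<star> rh (rh h \<star> x)"
      using sr rM xM S_Mh D_Mh by (simp add: PG.m_assoc)
    finally have "sg (h \<star> x) = sg h \<star> sg (rh h \<star> x)"
      using sg_eq(1)[OF S_mult[OF sh(1) sr(1)] sr(2)] rM xM by simp
    then show "sg (h \<star> x) \<in> ?G" using subgroup.m_closed[OF G h(3) step[OF sh(2) h(2)]] by simp
  qed
  then show "S \<subseteq> ?G"
    using sg_eq(1)[OF _ D_props(2)] S_Mh by (metis PG.r_one subsetI)
qed

abbreviation "SG \<equiv> PGL2Z\<lparr>carrier := S\<rparr>"

theorem S_decomposition:
  "cyclic_decomposition SG {H \<in> FF. card H = 2} {H \<in> FF. card H = 3} {H \<in> FF. infinite H}"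
proof -
  have cases: "card H = 2 \<or> card H = 3 \<or> infinite H" if H: "H \<in> FF" for H
  proof -
    obtain y K x where e: "exits (y, K, x)" "H = grp (y, K, x)" using H unfolding FF_def by (metis imageE mem_Collect_eq prod_cases3)
    then show ?thesis using torsion_grp_card[OF e(1)] free_exit(3)[OF e(1)] by metis
  qed
  have un: "{H \<in> FF. card H = 2} \<union> {H \<in> FF. card H = 3} \<union> {H \<in> FF. infinite H} = FF"
    using cases by auto
  have sub_S: "\<Union>FF \<subseteq> S" using grp_S(2) by (auto simp: FF_def)
  have "is_free_product SG FF"
    unfolding is_free_product_def
  proof (intro conjI ballI allI impI)
    fix H assume "H \<in> FF"
    then show "subgroup H SG" using grp_S PG.subgroup_incl[OF _ sub] by (auto simp: FF_def)
  next
    show "generate SG (\<Union>FF) = carrier SG"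
      using PG.generate_consistent[OF sub_S sub] FF_generate by simp
  next
    fix w assume w: "reduced_word SG FF w \<and> w \<noteq> []"
    then have "reduced_word PGL2Z FF w" by (simp add: reduced_word_def)
    then obtain es where "es \<noteq> []" "\<forall>f\<in>set es. exits f" "successively adm es" "sprod es = weval PGL2Z w"
      using FF_word w by blast
    then have "weval PGL2Z w \<noteq> \<e>" using sprod_nontrivial by metis
    then show "foldr (\<otimes>\<^bsub>SG\<^esub>) (map snd w) \<one>\<^bsub>SG\<^esub> \<noteq> \<one>\<^bsub>SG\<^esub>" by (simp add: weval_def)
  qed
  moreover have "\<exists>x\<in>H. H = generate SG {x}" if H: "H \<in> FF" for H
  proof -
    obtain e where e: "exits e" "H = grp e" using H unfolding FF_def by blast
    have "generate SG {lab e} = generate PGL2Z {lab e}"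
      using PG.generate_consistent[OF _ sub, of "{lab e}"] lab_S(1)[OF e(1)] by simp
    then show ?thesis using e grp_S(3)[OF e(1)] by (auto simp: grp_def)
  qed
  ultimately show ?thesis unfolding cyclic_decomposition_def un by blast
qed

end

section \<open>Infinite generation\<close>

lemma ev_Mh: "lword w \<Longrightarrow> ev w \<in> Mh"
  using ev_PSL2Z PSL2Z_carrier by blast

abbreviation Cpow where "Cpow (n::int) \<equiv> mC [^]\<^bsub>PGL2Z\<^esub> n"

lemma Cpow_add: "Cpow (m + n) = Cpow m \<star> Cpow n"
  by (simp add: PG.int_pow_mult)

lemma Cpow_1: "Cpow 1 = mA \<star> mB" "Cpow (- 1) = B2 \<star> mA" "Cpow 0 = \<e>"
proof -
  show 1: "Cpow 1 = mA \<star> mB" using relations(6) by (simp add: PG.int_pow_1)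
  have "Cpow (- 1) = pinv (mA \<star> mB)" using 1 by (metis PG.int_pow_neg gens_closed(4))
  then show "Cpow (- 1) = B2 \<star> mA" by (simp add: PG.inv_mult_group inv_gens)
qed simp

lemma letters_in: "mA \<in> HA" "mB \<in> HB" "B2 \<in> HB" "HB \<noteq> HA"
  using HA_HB_ne by (auto simp: HA_def HB_def)

text \<open>The reduced word is (AB)^k followed by \<open>a\<close>. The optional last letter
  accounts for V = AU, so that all of \<open>That\<close> is covered up to a final
  \<open>U\<close>.\<close>

lemma Cpow_nonneg_word:
  assumes a: "a = \<e> \<or> a = mA"
  shows "\<exists>w. rword w \<and> (w = [] \<or> fst (hd w) = HA) \<and> ev w = Cpow (int k) \<star> a"
proof (induction k)
  case 0
  have "rword [] \<and> ev [] = \<e>" "rword [(HA, mA)] \<and> ev [(HA, mA)] = mA"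
    using letters_in HA_HB_ne by (simp_all add: reduced_word_Cons)
  then have "\<exists>w\<in>{[], [(HA, mA)]}. rword w \<and> ev w = Cpow (int 0) \<star> a"
    using a by (elim disjE) simp_all
  moreover have "w = [] \<or> fst (hd w) = HA" if "w \<in> {[], [(HA, mA)]}" for w :: "((int ^ 2 ^ 2) set set \<times> (int ^ 2 ^ 2) set) list"
    using that by auto
  ultimately show ?case by blast
next
  case (Suc k)
  then obtain w where w: "rword w" "w = [] \<or> fst (hd w) = HA" "ev w = Cpow (int k) \<star> a" by blast
  have aM: "a \<in> Mh" using a by auto
  have "Cpow (int (Suc k)) \<star> a = mA \<star> (mB \<star> ev w)"
    using Cpow_add[of 1 "int k"] aM by (simp add: w(3) Cpow_1 PG.m_assoc)
  moreover have "rword ((HA, mA) # (HB, mB) # w)"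
    using w letters_in HA_HB_ne by (auto simp: reduced_word_Cons)
  ultimately show ?case by (intro exI[of _ "(HA, mA) # (HB, mB) # w"]) simp
qed

lemma Cpow_neg_word:
  assumes a: "a = \<e> \<or> a = mA"
  shows "\<exists>w. rword w \<and> w \<noteq> [] \<and> fst (hd w) = HB \<and> ev w = Cpow (- int (Suc k)) \<star> a"
proof (induction k)
  case 0
  have "rword [(HB, B2), (HA, mA)]" "rword [(HB, B2)]"
    using letters_in HA_HB_ne by (auto simp: reduced_word_Cons)
  moreover have "Cpow (- 1) \<star> \<e> = B2 \<star> mA" "Cpow (- 1) \<star> mA = B2" by (simp_all add: Cpow_1 letter_cancel)
  ultimately show ?case using a
    by (elim disjE) (force intro: exI[of _ "[(HB, B2), (HA, mA)]"] exI[of _ "[(HB, B2)]"])+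
next
  case (Suc k)
  then obtain w where w: "rword w" "w \<noteq> []" "fst (hd w) = HB" "ev w = Cpow (- int (Suc k)) \<star> a" by blast
  have aM: "a \<in> Mh" using a by auto
  have "Cpow (- int (Suc (Suc k))) = Cpow (- 1) \<star> Cpow (- int (Suc k))"
  proof -
    have e: "- int (Suc (Suc k)) = - 1 + - int (Suc k)" by simp
    show ?thesis unfolding e by (rule Cpow_add)
  qed
  then have "Cpow (- int (Suc (Suc k))) \<star> a = B2 \<star> (mA \<star> ev w)"
    using aM by (simp add: w(4) Cpow_1 PG.m_assoc)
  moreover have "rword ((HB, B2) # (HA, mA) # w)"
    using w letters_in HA_HB_ne by (auto simp: reduced_word_Cons)
  ultimately show ?case by (intro exI[of _ "(HB, B2) # (HA, mA) # w"]) simp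
qed

text \<open>The only possible cancellation is AA = 1 next to the first B, and it leaves B or merges
  two letters B into B^2. The initial letter stays in \<open>HB\<close>, so it absorbs nothing from
  a word ending in A to its left.\<close>

lemma BA_Cpow_word:
  assumes a: "a = \<e> \<or> a = mA"
  shows "\<exists>w. rword w \<and> w \<noteq> [] \<and> fst (hd w) = HB \<and> ev w = mB \<star> mA \<star> (Cpow m \<star> a)"
proof (cases m rule: int_cases2)
  case (nonneg k)
  have aM: "a \<in> Mh" using a by auto
  show ?thesis
  proof (cases k)
    case 0
    have "rword [(HB, mB), (HA, mA)]" "rword [(HB, mB)]"
      using letters_in HA_HB_ne by (auto simp: reduced_word_Cons)
    then show ?thesis using a nonneg 0
      by (elim disjE) (force simp: letter_cancel intro: exI[of _ "[(HB, mB), (HA, mA)]"] exI[of _ "[(HB, mB)]"])+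
  next
    case (Suc j)
    obtain w where w: "rword w" "w = [] \<or> fst (hd w) = HA" "ev w = Cpow (int j) \<star> a"
      using Cpow_nonneg_word[OF a] by blast
    have "Cpow m \<star> a = mA \<star> mB \<star> ev w"
      using Cpow_add[of 1 "int j"] aM nonneg Suc by (simp add: w(3) Cpow_1 PG.m_assoc)
    then have "mB \<star> mA \<star> (Cpow m \<star> a) = mB \<star> mA \<star> mA \<star> mB \<star> ev w"
      using ev_Mh[OF reduced_word_fword[OF w(1)]] by (simp add: PG.m_assoc)
    then have "mB \<star> mA \<star> (Cpow m \<star> a) = B2 \<star> ev w" by (simp add: letter_cancel)
    moreover have "rword ((HB, B2) # w)"
      using w letters_in HA_HB_ne by (auto simp: reduced_word_Cons)
    ultimately show ?thesis by (intro exI[of _ "(HB, B2) # w"]) simp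
  qed
next
  case (nonpos k)
  show ?thesis
  proof (cases k)
    case 0
    have "rword [(HB, mB), (HA, mA)]" "rword [(HB, mB)]"
      using letters_in HA_HB_ne by (auto simp: reduced_word_Cons)
    then show ?thesis using a nonpos 0
      by (elim disjE) (force simp: letter_cancel intro: exI[of _ "[(HB, mB), (HA, mA)]"] exI[of _ "[(HB, mB)]"])+
  next
    case (Suc j)
    obtain w where w: "rword w" "w \<noteq> []" "fst (hd w) = HB" "ev w = Cpow m \<star> a"
      using Cpow_neg_word[OF a, of j] nonpos Suc by auto
    have "rword ((HB, mB) # (HA, mA) # w)"
      using w letters_in HA_HB_ne by (auto simp: reduced_word_Cons)
    moreover have "ev ((HB, mB) # (HA, mA) # w) = mB \<star> mA \<star> (Cpow m \<star> a)"
      using ev_Mh[OF reduced_word_fword[OF w(1)]] by (simp add: w(4)[symmetric] PG.m_assoc)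
    ultimately show ?thesis by (intro exI[of _ "(HB, mB) # (HA, mA) # w"]) simp
  qed
qed

definition cw where "cw n = concat (replicate n [(HA, mA), (HB, mB)])"

lemma cw_props: "rword (cw n)" "ev (cw n) = Cpow (int n)" "cw n = [] \<or> fst (hd (cw n)) = HA"
  "cw n = [] \<or> fst (last (cw n)) = HB"
proof -
  have "rword (cw n) \<and> ev (cw n) = Cpow (int n) \<and> (cw n = [] \<or> fst (hd (cw n)) = HA) \<and>
     (cw n = [] \<or> fst (last (cw n)) = HB)"
  proof (induction n)
    case 0
    then show ?case by (simp add: cw_def)
  next
    case (Suc n)
    have cS: "cw (Suc n) = (HA, mA) # (HB, mB) # cw n" by (simp add: cw_def)
    have "Cpow (int (Suc n)) = mA \<star> (mB \<star> ev (cw n))"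
      using Cpow_add[of 1 "int n"] Suc by (simp add: Cpow_1 PG.m_assoc)
    then show ?case
      using Suc letters_in HA_HB_ne by (auto simp: cS reduced_word_Cons)
  qed
  then show "rword (cw n)" "ev (cw n) = Cpow (int n)" "cw n = [] \<or> fst (hd (cw n)) = HA"
    "cw n = [] \<or> fst (last (cw n)) = HB" by blast+
qed

lemma That_cases:
  assumes "t \<in> That"
  obtains n a where "t = Cpow n \<star> a \<or> t = Cpow n \<star> a \<star> mU" "a = \<e> \<or> a = mA"
proof -
  obtain e n where t: "t = pm (mk e n 0 1)" "e = 1 \<or> e = - 1" using assms by (auto simp: That_mk)
  have "pm (mk 1 n 0 1) = Cpow n \<star> \<e>" by (simp add: mC_pow unimod_mk)
  moreover have "pm (mk (- 1) n 0 1) = Cpow n \<star> mA \<star> mU"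
    by (simp add: mC_pow gens_mk(1) mU_mk pm_mk_mult unimod_mk pm_eq_iff)
  ultimately show ?thesis using that[of n \<e>] that[of n mA] t by auto
qed

lemma Cpow_That: "Cpow n \<in> That"
  by (auto simp: mC_pow That_mk)

lemma Cpow_eq_one: "Cpow n = \<e> \<longleftrightarrow> n = 0"
  by (simp add: mC_pow pm_one pm_eq_iff)

text \<open>Applied to each generator of a finitely generated \<open>S\<close>; the left translates
  by \<open>S\<close> of these finite pieces then connect the identity to every element of
  \<open>S\<close>.\<close>

lemma finite_connector:
  assumes "g \<in> Mh"
  shows "\<exists>P. finite P \<and> P \<subseteq> Mh \<and> \<e> \<in> P \<and> g \<in> P \<and> (\<forall>p\<in>P. p \<star> mU \<in> P) \<and> (\<e>, g) \<in> (stepR P)\<^sup>*"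
  using assms
proof (rule Mh_induct)
  show "\<exists>P. finite P \<and> P \<subseteq> Mh \<and> \<e> \<in> P \<and> \<e> \<in> P \<and> (\<forall>p\<in>P. p \<star> mU \<in> P) \<and> (\<e>, \<e>) \<in> (stepR P)\<^sup>*"
    by (intro exI[of _ "{\<e>, mU}"]) (simp add: letter_relations)
  fix h x assume h: "h \<in> Mh" and x: "x \<in> {mA, mB, mU}"
    and "\<exists>P. finite P \<and> P \<subseteq> Mh \<and> \<e> \<in> P \<and> h \<in> P \<and> (\<forall>p\<in>P. p \<star> mU \<in> P) \<and> (\<e>, h) \<in> (stepR P)\<^sup>*"
  then obtain P where P: "finite P" "P \<subseteq> Mh" "\<e> \<in> P" "h \<in> P" "\<forall>p\<in>P. p \<star> mU \<in> P" "(\<e>, h) \<in> (stepR P)\<^sup>*"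
    by blast
  have xM: "x \<in> Mh" using x by auto
  let ?P = "P \<union> {h \<star> x, h \<star> x \<star> mU}"
  have sub: "(stepR P)\<^sup>* \<subseteq> (stepR ?P)\<^sup>*" by (rule rtrancl_mono) (auto simp: stepR_def)
  have "(h, h \<star> x) \<in> stepR ?P" using P(4) x by (auto simp: stepR_def)
  then have "(\<e>, h \<star> x) \<in> (stepR ?P)\<^sup>*" using P(6) sub by (meson rtrancl.rtrancl_into_rtrancl subsetD)
  moreover have "finite ?P \<and> ?P \<subseteq> Mh \<and> \<e> \<in> ?P \<and> h \<star> x \<in> ?P" using P h xM by simp
  moreover have "\<forall>p\<in>?P. p \<star> mU \<in> ?P" using P(5) h xM by (simp add: letter_cancel)
  ultimately show "\<exists>P. finite P \<and> P \<subseteq> Mh \<and> \<e> \<in> P \<and> h \<star> x \<in> P \<and> (\<forall>p\<in>P. p \<star> mU \<in> P) \<and> (\<e>, h \<star> x) \<in> (stepR P)\<^sup>*"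
    by (intro exI[of _ ?P] conjI) simp_all
qed

context neumann
begin

text \<open>For a finitely generated \<open>S\<close> the cosets met by the reduced words of all elements of \<open>S\<close>
  form a finite set; but \<open>C\<^sup>n\<close> is a prefix of the reduced word of an element of \<open>S\<close> for every
  \<open>n\<close>, and the cosets \<open>SC\<^sup>n\<close> are distinct.\<close>

theorem not_finitely_generated:
  assumes X: "finite X" "X \<subseteq> S" "generate PGL2Z X = S"
  shows False
proof -
  have "\<forall>x\<in>X. \<exists>P. finite P \<and> P \<subseteq> Mh \<and> \<e> \<in> P \<and> x \<in> P \<and> (\<forall>p\<in>P. p \<star> mU \<in> P) \<and> (\<e>, x) \<in> (stepR P)\<^sup>*"
    using finite_connector X(2) S_Mh by blast
  then obtain P where P: "\<forall>x\<in>X. finite (P x) \<and> P x \<subseteq> Mh \<and> \<e> \<in> P x \<and> x \<in> P x \<and>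
      (\<forall>p\<in>P x. p \<star> mU \<in> P x) \<and> (\<e>, x) \<in> (stepR (P x))\<^sup>*" by metis
  define Q where "Q = (\<Union>x\<in>X. P x) \<union> {\<e>, mU}"
  have Q: "finite Q" "Q \<subseteq> Mh" "\<e> \<in> Q" "\<And>q. q \<in> Q \<Longrightarrow> q \<star> mU \<in> Q"
    using P X(1) by (auto simp: Q_def letter_relations)
  \<comment> \<open>The left translates by \<open>S\<close> of a finite set: only finitely many
    cosets, yet every element of \<open>S\<close> is reached by a path inside.\<close>
  define D where "D = {s \<star> q | s q. s \<in> S \<and> q \<in> Q}"
  have DM: "D \<subseteq> Mh" using Q(2) S_Mh by (auto simp: D_def)
  have QD: "Q \<subseteq> D"
  proof
    fix q assume q: "q \<in> Q"
    then have "q = \<e> \<star> q" using Q(2) by auto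
    then show "q \<in> D" using q S_one unfolding D_def by blast
  qed
  have DU: "d \<star> mU \<in> D" if "d \<in> D" for d
  proof -
    from that obtain s q where s: "s \<in> S" "q \<in> Q" "d = s \<star> q" unfolding D_def by blast
    then have "d \<star> mU = s \<star> (q \<star> mU)" using S_Mh Q(2) by (auto simp: PG.m_assoc)
    then show ?thesis using s Q(4) unfolding D_def by blast
  qed
  have DS: "s \<star> d \<in> D" if sd: "s \<in> S" "d \<in> D" for s d
  proof -
    from sd obtain s' q where s: "s' \<in> S" "q \<in> Q" "d = s' \<star> q" unfolding D_def by blast
    then have "s \<star> d = (s \<star> s') \<star> q" using S_Mh Q(2) sd(1) by (auto simp: PG.m_assoc)
    then show ?thesis using s S_mult[OF sd(1) s(1)] unfolding D_def by blast
  qed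
  have translate: "(s \<star> g, s \<star> h) \<in> (stepR D)\<^sup>*" if "(g, h) \<in> (stepR D)\<^sup>*" "s \<in> S" for s g h
    using that(1)
  proof (induction rule: rtrancl_induct)
    case (step h h')
    then obtain x where x: "x \<in> {mA, mB, B2, mU}" "h' = h \<star> x" "h \<in> D" "h' \<in> D"
      by (auto simp: stepR_def)
    then have "s \<star> h' = s \<star> h \<star> x" using DM S_Mh[OF that(2)] by (auto simp: PG.m_assoc)
    then have "(s \<star> h, s \<star> h') \<in> stepR D" using x DS[OF that(2)] unfolding stepR_def by blast
    then show ?case using step.IH by simp
  qed simp
  have conn: "(\<e>, s) \<in> (stepR D)\<^sup>*" if "s \<in> generate PGL2Z X" for s
    using that
  proof (induction rule: generate.induct)
    case one
    then show ?case by simp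
  next
    case (incl x)
    have "P x \<subseteq> D" using QD incl by (auto simp: Q_def)
    then have "(stepR (P x))\<^sup>* \<subseteq> (stepR D)\<^sup>*" by (intro rtrancl_mono) (auto simp: stepR_def)
    then show ?case using P incl by blast
  next
    case (inv x)
    then have xS: "x \<in> S" using X(2) by blast
    have "P x \<subseteq> D" using QD inv by (auto simp: Q_def)
    then have "(stepR (P x))\<^sup>* \<subseteq> (stepR D)\<^sup>*" by (intro rtrancl_mono) (auto simp: stepR_def)
    then have "(\<e>, x) \<in> (stepR D)\<^sup>*" using P inv by blast
    from translate[OF this S_inv[OF xS]] have "(pinv x, \<e>) \<in> (stepR D)\<^sup>*" using S_Mh[OF xS] by simp
    then show ?case using stepR_rtrancl_sym[OF DM] by blast
  next
    case (eng h1 h2)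
    have "h1 \<in> S" using eng(1) X(3) by simp
    then have "(h1, h1 \<star> h2) \<in> (stepR D)\<^sup>*" using translate[OF eng.IH(2)] S_Mh by fastforce
    then show ?case using eng.IH(1) by simp
  qed
  have C: "Cpow (int n) \<in> D" for n
  proof -
    \<comment> \<open>This yields s = C^(n+1) A t^-1 in \<open>S\<close>. By
      \<open>BA_Cpow_word\<close> the factor t^-1 cannot cancel past the last B of C^(n+1), so the
      normal form of s begins with that of C^n.\<close>
    obtain s t where st: "s \<in> S" "t \<in> That" "Cpow (int (Suc n)) \<star> mA = s \<star> t"
      using S_That_factor[of "Cpow (int (Suc n)) \<star> mA"] by auto
    have M: "s \<in> Mh" "t \<in> Mh" using st S_Mh That_Mh by auto
    have s: "s = Cpow (int (Suc n)) \<star> mA \<star> pinv t"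
      using M st(3) by (simp add: PG.inv_solve_right)
    obtain m a where a: "pinv t = Cpow m \<star> a \<or> pinv t = Cpow m \<star> a \<star> mU" "a = \<e> \<or> a = mA"
      using That_cases[OF subgroup.m_inv_closed[OF subgroup_That st(2)]] by blast
    have aM: "a \<in> Mh" using a(2) by auto
    obtain w where w: "rword w" "w \<noteq> []" "fst (hd w) = HB" "ev w = mB \<star> mA \<star> (Cpow m \<star> a)"
      using BA_Cpow_word[OF a(2)] by blast
    have lw: "lword w" using reduced_word_fword[OF w(1)] .
    define r where "r = cw n @ (HA, mA) # w"
    have "rword ((HA, mA) # w)" using w letters_in HA_HB_ne by (auto simp: reduced_word_Cons)
    then have r: "rword r" using cw_props[of n] letters_in by (auto simp: r_def rword_append)
    have lc: "lword (cw n)" using reduced_word_fword[OF cw_props(1)] .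
    have "ev r = Cpow (int n) \<star> (mA \<star> ev w)"
      using LF.weval_append[OF lc, of "(HA, mA) # w"] lw cw_props(2) letters_in by (simp add: r_def)
    also have "\<dots> = Cpow (int n) \<star> (mA \<star> mB) \<star> mA \<star> (Cpow m \<star> a)"
      using aM by (simp add: w(4) PG.m_assoc)
    also have "Cpow (int n) \<star> (mA \<star> mB) = Cpow (int (Suc n))"
      using Cpow_add[of "int n" 1] by (simp add: Cpow_1 algebra_simps)
    finally have er: "ev r = Cpow (int (Suc n)) \<star> mA \<star> (Cpow m \<star> a)" .
    then have s_r: "s = ev r \<or> s = ev r \<star> mU"
      using a(1) aM s by (elim disjE) (simp_all add: PG.m_assoc)
    have "(\<e>, s) \<in> (stepR D)\<^sup>*" using conn st(1) X(3) by simp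
    then obtain u where u: "rword u" "dpath D \<e> u" "s = \<e> \<star> ev u \<or> s = \<e> \<star> ev u \<star> mU"
      using connected_path[OF _ _ DM DU] QD Q(3) by blast
    have lu: "lword u" using reduced_word_fword[OF u(1)] .
    have su: "s = ev u \<or> s = ev u \<star> mU" using u(3) ev_Mh[OF lu] by simp
    have lr: "lword r" using reduced_word_fword[OF r] .
    have nU: "ev v \<star> mU \<notin> PSL2Z" if "lword v" for v
      using PSL2Z_mult[of "ev v" mU] ev_PSL2Z[OF that] ev_Mh[OF that] gens_PSL2Z by simp
    have "ev u = ev r"
    proof (cases "s \<in> PSL2Z")
      case True
      then have "s \<noteq> ev u \<star> mU" "s \<noteq> ev r \<star> mU" using nU lu lr by auto
      then show ?thesis using su s_r by simp
    next
      case False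
      then have "s \<noteq> ev u" "s \<noteq> ev r" using ev_PSL2Z lu lr by auto
      then have "ev u \<star> mU = ev r \<star> mU" using su s_r by simp
      then have "ev u \<star> mU \<star> mU = ev r \<star> mU \<star> mU" by simp
      then show ?thesis using ev_Mh[OF lu] ev_Mh[OF lr] by (simp add: letter_cancel)
    qed
    then have "u = r" using rword_unique[OF u(1) r] by simp
    then have "dpath D (\<e> \<star> ev (cw n)) ((HA, mA) # w)"
      using u(2) dpath_append[OF lc, of \<e> D] by (simp only: r_def PG.one_closed simp_thms)
    then show ?thesis using cw_props(2)[of n] by simp
  qed
  have "\<exists>q\<in>Q. \<exists>s\<in>S. Cpow (int n) = s \<star> q" for n using C[of n] by (auto simp: D_def)
  then obtain f where f: "\<And>n. f n \<in> Q" "\<And>n. \<exists>s\<in>S. Cpow (int n) = s \<star> f n" by metis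
  \<comment> \<open>Pigeonhole: two of the cosets of the powers of C share a representative in
    \<open>Q\<close> and hence coincide.\<close>
  have "\<not> inj f"
  proof
    assume "inj f"
    then have "infinite (range f)" using range_inj_infinite by blast
    moreover have "range f \<subseteq> Q" using f(1) by blast
    ultimately show False using Q(1) finite_subset by blast
  qed
  then obtain i j where ij: "i \<noteq> j" "f i = f j" by (auto simp: inj_def)
  obtain s s' where s: "s \<in> S" "Cpow (int i) = s \<star> f i" "s' \<in> S" "Cpow (int j) = s' \<star> f j" using f(2) by metis
  have M: "s \<in> Mh" "s' \<in> Mh" "f i \<in> Mh" using s S_Mh f(1) Q(2) by auto
  have "Cpow (int i - int j) = Cpow (int i) \<star> pinv (Cpow (int j))" by (simp add: PG.int_pow_diff)
  also have "\<dots> = s \<star> f i \<star> pinv (s' \<star> f i)" using s ij(2) by simp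
  also have "\<dots> = s \<star> (f i \<star> pinv (f i)) \<star> pinv s'"
    using M by (simp only: PG.m_assoc PG.inv_mult_group PG.inv_closed PG.m_closed)
  also have "\<dots> = s \<star> pinv s'" using M by simp
  finally have "Cpow (int i - int j) \<in> S" using S_mult[OF s(1) S_inv[OF s(3)]] by simp
  then have "Cpow (int i - int j) = \<e>" using S_That Cpow_That by blast
  then show False using ij(1) by (simp add: Cpow_eq_one)
qed

end

context neumann
begin

theorem decomposition_infinite:
  assumes "cyclic_decomposition (PGL2Z\<lparr>carrier := S\<rparr>) F\<^sub>2 F\<^sub>3 F\<^sub>i"
  shows "ecard F\<^sub>2 + ecard F\<^sub>3 + ecard F\<^sub>i = \<infinity>"
proof (rule ccontr)
  assume "\<not> ?thesis"
  then have fin: "finite (F\<^sub>2 \<union> F\<^sub>3 \<union> F\<^sub>i)" by (auto simp: ecard_def split: if_splits)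
  have "group (PGL2Z\<lparr>carrier := S\<rparr>)" using PG.subgroup_imp_group[OF sub] .
  then interpret C: cyclic_free_product "PGL2Z\<lparr>carrier := S\<rparr>" F\<^sub>2 F\<^sub>3 F\<^sub>i
    using assms by (simp add: cyclic_free_product_def cyclic_free_product_axioms_def)
  have X: "C.gen ` (F\<^sub>2 \<union> F\<^sub>3 \<union> F\<^sub>i) \<subseteq> S" using C.gen_carrier by auto
  have "generate PGL2Z (C.gen ` (F\<^sub>2 \<union> F\<^sub>3 \<union> F\<^sub>i)) = S"
    using C.gens_generate PG.generate_consistent[OF X sub] by simp
  then show False using not_finitely_generated[OF _ X] fin by blast
qed

end

section \<open>Cycle ranks of coset graphs\<close>

text \<open>The product of the \<open>x j\<close> serves; its order is immaterial for additive
  values.\<close>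

lemma (in group) hom_mod_products:
  assumes "finite J" "\<And>j. j \<in> J \<Longrightarrow> x j \<in> carrier G"
  shows "\<exists>s\<in>carrier G. \<forall>f\<in>hom_mod q G. [f s = (\<Sum>j\<in>J. f (x j))] (mod q)"
  using assms
proof (induction J)
  case empty
  then show ?case using hom_mod_one by (intro bexI[of _ \<one>]) auto
next
  case (insert j J)
  then obtain s where s: "s \<in> carrier G" "\<forall>f\<in>hom_mod q G. [f s = (\<Sum>j\<in>J. f (x j))] (mod q)" by auto
  have xj: "x j \<in> carrier G" using insert by simp
  show ?case
  proof (intro bexI[of _ "x j \<otimes> s"] ballI)
    fix f assume f: "f \<in> hom_mod q G"
    have "[f (x j \<otimes> s) = f (x j) + f s] (mod q)" by (rule hom_modD[OF f xj s(1)])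
    also have "[f (x j) + f s = f (x j) + (\<Sum>j\<in>J. f (x j))] (mod q)"
      by (intro cong_add cong_refl) (use s f in blast)
    finally show "[f (x j \<otimes> s) = (\<Sum>j\<in>insert j J. f (x j))] (mod q)" using insert by simp
  qed (use xj s in simp)
qed

lemma sum_sym_diff_mod2:
  fixes w :: "'e \<Rightarrow> int"
  assumes "finite A" "finite B" "\<And>e. e \<in> C \<longleftrightarrow> (e \<in> A) \<noteq> (e \<in> B)"
  shows "[sum w C = sum w A + sum w B] (mod 2)"
proof -
  have C: "C = (A - B) \<union> (B - A)" using assms(3) by auto
  have "sum w A = sum w (A - B) + sum w (A \<inter> B)" "sum w B = sum w (B - A) + sum w (A \<inter> B)"
    using sum.Int_Diff[OF assms(1), of w B] sum.Int_Diff[OF assms(2), of w A] by (simp_all add: Int_commute)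
  moreover have "sum w C = sum w (A - B) + sum w (B - A)"
    unfolding C using assms(1,2) by (intro sum.union_disjoint) auto
  ultimately have "sum w A + sum w B - sum w C = 2 * sum w (A \<inter> B)" by simp
  then have "2 dvd sum w A + sum w B - sum w C" by simp
  then show ?thesis by (simp add: cong_iff_dvd_diff dvd_diff_commute)
qed

lemma sum_list_count:
  fixes f :: "'e \<Rightarrow> int"
  assumes "finite E" "set xs \<subseteq> E"
  shows "(\<Sum>x\<leftarrow>xs. f x) = (\<Sum>e\<in>E. int (count_list xs e) * f e)"
  using assms(2)
proof (induction xs)
  case (Cons x xs)
  have "(\<Sum>e\<in>E. int (count_list (x # xs) e) * f e) =
      (\<Sum>e\<in>E. int (count_list xs e) * f e + (if e = x then f e else 0))"
    by (intro sum.cong) (auto simp: algebra_simps)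
  also have "\<dots> = (\<Sum>e\<in>E. int (count_list xs e) * f e) + f x"
    using assms(1) Cons.prems by (simp add: sum.distrib)
  finally show ?case using Cons by simp
qed simp

text \<open>The common frame of both graphs. States are cosets, vertices are orbits of
  \<open>Dd\<close>, edges are orbits under \<open>A\<close> and \<open>K\<close>;
  \<open>keep\<close> drops edges fixed by \<open>A\<close> and edges at leaves. By
  \<open>keep_A\<close> no remaining edge is inverted, so each can be oriented, and
  \<open>integral_cocycle\<close> then counts signed traversals.\<close>

locale edge_path_graph = state_action G X st for G (structure) and X :: "'x set" and st +
  fixes p :: 'x and A :: 'a and Dd K :: "'a set"
    and ed :: "'x \<Rightarrow> 'e" and vt :: "'x \<Rightarrow> 'v" and keep :: "'x \<Rightarrow> bool" and lf :: "'v \<Rightarrow> bool"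
    and Q :: "('v, 'e) mgraph"
  assumes p: "p \<in> X" and transitive: "v \<in> X \<Longrightarrow> \<exists>g\<in>carrier G. st p g = v"
    and A: "A \<in> carrier G" "A \<otimes> A = \<one>"
    and Dd: "subgroup Dd G" "d \<in> Dd \<Longrightarrow> d \<otimes> d = \<one> \<or> d \<otimes> d \<otimes> d = \<one>"
    and K: "subgroup K G" "K \<subseteq> Dd" "k \<in> K \<Longrightarrow> k \<otimes> A = A \<otimes> k"
    and gens: "generate G (insert A Dd) = carrier G"
    and vt: "v \<in> X \<Longrightarrow> w \<in> X \<Longrightarrow> vt v = vt w \<longleftrightarrow> (\<exists>d\<in>Dd. w = st v d)"
    and ed: "v \<in> X \<Longrightarrow> w \<in> X \<Longrightarrow> ed v = ed w \<longleftrightarrow> (\<exists>k\<in>K. w = st v k \<or> w = st (st v A) k)"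
    and edges: "edges Q = ed ` {v \<in> X. keep v}"
    and verts: "verts Q = {vt v | v. v \<in> X \<and> \<not> lf (vt v)}"
    and ends: "v \<in> X \<Longrightarrow> keep v \<Longrightarrow> ends Q (ed v) = {vt v, vt (st v A)} \<and> \<not> lf (vt v) \<and> \<not> lf (vt (st v A))"
    and keep_ed: "v \<in> X \<Longrightarrow> w \<in> X \<Longrightarrow> ed v = ed w \<Longrightarrow> keep v \<Longrightarrow> keep w"
    and not_keep: "v \<in> X \<Longrightarrow> \<not> keep v \<Longrightarrow> st v A = v \<or> lf (vt v) \<or> lf (vt (st v A))"
    and leaf: "v \<in> X \<Longrightarrow> w \<in> X \<Longrightarrow> lf (vt v) \<Longrightarrow> vt w = vt v \<Longrightarrow> ed w = ed v"
    and leaf_A: "v \<in> X \<Longrightarrow> lf (vt v) \<Longrightarrow> vt (st v A) \<noteq> vt v"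
    and keep_A: "v \<in> X \<Longrightarrow> keep v \<Longrightarrow> k \<in> K \<Longrightarrow> st v A \<noteq> st v k"
    and integral_cocycle: "\<And>\<kappa> :: 'x \<Rightarrow> int. (\<And>v. v \<in> X \<Longrightarrow> \<kappa> (st v A) = - \<kappa> v) \<Longrightarrow>
      (\<And>v k. v \<in> X \<Longrightarrow> k \<in> K \<Longrightarrow> \<kappa> (st v k) = \<kappa> v) \<Longrightarrow>
      \<exists>N. cocycle G X st 0 N \<and> (\<forall>v\<in>X. N v A = \<kappa> v \<and> (\<forall>d\<in>Dd. N v d = 0))"
begin

definition S where "S = {g \<in> carrier G. st p g = p}"

abbreviation "SG \<equiv> G\<lparr>carrier := S\<rparr>"

lemma Dd_carrier: "d \<in> Dd \<Longrightarrow> d \<in> carrier G"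
  using subgroup.mem_carrier[OF Dd(1)] .

lemma K_carrier: "k \<in> K \<Longrightarrow> k \<in> carrier G"
  using subgroup.mem_carrier[OF K(1)] .

lemma st_inv: "v \<in> X \<Longrightarrow> g \<in> carrier G \<Longrightarrow> st v g = w \<Longrightarrow> st w (inv g) = v"
  using st_mult[of v g "inv g"] by simp

lemma st_AA: "v \<in> X \<Longrightarrow> st (st v A) A = v"
  using st_mult[of v A A] A by simp

lemma st_kA: "v \<in> X \<Longrightarrow> k \<in> K \<Longrightarrow> st (st v k) A = st (st v A) k"
  using st_mult[of v k A] st_mult[of v A k] K(3)[of k] K_carrier A(1) by simp

lemma subgroup_S: "subgroup S G"
proof (rule subgroupI)
  show "S \<subseteq> carrier G" "S \<noteq> {}" using p by (auto simp: S_def)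
  fix a assume a: "a \<in> S"
  then show "inv a \<in> S" using st_inv[OF p, of a p] by (simp add: S_def)
  fix b assume "b \<in> S"
  then show "a \<otimes> b \<in> S" using a p st_mult[of p a b] by (simp add: S_def)
qed

sublocale SG: group SG
  using subgroup_imp_group[OF subgroup_S] .

lemma ed_A: "v \<in> X \<Longrightarrow> ed (st v A) = ed v"
  using ed[of v "st v A"] A(1) subgroup.one_closed[OF K(1)] by force

lemma vt_D: "v \<in> X \<Longrightarrow> d \<in> Dd \<Longrightarrow> vt (st v d) = vt v"
  using vt[of v "st v d"] Dd_carrier by auto

lemma ed_invariant:
  assumes h: "\<And>v. v \<in> X \<Longrightarrow> [h (st v A) = h v] (mod q)"
    "\<And>v k. v \<in> X \<Longrightarrow> k \<in> K \<Longrightarrow> [h (st v k) = h v] (mod q)"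
    and v: "v \<in> X" "w \<in> X" "ed v = ed w"
  shows "[h v = (h w :: int)] (mod q)"
proof -
  obtain k where k: "k \<in> K" "w = st v k \<or> w = st (st v A) k" using ed[OF v(1,2)] v(3) by blast
  from k(2) show ?thesis
  proof
    assume w: "w = st v k"
    show ?thesis unfolding w by (rule cong_sym[OF h(2)[OF v(1) k(1)]])
  next
    assume w: "w = st (st v A) k"
    have vA: "st v A \<in> X" using v(1) A(1) by simp
    show ?thesis unfolding w
      by (rule cong_sym[OF cong_trans[OF h(2)[OF vA k(1)] h(1)[OF v(1)]]])
  qed
qed

text \<open>\<open>L\<close> records the states in which the letter \<open>A\<close> is read while a
  word for \<open>m\<close> is spelled from \<open>v\<close>. A path is thus represented only by its
  effect on the cocycles that vanish on \<open>Dd\<close>.\<close>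

lemma path_list:
  assumes "m \<in> carrier G"
  shows "v \<in> X \<Longrightarrow> \<exists>L. set L \<subseteq> X \<and> (\<forall>\<psi>. cocycle G X st 2 \<psi> \<longrightarrow> (\<forall>v\<in>X. \<forall>d\<in>Dd. [\<psi> v d = 0] (mod 2)) \<longrightarrow>
      [\<psi> v m = (\<Sum>x\<leftarrow>L. \<psi> x A)] (mod 2))"
proof -
  have "m \<in> generate G (insert A Dd)" using assms gens by simp
  then show "v \<in> X \<Longrightarrow> ?thesis"
  proof (induction m arbitrary: v rule: generate.induct)
    case one
    then show ?case using cocycle_one by (intro exI[of _ "[]"]) auto
  next
    case (incl h)
    then show ?case
    proof (cases "h = A")
      case True
      then show ?thesis using incl by (intro exI[of _ "[v]"]) auto
    next
      case False
      then show ?thesis using incl by (intro exI[of _ "[]"]) auto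
    qed
  next
    case (inv h)
    then show ?case
    proof (cases "h = A")
      case True
      have "inv A = A" using A by (intro inv_equality) auto
      then show ?thesis using True inv by (intro exI[of _ "[v]"]) auto
    next
      case False
      then have "inv h \<in> Dd" using inv subgroup.m_inv_closed[OF Dd(1)] by blast
      then show ?thesis using inv by (intro exI[of _ "[]"]) auto
    qed
  next
    case (eng h1 h2)
    have h: "h1 \<in> carrier G" "h2 \<in> carrier G" using eng(1,2) gens by auto
    obtain L1 where L1: "set L1 \<subseteq> X" "\<And>\<psi>. cocycle G X st 2 \<psi> \<Longrightarrow> (\<forall>v\<in>X. \<forall>d\<in>Dd. [\<psi> v d = 0] (mod 2)) \<Longrightarrow>
      [\<psi> v h1 = (\<Sum>x\<leftarrow>L1. \<psi> x A)] (mod 2)" using eng.IH(1)[OF eng.prems] by blast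
    have "st v h1 \<in> X" using eng.prems h by simp
    then obtain L2 where L2: "set L2 \<subseteq> X" "\<And>\<psi>. cocycle G X st 2 \<psi> \<Longrightarrow> (\<forall>v\<in>X. \<forall>d\<in>Dd. [\<psi> v d = 0] (mod 2)) \<Longrightarrow>
      [\<psi> (st v h1) h2 = (\<Sum>x\<leftarrow>L2. \<psi> x A)] (mod 2)" using eng.IH(2) by blast
    show ?case
    proof (intro exI[of _ "L1 @ L2"] conjI allI impI)
      fix \<psi> assume \<psi>: "cocycle G X st 2 \<psi>" "\<forall>v\<in>X. \<forall>d\<in>Dd. [\<psi> v d = 0] (mod 2)"
      have "[\<psi> v (h1 \<otimes> h2) = \<psi> v h1 + \<psi> (st v h1) h2] (mod 2)"
        by (rule cocycleD[OF \<psi>(1) eng.prems h])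
      also have "[\<psi> v h1 + \<psi> (st v h1) h2 = (\<Sum>x\<leftarrow>L1. \<psi> x A) + (\<Sum>x\<leftarrow>L2. \<psi> x A)] (mod 2)"
        by (rule cong_add[OF L1(2)[OF \<psi>] L2(2)[OF \<psi>]])
      finally show "[\<psi> v (h1 \<otimes> h2) = (\<Sum>x\<leftarrow>L1 @ L2. \<psi> x A)] (mod 2)" by simp
    qed (use L1 L2 in simp)
  qed
qed

definition rep :: "'e \<Rightarrow> 'x" where "rep e = (SOME x. x \<in> X \<and> ed x = e)"

lemma rep: assumes "x \<in> X" shows "rep (ed x) \<in> X" "ed (rep (ed x)) = ed x"
proof -
  have "rep (ed x) \<in> X \<and> ed (rep (ed x)) = ed x"
    unfolding rep_def by (rule someI[of _ x]) (use assms in simp)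
  then show "rep (ed x) \<in> X" "ed (rep (ed x)) = ed x" by simp_all
qed

lemma rep_edge: assumes "e \<in> edges Q" shows "rep e \<in> X" "ed (rep e) = e" "keep (rep e)"
proof -
  obtain v where v: "v \<in> X" "keep v" "e = ed v" using assms edges by blast
  show *: "rep e \<in> X" "ed (rep e) = e" using rep[OF v(1)] v(3) by simp_all
  show "keep (rep e)" using keep_ed[OF v(1) *(1)] v * by simp
qed

text \<open>The algebraic number of traversals of an oriented edge.\<close>

lemma crossing_exists:
  assumes e: "e \<in> edges Q"
  shows "\<exists>N. cocycle G X st 0 N \<and> (\<forall>v\<in>X. \<forall>d\<in>Dd. N v d = 0) \<and> (\<forall>v\<in>X. [N v A = of_bool (ed v = e)] (mod 2))"
proof -
  define r where "r = rep e"
  have r: "r \<in> X" "ed r = e" "keep r" using rep_edge[OF e] by (simp_all add: r_def)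
  \<comment> \<open>The two orientations of \<open>e\<close>: the \<open>K\<close>-orbits of
    \<open>r\<close> and of \<open>st r A\<close>, disjoint by \<open>keep_A\<close>. They are
    counted with opposite signs, so modulo 2 each traversal counts once.\<close>
  define plus minus where "plus v \<longleftrightarrow> (\<exists>k\<in>K. v = st r k)" and "minus v \<longleftrightarrow> (\<exists>k\<in>K. v = st (st r A) k)" for v
  have Kmul: "\<exists>k''\<in>K. st (st v k) k' = st v k''" if "k \<in> K" "k' \<in> K" "v \<in> X" for k k' v
    by (rule bexI[OF _ subgroup.m_closed[OF K(1) that(1,2)]])
      (rule st_mult[OF that(3) K_carrier[OF that(1)] K_carrier[OF that(2)], symmetric])
  have Kinv: "st (st v k) (inv k) = v" if "k \<in> K" "v \<in> X" for k v
    using st_inv[OF that(2), of k] that K_carrier by simp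
  have rA: "st r A \<in> X" using r A by simp
  have pK: "plus (st v k)" if "plus v" "k \<in> K" for v k
    using that Kmul[OF _ that(2) r(1)] by (auto simp: plus_def)
  have mK: "minus (st v k)" if "minus v" "k \<in> K" for v k
    using that Kmul[OF _ that(2) rA] by (auto simp: minus_def)
  have pA: "minus (st v A)" if "plus v" for v
    using that st_kA[OF r(1)] by (auto simp: plus_def minus_def)
  have mA: "plus (st v A)" if "minus v" for v
    using that st_kA[OF rA] st_AA[OF r(1)] by (auto simp: plus_def minus_def)
  have disj: "\<not> (plus v \<and> minus v)" for v
  proof
    assume "plus v \<and> minus v"
    then obtain k k' where k: "k \<in> K" "k' \<in> K" "st r k = st (st r A) k'" by (auto simp: plus_def minus_def)
    then have "st r A = st (st r k) (inv k')" using Kinv[OF k(2) rA] by simp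
    moreover obtain k'' where "k'' \<in> K" "st (st r k) (inv k') = st r k''"
      using Kmul[OF k(1) subgroup.m_inv_closed[OF K(1) k(2)] r(1)] by blast
    ultimately show False using keep_A[OF r(1,3)] by auto
  qed
  have iff: "ed v = e \<longleftrightarrow> plus v \<or> minus v" if "v \<in> X" for v
    using ed[OF r(1) that] r(2) by (auto simp: plus_def minus_def)
  define \<kappa> :: "'x \<Rightarrow> int" where "\<kappa> v = (if plus v then 1 else if minus v then - 1 else 0)" for v
  have 1: "\<kappa> (st v A) = - \<kappa> v" if v: "v \<in> X" for v
  proof -
    have "plus (st v A) \<longleftrightarrow> minus v" "minus (st v A) \<longleftrightarrow> plus v"
      using pA[of v] mA[of v] pA[of "st v A"] mA[of "st v A"] st_AA[OF v] by auto
    then show ?thesis using disj[of v] by (auto simp: \<kappa>_def)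
  qed
  have 2: "\<kappa> (st v k) = \<kappa> v" if v: "v \<in> X" "k \<in> K" for v k
  proof -
    have "plus (st v k) \<longleftrightarrow> plus v" "minus (st v k) \<longleftrightarrow> minus v"
      using pK[of v k] mK[of v k] pK[of "st v k" "inv k"] mK[of "st v k" "inv k"] Kinv[OF v(2,1)] v
        subgroup.m_inv_closed[OF K(1) v(2)] by auto
    then show ?thesis by (simp add: \<kappa>_def)
  qed
  obtain N where N: "cocycle G X st 0 N" "\<forall>v\<in>X. N v A = \<kappa> v \<and> (\<forall>d\<in>Dd. N v d = 0)"
    using integral_cocycle[of \<kappa>, OF 1 2] by blast
  have "[N v A = of_bool (ed v = e)] (mod 2)" if "v \<in> X" for v
    using N(2) that iff[OF that] by (auto simp: \<kappa>_def cong_def)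
  then show ?thesis using N by blast
qed

definition N :: "'e \<Rightarrow> 'x \<Rightarrow> 'a \<Rightarrow> int" where
  "N e = (SOME N. cocycle G X st 0 N \<and> (\<forall>v\<in>X. \<forall>d\<in>Dd. N v d = 0) \<and> (\<forall>v\<in>X. [N v A = of_bool (ed v = e)] (mod 2)))"

lemma N:
  assumes "e \<in> edges Q"
  shows "cocycle G X st 0 (N e)" "\<And>v d. v \<in> X \<Longrightarrow> d \<in> Dd \<Longrightarrow> N e v d = 0"
    "\<And>v. v \<in> X \<Longrightarrow> [N e v A = of_bool (ed v = e)] (mod 2)" "cocycle G X st 2 (N e)"
proof -
  have *: "cocycle G X st 0 (N e) \<and> (\<forall>v\<in>X. \<forall>d\<in>Dd. N e v d = 0) \<and> (\<forall>v\<in>X. [N e v A = of_bool (ed v = e)] (mod 2))"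
    unfolding N_def by (rule someI_ex[OF crossing_exists[OF assms]])
  show "cocycle G X st 0 (N e)" using * by blast
  then show "cocycle G X st 2 (N e)" by (simp add: cocycle_def)
  show "\<And>v d. v \<in> X \<Longrightarrow> d \<in> Dd \<Longrightarrow> N e v d = 0" using * by blast
  show "\<And>v. v \<in> X \<Longrightarrow> [N e v A = of_bool (ed v = e)] (mod 2)" using * by blast
qed

text \<open>The 1-cycle modulo 2 swept by the closed path \<open>s\<close>, restricted to the edges
  that are kept.\<close>

definition D0 :: "'a \<Rightarrow> 'e set" where "D0 s = {e \<in> edges Q. odd (N e p s)}"

lemma cocycle_S_hom:
  assumes "cocycle G X st q \<psi>"
  shows "\<psi> p \<in> hom_mod q SG"
proof -
  have "[\<psi> p (x \<otimes> y) = \<psi> p x + \<psi> p y] (mod q)" if "x \<in> S" "y \<in> S" for x y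
    using cocycleD[OF assms p, of x y] that by (simp add: S_def)
  then show ?thesis by (simp add: hom_mod_def)
qed

lemma N_hom: "e \<in> edges Q \<Longrightarrow> N e p \<in> hom_mod 2 SG"
  using cocycle_S_hom N(4) .

text \<open>Incidence numbers with loops counted twice, in accordance with
  \<open>valence_in\<close>.\<close>

definition inc :: "'v \<Rightarrow> 'x \<Rightarrow> int" where "inc y x = of_bool (vt x = y) + of_bool (vt (st x A) = y)"

lemma inc_ed: "x \<in> X \<Longrightarrow> x' \<in> X \<Longrightarrow> ed x = ed x' \<Longrightarrow> inc y x = inc y x'"
proof -
  assume x: "x \<in> X" "x' \<in> X" "ed x = ed x'"
  have 1: "inc y (st v A) = inc y v" if "v \<in> X" for v
    using st_AA[OF that] by (simp add: inc_def)
  have 2: "inc y (st v k) = inc y v" if "v \<in> X" "k \<in> K" for v k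
  proof -
    have "k \<in> Dd" "st v A \<in> X" using that K(2) A(1) by auto
    then show ?thesis unfolding inc_def st_kA[OF that] by (simp only: vt_D[OF that(1)] vt_D)
  qed
  have "[inc y x = inc y x'] (mod 0)"
    by (rule ed_invariant[OF _ _ x]) (simp_all only: 1 2 cong_refl)
  then show "inc y x = inc y x'" by simp
qed

definition is_path :: "'a \<Rightarrow> 'x list \<Rightarrow> bool" where
  "is_path m L \<longleftrightarrow> set L \<subseteq> X \<and> (\<forall>\<psi>. cocycle G X st 2 \<psi> \<longrightarrow> (\<forall>v\<in>X. \<forall>d\<in>Dd. [\<psi> v d = 0] (mod 2)) \<longrightarrow>
      [\<psi> p m = (\<Sum>x\<leftarrow>L. \<psi> x A)] (mod 2))"

lemma path_exists: "m \<in> carrier G \<Longrightarrow> \<exists>L. is_path m L"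
  using path_list[OF _ p] unfolding is_path_def .

abbreviation cnt where "cnt L e \<equiv> int (count_list (map ed L) e)"

lemma path_sum:
  assumes "set L \<subseteq> X" and h: "\<And>x. x \<in> X \<Longrightarrow> [h x = h (rep (ed x))] (mod 2)"
  shows "[(\<Sum>x\<leftarrow>L. h x) = (\<Sum>e\<in>ed ` set L. cnt L e * h (rep e))] (mod 2)"
proof -
  have "[(\<Sum>x\<leftarrow>L. h x) = (\<Sum>x\<leftarrow>L. h (rep (ed x)))] (mod 2)"
    using assms(1)
  proof (induction L)
    case (Cons x L)
    then show ?case using h[of x] by (auto intro: cong_add)
  qed simp
  also have "(\<Sum>x\<leftarrow>L. h (rep (ed x))) = (\<Sum>e\<leftarrow>map ed L. h (rep e))" by (simp add: comp_def)
  also have "\<dots> = (\<Sum>e\<in>ed ` set L. cnt L e * h (rep e))"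
    by (rule sum_list_count) auto
  finally show ?thesis .
qed

lemma path_crossing:
  assumes "is_path s L" "e \<in> edges Q"
  shows "[N e p s = cnt L e] (mod 2)"
proof -
  have L: "set L \<subseteq> X" using assms(1) by (simp add: is_path_def)
  have "[N e p s = (\<Sum>x\<leftarrow>L. N e x A)] (mod 2)"
    using assms(1) N(2,4)[OF assms(2)] by (simp add: is_path_def)
  also have "[(\<Sum>x\<leftarrow>L. N e x A) = cnt L e] (mod 2)"
    using L
  proof (induction L)
    case (Cons x L)
    then have "[N e x A + (\<Sum>x\<leftarrow>L. N e x A) = of_bool (ed x = e) + cnt L e] (mod 2)"
      by (intro cong_add N(3)[OF assms(2)]) auto
    then show ?case by (cases "ed x = e") (simp_all add: add.commute)
  qed simp
  finally show ?thesis .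
qed

text \<open>The coboundary of the indicator of the vertex \<open>y\<close> vanishes on closed paths,
  and modulo 2 it counts the incidences of the traversed edges with \<open>y\<close>.\<close>

lemma path_boundary:
  assumes "is_path s L" "s \<in> S"
  shows "[(\<Sum>e\<in>ed ` set L. cnt L e * inc y (rep e)) = 0] (mod 2)"
proof -
  have L: "set L \<subseteq> X" using assms(1) by (simp add: is_path_def)
  define \<psi> :: "'x \<Rightarrow> 'a \<Rightarrow> int" where "\<psi> v m = of_bool (vt (st v m) = y) - of_bool (vt v = y)" for v m
  have "cocycle G X st 2 \<psi>" by (auto simp: cocycle_def \<psi>_def st_mult)
  moreover have "\<psi> v d = 0" if "v \<in> X" "d \<in> Dd" for v d using vt_D[OF that] by (simp add: \<psi>_def)
  ultimately have "[\<psi> p s = (\<Sum>x\<leftarrow>L. \<psi> x A)] (mod 2)" using assms(1) by (simp add: is_path_def)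
  moreover have "\<psi> p s = 0" using assms(2) by (simp add: \<psi>_def S_def)
  ultimately have "[(\<Sum>x\<leftarrow>L. \<psi> x A) = 0] (mod 2)" by (simp add: cong_sym_eq)
  moreover have "[(\<Sum>x\<leftarrow>L. inc y x) = (\<Sum>x\<leftarrow>L. \<psi> x A)] (mod 2)"
  proof (induction L)
    case (Cons x L)
    have "inc y x - \<psi> x A = 2 * of_bool (vt x = y)" by (simp only: inc_def \<psi>_def)
    then have "2 dvd inc y x - \<psi> x A" by (simp only: dvd_triv_left)
    then have "[inc y x = \<psi> x A] (mod 2)" by (simp add: cong_iff_dvd_diff)
    from cong_add[OF this Cons.IH] show ?case by simp
  qed simp
  ultimately have *: "[(\<Sum>x\<leftarrow>L. inc y x) = 0] (mod 2)" by (rule cong_trans[rotated])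
  have "[(\<Sum>x\<leftarrow>L. inc y x) = (\<Sum>e\<in>ed ` set L. cnt L e * inc y (rep e))] (mod 2)"
  proof (rule path_sum[OF L])
    fix x assume x: "x \<in> X"
    have "inc y x = inc y (rep (ed x))" by (rule inc_ed[OF x rep(1)[OF x] rep(2)[OF x, symmetric]])
    then show "[inc y x = inc y (rep (ed x))] (mod 2)" unfolding cong_def by (rule arg_cong)
  qed
  then show ?thesis by (rule cong_trans[OF cong_sym *])
qed

text \<open>Only one edge meets the leaf, and with one end only, so the boundary at the leaf is the
  number of its traversals.\<close>

lemma path_leaf:
  assumes "is_path s L" "s \<in> S" "x \<in> X" "lf (vt x)"
  shows "even (cnt L (ed x))"
proof (cases "ed x \<in> ed ` set L")
  case False
  then have "count_list (map ed L) (ed x) = 0" by (simp add: count_list_0_iff)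
  then show ?thesis by simp
next
  case True
  have L: "set L \<subseteq> X" using assms(1) by (simp add: is_path_def)
  have xA: "st x A \<in> X" using assms(3) A(1) by simp
  have 1: "inc (vt x) (rep (ed x)) = 1"
    using inc_ed[OF rep(1)[OF assms(3)] assms(3) rep(2)[OF assms(3)], of "vt x"] leaf_A[OF assms(3,4)]
    by (simp add: inc_def)
  have 0: "inc (vt x) (rep e) = 0" if e: "e \<in> ed ` set L" "e \<noteq> ed x" for e
  proof -
    obtain z where z: "z \<in> X" "e = ed z" using e L by blast
    have r: "rep e \<in> X" "ed (rep e) = e" using rep[OF z(1)] z by simp_all
    have rA: "st (rep e) A \<in> X" using r A(1) by simp
    have "vt (rep e) \<noteq> vt x" "vt (st (rep e) A) \<noteq> vt x"
      using leaf[OF assms(3) r(1) assms(4)] leaf[OF assms(3) rA assms(4)] ed_A[OF r(1)] r(2) e(2) by auto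
    then show ?thesis by (simp add: inc_def)
  qed
  have "(\<Sum>e\<in>ed ` set L. cnt L e * inc (vt x) (rep e)) =
      cnt L (ed x) * inc (vt x) (rep (ed x)) + (\<Sum>e\<in>ed ` set L - {ed x}. cnt L e * inc (vt x) (rep e))"
    using True by (intro sum.remove) auto
  also have "(\<Sum>e\<in>ed ` set L - {ed x}. cnt L e * inc (vt x) (rep e)) = 0"
    by (intro sum.neutral) (use 0 in auto)
  finally have "[cnt L (ed x) = 0] (mod 2)" using path_boundary[OF assms(1,2), of "vt x"] 1 by simp
  then show ?thesis by (simp add: cong_0_iff)
qed

text \<open>Why dropping edges does not disturb the cycles: edges at leaves are traversed an even
  number of times, and an edge fixed by \<open>A\<close> has even incidence with every
  vertex.\<close>

lemma path_removed:
  assumes "is_path s L" "s \<in> S" "x \<in> X" "\<not> keep x"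
  shows "even (cnt L (ed x)) \<or> st x A = x"
proof -
  have xA: "st x A \<in> X" using assms(3) A(1) by simp
  show ?thesis
    using not_keep[OF assms(3,4)] path_leaf[OF assms(1-3)] path_leaf[OF assms(1,2) xA] ed_A[OF assms(3)]
    by auto
qed

lemma finite_D0: assumes "s \<in> carrier G" shows "finite (D0 s)"
proof -
  obtain L where L: "is_path s L" using path_exists[OF assms] by blast
  have "D0 s \<subseteq> ed ` set L"
  proof
    fix e assume e: "e \<in> D0 s"
    then have "odd (cnt L e)" using path_crossing[OF L, of e] by (auto simp: D0_def cong_dvd_iff)
    then have "count_list (map ed L) e \<noteq> 0" by (intro notI) simp
    then show "e \<in> ed ` set L" by (simp add: count_list_0_iff)
  qed
  then show ?thesis by (rule finite_subset) simp
qed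

lemma valence_inc:
  assumes D: "finite D" "D \<subseteq> edges Q"
  shows "int (the_enat (valence_in Q D y)) = (\<Sum>e\<in>D. inc y (rep e))"
proof -
  have fin: "finite {e \<in> D. y \<in> ends Q e}" "finite {e \<in> D. y \<in> ends Q e \<and> is_loop Q e}" using D by auto
  have "int (the_enat (valence_in Q D y)) = int (card {e \<in> D. y \<in> ends Q e}) + int (card {e \<in> D. y \<in> ends Q e \<and> is_loop Q e})"
    using fin by (simp add: valence_in_def ecard_def)
  also have "\<dots> = (\<Sum>e\<in>D. of_bool (y \<in> ends Q e)) + (\<Sum>e\<in>D. of_bool (y \<in> ends Q e \<and> is_loop Q e))"
    using D by (simp add: of_bool_def sum.If_cases Int_def)
  also have "\<dots> = (\<Sum>e\<in>D. of_bool (y \<in> ends Q e) + of_bool (y \<in> ends Q e \<and> is_loop Q e))"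
    by (simp add: sum.distrib)
  also have "\<dots> = (\<Sum>e\<in>D. inc y (rep e))"
  proof (rule sum.cong[OF refl])
    fix e assume "e \<in> D"
    then have r: "rep e \<in> X" "ed (rep e) = e" "keep (rep e)" using rep_edge D(2) by blast+
    have e: "ends Q e = {vt (rep e), vt (st (rep e) A)}" using ends[OF r(1,3)] r(2) by simp
    show "of_bool (y \<in> ends Q e) + of_bool (y \<in> ends Q e \<and> is_loop Q e) = inc y (rep e)"
      by (cases "vt (rep e) = vt (st (rep e) A)") (auto simp: e is_loop_def inc_def)
  qed
  finally show ?thesis .
qed

lemma D0_cycle:
  assumes s: "s \<in> S"
  shows "D0 s \<in> cycle_space Q"
proof -
  have sc: "s \<in> carrier G" using s by (simp add: S_def)
  obtain L where L: "is_path s L" using path_exists[OF sc] by blast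
  have LX: "set L \<subseteq> X" using L by (simp add: is_path_def)
  have D: "finite (D0 s)" "D0 s \<subseteq> edges Q" using finite_D0[OF sc] by (auto simp: D0_def)
  have "even (the_enat (valence_in Q (D0 s) y))" for y
  proof -
    let ?U = "ed ` set L \<union> D0 s"
    \<comment> \<open>On kept edges the traversal count and the indicator of \<open>D0 s\<close>
      agree modulo 2; on dropped edges both terms are even by \<open>path_removed\<close>.\<close>
    have t: "[cnt L e * inc y (rep e) = of_bool (e \<in> D0 s) * inc y (rep e)] (mod 2)" if e: "e \<in> ?U" for e
    proof (cases "e \<in> edges Q")
      case True
      have "[cnt L e = of_bool (e \<in> D0 s)] (mod 2)"
        using path_crossing[OF L True] True by (auto simp: D0_def cong_def odd_iff_mod_2_eq_one)
      then show ?thesis by (intro cong_mult cong_refl)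
    next
      case False
      then obtain x where x: "x \<in> X" "e = ed x" using e LX D(2) by blast
      have nk: "\<not> keep x" using False edges x by blast
      have nD: "e \<notin> D0 s" using False by (simp add: D0_def)
      have "even (cnt L e * inc y (rep e))"
      proof (cases "st x A = x")
        case True
        then have "inc y x = 2 * of_bool (vt x = y)" by (simp add: inc_def)
        then have "even (inc y (rep e))" using inc_ed[OF rep(1)[OF x(1)] x(1) rep(2)[OF x(1)]] x(2) by simp
        then show ?thesis by simp
      next
        case False
        then show ?thesis using path_removed[OF L s x(1) nk] x(2) by simp
      qed
      then show ?thesis using nD by (simp add: cong_0_iff)
    qed
    have "int (the_enat (valence_in Q (D0 s) y)) = (\<Sum>e\<in>?U. of_bool (e \<in> D0 s) * inc y (rep e))"
      unfolding valence_inc[OF D] using D(1)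
      by (intro sum.mono_neutral_cong_left) auto
    moreover have "[(\<Sum>e\<in>?U. cnt L e * inc y (rep e)) = (\<Sum>e\<in>?U. of_bool (e \<in> D0 s) * inc y (rep e))] (mod 2)"
      by (intro cong_sum t)
    moreover have "(\<Sum>e\<in>?U. cnt L e * inc y (rep e)) = (\<Sum>e\<in>ed ` set L. cnt L e * inc y (rep e))"
    proof (rule sum.mono_neutral_right)
      show "\<forall>e\<in>?U - ed ` set L. cnt L e * inc y (rep e) = 0"
      proof
        fix e assume "e \<in> ?U - ed ` set L"
        then have "count_list (map ed L) e = 0" by (simp add: count_list_0_iff)
        then show "cnt L e * inc y (rep e) = 0" by simp
      qed
    qed (use D(1) in auto)
    ultimately have "[int (the_enat (valence_in Q (D0 s) y)) = 0] (mod 2)"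
      using path_boundary[OF L s, of y] by (metis cong_sym cong_trans)
    then show ?thesis by (simp add: cong_0_iff)
  qed
  then show ?thesis using D by (simp add: cycle_space_def)
qed

end

section \<open>Duality between closed paths and the cycle space\<close>

context edge_path_graph
begin

lemma S_carrier: "s \<in> S \<Longrightarrow> s \<in> carrier G"
  by (simp add: S_def)

definition base :: "'x \<Rightarrow> 'x" where "base v = (SOME w. w \<in> X \<and> vt w = vt v)"

definition lift\<^sub>0 :: "'x \<Rightarrow> 'a" where "lift\<^sub>0 v = (SOME g. g \<in> carrier G \<and> st p g = v)"

definition corner :: "'x \<Rightarrow> 'a" where "corner v = (SOME d. d \<in> Dd \<and> st (base v) d = v)"

text \<open>A path from \<open>p\<close> to each state, chosen so that the states of one vertex
  share the way to a base state and differ by a final turn in \<open>Dd\<close>.\<close>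

definition lift :: "'x \<Rightarrow> 'a" where "lift v = lift\<^sub>0 (base v) \<otimes> corner v"

lemma lift:
  assumes v: "v \<in> X"
  shows "base v \<in> X" "vt (base v) = vt v" "lift\<^sub>0 v \<in> carrier G" "st p (lift\<^sub>0 v) = v" "corner v \<in> Dd"
    "st (base v) (corner v) = v" "lift v \<in> carrier G" "st p (lift v) = v"
proof -
  have b: "base v \<in> X \<and> vt (base v) = vt v"
    unfolding base_def by (rule someI[of _ v]) (use v in simp)
  then show b1: "base v \<in> X" and b2: "vt (base v) = vt v" by simp_all
  have l: "lift\<^sub>0 v \<in> carrier G \<and> st p (lift\<^sub>0 v) = v" if "v \<in> X" for v
    unfolding lift\<^sub>0_def by (rule someI_ex) (use transitive[OF that] in blast)
  then show "lift\<^sub>0 v \<in> carrier G" "st p (lift\<^sub>0 v) = v" using v by simp_all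
  have "\<exists>d\<in>Dd. v = st (base v) d" using vt[OF b1 v] b2 by simp
  then have "\<exists>d. d \<in> Dd \<and> st (base v) d = v" by metis
  then have c: "corner v \<in> Dd \<and> st (base v) (corner v) = v"
    unfolding corner_def by (rule someI_ex)
  then show c1: "corner v \<in> Dd" and c2: "st (base v) (corner v) = v" by simp_all
  show "lift v \<in> carrier G" "st p (lift v) = v"
    using l[OF b1] c1 c2 Dd_carrier p by (simp_all add: lift_def st_mult)
qed

lemma base_cong: "vt v = vt w \<Longrightarrow> base v = base w"
  by (simp add: base_def)

text \<open>The closed path from \<open>p\<close> to \<open>v\<close>, along \<open>m\<close>, and
  back to \<open>p\<close>: a Schreier generator of \<open>S\<close>.\<close>

definition hop :: "'x \<Rightarrow> 'a \<Rightarrow> 'a" where "hop v m = lift v \<otimes> m \<otimes> inv (lift (st v m))"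

lemma hop_S: assumes "v \<in> X" "m \<in> carrier G" shows "hop v m \<in> S"
proof -
  have "st p (hop v m) = st (st (st p (lift v)) m) (inv (lift (st v m)))"
    using assms lift p by (simp add: hop_def st_mult)
  also have "\<dots> = p"
    using assms lift(8)[of v] st_inv[OF p lift(7) lift(8), of "st v m"] by simp
  finally show ?thesis using assms lift(7) by (simp add: S_def hop_def)
qed

lemma hop_mult:
  assumes "v \<in> X" "g \<in> carrier G" "h \<in> carrier G"
  shows "hop v (g \<otimes> h) = hop v g \<otimes> hop (st v g) h"
proof -
  have "hop v g \<otimes> hop (st v g) h = lift v \<otimes> (g \<otimes> h) \<otimes> inv (lift (st (st v g) h))"
    unfolding hop_def by (rule telescope) (use assms lift in auto)
  then show ?thesis using assms by (simp add: hop_def st_mult)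
qed

text \<open>Inside a vertex the transversal moves along \<open>Dd\<close>, so such hops are torsion elements.\<close>

lemma hop_D:
  assumes "v \<in> X" "d \<in> Dd"
  shows "hop v d \<otimes> hop v d = \<one> \<or> hop v d \<otimes> hop v d \<otimes> hop v d = \<one>"
proof -
  have vd: "st v d \<in> X" and dc: "d \<in> carrier G" using assms Dd_carrier by auto
  have b: "base (st v d) = base v" by (rule base_cong[OF vt_D[OF assms]])
  define l where "l = lift\<^sub>0 (base v)"
  define d' where "d' = corner v \<otimes> d \<otimes> inv (corner (st v d))"
  have lc: "l \<in> carrier G" using lift(3)[OF lift(1)[OF assms(1)]] by (simp add: l_def)
  note c = lift(5)[OF assms(1)] lift(5)[OF vd]
  have d': "d' \<in> Dd"
    using c assms(2) subgroup.m_closed[OF Dd(1)] subgroup.m_inv_closed[OF Dd(1)] by (simp add: d'_def)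
  have d'c: "d' \<in> carrier G" by (rule Dd_carrier[OF d'])
  have h: "hop v d = l \<otimes> d' \<otimes> inv l"
    using c[THEN Dd_carrier] lc dc by (simp add: hop_def lift_def b d'_def l_def inv_mult_group m_assoc)
  have 2: "hop v d \<otimes> hop v d = l \<otimes> (d' \<otimes> d') \<otimes> inv l"
    unfolding h by (rule telescope) (use lc d'c in auto)
  have 3: "hop v d \<otimes> hop v d \<otimes> hop v d = l \<otimes> (d' \<otimes> d' \<otimes> d') \<otimes> inv l"
    unfolding 2 unfolding h by (rule telescope) (use lc d'c in auto)
  show ?thesis
    using Dd(2)[OF d']
  proof
    assume "d' \<otimes> d' = \<one>"
    then have "hop v d \<otimes> hop v d = \<one>" unfolding 2 using lc by simp
    then show ?thesis ..
  next
    assume "d' \<otimes> d' \<otimes> d' = \<one>"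
    then have "hop v d \<otimes> hop v d \<otimes> hop v d = \<one>" unfolding 3 using lc by simp
    then show ?thesis ..
  qed
qed

lemma hom_torsion:
  assumes "f \<in> hom_mod2_tf SG" "s \<in> S" "s \<otimes> s = \<one> \<or> s \<otimes> s \<otimes> s = \<one>"
  shows "[f s = 0] (mod 2)"
proof (cases "s \<otimes> s = \<one>")
  case True
  then show ?thesis using assms by (simp add: hom_mod2_tf_def)
next
  case False
  then have 3: "s \<otimes> s \<otimes> s = \<one>" using assms(3) by simp
  have f: "f \<in> hom_mod 2 SG" using assms(1) by (simp add: hom_mod2_tf_def)
  have ss: "s \<otimes> s \<in> S" using subgroup.m_closed[OF subgroup_S assms(2,2)] .
  have "[f (s \<otimes> s \<otimes> s) = f (s \<otimes> s) + f s] (mod 2)" using hom_modD[OF f, of "s \<otimes> s" s] ss assms(2) by simp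
  also have "[f (s \<otimes> s) + f s = (f s + f s) + f s] (mod 2)"
    using hom_modD[OF f, of s s] assms(2) by (intro cong_add cong_refl) simp
  finally have "[f s + f s + f s = f \<one>] (mod 2)" unfolding 3 by (rule cong_sym)
  also have "[f \<one> = 0] (mod 2)" using SG.hom_mod_one[OF f] by simp
  finally have "2 dvd f s + f s + f s" by (simp add: cong_0_iff)
  then have "2 dvd f s" by presburger
  then show ?thesis by (simp add: cong_0_iff)
qed

text \<open>A homomorphism killing involutions depends on \<open>D0 s\<close> only:
  \<open>f s\<close> is the sum over the traversed edges of traversal number times a weight, and for
  empty \<open>D0 s\<close> each term is even.\<close>

lemma D0_kernel:
  assumes f: "f \<in> hom_mod2_tf SG" and s: "s \<in> S" and D: "D0 s = {}"
  shows "[f s = 0] (mod 2)"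
proof -
  have fh: "f \<in> hom_mod 2 SG" using f by (simp add: hom_mod2_tf_def)
  define \<phi> where "\<phi> v m = f (hop v m)" for v m
  have coc: "cocycle G X st 2 \<phi>"
    unfolding cocycle_def
  proof (intro ballI)
    fix v g h assume *: "v \<in> X" "g \<in> carrier G" "h \<in> carrier G"
    have "st v g \<in> X" using * by simp
    then show "[\<phi> v (g \<otimes> h) = \<phi> v g + \<phi> (st v g) h] (mod 2)"
      unfolding \<phi>_def hop_mult[OF *] using hom_modD[OF fh, of "hop v g" "hop (st v g) h"] hop_S * by simp
  qed
  have zero: "[\<phi> v d = 0] (mod 2)" if "v \<in> X" "d \<in> Dd" for v d
    unfolding \<phi>_def by (rule hom_torsion[OF f hop_S hop_D]) (use that Dd_carrier in auto)
  have sc: "s \<in> carrier G" using s by (rule S_carrier)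
  obtain L where L: "is_path s L" using path_exists[OF sc] by blast
  have LX: "set L \<subseteq> X" using L by (simp add: is_path_def)
  have two: "[a = b] (mod 2)" if "[a + b = 0] (mod 2)" for a b :: int
    using that by (simp add: cong_iff_dvd_diff)
  have symA: "[\<phi> (st v A) A = \<phi> v A] (mod 2)" if v: "v \<in> X" for v
  proof (rule two)
    have "[\<phi> v (A \<otimes> A) = \<phi> v A + \<phi> (st v A) A] (mod 2)" by (rule cocycleD[OF coc v A(1) A(1)])
    moreover have "[\<phi> v (A \<otimes> A) = 0] (mod 2)" unfolding A(2) by (rule cocycle_one[OF coc v])
    ultimately show "[\<phi> (st v A) A + \<phi> v A = 0] (mod 2)"
      unfolding add.commute[of "\<phi> (st v A) A"] by (rule cong_trans[OF cong_sym])
  qed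
  \<comment> \<open>As \<open>k\<close> commutes with \<open>A\<close> and costs nothing, the weight
    of an edge does not depend on the state that represents it.\<close>
  have symK: "[\<phi> (st v k) A = \<phi> v A] (mod 2)" if v: "v \<in> X" "k \<in> K" for v k
  proof -
    have kD: "k \<in> Dd" "k \<in> carrier G" using v K(2) K_carrier by auto
    have vA: "st v A \<in> X" using v A(1) by simp
    have "[\<phi> v (k \<otimes> A) = \<phi> v k + \<phi> (st v k) A] (mod 2)" by (rule cocycleD[OF coc v(1) kD(2) A(1)])
    also have "[\<phi> v k + \<phi> (st v k) A = 0 + \<phi> (st v k) A] (mod 2)"
      by (intro cong_add zero v(1) kD(1) cong_refl)
    finally have 1: "[\<phi> v (k \<otimes> A) = \<phi> (st v k) A] (mod 2)" by simp
    have "[\<phi> v (A \<otimes> k) = \<phi> v A + \<phi> (st v A) k] (mod 2)" by (rule cocycleD[OF coc v(1) A(1) kD(2)])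
    also have "[\<phi> v A + \<phi> (st v A) k = \<phi> v A + 0] (mod 2)"
      by (intro cong_add zero vA kD(1) cong_refl)
    finally have 2: "[\<phi> v (k \<otimes> A) = \<phi> v A] (mod 2)" by (simp add: K(3)[OF v(2)])
    show ?thesis by (rule cong_trans[OF cong_sym[OF 1] 2])
  qed
  have repA: "[\<phi> x A = \<phi> (rep (ed x)) A] (mod 2)" if x: "x \<in> X" for x
    by (rule ed_invariant[OF symA symK x rep(1)[OF x] rep(2)[OF x, symmetric]])
  have "[\<phi> p s = (\<Sum>x\<leftarrow>L. \<phi> x A)] (mod 2)"
    using L coc zero unfolding is_path_def by blast
  also have "[(\<Sum>x\<leftarrow>L. \<phi> x A) = (\<Sum>e\<in>ed ` set L. cnt L e * \<phi> (rep e) A)] (mod 2)"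
    by (rule path_sum[OF LX, where h = "\<lambda>x. \<phi> x A"]) (rule repA)
  also have "[(\<Sum>e\<in>ed ` set L. cnt L e * \<phi> (rep e) A) = (\<Sum>e\<in>ed ` set L. 0)] (mod 2)"
  proof (rule cong_sum)
    fix e assume "e \<in> ed ` set L"
    then obtain x where x: "x \<in> X" "e = ed x" using LX by blast
    have "even (cnt L e) \<or> even (\<phi> (rep e) A)"
    proof (cases "e \<in> edges Q")
      case True
      then have "even (N e p s)" using D by (auto simp: D0_def)
      then show ?thesis using path_crossing[OF L True] by (simp add: cong_dvd_iff)
    next
      case False
      then have nk: "\<not> keep x" using edges x by blast
      consider "even (cnt L e)" | "st x A = x" using path_removed[OF L s x(1) nk] x(2) by blast
      then show ?thesis
      proof cases
        \<comment> \<open>At an edge fixed by \<open>A\<close> the hop is an involution, which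
          \<open>f\<close> kills.\<close>
        case 2
        have lx: "lift x \<in> carrier G" using lift(7)[OF x(1)] .
        have "hop x A \<otimes> hop x A = lift x \<otimes> (A \<otimes> A) \<otimes> inv (lift x)"
          unfolding hop_def 2 by (rule telescope) (use lx A in auto)
        then have "hop x A \<otimes> hop x A = \<one>" using lx A by simp
        then have "[\<phi> x A = 0] (mod 2)"
          unfolding \<phi>_def using hom_torsion[OF f hop_S[OF x(1) A(1)]] by simp
        then have "[\<phi> (rep e) A = 0] (mod 2)"
          unfolding x(2) by (rule cong_trans[OF cong_sym[OF repA[OF x(1)]]])
        then show ?thesis by (simp add: cong_0_iff)
      qed simp
    qed
    then show "[cnt L e * \<phi> (rep e) A = 0] (mod 2)" by (auto simp: cong_0_iff)
  qed
  finally have "[\<phi> p s = 0] (mod 2)" by simp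
  \<comment> \<open>\<open>lift p\<close> need not be trivial, but \<open>hop p s\<close> is the
    conjugate of \<open>s\<close> by it, and conjugation does not change values of
    \<open>f\<close>.\<close>
  have lp: "lift p \<in> S" "lift p \<in> carrier G" using lift(7,8)[OF p] by (simp_all add: S_def)
  have hp: "hop p s \<otimes> lift p = lift p \<otimes> s"
    using s lp(2) sc by (simp add: hop_def S_def m_assoc)
  have "[f (hop p s) + f (lift p) = f (lift p) + f s] (mod 2)"
  proof -
    have "[f (hop p s \<otimes> lift p) = f (hop p s) + f (lift p)] (mod 2)"
      using hom_modD[OF fh, of "hop p s" "lift p"] hop_S[OF p sc] lp by simp
    moreover have "[f (hop p s \<otimes> lift p) = f (lift p) + f s] (mod 2)"
      unfolding hp using hom_modD[OF fh, of "lift p" s] lp s by simp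
    ultimately show ?thesis by (rule cong_trans[OF cong_sym])
  qed
  then have "[f (hop p s) = f s] (mod 2)"
    by (simp add: add.commute[of "f (lift p)"] cong_add_rcancel)
  then show ?thesis using \<open>[\<phi> p s = 0] (mod 2)\<close> unfolding \<phi>_def by (rule cong_trans[OF cong_sym])
qed

text \<open>The product of the hops across the edges of \<open>Z\<close> sweeps \<open>Z\<close> and
  the connecting paths to \<open>p\<close>. The latter cancel modulo 2, because every vertex has
  even valence in \<open>Z\<close>.\<close>

lemma D0_surjective:
  assumes Z: "Z \<in> cycle_space Q"
  shows "\<exists>s\<in>S. D0 s = Z"
proof -
  have Zf: "finite Z" "Z \<subseteq> edges Q" and ev: "\<And>y. y \<in> verts Q \<Longrightarrow> even (the_enat (valence_in Q Z y))"
    using Z by (auto simp: cycle_space_def)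
  have r: "rep e \<in> X" "ed (rep e) = e" "keep (rep e)" if "e \<in> Z" for e using rep_edge that Zf(2) by blast+
  have "\<exists>s\<in>carrier SG. \<forall>f\<in>hom_mod 2 SG. [f s = (\<Sum>e\<in>Z. f (hop (rep e) A))] (mod 2)"
    by (rule SG.hom_mod_products[OF Zf(1)]) (use hop_S r A(1) in simp)
  then obtain s where s: "s \<in> S" "\<And>f. f \<in> hom_mod 2 SG \<Longrightarrow> [f s = (\<Sum>e\<in>Z. f (hop (rep e) A))] (mod 2)"
    by auto
  have "odd (N e' p s) \<longleftrightarrow> e' \<in> Z" if e': "e' \<in> edges Q" for e'
  proof -
    \<comment> \<open>Turns in \<open>Dd\<close> cost 0, so the cost of a connecting path depends on
      its final vertex alone and acts as a potential.\<close>
    define pot where "pot y = N e' p (lift (SOME w. w \<in> X \<and> vt w = y))" for y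
    have c0: "N e' v (g \<otimes> h) = N e' v g + N e' (st v g) h" if "v \<in> X" "g \<in> carrier G" "h \<in> carrier G" for v g h
      using cocycleD[OF N(1)[OF e'] that] by simp
    have lift_pot: "N e' p (lift v) = N e' p (lift\<^sub>0 (base v))" if v: "v \<in> X" for v
    proof -
      note b = lift(1)[OF v]
      have "N e' p (lift v) = N e' p (lift\<^sub>0 (base v)) + N e' (base v) (corner v)"
        using c0[OF p lift(3)[OF b], of "corner v"] lift(4)[OF b] Dd_carrier[OF lift(5)[OF v]] by (simp add: lift_def)
      then show ?thesis using N(2)[OF e' b lift(5)[OF v]] by simp
    qed
    have pot: "N e' p (lift v) = pot (vt v)" if v: "v \<in> X" for v
    proof -
      have "pot (vt v) = N e' p (lift (base v))" by (simp add: pot_def base_def)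
      also have "\<dots> = N e' p (lift\<^sub>0 (base (base v)))" by (rule lift_pot[OF lift(1)[OF v]])
      also have "base (base v) = base v" by (rule base_cong[OF lift(2)[OF v]])
      finally show ?thesis using lift_pot[OF v] by simp
    qed
    have hopN: "N e' p (hop v A) = pot (vt v) + N e' v A - pot (vt (st v A))" if v: "v \<in> X" for v
    proof -
      have vA: "st v A \<in> X" using v A(1) by simp
      note l = lift(7,8)[OF v] lift(7,8)[OF vA]
      have "N e' p (hop v A) = N e' p (lift v \<otimes> A) + N e' (st v A) (inv (lift (st v A)))"
        using c0[OF p, of "lift v \<otimes> A" "inv (lift (st v A))"] l A(1) p by (simp add: hop_def st_mult)
      moreover have "N e' p (lift v \<otimes> A) = pot (vt v) + N e' v A"
        using c0[OF p l(1) A(1)] l pot[OF v] by simp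
      moreover have "N e' p (lift (st v A)) + N e' (st v A) (inv (lift (st v A))) = N e' p \<one>"
        using c0[OF p l(3), of "inv (lift (st v A))"] l by simp
      moreover have "N e' p \<one> = 0" using cocycle_one[OF N(1)[OF e'] p] by simp
      ultimately show ?thesis using pot[OF vA] by simp
    qed
    let ?Y = "(\<lambda>e. vt (rep e)) ` Z \<union> (\<lambda>e. vt (st (rep e) A)) ` Z"
    have fY: "finite ?Y" using Zf(1) by simp
    have "[N e' p s = (\<Sum>e\<in>Z. N e' p (hop (rep e) A))] (mod 2)" by (rule s(2)[OF N_hom[OF e']])
    also have "[(\<Sum>e\<in>Z. N e' p (hop (rep e) A)) =
        (\<Sum>e\<in>Z. of_bool (e = e') + (pot (vt (rep e)) + pot (vt (st (rep e) A))))] (mod 2)"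
    proof (rule cong_sum)
      fix e assume e: "e \<in> Z"
      have "[N e' (rep e) A = of_bool (e = e')] (mod 2)" using N(3)[OF e' r(1)[OF e]] r(2)[OF e] by simp
      then have "2 dvd N e' (rep e) A - of_bool (e = e')" by (simp only: cong_iff_dvd_diff)
      then have "2 dvd (N e' (rep e) A - of_bool (e = e')) - 2 * pot (vt (st (rep e) A))" by (rule dvd_diff) simp
      also have "(N e' (rep e) A - of_bool (e = e')) - 2 * pot (vt (st (rep e) A)) = N e' p (hop (rep e) A) -
          (of_bool (e = e') + (pot (vt (rep e)) + pot (vt (st (rep e) A))))"
        unfolding hopN[OF r(1)[OF e]] by simp
      finally show "[N e' p (hop (rep e) A) = of_bool (e = e') + (pot (vt (rep e)) + pot (vt (st (rep e) A)))] (mod 2)"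
        by (simp only: cong_iff_dvd_diff)
    qed
    also have "(\<Sum>e\<in>Z. of_bool (e = e') + (pot (vt (rep e)) + pot (vt (st (rep e) A)))) =
        of_bool (e' \<in> Z) + (\<Sum>e\<in>Z. \<Sum>y\<in>?Y. pot y * inc y (rep e))"
    proof -
      have "(\<Sum>e\<in>Z. of_bool (e = e')) = (of_bool (e' \<in> Z) :: int)" using Zf(1) by (simp add: of_bool_def)
      moreover have "pot (vt (rep e)) + pot (vt (st (rep e) A)) = (\<Sum>y\<in>?Y. pot y * inc y (rep e))" if e: "e \<in> Z" for e
      proof -
        have "(\<Sum>y\<in>?Y. pot y * inc y (rep e)) =
            (\<Sum>y\<in>?Y. if y = vt (rep e) then pot y else 0) + (\<Sum>y\<in>?Y. if y = vt (st (rep e) A) then pot y else 0)"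
          unfolding sum.distrib[symmetric] by (intro sum.cong) (auto simp: inc_def)
        also have "\<dots> = pot (vt (rep e)) + pot (vt (st (rep e) A))"
          using fY e by (simp add: sum.delta)
        finally show ?thesis by simp
      qed
      ultimately show ?thesis by (simp add: sum.distrib)
    qed
    also have "(\<Sum>e\<in>Z. \<Sum>y\<in>?Y. pot y * inc y (rep e)) = (\<Sum>y\<in>?Y. pot y * (\<Sum>e\<in>Z. inc y (rep e)))"
      by (subst sum.swap) (simp add: sum_distrib_left)
    also have "[of_bool (e' \<in> Z) + (\<Sum>y\<in>?Y. pot y * (\<Sum>e\<in>Z. inc y (rep e))) = of_bool (e' \<in> Z) + (\<Sum>y\<in>?Y. pot y * 0)] (mod 2)"
    proof (intro cong_add cong_refl cong_sum cong_mult)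
      fix y assume "y \<in> ?Y"
      then obtain e where e: "e \<in> Z" "y = vt (rep e) \<or> y = vt (st (rep e) A)" by blast
      have "\<not> lf y" using ends[OF r(1,3)[OF e(1)]] e(2) by blast
      moreover have "st (rep e) A \<in> X" using r(1)[OF e(1)] A(1) by simp
      ultimately have "y \<in> verts Q" using verts e(2) r(1)[OF e(1)] by blast
      then have "even (int (the_enat (valence_in Q Z y)))" using ev by simp
      then show "[(\<Sum>e\<in>Z. inc y (rep e)) = 0] (mod 2)"
        unfolding valence_inc[OF Zf] by (simp add: cong_0_iff)
    qed
    finally have "[N e' p s = of_bool (e' \<in> Z)] (mod 2)" by simp
    then show ?thesis by (cases "e' \<in> Z") (auto simp: cong_def odd_iff_mod_2_eq_one)
  qed
  then have "D0 s = Z" using Zf(2) by (auto simp: D0_def)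
  then show ?thesis using s(1) by blast
qed

lemma D0_mult:
  assumes "s \<in> S" "t \<in> S"
  shows "e \<in> D0 (s \<otimes> t) \<longleftrightarrow> (e \<in> D0 s) \<noteq> (e \<in> D0 t)"
proof (cases "e \<in> edges Q")
  case True
  have "[N e p (s \<otimes> t) = N e p s + N e p t] (mod 2)"
    using hom_modD[OF N_hom[OF True], of s t] assms by simp
  then have "even (N e p (s \<otimes> t)) \<longleftrightarrow> even (N e p s + N e p t)" by (rule cong_dvd_iff)
  then show ?thesis using True by (auto simp: D0_def)
qed (auto simp: D0_def)

lemma D0_torsion:
  assumes "s \<in> S" "s \<otimes> s = \<one>"
  shows "D0 s = {}"
proof -
  have "N e p s = 0" if e: "e \<in> edges Q" for e
  proof -
    have "N e p (s \<otimes> s) = N e p s + N e p s"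
      using cocycleD[OF N(1)[OF e] p, of s s] assms by (simp add: S_def)
    moreover have "N e p \<one> = 0" using cocycle_one[OF N(1)[OF e] p] by simp
    ultimately show ?thesis using assms(2) by simp
  qed
  then show ?thesis by (auto simp: D0_def)
qed

text \<open>Independent cycles lift to closed paths, and their dual functionals pull back along
  \<open>D0\<close>. Conversely, a dual system on \<open>S\<close> sweeps independent cycles, since
  by \<open>D0_kernel\<close> a product with vanishing cycle is invisible to the
  functionals.\<close>

theorem betti_dual_rank: "betti Q = dual_rank 2 S (hom_mod2_tf SG)"
proof (rule antisym)
  show "betti Q \<le> dual_rank 2 S (hom_mod2_tf SG)"
    unfolding betti_def
  proof (rule Sup_least, clarify)
    fix \<B> assume B: "finite \<B>" "\<B> \<subseteq> cycle_space Q" "independent_mod2 \<B>"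
    have "\<And>D. D \<in> \<B> \<Longrightarrow> finite D" using B(2) by (auto simp: cycle_space_def)
    then obtain w :: "'e set \<Rightarrow> 'e \<Rightarrow> int" where w: "\<forall>C\<in>\<B>. \<forall>D\<in>\<B>. [sum (w C) D = of_bool (C = D)] (mod 2)"
      using independent_mod2_dual[OF B(1,3)] by blast
    have "\<forall>C\<in>\<B>. \<exists>s. s \<in> S \<and> D0 s = C" using D0_surjective B(2) by blast
    then obtain x where x: "\<forall>C\<in>\<B>. x C \<in> S \<and> D0 (x C) = C" by metis
    have "enat (card \<B>) \<le> dual_rank 2 S (hom_mod2_tf SG)"
    proof (rule dual_rank_ge[OF B(1), where x = x and e = "\<lambda>C s. sum (w C) (D0 s)"])
      fix C assume C: "C \<in> \<B>"
      show "x C \<in> S" using x C by blast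
      have "[sum (w C) (D0 (s \<otimes> t)) = sum (w C) (D0 s) + sum (w C) (D0 t)] (mod 2)" if "s \<in> S" "t \<in> S" for s t
        by (rule sum_sym_diff_mod2) (use finite_D0 S_carrier D0_mult that in auto)
      then show "(\<lambda>s. sum (w C) (D0 s)) \<in> hom_mod2_tf SG"
        using D0_torsion by (simp add: hom_mod2_tf_def hom_mod_def)
    next
      fix C C' assume "C \<in> \<B>" "C' \<in> \<B>"
      then show "[sum (w C) (D0 (x C')) = of_bool (C = C')] (mod 2)" using w x by simp
    qed
    then show "ecard \<B> \<le> dual_rank 2 S (hom_mod2_tf SG)" using B(1) by (simp add: ecard_def)
  qed
next
  show "dual_rank 2 S (hom_mod2_tf SG) \<le> betti Q"
    unfolding dual_rank_def
  proof (rule Sup_least, clarify)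
    fix n :: nat and x f
    assume xf: "\<forall>i<n. x i \<in> S \<and> f i \<in> hom_mod2_tf SG"
      and dual: "\<forall>i<n. \<forall>j<n. [f i (x j) = of_bool (i = j)] (mod 2)"
    have sums: "\<exists>i\<in>J. \<not> [f i s = 0] (mod 2)"
      if J: "J \<subseteq> {..<n}" "J \<noteq> {}" and s: "\<forall>g\<in>hom_mod 2 SG. [g s = (\<Sum>j\<in>J. g (x j))] (mod 2)" for J s
    proof -
      obtain i where i: "i \<in> J" using J(2) by blast
      then have "i < n" using J(1) by blast
      then have "[f i s = (\<Sum>j\<in>J. f i (x j))] (mod 2)" using s xf by (simp add: hom_mod2_tf_def)
      also have "[(\<Sum>j\<in>J. f i (x j)) = (\<Sum>j\<in>J. of_bool (i = j))] (mod 2)"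
        by (rule cong_sum, rule dual[rule_format]) (use \<open>i < n\<close> J(1) in auto)
      also have "(\<Sum>j\<in>J. of_bool (i = j)) = (1 :: int)"
        using i finite_subset[OF J(1)] by (simp add: of_bool_def)
      finally have "[f i s = 1] (mod 2)" .
      then show ?thesis using i by (auto simp: cong_def)
    qed
    have indep: "\<exists>e. odd (card {j \<in> J. e \<in> D0 (x j)})" if J: "J \<subseteq> {..<n}" "J \<noteq> {}" for J
    proof (rule ccontr)
      assume no: "\<not> ?thesis"
      have fJ: "finite J" using J(1) finite_subset by blast
      have "\<exists>s\<in>carrier SG. \<forall>g\<in>hom_mod 2 SG. [g s = (\<Sum>j\<in>J. g (x j))] (mod 2)"
        by (rule SG.hom_mod_products[OF fJ]) (use xf J(1) in auto)
      then obtain s where s: "s \<in> S" "\<forall>g\<in>hom_mod 2 SG. [g s = (\<Sum>j\<in>J. g (x j))] (mod 2)" by auto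
      have "even (N e p s)" if e: "e \<in> edges Q" for e
      proof -
        have "[N e p s = (\<Sum>j\<in>J. N e p (x j))] (mod 2)" using s(2) N_hom[OF e] by blast
        also have "[(\<Sum>j\<in>J. N e p (x j)) = (\<Sum>j\<in>J. of_bool (e \<in> D0 (x j)))] (mod 2)"
          by (rule cong_sum) (use e in \<open>auto simp: D0_def cong_def odd_iff_mod_2_eq_one\<close>)
        also have "(\<Sum>j\<in>J. of_bool (e \<in> D0 (x j))) = int (card {j \<in> J. e \<in> D0 (x j)})"
          using fJ by (simp add: of_bool_def sum.If_cases Int_def)
        finally have "even (N e p s) \<longleftrightarrow> even (int (card {j \<in> J. e \<in> D0 (x j)}))" by (rule cong_dvd_iff)
        then show ?thesis using no by simp
      qed
      then have D: "D0 s = {}" by (auto simp: D0_def)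
      obtain i where i: "i \<in> J" "\<not> [f i s = 0] (mod 2)" using sums[OF J s(2)] by blast
      have "f i \<in> hom_mod2_tf SG" using i(1) J(1) xf by auto
      then show False using D0_kernel[OF _ s(1) D] i(2) by blast
    qed
    define \<B> where "\<B> = (\<lambda>i. D0 (x i)) ` {..<n}"
    \<comment> \<open>Two equal cycles would have sum zero, against \<open>indep\<close>.\<close>
    have inj: "inj_on (\<lambda>i. D0 (x i)) {..<n}"
    proof (rule inj_onI, rule ccontr)
      fix i j assume ij: "i \<in> {..<n}" "j \<in> {..<n}" "D0 (x i) = D0 (x j)" "i \<noteq> j"
      obtain e where e: "odd (card {l \<in> {i, j}. e \<in> D0 (x l)})" using indep[of "{i, j}"] ij by auto
      have "{l \<in> {i, j}. e \<in> D0 (x l)} = (if e \<in> D0 (x i) then {i, j} else {})" using ij(3) by auto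
      then show False using e ij(4) by (simp split: if_splits)
    qed
    have "independent_mod2 \<B>"
      unfolding independent_mod2_def
    proof (intro allI impI)
      fix \<D> assume D: "finite \<D> \<and> \<D> \<subseteq> \<B> \<and> \<D> \<noteq> {}"
      define J where "J = {j \<in> {..<n}. D0 (x j) \<in> \<D>}"
      have "J \<noteq> {}" using D by (auto simp: J_def \<B>_def)
      then obtain e where e: "odd (card {j \<in> J. e \<in> D0 (x j)})" using indep[of J] by (auto simp: J_def)
      have "{D \<in> \<D>. e \<in> D} = (\<lambda>i. D0 (x i)) ` {j \<in> J. e \<in> D0 (x j)}"
        using D by (auto simp: J_def \<B>_def)
      moreover have "inj_on (\<lambda>i. D0 (x i)) {j \<in> J. e \<in> D0 (x j)}"
        by (rule inj_on_subset[OF inj]) (auto simp: J_def)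
      ultimately have "card {D \<in> \<D>. e \<in> D} = card {j \<in> J. e \<in> D0 (x j)}" by (simp add: card_image)
      then have "odd (card {D \<in> \<D>. e \<in> D})" using e by simp
      then show "sum_mod2 \<D> \<noteq> {}" unfolding sum_mod2_def by blast
    qed
    moreover have "\<B> \<subseteq> cycle_space Q" using D0_cycle xf by (auto simp: \<B>_def)
    moreover have "finite \<B>" "ecard \<B> = enat n" using card_image[OF inj] by (simp_all add: \<B>_def ecard_def)
    ultimately show "enat n \<le> betti Q"
      unfolding betti_def by (metis (mono_tags, lifting) Sup_upper mem_Collect_eq)
  qed
qed

end

section \<open>The graphs of a Neumann subgroup\<close>

abbreviation act (infixl "\<triangleright>" 70) where "v \<triangleright> g \<equiv> v #>\<^bsub>PGL2Z\<^esub> g"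

section \<open>The action on the cosets and the labels of the edges\<close>

context neumann
begin

definition X where "X = rcosets\<^bsub>PGL2Z\<^esub> S"

lemma S_sub: "S \<subseteq> Mh"
  using S_Mh by blast

lemma X_iff: "v \<in> X \<longleftrightarrow> (\<exists>g\<in>Mh. v = S \<triangleright> g)"
  by (auto simp: X_def RCOSETS_def)

lemma act_assoc: "g \<in> Mh \<Longrightarrow> h \<in> Mh \<Longrightarrow> S \<triangleright> g \<triangleright> h = S \<triangleright> (g \<star> h)"
  using PG.coset_mult_assoc[OF S_sub] .

lemma act_one: "S \<triangleright> \<e> = S"
  using PG.coset_mult_one[OF S_sub] .

sublocale XA: state_action PGL2Z X act
proof
  fix v g h assume v: "v \<in> X" and g: "g \<in> Mh" and h: "h \<in> Mh"
  obtain x where x: "x \<in> Mh" "v = S \<triangleright> x" using v X_iff by blast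
  show "v \<triangleright> g \<in> X" using x g by (auto simp: X_iff act_assoc)
  show "v \<triangleright> (g \<star> h) = v \<triangleright> g \<triangleright> h" using x g h by (simp add: act_assoc PG.m_assoc)
next
  fix v assume "v \<in> X"
  then obtain x where x: "x \<in> Mh" "v = S \<triangleright> x" using X_iff by blast
  then show "v \<triangleright> \<e> = v" by (simp add: act_assoc)
qed

lemma S_X: "S \<in> X"
  using act_one X_iff PG.one_closed by metis

lemma act_S_iff: "g \<in> Mh \<Longrightarrow> S \<triangleright> g = S \<longleftrightarrow> g \<in> S"
  using PG.coset_join1[OF _ _ sub] PG.coset_join2[OF _ sub] by blast

lemma act_eq_iff:
  assumes "g \<in> Mh" "h \<in> Mh"
  shows "S \<triangleright> g = S \<triangleright> h \<longleftrightarrow> g \<star> pinv h \<in> S"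
proof
  assume eq: "S \<triangleright> g = S \<triangleright> h"
  have "S \<triangleright> (g \<star> pinv h) = S \<triangleright> g \<triangleright> pinv h" using assms by (simp add: act_assoc)
  also have "\<dots> = S" unfolding eq using assms by (simp add: act_assoc act_one)
  finally show "g \<star> pinv h \<in> S" using act_S_iff assms by simp
next
  assume "g \<star> pinv h \<in> S"
  then have "S \<triangleright> (g \<star> pinv h) = S" using act_S_iff assms by simp
  then have "S \<triangleright> (g \<star> pinv h) \<triangleright> h = S \<triangleright> h" by simp
  moreover have "(g \<star> pinv h) \<star> h = g" using assms by (simp add: PG.m_assoc)
  ultimately show "S \<triangleright> g = S \<triangleright> h" using assms by (simp add: act_assoc)
qed

lemma fixed_conj:
  assumes v: "v \<in> X" "g \<in> Mh" "v \<triangleright> g = v"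
  obtains x where "x \<in> Mh" "x \<star> g \<star> pinv x \<in> S"
proof -
  obtain x where x: "x \<in> Mh" "v = S \<triangleright> x" using v X_iff by blast
  then have "S \<triangleright> (x \<star> g) = S \<triangleright> x" using v by (simp add: act_assoc)
  then have "x \<star> g \<star> pinv x \<in> S" using act_eq_iff[of "x \<star> g" x] x v by simp
  then show ?thesis using that x by blast
qed

lemma act_cancel:
  assumes "v \<in> X"
  shows "v \<triangleright> mA \<triangleright> mA = v" "v \<triangleright> mU \<triangleright> mU = v" "v \<triangleright> mB \<triangleright> B2 = v" "v \<triangleright> B2 \<triangleright> mB = v"
    "v \<triangleright> mB \<triangleright> mB = v \<triangleright> B2" "v \<triangleright> B2 \<triangleright> B2 = v \<triangleright> mB" "v \<triangleright> mU \<triangleright> mA = v \<triangleright> mA \<triangleright> mU"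
    "v \<triangleright> mU \<triangleright> mB = v \<triangleright> B2 \<triangleright> mU" "v \<triangleright> mU \<triangleright> B2 = v \<triangleright> mB \<triangleright> mU"
  using assms by (simp_all add: XA.st_mult[symmetric] letter_relations)

lemma reflection_free:
  assumes "v \<in> X" "g \<in> Mh" "g \<star> g = \<e>" "g \<notin> PSL2Z"
  shows "v \<triangleright> g \<noteq> v"
  using fixed_conj[OF assms(1,2)] no_conj_reflection assms(2-4) by blast

lemma act_A_U: "v \<in> X \<Longrightarrow> v \<triangleright> mA \<noteq> v \<triangleright> mU"
proof
  assume v: "v \<in> X" and eq: "v \<triangleright> mA = v \<triangleright> mU"
  have "v \<triangleright> (mA \<star> mU) = v \<triangleright> mA \<triangleright> mU" using v by (simp add: XA.st_mult)
  also have "\<dots> = v" unfolding eq using v by (simp add: act_cancel)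
  finally have "v \<triangleright> (mA \<star> mU) = v" .
  moreover have "(mA \<star> mU) \<star> (mA \<star> mU) = \<e>" by (simp add: left_norm flip: PG.m_assoc)
  moreover have "mA \<star> mU \<notin> PSL2Z" using PSL2Z_mult[of mA mU] gens_PSL2Z by simp
  ultimately show False using reflection_free[OF v, of "mA \<star> mU"] by simp
qed

text \<open>Every coset has a representative t' in \<open>That\<close>, so its stabilizer is the
  conjugate of \<open>S\<close> by an element of \<open>That\<close> and still meets
  \<open>That\<close> trivially.\<close>

lemma That_free:
  assumes v: "v \<in> X" "t \<in> That" "v \<triangleright> t = v"
  shows "t = \<e>"
proof -
  have tM: "t \<in> Mh" using That_Mh[OF v(2)] .
  obtain x where x: "x \<in> Mh" "x \<star> t \<star> pinv x \<in> S" using fixed_conj[OF v(1) tM v(3)] .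
  obtain s t' where s: "s \<in> S" "t' \<in> That" "x = s \<star> t'" using S_That_factor[OF x(1)] .
  have M: "s \<in> Mh" "t' \<in> Mh" using s S_Mh That_Mh by auto
  have "t' \<star> t \<star> pinv t' = pinv s \<star> (x \<star> t \<star> pinv x) \<star> s"
  proof -
    have "pinv s \<star> (x \<star> t \<star> pinv x) \<star> s = (pinv s \<star> s) \<star> (t' \<star> t \<star> pinv t') \<star> (pinv s \<star> s)"
      unfolding s(3) using M tM by (simp only: PG.m_assoc PG.m_closed PG.inv_closed PG.inv_mult_group)
    then show ?thesis using M tM by simp
  qed
  then have "t' \<star> t \<star> pinv t' \<in> S" using x(2) s(1) S_mult S_inv by simp
  moreover have "t' \<star> t \<star> pinv t' \<in> That"
    using s(2) v(2) subgroup.m_closed[OF subgroup_That] subgroup.m_inv_closed[OF subgroup_That] by simp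
  ultimately have "t' \<star> t \<star> pinv t' = \<e>" using S_That by blast
  then show ?thesis using conj_eq_one[OF tM M(2)] by simp
qed

text \<open>Equality would make C = AB fix a coset. Hence contracting the B-edges turns an A-edge
  into a loop only if A fixes its end.\<close>

lemma act_A_B: assumes v: "v \<in> X" shows "v \<triangleright> mA \<noteq> v \<triangleright> mB" "v \<triangleright> mA \<noteq> v \<triangleright> B2"
proof -
  have C: "mA \<star> mB \<in> That" "mA \<star> mB \<noteq> \<e>"
    using Cpow_That[of 1] Cpow_eq_one[of 1] by (simp_all add: Cpow_1)
  show "v \<triangleright> mA \<noteq> v \<triangleright> B2"
  proof
    assume "v \<triangleright> mA = v \<triangleright> B2"
    then have "v \<triangleright> mA \<triangleright> mB = v" using v by (simp add: act_cancel)
    then show False using That_free[OF v C(1)] C(2) v by (simp add: XA.st_mult)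
  qed
  show "v \<triangleright> mA \<noteq> v \<triangleright> mB"
  proof
    assume eq: "v \<triangleright> mA = v \<triangleright> mB"
    have vA: "v \<triangleright> mA \<in> X" using v by simp
    have "v \<triangleright> mA \<triangleright> (mA \<star> mB) = v \<triangleright> mA \<triangleright> mA \<triangleright> mB" using vA by (simp add: XA.st_mult)
    also have "\<dots> = v \<triangleright> mA" unfolding act_cancel(1)[OF v] by (rule eq[symmetric])
    finally show False using That_free[OF vA C(1)] C(2) by blast
  qed
qed

lemma B_orbit: assumes v: "v \<in> X" shows "B_orbit v = {v, v \<triangleright> mB, v \<triangleright> B2}"
proof -
  have Bz: "mB [^]\<^bsub>PGL2Z\<^esub> (k::int) \<in> HB" for k
    by (rule PG.subgroup_int_pow_closed[OF subgroup_HB]) (simp add: HB_def)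
  have "mB [^]\<^bsub>PGL2Z\<^esub> (0::int) = \<e>" "mB [^]\<^bsub>PGL2Z\<^esub> (1::int) = mB" "mB [^]\<^bsub>PGL2Z\<^esub> (2::int) = B2"
    by (simp_all add: PG.int_pow_1 int_pow_def2 numeral_2_eq_2)
  then have "HB \<subseteq> range (\<lambda>k::int. mB [^]\<^bsub>PGL2Z\<^esub> k)" unfolding HB_def by (metis (no_types, lifting) empty_subsetI insert_subset rangeI)
  then have "range (\<lambda>k::int. mB [^]\<^bsub>PGL2Z\<^esub> k) = HB" using Bz by blast
  then have "B_orbit v = (\<lambda>d. v \<triangleright> d) ` HB" by (simp add: B_orbit_def image_image[symmetric])
  then show ?thesis using v by (simp add: HB_def)
qed

lemma B_orbit_eq: assumes "v \<in> X" "w \<in> X" shows "B_orbit v = B_orbit w \<longleftrightarrow> w \<in> {v, v \<triangleright> mB, v \<triangleright> B2}"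
proof
  assume "B_orbit v = B_orbit w"
  then show "w \<in> {v, v \<triangleright> mB, v \<triangleright> B2}" using B_orbit assms by blast
next
  assume "w \<in> {v, v \<triangleright> mB, v \<triangleright> B2}"
  then show "B_orbit v = B_orbit w" using assms(1) by (auto simp: B_orbit act_cancel)
qed

lemma V_mk: "mV = mA \<star> mU" by (rule relations)

definition CV where "CV n e = Cpow n \<star> mV [^]\<^bsub>PGL2Z\<^esub> (e::nat)"

lemma CV_mk: "CV n 0 = pm (mk 1 n 0 1)" "CV n (Suc 0) = pm (mk (- 1) n 0 1)"
  by (simp_all add: CV_def mC_pow unimod_mk gens_mk(1,3) pm_mk_mult)

lemma CV_Mh [simp]: "CV n e \<in> Mh"
  by (simp add: CV_def)

lemma CV_That: "e \<in> {0, 1} \<Longrightarrow> CV n e \<in> That"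
proof -
  have "pm (mk 1 n 0 1) \<in> That" "pm (mk (- 1) n 0 1) \<in> That" unfolding That_mk by blast+
  then show "e \<in> {0, 1} \<Longrightarrow> CV n e \<in> That" by (auto simp: CV_mk)
qed

lemma That_CV: "t \<in> That \<Longrightarrow> \<exists>n. \<exists>e\<in>{0, 1}. t = CV n e"
  by (auto simp: CV_mk That_mk)

lemma CV_eq: "e \<in> {0, 1} \<Longrightarrow> e' \<in> {0, 1} \<Longrightarrow> CV n e = CV n' e' \<Longrightarrow> n = n' \<and> e = e'"
  by (auto simp: CV_mk pm_eq_iff)

lemma coset_at_CV: "coset_at S n e = S \<triangleright> CV n e"
  by (simp add: coset_at_def CV_def)

lemma coset_at_X [simp]: "coset_at S n e \<in> X"
  by (auto simp: coset_at_CV X_iff)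

lemma coset_at_ex: assumes "v \<in> X" shows "\<exists>n. \<exists>e\<in>{0, 1}. v = coset_at S n e"
proof -
  obtain g where g: "g \<in> Mh" "v = S \<triangleright> g" using assms X_iff by blast
  obtain s t where s: "s \<in> S" "t \<in> That" "g = s \<star> t" using S_That_factor[OF g(1)] .
  have M: "s \<in> Mh" "t \<in> Mh" using s S_Mh That_Mh by auto
  have "v = S \<triangleright> s \<triangleright> t" using g s M by (simp add: act_assoc)
  also have "S \<triangleright> s = S" using act_S_iff M s by simp
  finally show ?thesis using That_CV[OF s(2)] coset_at_CV by auto
qed

lemma coset_at_eq:
  assumes "e \<in> {0, 1}" "e' \<in> {0, 1}" "coset_at S n e = coset_at S n' e'"
  shows "n = n'" "e = e'"
proof -
  have "CV n e \<star> pinv (CV n' e') \<in> S"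
    using assms(3) act_eq_iff by (simp add: coset_at_CV)
  moreover have "CV n e \<star> pinv (CV n' e') \<in> That"
    using CV_That assms(1,2) subgroup.m_closed[OF subgroup_That] subgroup.m_inv_closed[OF subgroup_That] by blast
  ultimately have "CV n e \<star> pinv (CV n' e') = \<e>" using S_That by blast
  then have "CV n e = CV n' e'" by (metis CV_Mh PG.inv_equality PG.inv_inv PG.inv_closed)
  from CV_eq[OF assms(1,2) this] show "n = n'" "e = e'" by simp_all
qed

lemma coset_at_V: "e \<in> {0, 1} \<Longrightarrow> coset_at S n e \<triangleright> mV = coset_at S n (1 - e)"
proof -
  have "mV \<star> mV = \<e>" by (simp add: V_mk left_norm flip: PG.m_assoc)
  then have "CV n 0 \<star> mV = CV n 1" "CV n 1 \<star> mV = CV n 0" by (simp_all add: CV_def PG.m_assoc)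
  then show "e \<in> {0, 1} \<Longrightarrow> coset_at S n e \<triangleright> mV = coset_at S n (1 - e)"
    by (auto simp: coset_at_CV act_assoc)
qed

lemma act_V: "v \<in> X \<Longrightarrow> v \<triangleright> mV = v \<triangleright> mA \<triangleright> mU"
  by (simp add: V_mk XA.st_mult)

lemma sign_exp_vals [simp]: "sign_exp 1 = 0" "sign_exp (- 1) = 1"
  by (simp_all add: sign_exp_def)

text \<open>The existence and uniqueness behind the two definite descriptions: each coset has
  exactly one representative in \<open>That\<close>.\<close>

lemma iota_delta:
  "delta S n \<in> {- 1, 1}" "coset_at S n 0 \<triangleright> mA = coset_at S (iota S n) (sign_exp (delta S n))"
proof -
  obtain m e where me: "e \<in> {0, 1}" "coset_at S n 0 \<triangleright> mA = coset_at S m e"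
    using coset_at_ex[of "coset_at S n 0 \<triangleright> mA"] by auto
  define d :: int where "d = (if e = 0 then 1 else - 1)"
  have d: "d \<in> {- 1, 1}" "sign_exp d = e" using me(1) by (auto simp: d_def)
  have se: "sign_exp d' \<in> {0, 1}" if "d' \<in> {- 1, 1}" for d' using that by auto
  have i: "iota S n = m"
    unfolding iota_def
  proof (rule the_equality)
    show "\<exists>d\<in>{- 1, 1}. coset_at S n 0 \<triangleright> mA = coset_at S m (sign_exp d)" using d me by blast
    fix m' assume "\<exists>d\<in>{- 1, 1}. coset_at S n 0 \<triangleright> mA = coset_at S m' (sign_exp d)"
    then show "m' = m" using coset_at_eq(1) se me by metis
  qed
  have "delta S n = d"
    unfolding delta_def i
  proof (rule the_equality)
    show "d \<in> {- 1, 1} \<and> coset_at S n 0 \<triangleright> mA = coset_at S m (sign_exp d)" using d me by blast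
    fix d' assume d': "d' \<in> {- 1, 1} \<and> coset_at S n 0 \<triangleright> mA = coset_at S m (sign_exp d')"
    then have "coset_at S m (sign_exp d') = coset_at S m e" "d' \<in> {- 1, 1}" using me(2) by simp_all
    then have "sign_exp d' = e" using coset_at_eq(2)[OF se me(1)] by blast
    then show "d' = d" using d \<open>d' \<in> {- 1, 1}\<close> by auto
  qed
  then show "delta S n \<in> {- 1, 1}" "coset_at S n 0 \<triangleright> mA = coset_at S (iota S n) (sign_exp (delta S n))"
    using d me i by simp_all
qed

lemma coset_at_A: assumes "e \<in> {0, 1}" shows "\<exists>e'\<in>{0, 1}. coset_at S n e \<triangleright> mA = coset_at S (iota S n) e'"
proof -
  define e0 where "e0 = sign_exp (delta S n)"
  have e0: "e0 \<in> {0, 1}" using iota_delta(1)[of n] by (auto simp: e0_def)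
  note A0 = iota_delta(2)[of n, folded e0_def]
  show ?thesis
  proof (cases "e = 0")
    case True
    then show ?thesis using A0 e0 by blast
  next
    case False
    then have e: "e = 1" using assms by simp
    have "coset_at S n 1 = coset_at S n 0 \<triangleright> mV" using coset_at_V[of 0 n] by simp
    then have "coset_at S n 1 \<triangleright> mA = coset_at S n 0 \<triangleright> mA \<triangleright> mV"
      by (simp add: act_V act_cancel)
    also have "\<dots> = coset_at S (iota S n) (1 - e0)" unfolding A0 by (rule coset_at_V[OF e0])
    finally show ?thesis using e e0 by (intro bexI[of _ "1 - e0"]) auto
  qed
qed

lemma iota_iota: "iota S (iota S n) = n"
proof -
  obtain e where e: "e \<in> {0, 1}" "coset_at S n 0 \<triangleright> mA = coset_at S (iota S n) e"
    using coset_at_A[of 0 n] by auto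
  obtain e' where e': "e' \<in> {0, 1}" "coset_at S (iota S n) e \<triangleright> mA = coset_at S (iota S (iota S n)) e'"
    using coset_at_A[OF e(1)] by blast
  have "coset_at S n 0 = coset_at S (iota S (iota S n)) e'"
    using e'(2) e(2)[symmetric] by (simp add: act_cancel)
  from coset_at_eq(1)[OF _ e'(1) this] show ?thesis by simp
qed

text \<open>\<open>Sigma_gen S n\<close> has the form C^n A t with t in \<open>That\<close>, so
  equality for n and m puts A C^(n-m) A into \<open>That\<close>.\<close>

lemma Sigma_inj: assumes "Sigma_gen S n = Sigma_gen S m" shows "n = m"
proof -
  define t where "t n = mV [^]\<^bsub>PGL2Z\<^esub> sign_exp (delta S n) \<star> Cpow (- iota S n)" for n
  have t: "t n \<in> That" for n
  proof -
    have "CV 0 (sign_exp (delta S n)) \<in> That" using iota_delta(1)[of n] CV_That by auto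
    then have "mV [^]\<^bsub>PGL2Z\<^esub> sign_exp (delta S n) \<in> That" by (simp add: CV_def)
    then show ?thesis using Cpow_That subgroup.m_closed[OF subgroup_That] by (simp add: t_def)
  qed
  have tM: "t n \<in> Mh" for n using That_Mh[OF t] .
  have Sg: "Sigma_gen S n = Cpow n \<star> (mA \<star> t n)" for n
    by (simp add: Sigma_gen_def t_def PG.m_assoc)
  have "Cpow (- m) \<star> (Cpow n \<star> (mA \<star> t n)) = Cpow (- m) \<star> (Cpow m \<star> (mA \<star> t m))"
    using assms unfolding Sg by simp
  then have "Cpow (n - m) \<star> (mA \<star> t n) = mA \<star> t m"
    using Cpow_add[of "- m" n] Cpow_add[of "- m" m] tM by (simp add: PG.m_assoc[symmetric] Cpow_eq_one)
  then have "mA \<star> (Cpow (n - m) \<star> (mA \<star> t n)) \<star> pinv (t n) = mA \<star> (mA \<star> t m) \<star> pinv (t n)" by simp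
  then have "mA \<star> Cpow (n - m) \<star> mA = t m \<star> pinv (t n)"
    using tM by (simp add: PG.m_assoc) (simp add: letter_relations flip: PG.m_assoc)
  moreover have "t m \<star> pinv (t n) \<in> That"
    using t subgroup.m_closed[OF subgroup_That] subgroup.m_inv_closed[OF subgroup_That] by blast
  ultimately have "mA \<star> Cpow (n - m) \<star> mA \<in> That" by (simp only:)
  from A_C_pow_A_That[OF this] show ?thesis by simp
qed

definition ed_bar :: "pgl_coset \<Rightarrow> pgl_coset set" where "ed_bar v = {v, v \<triangleright> mA}"

lemma A_edges_eq: "A_edges S = ed_bar ` X"
  by (simp add: A_edges_def ed_bar_def X_def)

lemma label_eq:
  assumes "e \<in> {0, 1}"
  shows "label S (ed_bar (coset_at S n e)) = {Sigma_gen S n, Sigma_gen S (iota S n)}"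
  unfolding label_def
proof (rule the_equality)
  show "\<exists>m. \<exists>e'\<in>{0, 1}. coset_at S m e' \<in> ed_bar (coset_at S n e) \<and>
      {Sigma_gen S n, Sigma_gen S (iota S n)} = {Sigma_gen S m, Sigma_gen S (iota S m)}"
    using assms by (intro exI[of _ n] bexI[of _ e]) (simp_all add: ed_bar_def)
  fix L assume "\<exists>m. \<exists>e'\<in>{0, 1}. coset_at S m e' \<in> ed_bar (coset_at S n e) \<and>
      L = {Sigma_gen S m, Sigma_gen S (iota S m)}"
  then obtain m e' where m: "e' \<in> {0, 1}" "coset_at S m e' \<in> ed_bar (coset_at S n e)"
    "L = {Sigma_gen S m, Sigma_gen S (iota S m)}" by blast
  obtain e'' where e'': "e'' \<in> {0, 1}" "coset_at S n e \<triangleright> mA = coset_at S (iota S n) e''"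
    using coset_at_A[OF assms] by blast
  have "coset_at S m e' = coset_at S n e \<or> coset_at S m e' = coset_at S (iota S n) e''"
    using m(2) e''(2) by (simp add: ed_bar_def)
  then have "m = n \<or> m = iota S n" using coset_at_eq(1) m(1) assms e''(1) by blast
  then show "L = {Sigma_gen S n, Sigma_gen S (iota S n)}" using m(3) iota_iota by auto
qed

text \<open>By \<open>Sigma_inj\<close> a label determines the index up to \<open>iota\<close>. The
  cosets with the two indices are v, vUA, vA and vU, so edges with equal labels agree up to
  \<open>U\<close>.\<close>

lemma edge_class_eq:
  assumes v: "v \<in> X"
  shows "edge_class S (ed_bar v) = {ed_bar v, ed_bar (v \<triangleright> mU)}"
proof -
  obtain n e where n: "e \<in> {0, 1}" "v = coset_at S n e" using coset_at_ex[OF v] by blast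
  obtain e' where e': "e' \<in> {0, 1}" "v \<triangleright> mA = coset_at S (iota S n) e'" using coset_at_A[OF n(1)] n(2) by blast
  have vX: "v \<triangleright> mA \<in> X" "v \<triangleright> mU \<in> X" using v by simp_all
  have vU: "v \<triangleright> mU = coset_at S (iota S n) (1 - e')"
  proof -
    have "v \<triangleright> mA \<triangleright> mV = v \<triangleright> mU" using v by (simp add: act_V act_cancel)
    then show ?thesis using coset_at_V[OF e'(1)] e'(2) by simp
  qed
  have vV: "v \<triangleright> mU \<triangleright> mA = coset_at S n (1 - e)"
    using coset_at_V[OF n(1), of n] act_V[OF v] v n(2) by (simp add: act_cancel)
  have eA: "ed_bar (w \<triangleright> mA) = ed_bar w" if "w \<in> X" for w
    using that by (auto simp: ed_bar_def act_cancel)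
  have lab: "label S (ed_bar v) = {Sigma_gen S n, Sigma_gen S (iota S n)}" using label_eq[OF n(1)] n(2) by simp
  have labU: "label S (ed_bar (v \<triangleright> mU)) = label S (ed_bar v)"
    using label_eq[of "1 - e'" "iota S n"] e'(1) vU lab iota_iota by auto
  show ?thesis
  proof
    show "{ed_bar v, ed_bar (v \<triangleright> mU)} \<subseteq> edge_class S (ed_bar v)"
      using v vX labU by (auto simp: edge_class_def A_edges_eq)
    show "edge_class S (ed_bar v) \<subseteq> {ed_bar v, ed_bar (v \<triangleright> mU)}"
    proof
      fix b assume "b \<in> edge_class S (ed_bar v)"
      then obtain w where w: "w \<in> X" "b = ed_bar w" "label S b = label S (ed_bar v)"
        by (auto simp: edge_class_def A_edges_eq)
      obtain m f where m: "f \<in> {0, 1}" "w = coset_at S m f" using coset_at_ex[OF w(1)] by blast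
      have "{Sigma_gen S m, Sigma_gen S (iota S m)} = {Sigma_gen S n, Sigma_gen S (iota S n)}"
        using w lab label_eq[OF m(1)] m(2) by simp
      then have "m = n \<or> m = iota S n" using Sigma_inj by (metis insertCI insertE singletonD)
      then have "w \<in> {v, v \<triangleright> mU \<triangleright> mA, v \<triangleright> mA, v \<triangleright> mU}"
        using m n e' vU vV by auto
      then show "b \<in> {ed_bar v, ed_bar (v \<triangleright> mU)}" using w(2) eA v vX by auto
    qed
  qed
qed

end

section \<open>The graph with contracted B-edges\<close>

context neumann
begin

lemma PSLG_action: "state_action PSLG X act"
  by (intro state_action.intro state_action_axioms.intro PSLG.is_group)
    (use PSL2Z_carrier XA.st_mult in \<open>auto simp: subset_iff\<close>)

definition leaf_orbit :: "pgl_coset set \<Rightarrow> bool" where "leaf_orbit y \<longleftrightarrow> (\<exists>v. y = {v})"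

definition keep :: "pgl_coset \<Rightarrow> bool" where
  "keep v \<longleftrightarrow> v \<triangleright> mA \<noteq> v \<and> \<not> leaf_orbit (B_orbit v) \<and> \<not> leaf_orbit (B_orbit (v \<triangleright> mA))"

lemma leaf_orbit_iff: assumes v: "v \<in> X" shows "leaf_orbit (B_orbit v) \<longleftrightarrow> v \<triangleright> mB = v"
proof
  assume "leaf_orbit (B_orbit v)"
  then show "v \<triangleright> mB = v" using v by (auto simp: leaf_orbit_def B_orbit)
next
  assume "v \<triangleright> mB = v"
  then have "B_orbit v = {v}" using act_cancel(5)[OF v] by (simp add: B_orbit[OF v])
  then show "leaf_orbit (B_orbit v)" by (auto simp: leaf_orbit_def)
qed

lemma leaf_orbit_single: "v \<in> X \<Longrightarrow> leaf_orbit (B_orbit v) \<Longrightarrow> B_orbit v = {v}"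
  by (auto simp: leaf_orbit_def B_orbit)

lemma ed_bar_eq: assumes "v \<in> X" "w \<in> X" shows "ed_bar v = ed_bar w \<longleftrightarrow> w = v \<or> w = v \<triangleright> mA"
proof
  assume "ed_bar v = ed_bar w"
  then have "w \<in> ed_bar v" by (simp add: ed_bar_def)
  then show "w = v \<or> w = v \<triangleright> mA" by (simp add: ed_bar_def)
next
  assume "w = v \<or> w = v \<triangleright> mA"
  then show "ed_bar v = ed_bar w" using assms(1) by (auto simp: ed_bar_def act_cancel)
qed

lemma orbit_A: assumes v: "v \<in> X" shows "B_orbit v = B_orbit (v \<triangleright> mA) \<longleftrightarrow> v \<triangleright> mA = v"
  using B_orbit_eq[of v "v \<triangleright> mA"] act_A_B[OF v] v by auto

lemma is_loop_bar: assumes v: "v \<in> X" shows "is_loop (Gamma_bar S) (ed_bar v) \<longleftrightarrow> v \<triangleright> mA = v"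
proof -
  have "card {B_orbit v, B_orbit (v \<triangleright> mA)} = 1 \<longleftrightarrow> B_orbit v = B_orbit (v \<triangleright> mA)"
    by (auto simp: card_insert_if)
  then show ?thesis using orbit_A[OF v] by (simp add: is_loop_def Gamma_bar_def ed_bar_def)
qed

lemma ecard_one: "ecard {a} = 1"
  by (simp add: ecard_def one_enat_def)

lemma ecard_ge_2:
  assumes "a \<in> E" "b \<in> E" "a \<noteq> b"
  shows "ecard E \<ge> 2"
proof (cases "finite E")
  case True
  then have "card {a, b} \<le> card E" using assms by (intro card_mono) auto
  then show ?thesis using True assms(3) by (simp add: ecard_def numeral_eq_enat)
qed (simp add: ecard_def)

lemma bar0_ends: "ends (Gamma_bar0 S) a = B_orbit ` a" "ends (Gamma_bar S) a = B_orbit ` a"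
  by (simp_all add: Gamma_bar0_def Let_def Gamma_bar_def)

text \<open>A coset fixed by B carries one A-edge, which is no loop by \<open>act_A_B\<close>. In an
  orbit of three, the cosets v and vB already lie on different A-edges.\<close>

lemma valence_bar: assumes v: "v \<in> X" shows "valence (Gamma_bar S) (B_orbit v) = 1 \<longleftrightarrow> leaf_orbit (B_orbit v)"
proof -
  have E: "edges (Gamma_bar S) = A_edges S" by (simp add: Gamma_bar_def)
  show ?thesis
  proof
    have ends: "B_orbit v \<in> ends (Gamma_bar S) a \<longleftrightarrow> (\<exists>u\<in>a. B_orbit u = B_orbit v)" for a
      unfolding bar0_ends image_iff by (rule bex_cong[OF refl], rule eq_commute)
    assume lf: "leaf_orbit (B_orbit v)"
    have ed: "B_orbit v \<in> ends (Gamma_bar S) a \<longleftrightarrow> a = ed_bar v" if a: "a \<in> A_edges S" for a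
    proof
      obtain w where w: "w \<in> X" "a = ed_bar w" using a unfolding A_edges_eq by (rule imageE)
      assume "B_orbit v \<in> ends (Gamma_bar S) a"
      then obtain u where u: "u \<in> a" "B_orbit u = B_orbit v" using ends by blast
      have uX: "u \<in> X" using u(1) w by (auto simp: ed_bar_def)
      then have "u \<in> B_orbit v" using B_orbit[OF uX] u(2) by blast
      then have "u = v" using leaf_orbit_single[OF v lf] by simp
      then show "a = ed_bar v" using u(1) w ed_bar_eq[OF w(1) v] by (auto simp: ed_bar_def)
    next
      assume "a = ed_bar v"
      then show "B_orbit v \<in> ends (Gamma_bar S) a" using ends by (auto simp: ed_bar_def)
    qed
    have e1: "{a \<in> A_edges S. B_orbit v \<in> ends (Gamma_bar S) a} = {ed_bar v}"
      using ed v A_edges_eq by auto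
    have "v \<triangleright> mA \<noteq> v"
      using act_A_B(1)[OF v] leaf_orbit_iff[OF v] lf by auto
    then have e2: "{a \<in> A_edges S. B_orbit v \<in> ends (Gamma_bar S) a \<and> is_loop (Gamma_bar S) a} = {}"
      using ed is_loop_bar[OF v] by auto
    have e0: "ecard ({} :: pgl_coset set set) = 0" by (simp add: ecard_def zero_enat_def)
    show "valence (Gamma_bar S) (B_orbit v) = 1"
      unfolding valence_def valence_in_def E e1 e2 e0 by (simp add: ecard_one)
  next
    assume val: "valence (Gamma_bar S) (B_orbit v) = 1"
    show "leaf_orbit (B_orbit v)"
    proof (rule ccontr)
      assume "\<not> leaf_orbit (B_orbit v)"
      then have ne: "v \<triangleright> mB \<noteq> v" using leaf_orbit_iff[OF v] by simp
      let ?E = "{a \<in> A_edges S. B_orbit v \<in> ends (Gamma_bar S) a}"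
      have vB: "v \<triangleright> mB \<in> X" using v by simp
      have orb: "B_orbit (v \<triangleright> mB) = B_orbit v" using B_orbit_eq[OF v vB] by simp
      have "ed_bar v \<in> ?E" using v by (auto simp: A_edges_eq Gamma_bar_def ed_bar_def)
      moreover have "ed_bar (v \<triangleright> mB) \<in> ?E"
        using vB orb[symmetric] by (auto simp: A_edges_eq Gamma_bar_def ed_bar_def)
      moreover have "ed_bar v \<noteq> ed_bar (v \<triangleright> mB)"
        using ed_bar_eq[OF v vB] ne act_A_B(1)[OF v] by auto
      ultimately have "ecard ?E \<ge> 2" by (rule ecard_ge_2)
      then have "valence (Gamma_bar S) (B_orbit v) \<ge> 2"
        unfolding valence_def valence_in_def E by (rule add_increasing2[rotated]) simp
      then show False using val by (simp add: one_enat_def numeral_eq_enat)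
    qed
  qed
qed

lemma bar0_verts: "verts (Gamma_bar0 S) = {B_orbit v | v. v \<in> X \<and> \<not> leaf_orbit (B_orbit v)}"
proof -
  have "verts (Gamma_bar0 S) = {x \<in> B_orbit ` X. valence (Gamma_bar S) x \<noteq> 1}"
    by (simp add: Gamma_bar0_def Let_def Gamma_bar_def X_def)
  then show ?thesis using valence_bar by auto
qed

lemma bar0_edges: "edges (Gamma_bar0 S) = ed_bar ` {v \<in> X. keep v}"
proof -
  have "edges (Gamma_bar0 S) = {a \<in> A_edges S. \<not> is_loop (Gamma_bar S) a \<and>
      B_orbit ` a \<subseteq> {x \<in> B_orbit ` X. valence (Gamma_bar S) x \<noteq> 1}}"
    by (simp add: Gamma_bar0_def Let_def Gamma_bar_def X_def)
  also have "\<dots> = ed_bar ` {v \<in> X. \<not> is_loop (Gamma_bar S) (ed_bar v) \<and>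
      B_orbit ` ed_bar v \<subseteq> {x \<in> B_orbit ` X. valence (Gamma_bar S) x \<noteq> 1}}"
    unfolding A_edges_eq by blast
  also have "{v \<in> X. \<not> is_loop (Gamma_bar S) (ed_bar v) \<and>
      B_orbit ` ed_bar v \<subseteq> {x \<in> B_orbit ` X. valence (Gamma_bar S) x \<noteq> 1}} = {v \<in> X. keep v}"
  proof (rule Collect_cong, rule conj_cong[OF refl])
    fix v assume v: "v \<in> X"
    then have vA: "v \<triangleright> mA \<in> X" by simp
    have "B_orbit ` ed_bar v = {B_orbit v, B_orbit (v \<triangleright> mA)}" by (simp add: ed_bar_def)
    then show "(\<not> is_loop (Gamma_bar S) (ed_bar v) \<and>
        B_orbit ` ed_bar v \<subseteq> {x \<in> B_orbit ` X. valence (Gamma_bar S) x \<noteq> 1}) = keep v"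
      using v vA valence_bar[OF v] valence_bar[OF vA] is_loop_bar[OF v] by (simp add: keep_def)
  qed
  finally show ?thesis .
qed

lemma leaf_orbit_U: assumes v: "v \<in> X" shows "leaf_orbit (B_orbit (v \<triangleright> mU)) \<longleftrightarrow> leaf_orbit (B_orbit v)"
proof -
  have *: "leaf_orbit (B_orbit (w \<triangleright> mU))" if w: "w \<in> X" "leaf_orbit (B_orbit w)" for w
  proof -
    have "w \<triangleright> B2 = w" using leaf_orbit_single[OF w] B_orbit[OF w(1)] by auto
    then have "w \<triangleright> mU \<triangleright> mB = w \<triangleright> mU" by (simp only: act_cancel(8)[OF w(1)])
    then show ?thesis using leaf_orbit_iff[of "w \<triangleright> mU"] w by simp
  qed
  show ?thesis using *[of v] *[of "v \<triangleright> mU"] v by (auto simp: act_cancel)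
qed

lemma keep_inv: assumes v: "v \<in> X" shows "keep (v \<triangleright> mA) \<longleftrightarrow> keep v" "keep (v \<triangleright> mU) \<longleftrightarrow> keep v"
proof -
  have X: "v \<triangleright> mA \<in> X" "v \<triangleright> mU \<in> X" "v \<triangleright> mA \<triangleright> mU \<in> X" using v by simp_all
  have inj: "x \<triangleright> mU = y \<triangleright> mU \<longleftrightarrow> x = y" if "x \<in> X" "y \<in> X" for x y
    using act_cancel(2)[OF that(1)] act_cancel(2)[OF that(2)] by metis
  show "keep (v \<triangleright> mA) \<longleftrightarrow> keep v" using v by (auto simp: keep_def act_cancel)
  show "keep (v \<triangleright> mU) \<longleftrightarrow> keep v"
    using leaf_orbit_U[OF v] leaf_orbit_U[OF X(1)] inj[OF X(1) v] v by (simp add: keep_def act_cancel)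
qed

text \<open>PSL2(Z) is the free product of the groups generated by A and B, so costs on the two
  factors can be prescribed; the sign rule for \<open>\<kappa>\<close> is the cocycle condition for
  A^2 = 1.\<close>

lemma PSL_cocycle:
  fixes \<kappa> :: "pgl_coset \<Rightarrow> int"
  assumes \<kappa>: "\<And>v. v \<in> X \<Longrightarrow> \<kappa> (v \<triangleright> mA) = - \<kappa> v"
  shows "\<exists>N. cocycle PSLG X act 0 N \<and> (\<forall>v\<in>X. N v mA = \<kappa> v \<and> (\<forall>d\<in>HB. N v d = 0))"
proof -
  define c where "c v H x = (if H = HA \<and> x = mA then \<kappa> v else 0)" for v H x
  have c: "[c k H (x \<otimes>\<^bsub>PSLG\<^esub> y) = c k H x + c (k \<triangleright> x) H y] (mod 0)"
    if k: "k \<in> X" and H: "H \<in> {HA, HB}" and x: "x \<in> H" and y: "y \<in> H" for k H x y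
  proof (cases "H = HA")
    case True
    then have "x = \<e> \<or> x = mA" "y = \<e> \<or> y = mA" using x y by (auto simp: HA_def)
    moreover have "mA \<noteq> \<e>" "\<e> \<noteq> mA" using HA_HB_ne(2) by metis+
    ultimately have "c k H (x \<otimes>\<^bsub>PSLG\<^esub> y) = c k H x + c (k \<triangleright> x) H y"
      using \<kappa>[OF k] k True by (elim disjE; simp add: c_def letter_relations)
    then show ?thesis by simp
  qed (simp add: c_def)
  from free_product.cocycle_extension[OF FP.free_product_axioms PSLG_action, of c 0, OF c]
  obtain N where N: "cocycle PSLG X act 0 N" "\<forall>k\<in>X. \<forall>H\<in>{HA, HB}. \<forall>x\<in>H. [N k x = c k H x] (mod 0)"
    by blast
  have "N v mA = \<kappa> v" if "v \<in> X" for v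
    using N(2) that letters_in by (auto simp: c_def)
  moreover have "N v d = 0" if "v \<in> X" "d \<in> HB" for v d
    using N(2) that letters_in by (auto simp: c_def)
  ultimately show ?thesis using N(1) by blast
qed

lemma generate_A_HB: "generate PSLG (insert mA HB) = PSL2Z"
proof -
  have sub: "insert mA HB \<subseteq> PSL2Z" using gens_PSL2Z PSL2Z_mult by (auto simp: HB_def)
  have "generate PSLG (insert mA HB) = generate PGL2Z (insert mA HB)"
    using PG.generate_consistent[OF sub subgroup_PSL2Z] by simp
  also have "\<dots> = PSL2Z"
  proof
    show "generate PGL2Z (insert mA HB) \<subseteq> PSL2Z" by (rule PG.generate_subgroup_incl[OF sub subgroup_PSL2Z])
    have "generate PGL2Z {mA, mB} \<subseteq> generate PGL2Z (insert mA HB)"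
      by (rule PG.mono_generate) (auto simp: HB_def)
    then show "PSL2Z \<subseteq> generate PGL2Z (insert mA HB)" by (simp add: PSL2Z_generated)
  qed
  finally show ?thesis .
qed

theorem betti_Gamma_bar0:
  assumes nS: "\<not> S \<subseteq> PSL2Z"
  shows "betti (Gamma_bar0 S) =
    dual_rank 2 (S \<inter> PSL2Z) (hom_mod2_tf (PGL2Z\<lparr>carrier := S \<inter> PSL2Z\<rparr>))"
proof -
  have inst: "edge_path_graph PSLG X act S mA HB {\<e>} ed_bar B_orbit keep leaf_orbit (Gamma_bar0 S)"
  proof (intro edge_path_graph.intro edge_path_graph_axioms.intro PSLG_action)
    show "S \<in> X" by (rule S_X)
    show "\<exists>g\<in>carrier PSLG. S \<triangleright> g = v" if v: "v \<in> X" for v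
    proof -
      obtain g where g: "g \<in> Mh" "v = S \<triangleright> g" using v X_iff by blast
      \<comment> \<open>The hypothesis \<open>nS\<close> enters here: an element of \<open>S\<close>
        outside \<open>PSL2Z\<close> corrects the determinant of \<open>g\<close>, so
        \<open>PSL2Z\<close> alone is transitive on the cosets.\<close>
      obtain s where s: "s \<in> S" "s \<notin> PSL2Z" using nS by blast
      have sM: "s \<in> Mh" using S_Mh[OF s(1)] .
      have "S \<triangleright> (s \<star> g) = v" using act_S_iff[OF sM] s(1) g sM by (simp flip: act_assoc)
      then show ?thesis using g s(2) PSL2Z_mult[OF sM g(1)] by (cases "g \<in> PSL2Z") auto
    qed
    show "mA \<in> carrier PSLG" "mA \<otimes>\<^bsub>PSLG\<^esub> mA = \<one>\<^bsub>PSLG\<^esub>" using gens_PSL2Z letter_relations by simp_all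
    show "subgroup HB PSLG"
      using PG.subgroup_incl[OF subgroup_HB subgroup_PSL2Z] gens_PSL2Z PSL2Z_mult by (auto simp: HB_def)
    show "d \<otimes>\<^bsub>PSLG\<^esub> d = \<one>\<^bsub>PSLG\<^esub> \<or> d \<otimes>\<^bsub>PSLG\<^esub> d \<otimes>\<^bsub>PSLG\<^esub> d = \<one>\<^bsub>PSLG\<^esub>" if "d \<in> HB" for d
      using that by (auto simp: HB_def relations letter_relations)
    show "subgroup {\<e>} PSLG"
      using group.triv_subgroup[OF PSLG.is_group] by simp
    show "{\<e>} \<subseteq> HB" by (simp add: HB_def)
    show "k \<otimes>\<^bsub>PSLG\<^esub> mA = mA \<otimes>\<^bsub>PSLG\<^esub> k" if "k \<in> {\<e>}" for k using that by simp
    show "generate PSLG (insert mA HB) = carrier PSLG" using generate_A_HB by simp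
    show "B_orbit v = B_orbit w \<longleftrightarrow> (\<exists>d\<in>HB. w = v \<triangleright> d)" if "v \<in> X" "w \<in> X" for v w
      using B_orbit_eq[OF that] that by (auto simp: HB_def)
    show "ed_bar v = ed_bar w \<longleftrightarrow> (\<exists>k\<in>{\<e>}. w = v \<triangleright> k \<or> w = v \<triangleright> mA \<triangleright> k)" if "v \<in> X" "w \<in> X" for v w
      using ed_bar_eq[OF that] that by auto
    show "edges (Gamma_bar0 S) = ed_bar ` {v \<in> X. keep v}" by (rule bar0_edges)
    show "verts (Gamma_bar0 S) = {B_orbit v |v. v \<in> X \<and> \<not> leaf_orbit (B_orbit v)}" by (rule bar0_verts)
    show "ends (Gamma_bar0 S) (ed_bar v) = {B_orbit v, B_orbit (v \<triangleright> mA)} \<and>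
        \<not> leaf_orbit (B_orbit v) \<and> \<not> leaf_orbit (B_orbit (v \<triangleright> mA))" if "v \<in> X" "keep v" for v
      using that by (simp add: bar0_ends ed_bar_def keep_def)
    show "keep w" if "v \<in> X" "w \<in> X" "ed_bar v = ed_bar w" "keep v" for v w
      using ed_bar_eq[OF that(1,2)] that keep_inv by auto
    show "v \<triangleright> mA = v \<or> leaf_orbit (B_orbit v) \<or> leaf_orbit (B_orbit (v \<triangleright> mA))" if "v \<in> X" "\<not> keep v" for v
      using that by (auto simp: keep_def)
    show "ed_bar w = ed_bar v" if "v \<in> X" "w \<in> X" "leaf_orbit (B_orbit v)" "B_orbit w = B_orbit v" for v w
      using that leaf_orbit_single[of v] leaf_orbit_single[of w] by auto
    show "B_orbit (v \<triangleright> mA) \<noteq> B_orbit v" if "v \<in> X" "leaf_orbit (B_orbit v)" for v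
      using orbit_A[OF that(1)] act_A_B(1)[OF that(1)] leaf_orbit_iff[OF that(1)] that(2) by auto
    show "v \<triangleright> mA \<noteq> v \<triangleright> k" if "v \<in> X" "keep v" "k \<in> {\<e>}" for v k
      using that by (simp add: keep_def)
    show "\<exists>N. cocycle PSLG X act 0 N \<and> (\<forall>v\<in>X. N v mA = \<kappa> v \<and> (\<forall>d\<in>HB. N v d = 0))"
      if "\<And>v. v \<in> X \<Longrightarrow> \<kappa> (v \<triangleright> mA) = - \<kappa> v" for \<kappa> :: "pgl_coset \<Rightarrow> int"
      using PSL_cocycle[of \<kappa>] that by blast
  qed
  have "edge_path_graph.S PSLG act S = S \<inter> PSL2Z"
    unfolding edge_path_graph.S_def[OF inst] using act_S_iff PSL2Z_carrier by auto
  then show ?thesis using edge_path_graph.betti_dual_rank[OF inst] by simp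
qed

end

section \<open>The quotient graph by AV\<close>

lemma U_conj_PSL2Z: "m \<in> PSL2Z \<Longrightarrow> mU \<star> m \<star> mU \<in> PSL2Z"
  using PSL2Z_carrier PSL2Z_mult[of mU m] PSL2Z_mult[of "mU \<star> m" mU] gens_PSL2Z
  by (simp add: subset_iff)

context neumann
begin

lemma B_orbit_U:
  assumes v: "v \<in> X"
  shows "B_orbit (v \<triangleright> mU) = {v \<triangleright> mU, v \<triangleright> mB \<triangleright> mU, v \<triangleright> B2 \<triangleright> mU}"
proof -
  have "v \<triangleright> mU \<in> X" using v by simp
  from B_orbit[OF this] show ?thesis
    using act_cancel(8,9)[OF v] by (simp only: insert_commute)
qed

lemma vert_class_eq:
  assumes v: "v \<in> X"
  shows "vert_class (B_orbit v) = {B_orbit v, B_orbit (v \<triangleright> mU)}"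
proof -
  have "AV_image (B_orbit v) = B_orbit (v \<triangleright> mU)"
    unfolding AV_image_def B_orbit_U[OF v] B_orbit[OF v] by (simp flip: mU_def)
  then show ?thesis by (simp add: vert_class_def)
qed

lemma vert_class_iff:
  assumes v: "v \<in> X" and w: "w \<in> X"
  shows "vert_class (B_orbit v) = vert_class (B_orbit w) \<longleftrightarrow> (\<exists>d\<in>D3. w = v \<triangleright> d)"
proof -
  have vU: "v \<triangleright> mU \<in> X" and wU: "w \<triangleright> mU \<in> X" using v w by simp_all
  have "vert_class (B_orbit v) = vert_class (B_orbit w) \<longleftrightarrow>
      B_orbit v = B_orbit w \<or> B_orbit (v \<triangleright> mU) = B_orbit w"
  proof
    assume "vert_class (B_orbit v) = vert_class (B_orbit w)"
    then show "B_orbit v = B_orbit w \<or> B_orbit (v \<triangleright> mU) = B_orbit w"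
      unfolding vert_class_eq[OF v] vert_class_eq[OF w] by blast
  next
    assume "B_orbit v = B_orbit w \<or> B_orbit (v \<triangleright> mU) = B_orbit w"
    then show "vert_class (B_orbit v) = vert_class (B_orbit w)"
    proof
      assume "B_orbit v = B_orbit w"
      then show ?thesis by simp
    next
      assume eq: "B_orbit (v \<triangleright> mU) = B_orbit w"
      have "vert_class (B_orbit w) = vert_class (B_orbit (v \<triangleright> mU))" by (simp only: eq)
      also have "\<dots> = {B_orbit (v \<triangleright> mU), B_orbit v}"
        unfolding vert_class_eq[OF vU] act_cancel(2)[OF v] ..
      finally show ?thesis unfolding vert_class_eq[OF v] by (simp only: insert_commute)
    qed
  qed
  also have "\<dots> \<longleftrightarrow> w \<in> {v, v \<triangleright> mB, v \<triangleright> B2, v \<triangleright> mU, v \<triangleright> mB \<triangleright> mU, v \<triangleright> B2 \<triangleright> mU}"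
    unfolding B_orbit_eq[OF v w] B_orbit_eq[OF vU w] act_cancel(8,9)[OF v] by blast
  also have "\<dots> \<longleftrightarrow> (\<exists>d\<in>D3. w = v \<triangleright> d)"
    using v by (simp add: D3_def XA.st_mult)
  finally show ?thesis .
qed

definition ed_tilde :: "pgl_coset \<Rightarrow> pgl_coset set set" where "ed_tilde v = edge_class S (ed_bar v)"

definition leaf_class :: "pgl_coset set set \<Rightarrow> bool" where "leaf_class y \<longleftrightarrow> (\<exists>x\<in>y. leaf_orbit x)"

lemma ed_tilde_iff:
  assumes v: "v \<in> X" and w: "w \<in> X"
  shows "ed_tilde v = ed_tilde w \<longleftrightarrow> w = v \<or> w = v \<triangleright> mA \<or> w = v \<triangleright> mU \<or> w = v \<triangleright> mA \<triangleright> mU"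
proof -
  have X: "v \<triangleright> mU \<in> X" "w \<triangleright> mU \<in> X" "v \<triangleright> mA \<in> X" using v w by simp_all
  have t: "ed_tilde u = {ed_bar u, ed_bar (u \<triangleright> mU)}" if "u \<in> X" for u
    using edge_class_eq[OF that] by (simp add: ed_tilde_def)
  have "ed_tilde v = ed_tilde w \<longleftrightarrow> ed_bar v = ed_bar w \<or> ed_bar (v \<triangleright> mU) = ed_bar w"
  proof
    assume "ed_tilde v = ed_tilde w"
    then show "ed_bar v = ed_bar w \<or> ed_bar (v \<triangleright> mU) = ed_bar w"
      unfolding t[OF v] t[OF w] by blast
  next
    have U: "ed_tilde (u \<triangleright> mU) = ed_tilde u" if "u \<in> X" for u
      using that t[OF that] t[of "u \<triangleright> mU"] by (simp add: act_cancel insert_commute)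
    assume "ed_bar v = ed_bar w \<or> ed_bar (v \<triangleright> mU) = ed_bar w"
    then show "ed_tilde v = ed_tilde w"
    proof
      assume "ed_bar (v \<triangleright> mU) = ed_bar w"
      then have "ed_tilde (v \<triangleright> mU) = ed_tilde w" by (simp add: ed_tilde_def)
      then show ?thesis using U[OF v] by simp
    qed (simp add: ed_tilde_def)
  qed
  also have "\<dots> \<longleftrightarrow> w = v \<or> w = v \<triangleright> mA \<or> w = v \<triangleright> mU \<or> w = v \<triangleright> mA \<triangleright> mU"
    unfolding ed_bar_eq[OF v w] ed_bar_eq[OF X(1) w] act_cancel(7)[OF v] by blast
  finally show ?thesis .
qed

lemma leaf_class_iff: "v \<in> X \<Longrightarrow> leaf_class (vert_class (B_orbit v)) \<longleftrightarrow> leaf_orbit (B_orbit v)"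
  by (simp add: leaf_class_def vert_class_eq leaf_orbit_U)

lemma ends_tilde0:
  assumes v: "v \<in> X"
  shows "ends (Gamma_tilde0 S) (ed_tilde v) = {vert_class (B_orbit v), vert_class (B_orbit (v \<triangleright> mA))}"
proof -
  have X: "v \<triangleright> mU \<in> X" "v \<triangleright> mA \<in> X" using v by simp_all
  have U: "vert_class (B_orbit (u \<triangleright> mU)) = vert_class (B_orbit u)" if u: "u \<in> X" for u
    using vert_class_iff[OF u, of "u \<triangleright> mU"] u by (auto simp: D3_def)
  have "ends (Gamma_tilde0 S) (ed_tilde v) = (\<Union>a\<in>ed_tilde v. vert_class ` B_orbit ` a)"
    by (simp add: Gamma_tilde0_def Gamma_tilde_def bar0_ends)
  also have "\<dots> = {vert_class (B_orbit v), vert_class (B_orbit (v \<triangleright> mA)),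
      vert_class (B_orbit (v \<triangleright> mU)), vert_class (B_orbit (v \<triangleright> mA \<triangleright> mU))}"
    unfolding ed_tilde_def edge_class_eq[OF v] unfolding ed_bar_def act_cancel(7)[OF v] by auto
  also have "\<dots> = {vert_class (B_orbit v), vert_class (B_orbit (v \<triangleright> mA))}"
    unfolding U[OF v] U[OF X(2)] by blast
  finally show ?thesis .
qed

text \<open>The cocycle on \<open>PSL2Z\<close> is extended by charging nothing for U. This is
  consistent: reflecting the cocycle by U gives a cocycle with the same values on A and B, hence the
  same one.\<close>

lemma PGL_cocycle:
  fixes \<kappa> :: "pgl_coset \<Rightarrow> int"
  assumes \<kappa>A: "\<And>v. v \<in> X \<Longrightarrow> \<kappa> (v \<triangleright> mA) = - \<kappa> v" and \<kappa>U: "\<And>v. v \<in> X \<Longrightarrow> \<kappa> (v \<triangleright> mU) = \<kappa> v"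
  shows "\<exists>N. cocycle PGL2Z X act 0 N \<and> (\<forall>v\<in>X. N v mA = \<kappa> v \<and> (\<forall>d\<in>D3. N v d = 0))"
proof -
  obtain N0 where N0: "cocycle PSLG X act 0 N0" "\<And>v. v \<in> X \<Longrightarrow> N0 v mA = \<kappa> v"
      "\<And>v d. v \<in> X \<Longrightarrow> d \<in> HB \<Longrightarrow> N0 v d = 0"
    using PSL_cocycle[of \<kappa>, OF \<kappa>A] by blast
  have cM: "m \<in> PSL2Z \<Longrightarrow> m \<in> Mh" for m using PSL2Z_carrier by blast
  have N0_mult: "N0 v (m \<star> n) = N0 v m + N0 (v \<triangleright> m) n" if "v \<in> X" "m \<in> PSL2Z" "n \<in> PSL2Z" for v m n
    using cocycleD[OF N0(1), of v m n] that by simp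
  have conj_mult: "mU \<star> (m \<star> n) \<star> mU = (mU \<star> m \<star> mU) \<star> (mU \<star> n \<star> mU)" if "m \<in> Mh" "n \<in> Mh" for m n
    using that by (simp add: left_norm flip: PG.m_assoc)
  have act_conj: "v \<triangleright> mU \<triangleright> (mU \<star> m \<star> mU) = v \<triangleright> m \<triangleright> mU" if "v \<in> X" "m \<in> Mh" for v m
    using that by (simp add: XA.st_mult act_cancel)
  have "cocycle PSLG X act 0 (\<lambda>v m. N0 (v \<triangleright> mU) (mU \<star> m \<star> mU))"
    unfolding cocycle_def
  proof (intro ballI)
    fix v m n assume v: "v \<in> X" and "m \<in> carrier PSLG" "n \<in> carrier PSLG"
    then have mn: "m \<in> PSL2Z" "n \<in> PSL2Z" by simp_all
    note M = cM[OF mn(1)] cM[OF mn(2)]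
    have "v \<triangleright> mU \<in> X" using v by simp
    from N0_mult[OF this U_conj_PSL2Z[OF mn(1)] U_conj_PSL2Z[OF mn(2)]]
    have "N0 (v \<triangleright> mU) (mU \<star> (m \<star> n) \<star> mU) =
        N0 (v \<triangleright> mU) (mU \<star> m \<star> mU) + N0 (v \<triangleright> m \<triangleright> mU) (mU \<star> n \<star> mU)"
      unfolding conj_mult[OF M] act_conj[OF v M(1)] .
    then show "[N0 (v \<triangleright> mU) (mU \<star> (m \<otimes>\<^bsub>PSLG\<^esub> n) \<star> mU) =
        N0 (v \<triangleright> mU) (mU \<star> m \<star> mU) + N0 (v \<triangleright> m \<triangleright> mU) (mU \<star> n \<star> mU)] (mod 0)" by simp
  qed
  note tw = state_action.cocycle_agree[OF PSLG_action this N0(1), of "insert mA HB"]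
  have twist: "N0 (v \<triangleright> mU) (mU \<star> m \<star> mU) = N0 v m" if v: "v \<in> X" and m: "m \<in> PSL2Z" for v m
  proof -
    have "[N0 (v \<triangleright> mU) (mU \<star> m \<star> mU) = N0 v m] (mod 0)"
    proof (rule tw)
      show "insert mA HB \<subseteq> carrier PSLG" using gens_PSL2Z PSL2Z_mult by (auto simp: HB_def)
      show "m \<in> generate PSLG (insert mA HB)" using m generate_A_HB by simp
      show "v \<in> X" by (rule v)
    next
      fix w x assume w: "w \<in> X" and "x \<in> insert mA HB"
      then show "[N0 (w \<triangleright> mU) (mU \<star> x \<star> mU) = N0 w x] (mod 0)"
        using N0(2,3) \<kappa>U U_conj U_conj_factor[of HB x] by auto
    qed
    then show ?thesis by simp
  qed
  define \<rho> where "\<rho> g = (if g \<in> PSL2Z then g else g \<star> mU)" for g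
  define N where "N v g = N0 v (\<rho> g)" for v g
  have \<rho>: "\<rho> g \<in> PSL2Z" if "g \<in> Mh" for g
    using that PSL2Z_mult[OF that, of mU] gens_PSL2Z by (simp add: \<rho>_def)
  have "N v (g \<star> h) = N v g + N (v \<triangleright> g) h" if v: "v \<in> X" and g: "g \<in> Mh" and h: "h \<in> Mh" for v g h
  proof (cases "g \<in> PSL2Z")
    case True
    then have "\<rho> (g \<star> h) = g \<star> \<rho> h" "\<rho> g = g"
      using PSL2Z_mult[OF g h] g h by (simp_all add: \<rho>_def PG.m_assoc)
    then show ?thesis using N0_mult[OF v True \<rho>[OF h]] by (simp add: N_def)
  next
    case False
    have \<rho>g: "\<rho> g = g \<star> mU" using False by (simp add: \<rho>_def)
    have "\<rho> (g \<star> h) = \<rho> g \<star> (mU \<star> \<rho> h \<star> mU)"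
      unfolding \<rho>g using False PSL2Z_mult[OF g h] g h
      by (simp add: \<rho>_def left_norm flip: PG.m_assoc)
    then have "N v (g \<star> h) = N0 v (\<rho> g) + N0 (v \<triangleright> \<rho> g) (mU \<star> \<rho> h \<star> mU)"
      using N0_mult[OF v \<rho>[OF g] U_conj_PSL2Z[OF \<rho>[OF h]]] by (simp add: N_def)
    also have "v \<triangleright> \<rho> g = v \<triangleright> g \<triangleright> mU" using \<rho>g v g by (simp add: XA.st_mult)
    also have "N0 (v \<triangleright> g \<triangleright> mU) (mU \<star> \<rho> h \<star> mU) = N0 (v \<triangleright> g) (\<rho> h)"
      by (rule twist) (use v g \<rho>[OF h] in simp_all)
    finally show ?thesis by (simp add: N_def)
  qed
  then have "cocycle PGL2Z X act 0 N" by (simp add: cocycle_def)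
  moreover have "\<rho> d \<in> HB" if "d \<in> D3" for d
  proof -
    have "B2 \<in> PSL2Z" "mB \<star> mU \<notin> PSL2Z" "B2 \<star> mU \<notin> PSL2Z"
      using PSL2Z_mult[of mB mB] PSL2Z_mult[of mB mU] PSL2Z_mult[of B2 mU] gens_PSL2Z by simp_all
    then show ?thesis
      using that gens_PSL2Z unfolding D3_def
      by (elim insertE emptyE; simp add: \<rho>_def HB_def letter_cancel letter_relations)
  qed
  ultimately show ?thesis using N0(2,3) gens_PSL2Z by (intro exI[of _ N]) (simp add: N_def \<rho>_def)
qed

theorem betti_Gamma_tilde0:
  "betti (Gamma_tilde0 S) = dual_rank 2 S (hom_mod2_tf (PGL2Z\<lparr>carrier := S\<rparr>))"
proof -
  have inst: "edge_path_graph PGL2Z X act S mA D3 {\<e>, mU} ed_tilde (\<lambda>v. vert_class (B_orbit v))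
      keep leaf_class (Gamma_tilde0 S)"
  proof (intro edge_path_graph.intro edge_path_graph_axioms.intro XA.state_action_axioms)
    show "S \<in> X" by (rule S_X)
    show "\<exists>g\<in>Mh. S \<triangleright> g = v" if "v \<in> X" for v
      using that X_iff by auto
    show "mA \<in> Mh" "mA \<star> mA = \<e>" using letter_relations by simp_all
    show "subgroup D3 PGL2Z" by (rule subgroup_D3)
    show "d \<star> d = \<e> \<or> d \<star> d \<star> d = \<e>" if "d \<in> D3" for d
      using that unfolding D3_def by (elim insertE emptyE; simp add: left_norm flip: PG.m_assoc)
    show "subgroup {\<e>, mU} PGL2Z"
    proof (rule PG.subgroupI)
      fix a assume "a \<in> {\<e>, mU}"
      moreover have "pinv mU = mU" by (rule PG.inv_equality) (simp_all add: letter_relations)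
      ultimately show "pinv a \<in> {\<e>, mU}" by auto
    next
      fix a b assume "a \<in> {\<e>, mU}" "b \<in> {\<e>, mU}"
      then show "a \<star> b \<in> {\<e>, mU}" by (elim insertE emptyE; simp add: letter_relations)
    qed simp_all
    show "{\<e>, mU} \<subseteq> D3" by (simp add: D3_def)
    show "k \<star> mA = mA \<star> k" if "k \<in> {\<e>, mU}" for k
      using that by (elim insertE emptyE; simp add: letter_relations)
    show "generate PGL2Z (insert mA D3) = Mh"
    proof
      have D: "insert mA D3 \<subseteq> Mh" using D3_closed by auto
      then show "generate PGL2Z (insert mA D3) \<subseteq> Mh" by (rule PG.generate_incl)
      note sg = PG.generate_is_subgroup[OF D]
      show "Mh \<subseteq> generate PGL2Z (insert mA D3)"
      proof
        fix g assume "g \<in> Mh"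
        then show "g \<in> generate PGL2Z (insert mA D3)"
        proof (rule Mh_induct[where P = "\<lambda>g. g \<in> generate PGL2Z (insert mA D3)"])
          show "\<e> \<in> generate PGL2Z (insert mA D3)" by (rule generate.one)
        next
          fix h x assume h: "h \<in> generate PGL2Z (insert mA D3)" and "x \<in> {mA, mB, mU}"
          then have "x \<in> insert mA D3" by (auto simp: D3_def)
          then have "x \<in> generate PGL2Z (insert mA D3)" by (rule generate.incl)
          then show "h \<star> x \<in> generate PGL2Z (insert mA D3)" using subgroup.m_closed[OF sg h] by blast
        qed
      qed
    qed
    show "vert_class (B_orbit v) = vert_class (B_orbit w) \<longleftrightarrow> (\<exists>d\<in>D3. w = v \<triangleright> d)"
      if "v \<in> X" "w \<in> X" for v w
      by (rule vert_class_iff[OF that])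
    show "ed_tilde v = ed_tilde w \<longleftrightarrow> (\<exists>k\<in>{\<e>, mU}. w = v \<triangleright> k \<or> w = v \<triangleright> mA \<triangleright> k)"
      if "v \<in> X" "w \<in> X" for v w
      unfolding ed_tilde_iff[OF that] using that by auto
    show "edges (Gamma_tilde0 S) = ed_tilde ` {v \<in> X. keep v}"
      by (simp add: Gamma_tilde0_def bar0_edges image_image ed_tilde_def)
    show "verts (Gamma_tilde0 S) =
        {vert_class (B_orbit v) |v. v \<in> X \<and> \<not> leaf_class (vert_class (B_orbit v))}"
      using leaf_class_iff by (auto simp: Gamma_tilde0_def bar0_verts)
    show "ends (Gamma_tilde0 S) (ed_tilde v) = {vert_class (B_orbit v), vert_class (B_orbit (v \<triangleright> mA))} \<and>
        \<not> leaf_class (vert_class (B_orbit v)) \<and> \<not> leaf_class (vert_class (B_orbit (v \<triangleright> mA)))"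
      if "v \<in> X" "keep v" for v
      using that by (simp add: ends_tilde0 leaf_class_iff keep_def)
    show "keep w" if "v \<in> X" "w \<in> X" "ed_tilde v = ed_tilde w" "keep v" for v w
      using ed_tilde_iff[OF that(1,2)] that keep_inv[OF that(1)] keep_inv[of "v \<triangleright> mA"] by auto
    show "v \<triangleright> mA = v \<or> leaf_class (vert_class (B_orbit v)) \<or> leaf_class (vert_class (B_orbit (v \<triangleright> mA)))"
      if "v \<in> X" "\<not> keep v" for v
      using that by (auto simp: keep_def leaf_class_iff)
    have leaf: "w = v \<or> w = v \<triangleright> mU" if v: "v \<in> X" and w: "w \<in> X"
      and lf: "leaf_class (vert_class (B_orbit v))" and eq: "vert_class (B_orbit w) = vert_class (B_orbit v)" for v w
    proof -
      have "leaf_orbit (B_orbit v)" using lf leaf_class_iff[OF v] by simp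
      then have B: "v \<triangleright> mB = v" "v \<triangleright> B2 = v"
        using leaf_orbit_single[OF v] B_orbit[OF v] by auto
      obtain d where d: "d \<in> D3" "w = v \<triangleright> d" using vert_class_iff[OF v w] eq by auto
      have "v \<triangleright> (mB \<star> mU) = v \<triangleright> mU" "v \<triangleright> (B2 \<star> mU) = v \<triangleright> mU"
        using v B XA.st_mult[of v mB mU] XA.st_mult[of v B2 mU] by simp_all
      then show ?thesis
        using d B v unfolding D3_def by (elim insertE emptyE; simp)
    qed
    show "ed_tilde w = ed_tilde v"
      if "v \<in> X" "w \<in> X" "leaf_class (vert_class (B_orbit v))" "vert_class (B_orbit w) = vert_class (B_orbit v)"
      for v w
      using leaf[OF that] ed_tilde_iff[OF that(1,2)] by auto
    show "vert_class (B_orbit (v \<triangleright> mA)) \<noteq> vert_class (B_orbit v)"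
      if v: "v \<in> X" and lf: "leaf_class (vert_class (B_orbit v))" for v
    proof
      assume "vert_class (B_orbit (v \<triangleright> mA)) = vert_class (B_orbit v)"
      then have "v \<triangleright> mA = v" using leaf[OF v _ lf, of "v \<triangleright> mA"] act_A_U[OF v] v by simp
      then show False using act_A_B(1)[OF v] leaf_orbit_iff[OF v] lf leaf_class_iff[OF v] by simp
    qed
    show "v \<triangleright> mA \<noteq> v \<triangleright> k" if "v \<in> X" "keep v" "k \<in> {\<e>, mU}" for v k
      using that(3)
    proof (elim insertE emptyE)
      assume "k = \<e>"
      then show ?thesis using that(1,2) by (simp add: keep_def)
    qed (use act_A_U[OF that(1)] in simp)
    show "\<exists>N. cocycle PGL2Z X act 0 N \<and> (\<forall>v\<in>X. N v mA = \<kappa> v \<and> (\<forall>d\<in>D3. N v d = 0))"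
      if "\<And>v. v \<in> X \<Longrightarrow> \<kappa> (v \<triangleright> mA) = - \<kappa> v" "\<And>v k. v \<in> X \<Longrightarrow> k \<in> {\<e>, mU} \<Longrightarrow> \<kappa> (v \<triangleright> k) = \<kappa> v"
      for \<kappa> :: "pgl_coset \<Rightarrow> int"
      by (rule PGL_cocycle) (use that in simp_all)
  qed
  have "edge_path_graph.S PGL2Z act S = S"
    unfolding edge_path_graph.S_def[OF inst] using act_S_iff S_Mh by auto
  then show ?thesis using edge_path_graph.betti_dual_rank[OF inst] by simp
qed

end

section \<open>Ranks and elliptic generators\<close>

context neumann
begin

lemma group_S: "group (PGL2Z\<lparr>carrier := S\<rparr>)"
  using PG.subgroup_imp_group[OF sub] .

lemma finite_factor_order:
  assumes "cyclic_decomposition (PGL2Z\<lparr>carrier := S\<rparr>) F\<^sub>2 F\<^sub>3 F\<^sub>i"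
  shows "H \<in> F\<^sub>2 \<Longrightarrow> x \<in> H \<Longrightarrow> x \<in> S \<and> x \<star> x = \<e>"
    and "H \<in> F\<^sub>3 \<Longrightarrow> x \<in> H \<Longrightarrow> x \<in> S \<and> x \<star> x \<star> x = \<e>"
proof -
  interpret SG: cyclic_free_product "PGL2Z\<lparr>carrier := S\<rparr>" F\<^sub>2 F\<^sub>3 F\<^sub>i
    by (intro cyclic_free_product.intro cyclic_free_product_axioms.intro group_S assms)
  have x: "x \<in> carrier (PGL2Z\<lparr>carrier := S\<rparr>)" if "H \<in> SG.F" "x \<in> H" for H x
    using SG.factor_carrier that by blast
  have prime3: "prime (3::nat)" by simp
  have ord: "x [^]\<^bsub>PGL2Z\<lparr>carrier := S\<rparr>\<^esub> card H = \<e>" if H: "H \<in> SG.F" "x \<in> H" and c: "prime (card H)" for H x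
  proof (cases "x = \<e>")
    case False
    then have "SG.ord x = card H"
      using SG.prime_order_subgroup_generated[OF SG.factor_subgroup[OF H(1)] c H(2)] by simp
    then show ?thesis using SG.pow_ord_eq_1[OF x[OF H]] by simp
  next
    case True
    then show ?thesis using SG.nat_pow_one[of "card H"] by simp
  qed
  show "x \<in> S \<and> x \<star> x = \<e>" if H: "H \<in> F\<^sub>2" "x \<in> H"
    using ord[of H x] x[of H x] SG.cards(1)[OF H(1)] H S_Mh two_is_prime_nat by (simp add: numeral_2_eq_2)
  show "x \<in> S \<and> x \<star> x \<star> x = \<e>" if H: "H \<in> F\<^sub>3" "x \<in> H"
    using ord[of H x] x[of H x] SG.cards(2)[OF H(1)] H S_Mh prime3 by (simp add: numeral_3_eq_3)
qed

lemma finite_factor_elliptic: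
  assumes dec: "cyclic_decomposition (PGL2Z\<lparr>carrier := S\<rparr>) F\<^sub>2 F\<^sub>3 F\<^sub>i"
    and H: "H \<in> F\<^sub>2 \<union> F\<^sub>3" "x \<in> H"
  shows "x = \<e> \<or> elliptic x" "x \<in> PSL2Z"
proof -
  note o = finite_factor_order[OF dec]
  show e: "x = \<e> \<or> elliptic x"
  proof (cases "H \<in> F\<^sub>2")
    case True
    then show ?thesis using o(1)[OF True H(2)] no_reflection elliptic_order2 by blast
  next
    case False
    then have "H \<in> F\<^sub>3" using H by blast
    from o(2)[OF this H(2)] show ?thesis using S_Mh order3_elliptic by blast
  qed
  then show "x \<in> PSL2Z" using gens_PSL2Z(5) by (auto simp: elliptic_def)
qed

text \<open>The finite factors lie in \<open>PSL2Z\<close>, so an infinite factor must contribute an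
  odd generator, as otherwise all of \<open>S\<close> would be even. In particular there is at least
  one infinite factor.\<close>

lemma odd_decomposition:
  assumes dec: "cyclic_decomposition (PGL2Z\<lparr>carrier := S\<rparr>) F\<^sub>2 F\<^sub>3 F\<^sub>i" and nS: "\<not> S \<subseteq> PSL2Z"
  shows "\<exists>H\<^sub>0. odd_free_product (PGL2Z\<lparr>carrier := S\<rparr>) F\<^sub>2 F\<^sub>3 F\<^sub>i (\<lambda>x. x \<notin> PSL2Z) H\<^sub>0"
proof -
  interpret SG: parity_free_product "PGL2Z\<lparr>carrier := S\<rparr>" F\<^sub>2 F\<^sub>3 F\<^sub>i "\<lambda>x. x \<notin> PSL2Z"
  proof (intro parity_free_product.intro parity_free_product_axioms.intro
      cyclic_free_product.intro cyclic_free_product_axioms.intro group_S dec)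
    fix x y assume "x \<in> carrier (PGL2Z\<lparr>carrier := S\<rparr>)" "y \<in> carrier (PGL2Z\<lparr>carrier := S\<rparr>)"
    then show "(x \<otimes>\<^bsub>PGL2Z\<lparr>carrier := S\<rparr>\<^esub> y \<notin> PSL2Z) = ((x \<notin> PSL2Z) \<noteq> (y \<notin> PSL2Z))"
      using S_Mh PSL2Z_mult[of x y] by simp
  qed (use finite_factor_elliptic(2)[OF dec] in blast)
  have "\<exists>H\<^sub>0\<in>F\<^sub>i. SG.gen H\<^sub>0 \<notin> PSL2Z"
  proof (rule ccontr)
    assume no: "\<not> (\<exists>H\<^sub>0\<in>F\<^sub>i. SG.gen H\<^sub>0 \<notin> PSL2Z)"
    have "SG.gen ` SG.F \<subseteq> PSL2Z \<inter> S"
    proof clarify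
      fix H assume H: "H \<in> SG.F"
      have "SG.gen H \<in> PSL2Z"
      proof (cases "H \<in> F\<^sub>i")
        case False
        then show ?thesis using finite_factor_elliptic(2)[OF dec _ SG.gen(1)[OF H]] H by blast
      qed (use no in blast)
      then show "SG.gen H \<in> PSL2Z \<inter> S" using SG.gen_carrier[OF H] by simp
    qed
    moreover have "generate (PGL2Z\<lparr>carrier := S\<rparr>) (SG.gen ` SG.F) = generate PGL2Z (SG.gen ` SG.F)"
      by (rule PG.generate_consistent[OF _ sub]) (use calculation in blast)
    ultimately have "generate (PGL2Z\<lparr>carrier := S\<rparr>) (SG.gen ` SG.F) \<subseteq> PSL2Z"
      using PG.generate_subgroup_incl[OF _ subgroup_PSL2Z, of "SG.gen ` SG.F"] by blast
    then show False using SG.gens_generate nS by simp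
  qed
  then obtain H\<^sub>0 where "H\<^sub>0 \<in> F\<^sub>i" "SG.gen H\<^sub>0 \<notin> PSL2Z" by blast
  then have "odd_free_product (PGL2Z\<lparr>carrier := S\<rparr>) F\<^sub>2 F\<^sub>3 F\<^sub>i (\<lambda>x. x \<notin> PSL2Z) H\<^sub>0"
    by (intro odd_free_product.intro odd_free_product_axioms.intro SG.parity_free_product_axioms)
  then show ?thesis ..
qed

end

theorem theorem14:
  fixes S_hat :: "(int ^ 2 ^ 2) set set"
  assumes "neumann_subgroup S_hat"
    and "\<not> S_hat \<subseteq> PSL2Z"
  shows "\<exists>rh\<^sub>2 rh\<^sub>3 rh\<^sub>i :: enat.
    has_structure (PGL2Z\<lparr>carrier := S_hat\<rparr>) rh\<^sub>2 rh\<^sub>3 rh\<^sub>i \<and>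
    rh\<^sub>2 + rh\<^sub>3 + rh\<^sub>i = \<infinity> \<and>
    rh\<^sub>i \<ge> 1 \<and>
    rh\<^sub>i = betti (Gamma_tilde0 S_hat) \<and>
    (\<forall>F\<^sub>2 F\<^sub>3 F\<^sub>i. cyclic_decomposition (PGL2Z\<lparr>carrier := S_hat\<rparr>) F\<^sub>2 F\<^sub>3 F\<^sub>i \<longrightarrow>
       (\<forall>H\<in>F\<^sub>2 \<union> F\<^sub>3. \<forall>x\<in>H. H = generate PGL2Z {x} \<longrightarrow> elliptic x)) \<and>
    (\<forall>r\<^sub>2 r\<^sub>3 r\<^sub>i :: enat.
       has_structure (PGL2Z\<lparr>carrier := S_hat \<inter> PSL2Z\<rparr>) r\<^sub>2 r\<^sub>3 r\<^sub>i \<longrightarrow>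
       (r\<^sub>2, r\<^sub>3, r\<^sub>i) = (2 * rh\<^sub>2, 2 * rh\<^sub>3, 2 * rh\<^sub>i - 1) \<and>
       r\<^sub>i = betti (Gamma_bar0 S_hat))"
proof -
  interpret neumann S_hat by (rule neumann.intro) (rule assms(1))
  let ?SG = "PGL2Z\<lparr>carrier := S_hat\<rparr>" and ?KG = "PGL2Z\<lparr>carrier := S_hat \<inter> PSL2Z\<rparr>"
  obtain D where D: "partial_transversal D" "\<forall>g\<in>Mh. \<exists>s\<in>S_hat. \<exists>d\<in>D. g = s \<star> d"
    using transversal_exists by blast
  have D: "neumann_transversal S_hat D"
    by (intro neumann_transversal.intro neumann_transversal_axioms.intro neumann_axioms) (use D in blast)+
  obtain F\<^sub>2 F\<^sub>3 F\<^sub>i where dec: "cyclic_decomposition ?SG F\<^sub>2 F\<^sub>3 F\<^sub>i"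
    using neumann_transversal.S_decomposition[OF D] by blast
  obtain H\<^sub>0 where odd: "odd_free_product ?SG F\<^sub>2 F\<^sub>3 F\<^sub>i (\<lambda>x. x \<notin> PSL2Z) H\<^sub>0"
    using odd_decomposition[OF dec assms(2)] by blast
  interpret SG: odd_free_product ?SG F\<^sub>2 F\<^sub>3 F\<^sub>i "\<lambda>x. x \<notin> PSL2Z" H\<^sub>0 by (rule odd)
  have K: "?SG\<lparr>carrier := {g \<in> carrier ?SG. \<not> g \<notin> PSL2Z}\<rparr> = ?KG" by (simp add: Int_def)
  have "has_structure ?SG (ecard F\<^sub>2) (ecard F\<^sub>3) (ecard F\<^sub>i)"
    unfolding has_structure_def using dec by blast
  moreover have "ecard F\<^sub>2 + ecard F\<^sub>3 + ecard F\<^sub>i = \<infinity>" by (rule decomposition_infinite[OF dec])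
  moreover have "ecard F\<^sub>i \<ge> 1"
  proof -
    have "F\<^sub>i \<noteq> {}" using SG.H0 by blast
    then show ?thesis by (auto simp: ecard_def one_enat_def Suc_le_eq card_gt_0_iff)
  qed
  moreover have "ecard F\<^sub>i = betti (Gamma_tilde0 S_hat)"
    using SG.decomposition_ranks(3) betti_Gamma_tilde0 by simp
  moreover have "elliptic x"
    if dec': "cyclic_decomposition ?SG F2 F3 Fi" and H: "H \<in> F2 \<union> F3" "x \<in> H" "H = generate PGL2Z {x}"
    for F2 F3 Fi H x
  proof -
    have "card H = 2 \<or> card H = 3" using dec' H(1) by (auto simp: cyclic_decomposition_def)
    moreover have "generate PGL2Z {\<e>} = {\<e>}" by (rule PG.generate_one)
    ultimately have "x \<noteq> \<e>" using H(3) by auto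
    then show ?thesis using finite_factor_elliptic(1)[OF dec' H(1,2)] by blast
  qed
  moreover have "(r\<^sub>2, r\<^sub>3, r\<^sub>i) = (2 * ecard F\<^sub>2, 2 * ecard F\<^sub>3, 2 * ecard F\<^sub>i - 1) \<and> r\<^sub>i = betti (Gamma_bar0 S_hat)"
    if r: "has_structure ?KG r\<^sub>2 r\<^sub>3 r\<^sub>i" for r\<^sub>2 r\<^sub>3 r\<^sub>i
  proof -
    obtain E2 E3 Ei where E: "cyclic_decomposition ?KG E2 E3 Ei" "r\<^sub>2 = ecard E2" "r\<^sub>3 = ecard E3" "r\<^sub>i = ecard Ei"
      using r unfolding has_structure_def by blast
    have "group ?KG"
      using PG.subgroup_imp_group[OF PG.subgroups_Inter_pair[OF sub subgroup_PSL2Z]] .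
    then have KG: "cyclic_free_product ?KG E2 E3 Ei"
      by (intro cyclic_free_product.intro cyclic_free_product_axioms.intro E)
    \<comment> \<open>The given decomposition of the even part and the computation from
      \<open>S\<close> evaluate the same three pairing ranks, so their values are equated without
      comparing the factors.\<close>
    note ranks = cyclic_free_product.decomposition_ranks[OF KG] SG.kernel_ranks[unfolded K]
    have "r\<^sub>2 = 2 * ecard F\<^sub>2" "r\<^sub>3 = 2 * ecard F\<^sub>3" "r\<^sub>i = 2 * ecard F\<^sub>i - 1"
      unfolding E(2-4) using ranks by simp_all
    moreover have "r\<^sub>i = betti (Gamma_bar0 S_hat)"
      unfolding E(4) betti_Gamma_bar0[OF assms(2)] using ranks(3) by simp
    ultimately show ?thesis by simp
  qed
  ultimately show ?thesis
    by (intro exI[of _ "ecard F\<^sub>2"] exI[of _ "ecard F\<^sub>3"] exI[of _ "ecard F\<^sub>i"] conjI allI impI ballI) blast+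
qed

end
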